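(* Let $F:\mathcal P_2(\mathbb R^d)\to\mathbb R$ be a functional with linear functional derivative $\frac{\delta F}{\delta m}$ and intrinsic derivative $D_mF=\nabla\frac{\delta F}{\delta m}$, and assume that there are constants $M^F_{mm}\ge 0$, $M^F_{mx}\ge 0$, $\rho>0$ such that: (1) $F((1-t)m+tm')\le(1-t)F(m)+tF(m')$ for all $t\in[0,1]$, $m,m'\in\mathcal P_2(\mathbb R^d)$; (2) $|D_mF(m,x)-D_mF(m',x)|\le M^F_{mm}W_1(m,m')$ for all $x\in\mathbb R^d$, $m,m'\in\mathcal P_2(\mathbb R^d)$; (3) for every $m\in\mathcal P_2(\mathbb R^d)$, $\int\exp(-\frac{\delta F}{\delta m}(m,x))\,dx<\infty$ and the probability measure $\hat m(dx)\propto\exp(-\frac{\delta F}{\delta m}(m,x))\,dx$ satisfies $\rho\,\mathrm{Ent}_{\hat m}(f^2)\le\mathbb E_{\hat m}[|\nabla f|^2]$ for all $f\in C^1_b(\mathbb R^d)$; (4) $\sup_{m}\sup_{x}|\nabla D_mF(m,x)|\le M^F_{mx}$; (5) $x\mapsto D_mF(m,x)$ is $C^3$ and $\sup_{m}\sup_{x}|\nabla^kD_mF(m,x)|<\infty$ for $k=2,3$. Let $(m_t)_{t\ge0}$ be a solution of $\partial_t m_t=\Delta m_t+\nabla\cdot(D_mF(m_t,\cdot)m_t)$ and $h_t=\frac{dm_t}{dm_\infty}$. Suppose $h_{t_0}\in L^{q_0}_+(m_\infty)$ for some $t_0\ge0$ and some real $q_0\ne1$. Let $\varepsilon\in(0,1]$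 and let $q$ solve $\dot q=4(1-\varepsilon)\rho(q-1)$ with $q(t_0)=q_0$. Then $h_t\in L^{q(t)}_+(m_\infty)$ for all $t\ge t_0$. Moreover, with $\delta(t)=\frac1{4\varepsilon}(q(t)-1)(M^F_{mm})^2W_1^2(m_t,m_\infty)$, for all $t\ge t_0$: if $q_0>1$, $$\log\|h_t\|_{q(t)}\le\log\|h_{t_0}\|_{q_0}+\int_{t_0}^t\delta(s)\,ds,$$ and if $q_0<1$, $$\log\|h_t\|_{q(t)}\ge\log\|h_{t_0}\|_{q_0}+\int_{t_0}^t\delta(s)\,ds.$$
   Context: $\mathcal P_2(\mathbb R^d)$ is the set of probability measures on $\mathbb R^d$ with finite second moment; $W_p$ is the $L^p$-Wasserstein distance. The linear functional derivative of $F$ is a function $\frac{\delta F}{\delta m}:\mathcal P_2(\mathbb R^d)\times\mathbb R^d\to\mathbb R$, jointly continuous, of at most quadratic growth in $x$ uniformly for $m$ in bounded subsets of $\mathcal P_2$, with $F(m')-F(m)=\int_0^1\int\frac{\delta F}{\delta m}((1-t)m+tm',x)(m'-m)(dx)\,dt$. $\mathrm{Ent}_m f=\mathbb E_m[f\log f]-\mathbb E_m[f]\log\mathbb E_m[f]$. Solutions of the Fokker–Planck equation are weak solutions in $C([0,\infty);(\mathcal P_2(\mathbb R^d),W_2))$. $H(m)=\int m\log m$ and $\mathcal F(m)=F(m)+H(m)$. Under (1)–(4), $\mathcal F$ has a unique minimizer $m_\infty\in\mathcal P_2(\mathbb R^d)$; it is also the unique solution in $\mathcal P_2(\mathbb R^d)$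 of $m_\infty=\hat m_\infty$ and the unique invariant measure of the equation. For measurable $h:\mathbb R^d\to[0,+\infty]$ and $p\in\mathbb R$: $\|h\|_p=\|h\|_{L^p(m_\infty)}=(\int h^p\,dm_\infty)^{1/p}$ if $p\ne0$, and $\|h\|_0=\exp(\int\log h\,dm_\infty)$. One says $h\in L^p_+(m_\infty)$ if $\|h\|_p<+\infty$ (when $p>0$), $\|h\|_p\in(0,+\infty)$ (when $p=0$), $\|h\|_p>0$ (when $p<0$). *)

theory Defs
  imports "HOL-Probability.Probability"
begin

section \<open>Calculus on Euclidean space\<close>

text \<open>\<open>iter_deriv [v\<^sub>1, \<dots>, v\<^sub>k] g x\<close> is \<open>\<nabla>\<^sup>k g(x)[v\<^sub>1, \<dots>, v\<^sub>k]\<close>.\<close>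

primrec iter_deriv ::
  "'a::euclidean_space list \<Rightarrow> ('a \<Rightarrow> 'b::real_normed_vector) \<Rightarrow> 'a \<Rightarrow> 'b" where
  "iter_deriv [] g = g"
| "iter_deriv (v # vs) g = (\<lambda>x. frechet_derivative (iter_deriv vs g) (at x) v)"

definition Ck :: "nat \<Rightarrow> ('a::euclidean_space \<Rightarrow> 'b::real_normed_vector) \<Rightarrow> bool" where
  "Ck k g \<longleftrightarrow>
     (\<forall>vs. length vs < k \<longrightarrow> (\<forall>x. iter_deriv vs g differentiable (at x))) \<and>
     (\<forall>vs. length vs \<le> k \<longrightarrow> continuous_on UNIV (iter_deriv vs g))"

text \<open>Operator norm of the \<open>k\<close>-linear map \<open>\<nabla>\<^sup>k g(x)\<close>; to be used only where \<open>g\<close> is \<open>k\<close> times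
  differentiable.\<close>

definition deriv_norm ::
  "nat \<Rightarrow> ('a::euclidean_space \<Rightarrow> 'b::real_normed_vector) \<Rightarrow> 'a \<Rightarrow> ennreal" where
  "deriv_norm k g x =
     (SUP vs\<in>{vs. length vs = k \<and> (\<forall>v\<in>set vs. norm v \<le> 1)}. ennreal (norm (iter_deriv vs g x)))"

definition laplacian :: "('a::euclidean_space \<Rightarrow> real) \<Rightarrow> 'a \<Rightarrow> real" where
  "laplacian \<phi> x = (\<Sum>b\<in>Basis. iter_deriv [b, b] \<phi> x)"

definition test_function :: "('a::euclidean_space \<Rightarrow> real) \<Rightarrow> bool" where
  "test_function \<phi> \<longleftrightarrow> (\<forall>k. Ck k \<phi>) \<and> compact (closure {x. \<phi> x \<noteq> 0})"


section \<open>Probability measures with finite second moment\<close>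

definition P2 :: "'a::euclidean_space measure set" where
  "P2 = {m. prob_space m \<and> sets m = sets borel \<and> integrable m (\<lambda>x. (norm x)\<^sup>2)}"

text \<open>The convex combination \<open>(1 - t) m + t m'\<close>, for \<open>t \<in> [0,1]\<close>.\<close>

definition mix :: "real \<Rightarrow> 'a::euclidean_space measure \<Rightarrow> 'a measure \<Rightarrow> 'a measure" where
  "mix t m m' = measure_of UNIV (sets borel)
     (\<lambda>A. ennreal (1 - t) * emeasure m A + ennreal t * emeasure m' A)"

lemma sets_mix [simp]: "sets (mix t m m') = sets borel"
  unfolding mix_def by (metis sets.sigma_sets_eq sets_measure_of space_borel top_greatest Pow_UNIV)

lemma emeasure_mix:
  assumes [simp]: "sets m = sets borel" "sets m' = sets borel" and A: "A \<in> sets borel"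
  shows "emeasure (mix t m m') A = ennreal (1 - t) * emeasure m A + ennreal t * emeasure m' A"
proof (rule emeasure_measure_of[OF mix_def])
  show "countably_additive (sets (mix t m m'))
      (\<lambda>A. ennreal (1 - t) * emeasure m A + ennreal t * emeasure m' A)"
  proof (rule countably_additiveI)
    fix B :: "nat \<Rightarrow> 'a set"
    assume "range B \<subseteq> sets (mix t m m')" and d: "disjoint_family B"
    then have "range B \<subseteq> sets m" "range B \<subseteq> sets m'" by simp_all
    then show "(\<Sum>i. ennreal (1 - t) * emeasure m (B i) + ennreal t * emeasure m' (B i)) =
        ennreal (1 - t) * emeasure m (\<Union> (range B)) + ennreal t * emeasure m' (\<Union> (range B))"
      using d by (simp add: suminf_add[symmetric] suminf_emeasure)
  qed
qed (auto simp: positive_def A)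

definition couplings ::
  "'a::euclidean_space measure \<Rightarrow> 'a measure \<Rightarrow> ('a \<times> 'a) measure set" where
  "couplings m m' = {\<pi>. prob_space \<pi> \<and> sets \<pi> = sets (borel \<Otimes>\<^sub>M borel) \<and>
     distr \<pi> borel fst = m \<and> distr \<pi> borel snd = m'}"

text \<open>The infimum is finite, so that nothing is lost by \<^const>\<open>enn2real\<close>, for \<open>1 \<le> p \<le> 2\<close> on
  \<^const>\<open>P2\<close>.\<close>

definition W :: "real \<Rightarrow> 'a::euclidean_space measure \<Rightarrow> 'a measure \<Rightarrow> real" where
  "W p m m' =
     enn2real (INF \<pi>\<in>couplings m m'. \<integral>\<^sup>+ z. ennreal (dist (fst z) (snd z) powr p) \<partial>\<pi>) powr (1 / p)"


section \<open>Functionals on \<open>P2\<close>\<close>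

text \<open>Linear functional derivative: joint continuity (\<^const>\<open>P2\<close> carrying the distance \<open>W\<^sub>2\<close>),
  quadratic growth uniformly on \<open>W\<^sub>2\<close>-bounded sets, and the fundamental identity.\<close>

definition linear_functional_derivative ::
  "('a::euclidean_space measure \<Rightarrow> real) \<Rightarrow> ('a measure \<Rightarrow> 'a \<Rightarrow> real) \<Rightarrow> bool" where
  "linear_functional_derivative F dF \<longleftrightarrow>
     (\<forall>m\<in>P2. \<forall>x. \<forall>e>0. \<exists>d>0. \<forall>m'\<in>P2. \<forall>x'.
        W 2 m m' < d \<and> dist x x' < d \<longrightarrow> \<bar>dF m' x' - dF m x\<bar> < e) \<and>
     (\<forall>m\<^sub>0\<in>P2. \<forall>R. \<exists>C. \<forall>m\<in>P2. W 2 m\<^sub>0 m \<le> R \<longrightarrow> (\<forall>x. \<bar>dF m x\<bar> \<le> C * (1 + (norm x)\<^sup>2))) \<and>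
     (\<forall>m\<in>P2. \<forall>m'\<in>P2. F m' - F m =
        (LBINT t:{0..1}. (\<integral>x. dF (mix t m m') x \<partial>m') - (\<integral>x. dF (mix t m m') x \<partial>m)))"

definition intrinsic_derivative ::
  "('a::euclidean_space measure \<Rightarrow> 'a \<Rightarrow> real) \<Rightarrow> ('a measure \<Rightarrow> 'a \<Rightarrow> 'a) \<Rightarrow> bool" where
  "intrinsic_derivative dF D \<longleftrightarrow> (\<forall>m\<in>P2. \<forall>x. GDERIV (dF m) x :> D m x)"

text \<open>The measure with Lebesgue density proportional to \<open>exp (- dF m)\<close>; a probability
  measure once the exponential is integrable.\<close>

definition hat :: "('a::euclidean_space measure \<Rightarrow> 'a \<Rightarrow> real) \<Rightarrow> 'a measure \<Rightarrow> 'a measure" where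
  "hat dF m =
     density lborel (\<lambda>x. ennreal (exp (- dF m x) / (\<integral>y. exp (- dF m y) \<partial>lborel)))"

definition Ent :: "'a measure \<Rightarrow> ('a \<Rightarrow> real) \<Rightarrow> real" where
  "Ent m f = (\<integral>x. f x * ln (f x) \<partial>m) - (\<integral>x. f x \<partial>m) * ln (\<integral>x. f x \<partial>m)"

text \<open>The functions in \<open>C\<^sup>1\<^sub>b\<close> are the bounded ones with bounded continuous gradient \<open>g\<close>.\<close>

definition log_sobolev :: "real \<Rightarrow> 'a::euclidean_space measure \<Rightarrow> bool" where
  "log_sobolev \<rho> m \<longleftrightarrow>
     (\<forall>f g. (\<forall>x. GDERIV f x :> g x) \<and> continuous_on UNIV g \<and>
        bounded (range f) \<and> bounded (range g) \<longrightarrow>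
        \<rho> * Ent m (\<lambda>x. (f x)\<^sup>2) \<le> (\<integral>x. (norm (g x))\<^sup>2 \<partial>m))"


section \<open>Extended-valued logarithm, powers, integrals and \<open>L\<^sup>p\<close> norms for real \<open>p\<close>\<close>

definition elog :: "ennreal \<Rightarrow> ereal" where
  "elog x = (if x = 0 then - \<infinity> else if x = \<infinity> then \<infinity> else ereal (ln (enn2real x)))"

definition eexp :: "ereal \<Rightarrow> ennreal" where
  "eexp x = (if x = - \<infinity> then 0 else if x = \<infinity> then \<infinity> else ennreal (exp (real_of_ereal x)))"

definition epowr :: "ennreal \<Rightarrow> real \<Rightarrow> ennreal" where
  "epowr x p =
     (if p = 0 then 1
      else if x = 0 then (if p > 0 then 0 else \<infinity>)
      else if x = \<infinity> then (if p > 0 then \<infinity> else 0)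
      else ennreal (enn2real x powr p))"

text \<open>Integral of an extended-valued function, meaningful when its positive or its negative part
  has finite integral. (Otherwise the value is \<open>\<infinity> - \<infinity> = \<infinity>\<close>; this occurs neither for the
  entropy on \<^const>\<open>P2\<close> nor for \<open>log h\<close> with \<open>h\<close> a probability density.)\<close>

definition eintegral :: "'a measure \<Rightarrow> ('a \<Rightarrow> ereal) \<Rightarrow> ereal" where
  "eintegral M f =
     enn2ereal (\<integral>\<^sup>+ x. e2ennreal (f x) \<partial>M) - enn2ereal (\<integral>\<^sup>+ x. e2ennreal (- f x) \<partial>M)"

definition Lp_norm :: "'a measure \<Rightarrow> real \<Rightarrow> ('a \<Rightarrow> ennreal) \<Rightarrow> ennreal" where
  "Lp_norm M p h =
     (if p = 0 then eexp (eintegral M (\<lambda>x. elog (h x)))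
      else epowr (\<integral>\<^sup>+ x. epowr (h x) p \<partial>M) (1 / p))"

definition Lp_plus :: "'a measure \<Rightarrow> real \<Rightarrow> ('a \<Rightarrow> ennreal) set" where
  "Lp_plus M p = {h \<in> borel_measurable M.
     (p > 0 \<longrightarrow> Lp_norm M p h < \<infinity>) \<and>
     (p = 0 \<longrightarrow> 0 < Lp_norm M p h \<and> Lp_norm M p h < \<infinity>) \<and>
     (p < 0 \<longrightarrow> 0 < Lp_norm M p h)}"


section \<open>Free energy and the Fokker--Planck equation\<close>

text \<open>\<open>H(m) = \<integral> m log m\<close>, with \<open>m\<close> also denoting the Lebesgue density, and \<open>H(m) = \<infinity>\<close> if there is
  none. In \<^typ>\<open>ereal\<close> one has \<open>0 * (- \<infinity>) = 0\<close>.\<close>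

definition H :: "'a::euclidean_space measure \<Rightarrow> ereal" where
  "H m = (if absolutely_continuous lborel m
     then eintegral lborel (\<lambda>x. enn2ereal (RN_deriv lborel m x) * elog (RN_deriv lborel m x))
     else \<infinity>)"

definition free_energy :: "('a::euclidean_space measure \<Rightarrow> real) \<Rightarrow> 'a measure \<Rightarrow> ereal" where
  "free_energy F m = ereal (F m) + H m"

definition free_energy_minimizer ::
  "('a::euclidean_space measure \<Rightarrow> real) \<Rightarrow> 'a measure \<Rightarrow> bool" where
  "free_energy_minimizer F m \<longleftrightarrow> m \<in> P2 \<and> (\<forall>m'\<in>P2. free_energy F m \<le> free_energy F m')"

text \<open>Weak solutions in \<open>C([0,\<infinity>); (P2, W\<^sub>2))\<close> of \<open>\<partial>\<^sub>t m\<^sub>t = \<Delta> m\<^sub>t + \<nabla> \<cdot> (D(m\<^sub>t, \<cdot>) m\<^sub>t)\<close>,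
  integrated in time against test functions of the space variable. The term
  \<open>iter_deriv [D (m r) x] \<phi> x\<close> is \<open>\<nabla>\<phi>(x) \<cdot> D(m\<^sub>r, x)\<close>.\<close>

definition fokker_planck_solution ::
  "('a::euclidean_space measure \<Rightarrow> 'a \<Rightarrow> 'a) \<Rightarrow> (real \<Rightarrow> 'a measure) \<Rightarrow> bool" where
  "fokker_planck_solution D m \<longleftrightarrow>
     (\<forall>t\<ge>0. m t \<in> P2) \<and>
     (\<forall>t\<ge>0. ((\<lambda>s. W 2 (m s) (m t)) \<longlongrightarrow> 0) (at t within {0..})) \<and>
     (\<forall>\<phi>. test_function \<phi> \<longrightarrow> (\<forall>s t. 0 \<le> s \<and> s \<le> t \<longrightarrow>
        (\<integral>x. \<phi> x \<partial>(m t)) - (\<integral>x. \<phi> x \<partial>(m s)) =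
        (LBINT r:{s..t}. (\<integral>x. laplacian \<phi> x - iter_deriv [D (m r) x] \<phi> x \<partial>(m r)))))"

end

theory Submission
  imports Defs
begin

text \<open>The proof is by duality and needs no regularity theory for the equation. With \<open>p = q / (q - 1)\<close> and
  \<open>\<sigma> = sgn (q - 1)\<close>, Hoelder's inequality and its reverse say that \<open>\<sigma> log \<parallel>h\<parallel>\<^sub>q\<close> is the supremum of
  \<open>\<sigma> (log \<integral> \<phi> h - log \<parallel>\<phi>\<parallel>\<^sub>p)\<close> over functions \<open>\<phi>\<close> with values in a compact subset of \<open>(0, \<infinity>)\<close>. Such a
  \<open>\<phi>\<close> is transported backwards in time by explicit Euler steps for the generator
  \<open>\<Delta> - D(m\<^sub>t, \<cdot>) \<cdot> \<nabla>\<close>. A step averages \<open>\<phi>\<close> over finitely many points; hence it preserves the bounds of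
  \<open>\<phi>\<close> and controls three derivatives, while the integral against \<open>m\<^sub>t\<close> changes by \<open>o(\<tau>)\<close> only. Since the invariant
  measure is a Gibbs measure for \<open>D(m\<^sub>\<infinity>, \<cdot>)\<close>, the logarithmic Sobolev inequality, with the exponent
  \<open>p\<close> moving, absorbs the gradient term that arises from the difference of the drifts. Bolzano's bisection
  argument assembles the steps.\<close>

section \<open>Functions with three bounded derivatives and Euler steps\<close>

text \<open>Only a weak solution is given, so neither h_t nor its norm may be differentiated in
  time, whereas the dual functions can be kept smooth; they must avoid 0 because p may be negative.
  The obstacle is uniformity: bisection picks the partition after the neighbourhoods, and a function
  reaching an interval is known only through its bounds. So every local estimate fixes its step
  length before the function is chosen, C^3 constants grow only by factors exp(k \<tau>), and no
  constant may blow up as p passes 0. Budget of one step: integration by parts yields -|p - 1| G,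
  where G is the normalised weighted energy. The difference of the drifts, at most Mmm W1, takes
  \<epsilon> |p - 1| G by Young's inequality and leaves (Mmm W1)^2 / (4 \<epsilon> |p - 1|), which
  is |\<delta>| since |p - 1| = 1 / |q - 1|. The remaining (1 - \<epsilon>) |p - 1| G pays, through
  log-Sobolev, for moving p at speed 4 (1 - \<epsilon>) \<rho> |p - 1|. The dual bound says
  something about a density only if there is one, so absolute continuity of m_t is shown separately,
  by the same transport at p = 2.\<close>

definition has_derivs3 ::
  "('a::euclidean_space => 'b::real_normed_vector) => ('a => 'a => 'b) => ('a => 'a => 'a => 'b) =>
    ('a => 'a => 'a => 'a => 'b) => bool" where
  "has_derivs3 f f1 f2 f3 \<longleftrightarrow> (\<forall>x. (f has_derivative f1 x) (at x)) \<and> (\<forall>u x. ((\<lambda>x. f1 x u) has_derivative f2 x u) (at x)) \<and>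
     (\<forall>u v x. ((\<lambda>x. f2 x u v) has_derivative f3 x u v) (at x))"

definition derivs_bounded ::
  "real => real => real => ('a::euclidean_space => 'a => 'b::real_normed_vector) =>
    ('a => 'a => 'a => 'b) => ('a => 'a => 'a => 'a => 'b) => bool" where
  "derivs_bounded A B C f1 f2 f3 \<longleftrightarrow> (\<forall>x u. norm (f1 x u) <= A * norm u) \<and> (\<forall>x u v. norm (f2 x u v) <= B * norm u * norm v) \<and>
     (\<forall>x u v w. norm (f3 x u v w) <= C * norm u * norm v * norm w)"

lemma has_derivs3D:
  assumes "has_derivs3 f f1 f2 f3"
  shows "(f has_derivative f1 x) (at x)" "((\<lambda>x. f1 x u) has_derivative f2 x u) (at x)"
    "((\<lambda>x. f2 x u v) has_derivative f3 x u v) (at x)" using assms by (auto simp: has_derivs3_def)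

text \<open>Linearity in the direction differentiated last is part of \<open>has_derivative\<close>.
  In the earlier slots it follows from uniqueness of derivatives, because differentiation in
  \<open>x\<close> preserves the linear relations that hold before it. Hence derivatives can be
  carried as plain functions of directions, with no space of multilinear maps.\<close>

lemma has_derivs3_linear:
  assumes "has_derivs3 f f1 f2 f3"
  shows "linear (f1 x)" "linear (f2 x u)" "linear (\<lambda>u. f2 x u v)"
    "linear (f3 x u v)" "linear (\<lambda>u. f3 x u v w)" "linear (\<lambda>v. f3 x u v w)"
proof -
  note d = has_derivs3D[OF assms]
  show l1: "linear (f1 x)" for x using has_derivative_linear[OF d(1)] .
  show l2: "linear (f2 x u)" for x u using has_derivative_linear[OF d(2)] .
  show "linear (f3 x u v)" using has_derivative_linear[OF d(3)] .
  have a2: "f2 x (u + u') = (\<lambda>v. f2 x u v + f2 x u' v)" for x u u' using has_derivative_unique[OF d(2)[of "u + u'"]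
        has_derivative_add[OF d(2)[of u] d(2)[of u'], folded linear_add[OF l1]]] .
  have s2: "f2 x (c *\<^sub>R u) = (\<lambda>v. c *\<^sub>R f2 x u v)" for x c u using has_derivative_unique[OF d(2)[of "c *\<^sub>R u"]
        has_derivative_scaleR_right[OF d(2)[of u], of c, folded linear_scale[OF l1]]] .
  show "linear (\<lambda>u. f2 x u v)" for x v by (rule linearI) (simp_all add: a2 s2)
  have "f3 x (u + u') v = (\<lambda>w. f3 x u v w + f3 x u' v w)" for u u' by (rule has_derivative_unique[OF d(3)[of "u + u'" v]])
      (use has_derivative_add[OF d(3)[of u v] d(3)[of u' v]] in \<open>simp add: a2\<close>)
  moreover have "f3 x (c *\<^sub>R u) v = (\<lambda>w. c *\<^sub>R f3 x u v w)" for c u by (rule has_derivative_unique[OF d(3)[of "c *\<^sub>R u" v]])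
      (use has_derivative_scaleR_right[OF d(3)[of u v], of c] in \<open>simp add: s2\<close>)
  ultimately show "linear (\<lambda>u. f3 x u v w)" by (intro linearI) simp_all
  have "f3 x u (v + v') = (\<lambda>w. f3 x u v w + f3 x u v' w)" for v v' by (rule has_derivative_unique[OF d(3)[of u "v + v'"]])
      (use has_derivative_add[OF d(3)[of u v] d(3)[of u v']] in \<open>simp add: linear_add[OF l2]\<close>)
  moreover have "f3 x u (c *\<^sub>R v) = (\<lambda>w. c *\<^sub>R f3 x u v w)" for c v by (rule has_derivative_unique[OF d(3)[of u "c *\<^sub>R v"]])
      (use has_derivative_scaleR_right[OF d(3)[of u v], of c] in \<open>simp add: linear_scale[OF l2]\<close>)
  ultimately show "linear (\<lambda>v. f3 x u v w)" by (intro linearI) simp_all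
qed

lemma linear_euclidean_sum:
  fixes g :: "'a::euclidean_space => 'b::real_vector"
  assumes "linear g" shows "g x = (\<Sum>b\<in>Basis. (x \<bullet> b) *\<^sub>R g b)"
proof -
  have "g x = g (\<Sum>b\<in>Basis. (x \<bullet> b) *\<^sub>R b)" by (simp add: euclidean_representation)
  then show ?thesis by (simp add: linear_sum[OF assms] linear_scale[OF assms])
qed

text \<open>Product rule for an \<open>x\<close>-dependent linear map applied to a moving vector.
  Expanding the vector in the basis reduces it to finitely many scalar products, so no topology on
  linear maps enters.\<close>

lemma has_derivative_linear_family:
  fixes f :: "'a::euclidean_space => 'c::euclidean_space => 'b::real_normed_vector"
  assumes f: "\<And>u. ((\<lambda>x. f x u) has_derivative f' u) (at x)" and l: "\<And>x. linear (f x)"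
    and w: "(w has_derivative w') (at x)"
  shows "((\<lambda>x. f x (w x)) has_derivative (\<lambda>h. f' (w x) h + f x (w' h))) (at x)"
proof -
  have l': "linear (\<lambda>u. f' u h)" for h
  proof (rule linearI)
    fix u v c
    have "f' (u + v) = (\<lambda>h. f' u h + f' v h)" by (rule has_derivative_unique[OF f[of "u + v"]])
        (use has_derivative_add[OF f[of u] f[of v]] in \<open>simp add: linear_add[OF l]\<close>)
    then show "f' (u + v) h = f' u h + f' v h" by simp
    have "f' (c *\<^sub>R u) = (\<lambda>h. c *\<^sub>R f' u h)" by (rule has_derivative_unique[OF f[of "c *\<^sub>R u"]])
        (use has_derivative_scaleR_right[OF f[of u], of c] in \<open>simp add: linear_scale[OF l]\<close>)
    then show "f' (c *\<^sub>R u) h = c *\<^sub>R f' u h" by simp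
  qed
  have "((\<lambda>x. \<Sum>b\<in>Basis. (w x \<bullet> b) *\<^sub>R f x b) has_derivative (\<lambda>h. \<Sum>b\<in>Basis. (w x \<bullet> b) *\<^sub>R f' b h + (w' h \<bullet> b) *\<^sub>R f x b)) (at x)"
    by (intro has_derivative_sum has_derivative_scaleR f has_derivative_inner_left w)
  moreover have "(\<lambda>h. \<Sum>b\<in>Basis. (w x \<bullet> b) *\<^sub>R f' b h + (w' h \<bullet> b) *\<^sub>R f x b) = (\<lambda>h. f' (w x) h + f x (w' h))"
    by (simp add: sum.distrib flip: linear_euclidean_sum[OF l] linear_euclidean_sum[OF l'])
  ultimately show ?thesis by (simp flip: linear_euclidean_sum[OF l])
qed

lemma has_derivative_compose_family:
  fixes f :: "'a::euclidean_space => 'c::euclidean_space => 'b::real_normed_vector"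
    and T :: "'d::euclidean_space => 'a"
  assumes f: "\<And>u y. ((\<lambda>x. f x u) has_derivative f' y u) (at y)" and l: "\<And>x. linear (f x)"
    and T: "(T has_derivative T') (at x)" and w: "(w has_derivative w') (at x)"
  shows "((\<lambda>x. f (T x) (w x)) has_derivative (\<lambda>h. f' (T x) (w x) (T' h) + f (T x) (w' h))) (at x)"
  by (rule has_derivative_linear_family[where f = "\<lambda>x. f (T x)" and f' = "\<lambda>u h. f' (T x) u (T' h)"])
    (use has_derivative_compose[OF T f] l w in auto)

text \<open>Each new derivative hits either the outer function or one of the vectors plugged into
  it, whence one term with \<open>f3\<close>, three with \<open>f2\<close> and one with
  \<open>f1\<close> at third order.\<close>

lemma has_derivs3_compose:
  fixes f :: "'a::euclidean_space => 'b::real_normed_vector" and T :: "'a => 'a"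
  assumes f: "has_derivs3 f f1 f2 f3" and T: "has_derivs3 T T1 T2 T3"
  shows "has_derivs3 (\<lambda>x. f (T x)) (\<lambda>x u. f1 (T x) (T1 x u)) (\<lambda>x u v. f2 (T x) (T1 x u) (T1 x v) + f1 (T x) (T2 x u v))
    (\<lambda>x u v w. f3 (T x) (T1 x u) (T1 x v) (T1 x w) + f2 (T x) (T1 x u) (T2 x v w)
       + f2 (T x) (T2 x u w) (T1 x v) + f2 (T x) (T2 x u v) (T1 x w) + f1 (T x) (T3 x u v w))" unfolding has_derivs3_def
proof (intro conjI allI)
  note d = has_derivs3D[OF f] and e = has_derivs3D[OF T] and l = has_derivs3_linear[OF f]
  show "((\<lambda>x. f (T x)) has_derivative (\<lambda>u. f1 (T x) (T1 x u))) (at x)" for x by (rule has_derivative_compose[OF e(1) d(1)])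
  have D1: "((\<lambda>x. f1 (T x) (w x)) has_derivative (\<lambda>v. f2 (T x) (w x) (T1 x v) + f1 (T x) (w' v))) (at x)"
    if "(w has_derivative w') (at x)" for w w' x using has_derivative_compose_family[OF d(2) l(1) e(1) that] .
  show "((\<lambda>x. f1 (T x) (T1 x u)) has_derivative (\<lambda>v. f2 (T x) (T1 x u) (T1 x v) + f1 (T x) (T2 x u v))) (at x)" for u x
    by (rule D1[OF e(2)])
  have D2: "((\<lambda>x. f2 (T x) (T1 x u) v) has_derivative
       (\<lambda>w. f3 (T x) (T1 x u) v (T1 x w) + f2 (T x) (T2 x u w) v)) (at x)" for u v x
    using has_derivative_compose_family[OF d(3) l(3) e(1) e(2)] .
  have "((\<lambda>x. f2 (T x) (T1 x u) (T1 x v)) has_derivative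
       (\<lambda>w. (f3 (T x) (T1 x u) (T1 x v) (T1 x w) + f2 (T x) (T2 x u w) (T1 x v)) +
         f2 (T x) (T1 x u) (T2 x v w))) (at x)" for u v x
    by (rule has_derivative_linear_family[where f = "\<lambda>x. f2 (T x) (T1 x u)" and
       f' = "\<lambda>v w. f3 (T x) (T1 x u) v (T1 x w) + f2 (T x) (T2 x u w) v", OF D2 l(2) e(2)])
  from has_derivative_add[OF this D1[OF e(3)]]
  show "((\<lambda>x. f2 (T x) (T1 x u) (T1 x v) + f1 (T x) (T2 x u v)) has_derivative
      (\<lambda>w. f3 (T x) (T1 x u) (T1 x v) (T1 x w) + f2 (T x) (T1 x u) (T2 x v w)
       + f2 (T x) (T2 x u w) (T1 x v) + f2 (T x) (T2 x u v) (T1 x w) + f1 (T x) (T3 x u v w))) (at x)"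
    for u v x by (rule has_derivative_eq_rhs) (auto simp: fun_eq_iff)
qed

text \<open>The constants count the terms of the chain rule: \<open>f3\<close> meets three first
  derivatives of \<open>T\<close>, \<open>f2\<close> meets a first and a second one in three ways,
  \<open>f1\<close> meets the third.\<close>

lemma derivs_bounded_compose:
  assumes f: "derivs_bounded A A A f1 f2 f3" and T: "derivs_bounded a b c T1 T2 T3"
    and nonneg: "0 <= A" "0 <= a" "0 <= b" "0 <= c"
  shows "derivs_bounded (A * a) (A * (a^2 + b)) (A * (a^3 + 3 * a * b + c)) (\<lambda>x u. f1 (T x) (T1 x u))
    (\<lambda>x u v. f2 (T x) (T1 x u) (T1 x v) + f1 (T x) (T2 x u v))
    (\<lambda>x u v w. f3 (T x) (T1 x u) (T1 x v) (T1 x w) + f2 (T x) (T1 x u) (T2 x v w)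
       + f2 (T x) (T2 x u w) (T1 x v) + f2 (T x) (T2 x u v) (T1 x w) + f1 (T x) (T3 x u v w))"
proof -
  have f1: "norm (f1 x u) <= A * r" if "norm u <= r" for x u r
    using f that nonneg unfolding derivs_bounded_def by (meson mult_left_mono order_trans)
  have f2: "norm (f2 x u v) <= A * r * s" if "norm u <= r" "norm v <= s" for x u v r s
  proof -
    have "0 <= r" "0 <= s" using that norm_ge_zero order_trans by blast+
    moreover have "norm (f2 x u v) <= A * norm u * norm v" using f by (auto simp: derivs_bounded_def)
    moreover have "A * norm u * norm v <= A * r * s" using that nonneg calculation by (intro mult_mono mult_nonneg_nonneg) auto
    ultimately show ?thesis by linarith
  qed
  have f3: "norm (f3 x u v w) <= A * r * s * t" if "norm u <= r" "norm v <= s" "norm w <= t" for x u v w r s t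
  proof -
    have "0 <= r" "0 <= s" "0 <= t" using that norm_ge_zero order_trans by blast+
    moreover have "norm (f3 x u v w) <= A * norm u * norm v * norm w" using f by (auto simp: derivs_bounded_def)
    moreover have "A * norm u * norm v * norm w <= A * r * s * t" using that nonneg calculation
      by (intro mult_mono mult_nonneg_nonneg) auto
    ultimately show ?thesis by linarith
  qed
  have T1: "norm (T1 x u) <= a * norm u" and T2: "norm (T2 x u v) <= b * norm u * norm v"
    and T3: "norm (T3 x u v w) <= c * norm u * norm v * norm w" for x u v w using T by (auto simp: derivs_bounded_def)
  show ?thesis unfolding derivs_bounded_def
  proof (intro conjI allI)
    fix x u v w
    show "norm (f1 (T x) (T1 x u)) <= A * a * norm u" using f1[OF T1] by (simp add: mult.assoc)
    show "norm (f2 (T x) (T1 x u) (T1 x v) + f1 (T x) (T2 x u v)) <= A * (a^2 + b) * norm u * norm v"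
      by (rule order_trans[OF norm_triangle_mono[OF f2[OF T1 T1] f1[OF T2]]]) (simp add: algebra_simps power2_eq_square)
    show "norm (f3 (T x) (T1 x u) (T1 x v) (T1 x w) + f2 (T x) (T1 x u) (T2 x v w)
       + f2 (T x) (T2 x u w) (T1 x v) + f2 (T x) (T2 x u v) (T1 x w) + f1 (T x) (T3 x u v w))
       <= A * (a^3 + 3 * a * b + c) * norm u * norm v * norm w"
      by (rule order_trans[OF norm_triangle_mono[OF norm_triangle_mono[OF norm_triangle_mono[OF
          norm_triangle_mono[OF f3[OF T1 T1 T1] f2[OF T1 T2]] f2[OF T2 T1]] f2[OF T2 T1]] f1[OF T3]]])
        (simp add: algebra_simps power2_eq_square power3_eq_cube)
  qed
qed


definition C3 :: "real => ('a::euclidean_space => 'b::real_normed_vector) => bool" where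
  "C3 A f \<longleftrightarrow> 0 <= A \<and> (\<exists>f1 f2 f3. has_derivs3 f f1 f2 f3 \<and> derivs_bounded A A A f1 f2 f3)"

lemma derivs_bounded_mono:
  assumes "derivs_bounded A B C f1 f2 f3" "A <= A'" "B <= B'" "C <= C'"
  shows "derivs_bounded A' B' C' f1 f2 f3" using assms unfolding derivs_bounded_def
  by (meson mult_right_mono norm_ge_zero order_trans)

lemma C3_mono: "C3 A f ==> A <= B ==> C3 B f" unfolding C3_def by (meson derivs_bounded_mono order_trans)

lemma C3I:
  assumes "has_derivs3 f f1 f2 f3" "derivs_bounded A B C f1 f2 f3" "A <= D" "B <= D" "C <= D" "0 <= D"
  shows "C3 D f" using assms unfolding C3_def by (meson derivs_bounded_mono)

lemma C3_const [simp]: "0 <= A ==> C3 A (\<lambda>x. c)"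
  by (rule C3I[where A = 0 and B = 0 and C = 0 and ?f1.0 = "\<lambda>_ _. 0" and ?f2.0 = "\<lambda>_ _ _. 0"
        and ?f3.0 = "\<lambda>_ _ _ _. 0"]) (auto simp: has_derivs3_def derivs_bounded_def)

lemma C3_add:
  assumes "C3 A f" "C3 B g" shows "C3 (A + B) (\<lambda>x. f x + g x)"
proof -
  obtain f1 f2 f3 where f: "has_derivs3 f f1 f2 f3" "derivs_bounded A A A f1 f2 f3" "0 <= A" using assms by (auto simp: C3_def)
  obtain g1 g2 g3 where g: "has_derivs3 g g1 g2 g3" "derivs_bounded B B B g1 g2 g3" "0 <= B" using assms by (auto simp: C3_def)
  have "has_derivs3 (\<lambda>x. f x + g x) (\<lambda>x u. f1 x u + g1 x u) (\<lambda>x u v. f2 x u v + g2 x u v) (\<lambda>x u v w. f3 x u v w + g3 x u v w)"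
    using f(1) g(1) by (auto simp: has_derivs3_def intro!: has_derivative_add)
  moreover have "derivs_bounded (A + B) (A + B) (A + B) (\<lambda>x u. f1 x u + g1 x u)
      (\<lambda>x u v. f2 x u v + g2 x u v) (\<lambda>x u v w. f3 x u v w + g3 x u v w)"
    using f(2) g(2) by (auto simp: derivs_bounded_def distrib_right intro!: norm_triangle_mono)
  ultimately show ?thesis using f(3) g(3) by (auto simp: C3_def)
qed

lemma C3_cmult:
  fixes f :: "'a::euclidean_space => real"
  assumes "C3 A f" shows "C3 (\<bar>c\<bar> * A) (\<lambda>x. c * f x)"
proof -
  obtain f1 f2 f3 where f: "has_derivs3 f f1 f2 f3" "derivs_bounded A A A f1 f2 f3" "0 <= A" using assms by (auto simp: C3_def)
  have "has_derivs3 (\<lambda>x. c * f x) (\<lambda>x u. c * f1 x u) (\<lambda>x u v. c * f2 x u v) (\<lambda>x u v w. c * f3 x u v w)"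
    using f(1) by (auto simp: has_derivs3_def intro!: has_derivative_mult_right)
  moreover have "derivs_bounded (\<bar>c\<bar> * A) (\<bar>c\<bar> * A) (\<bar>c\<bar> * A) (\<lambda>x u. c * f1 x u)
      (\<lambda>x u v. c * f2 x u v) (\<lambda>x u v w. c * f3 x u v w)"
    using f(2) by (auto simp: derivs_bounded_def abs_mult mult.assoc intro!: mult_left_mono)
  ultimately show ?thesis using f(3) by (auto simp: C3_def)
qed

lemma C3_sum:
  fixes f :: "'i => 'a::euclidean_space => real"
  assumes "\<And>i. i \<in> I ==> C3 (A i) (f i)"
  shows "C3 (\<Sum>i\<in>I. A i) (\<lambda>x. \<Sum>i\<in>I. f i x)" using assms by (induction I rule: infinite_finite_induct) (auto intro!: C3_add)

lemma lipschitz_of_has_derivative: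
  fixes f :: "'a::euclidean_space => 'b::real_normed_vector"
  assumes "\<And>x. (f has_derivative f' x) (at x)" "\<And>x u. norm (f' x u) <= A * norm u"
  shows "norm (f (y + h) - f y) <= A * norm h"
proof -
  have "norm (f (y + h) - f y) <= A * norm ((y + h) - y)" by (rule differentiable_bound[where S = UNIV and f' = f'])
      (use assms in \<open>auto intro!: onorm_le\<close>)
  then show ?thesis by simp
qed

text \<open>Subtracting the linear map \<open>f' y\<close> leaves a function whose derivative is at
  most B |h| on the segment, and the mean value inequality applies; the factor 1/2 is given
  away.\<close>

lemma taylor1_of_has_derivative:
  fixes f :: "'a::euclidean_space => 'b::real_normed_vector"
  assumes f: "\<And>x. (f has_derivative f' x) (at x)"
    and B: "\<And>x h u. norm (f' (x + h) u - f' x u) <= B * norm h * norm u"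
  shows "norm (f (y + h) - f y - f' y h) <= B * norm h * norm h"
proof -
  have l: "linear (f' y)" by (rule has_derivative_linear[OF f])
  have "norm ((f (y + h) - f' y (y + h)) - (f y - f' y y)) <= B * norm h * norm ((y + h) - y)"
  proof (rule differentiable_bound[where S = "closed_segment y (y + h)" and
        f = "\<lambda>x. f x - f' y x" and f' = "\<lambda>x u. f' x u - f' y u"])
    fix x assume "x \<in> closed_segment y (y + h)"
    then obtain t where t: "x = y + t *\<^sub>R h" "0 <= t" "t <= 1" by (auto simp: closed_segment_def algebra_simps)
    have "0 <= B * norm h * norm h" using B[of 0 h h] norm_ge_zero order_trans by blast
    then have B0: "0 <= B * norm h" by (cases "h = 0") (auto simp: zero_le_mult_iff)
    show "onorm (\<lambda>u. f' x u - f' y u) <= B * norm h"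
    proof (rule onorm_le)
      fix u
      have "norm (f' x u - f' y u) <= (B * norm h) * t * norm u" using B[of y "t *\<^sub>R h" u] t by (simp add: mult_ac)
      also have "... <= (B * norm h) * 1 * norm u" using t B0 by (intro mult_right_mono[OF mult_left_mono] norm_ge_zero)
      finally show "norm (f' x u - f' y u) <= B * norm h * norm u" by simp
    qed
    show "((\<lambda>x. f x - f' y x) has_derivative (\<lambda>u. f' x u - f' y u)) (at x within closed_segment y (y + h))"
      by (intro has_derivative_diff has_derivative_at_withinI[OF f] linear_imp_has_derivative l)
  qed auto
  then show ?thesis by (simp add: linear_add[OF l] algebra_simps)
qed

lemma C3_taylor:
  assumes f: "has_derivs3 f f1 f2 f3" and A: "derivs_bounded A A A f1 f2 f3"
  shows "norm (f (y + h) - f y) <= A * norm h"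
    and "norm (f1 (y + h) u - f1 y u) <= A * norm u * norm h"
    and "norm (f2 (y + h) u v - f2 y u v) <= A * norm u * norm v * norm h"
    and "norm (f (y + h) - f y - f1 y h) <= A * norm h * norm h"
    and "norm (f1 (y + h) u - f1 y u - f2 y u h) <= A * norm u * norm h * norm h"
proof -
  note d = has_derivs3D[OF f]
  show "norm (f (y + h) - f y) <= A * norm h"
    by (rule lipschitz_of_has_derivative[OF d(1)]) (use A in \<open>auto simp: derivs_bounded_def\<close>)
  show 2: "norm (f1 (y + h) u - f1 y u) <= A * norm u * norm h" for y h u
    by (rule lipschitz_of_has_derivative[OF d(2)]) (use A in \<open>auto simp: derivs_bounded_def\<close>)
  show 3: "norm (f2 (y + h) u v - f2 y u v) <= A * norm u * norm v * norm h" for y h u v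
    by (rule lipschitz_of_has_derivative[OF d(3)]) (use A in \<open>auto simp: derivs_bounded_def\<close>)
  show "norm (f (y + h) - f y - f1 y h) <= A * norm h * norm h"
    by (rule taylor1_of_has_derivative[OF d(1)]) (use 2 in \<open>simp add: mult_ac\<close>)
  show "norm (f1 (y + h) u - f1 y u - f2 y u h) <= A * norm u * norm h * norm h"
    by (rule taylor1_of_has_derivative[OF d(2), where B = "A * norm u"]) (metis 3 mult.assoc mult.commute)
qed

text \<open>Along the segment the second-order remainder \<open>g\<close> has the first-order
  remainder of \<open>f1\<close> as its derivative, which is at most A s^2 |h|^3; the mean value
  inequality on [0, 1] concludes.\<close>

lemma C3_taylor2:
  assumes f: "has_derivs3 f f1 f2 f3" and A: "derivs_bounded A A A f1 f2 f3"
  shows "norm (f (y + h) - f y - f1 y h - (1/2) *\<^sub>R f2 y h h) <= A * norm h * norm h * norm h"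
proof -
  note d = has_derivs3D[OF f] and l = has_derivs3_linear[OF f]
  define g where "g s = f (y + s *\<^sub>R h) - s *\<^sub>R f1 y h - (s^2/2) *\<^sub>R f2 y h h" for s
  have A0: "0 <= A * norm h * norm h * norm h" using C3_taylor(5)[OF f A, of 0 h h] norm_ge_zero order_trans by blast
  have "norm (g 1 - g 0) <= A * norm h * norm h * norm h * norm (1 - 0 :: real)"
  proof (rule differentiable_bound[where S = "{0..1}" and
      f' = "\<lambda>s r. r *\<^sub>R (f1 (y + s *\<^sub>R h) h - f1 y h - s *\<^sub>R f2 y h h)"])
    fix s :: real assume s: "s \<in> {0..1}"
    have "((\<lambda>s. f (y + s *\<^sub>R h)) has_derivative (\<lambda>r. f1 (y + s *\<^sub>R h) (r *\<^sub>R h))) (at s)"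
      by (rule has_derivative_compose[OF _ d(1)]) (auto intro!: derivative_eq_intros)
    moreover have "((\<lambda>s. s *\<^sub>R f1 y h) has_derivative (\<lambda>r. r *\<^sub>R f1 y h)) (at s)" by (auto intro!: derivative_eq_intros)
    moreover have "((\<lambda>s. s^2/2) has_derivative (\<lambda>r. r * s)) (at s)" by (auto intro!: derivative_eq_intros)
    then have "((\<lambda>s. (s^2/2) *\<^sub>R f2 y h h) has_derivative (\<lambda>r. (r * s) *\<^sub>R f2 y h h)) (at s)" by (rule has_derivative_scaleR_left)
    ultimately have "(g has_derivative (\<lambda>r. f1 (y + s *\<^sub>R h) (r *\<^sub>R h) - r *\<^sub>R f1 y h - (r * s) *\<^sub>R f2 y h h)) (at s)"
      unfolding g_def by (intro has_derivative_diff)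
    then show "(g has_derivative (\<lambda>r. r *\<^sub>R (f1 (y + s *\<^sub>R h) h - f1 y h - s *\<^sub>R f2 y h h))) (at s within {0..1})"
      by (simp add: has_derivative_at_withinI linear_scale[OF l(1)] scaleR_diff_right)
    have "norm (f1 (y + s *\<^sub>R h) h - f1 y h - s *\<^sub>R f2 y h h) <= s^2 * (A * norm h * norm h * norm h)"
      using C3_taylor(5)[OF f A, of y "s *\<^sub>R h" h] s by (simp add: linear_scale[OF l(2)] mult_ac power2_eq_square)
    also have "... <= 1 * (A * norm h * norm h * norm h)" using s A0 by (intro mult_right_mono) (auto simp: power_le_one)
    finally show "onorm (\<lambda>r. r *\<^sub>R (f1 (y + s *\<^sub>R h) h - f1 y h - s *\<^sub>R f2 y h h)) <= A * norm h * norm h * norm h"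
      by (intro onorm_le) (auto simp: mult.commute intro: mult_left_mono)
  qed auto
  moreover have "g 1 - g 0 = f (y + h) - f y - f1 y h - (1/2) *\<^sub>R f2 y h h" by (simp add: g_def)
  ultimately show ?thesis by simp
qed

section \<open>The explicit Euler step: stability and expansion\<close>

text \<open>A discrete substitute for Gaussian noise of covariance 2 \<tau> Id: a coordinate
  direction is picked uniformly, with a random sign, so the squared jump must be 2 DIM \<tau> for
  its mean along each axis to be 2 \<tau>. Up to o(\<tau>) this reproduces \<tau> times the
  Laplacian.\<close>

definition euler_step :: "real => ('a::euclidean_space => 'a) => ('a => real) => 'a => real" where
  "euler_step \<tau> b \<phi> x = (\<Sum>e\<in>Basis.
      \<phi> (x - \<tau> *\<^sub>R b x + sqrt (2 * real DIM('a) * \<tau>) *\<^sub>R e) +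
      \<phi> (x - \<tau> *\<^sub>R b x + (- sqrt (2 * real DIM('a) * \<tau>)) *\<^sub>R e)) / (2 * DIM('a))"

lemma euler_step_bounds:
  fixes f :: "'a::euclidean_space => real"
  assumes "\<And>x. c <= f x" "\<And>x. f x <= C"
  shows "c <= euler_step s b f x" "euler_step s b f x <= C"
proof -
  have "(\<Sum>e\<in>(Basis :: 'a set). c + c) <= (\<Sum>e\<in>Basis.
      f (x - s *\<^sub>R b x + sqrt (2 * real DIM('a) * s) *\<^sub>R e) +
      f (x - s *\<^sub>R b x + (- sqrt (2 * real DIM('a) * s)) *\<^sub>R e))" by (intro sum_mono add_mono assms)
  then show "c <= euler_step s b f x" by (simp add: euler_step_def field_simps)
  have "(\<Sum>e\<in>Basis.
      f (x - s *\<^sub>R b x + sqrt (2 * real DIM('a) * s) *\<^sub>R e) +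
      f (x - s *\<^sub>R b x + (- sqrt (2 * real DIM('a) * s)) *\<^sub>R e)) <= (\<Sum>e\<in>(Basis :: 'a set). C + C)"
    by (intro sum_mono add_mono assms)
  then show "euler_step s b f x <= C" by (simp add: euler_step_def field_simps)
qed

text \<open>Each point of the average is a translate of x - s b(x), whose derivatives are at most 1
  + m, m, m with m = s M. A growth factor exp(k s), k = 7 M + 3 M^2, is multiplicative over
  consecutive steps, which keeps the constants bounded however fine the partition is.\<close>

lemma C3_euler_step:
  fixes g :: "'a::euclidean_space => real"
  assumes g: "C3 A g" and b: "C3 M b" and s: "0 <= s" "s <= 1"
  shows "C3 (A * exp ((7 * M + 3 * M^2) * s)) (euler_step s b g)"
proof -
  obtain f1 f2 f3 where f: "has_derivs3 g f1 f2 f3" "derivs_bounded A A A f1 f2 f3" "0 <= A" using g by (auto simp: C3_def)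
  obtain b1 b2 b3 where bb: "has_derivs3 b b1 b2 b3" "derivs_bounded M M M b1 b2 b3" "0 <= M" using b by (auto simp: C3_def)
  define B where "B = A * exp ((7 * M + 3 * M^2) * s)"
  define m where "m = s * M"
  have m0: "0 <= m" using s bb(3) by (simp add: m_def)
  have shift: "C3 B (\<lambda>x. g (x - s *\<^sub>R b x + z))" for z
  proof -
    have T: "has_derivs3 (\<lambda>x. x - s *\<^sub>R b x + z) (\<lambda>x u. u - s *\<^sub>R b1 x u) (\<lambda>x u v. - (s *\<^sub>R b2 x u v))
        (\<lambda>x u v w. - (s *\<^sub>R b3 x u v w))" using has_derivs3D[OF bb(1)]
      by (auto simp: has_derivs3_def intro!: derivative_eq_intros)
    have TB: "derivs_bounded (1 + m) m m (\<lambda>x u. u - s *\<^sub>R b1 x u) (\<lambda>x u v. - (s *\<^sub>R b2 x u v)) (\<lambda>x u v w. - (s *\<^sub>R b3 x u v w))"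
      unfolding derivs_bounded_def
    proof (intro conjI allI)
      fix x u v w
      have "norm (u - s *\<^sub>R b1 x u) <= norm u + s * norm (b1 x u)" using norm_triangle_ineq4[of u "s *\<^sub>R b1 x u"] s by simp
      also have "... <= norm u + s * (M * norm u)" using bb(2) s by (auto simp: derivs_bounded_def intro!: mult_left_mono)
      finally show "norm (u - s *\<^sub>R b1 x u) <= (1 + m) * norm u" by (simp add: m_def algebra_simps)
      show "norm (- (s *\<^sub>R b2 x u v)) <= m * norm u * norm v"
        using bb(2) s by (auto simp: derivs_bounded_def m_def mult.assoc intro!: mult_left_mono)
      show "norm (- (s *\<^sub>R b3 x u v w)) <= m * norm u * norm v * norm w"
        using bb(2) s by (auto simp: derivs_bounded_def m_def mult.assoc intro!: mult_left_mono)
    qed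
    \<comment> \<open>The largest of the three composition bounds is (1 + m)^3 + 3 (1 + m) m + m =
      (1 + m)^3 + m (4 + 3 m). It is at most exp(3 m) exp(m (4 + 3 M)), where \<open>s <= 1\<close>
      gives m <= M; this produces the coefficients 7 and 3.\<close>
    have "m * (4 + 3 * m) <= m * (4 + 3 * M)" using m0 s bb(3) by (intro mult_left_mono) (auto simp: m_def mult_left_le_one_le)
    moreover have "0 <= m * (4 + 3 * m)" using m0 by simp
    moreover have "(1 + m) ^ 3 <= exp m ^ 3" using m0 by (intro power_mono) auto
    moreover have "1 <= exp m ^ 3" using m0 by simp
    ultimately have "(1 + m) ^ 3 + m * (4 + 3 * m) <= exp m ^ 3 + exp m ^ 3 * (m * (4 + 3 * M))"
      by (intro add_mono) (auto intro: order_trans[OF _ mult_right_mono[of 1]])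
    also have "... = exp m ^ 3 * (1 + m * (4 + 3 * M))" by (simp add: algebra_simps)
    also have "... <= exp m ^ 3 * exp (m * (4 + 3 * M))" by (intro mult_left_mono) auto
    also have "... = exp ((7 * M + 3 * M^2) * s)"
      by (simp add: m_def algebra_simps power2_eq_square flip: exp_add exp_of_nat_mult)
    finally have E: "(1 + m) ^ 3 + m * (4 + 3 * m) <= exp ((7 * M + 3 * M^2) * s)" .
    have "1 + m <= exp ((7 * M + 3 * M^2) * s)" "(1 + m)^2 + m <= exp ((7 * M + 3 * M^2) * s)"
      "(1 + m)^3 + 3 * (1 + m) * m + m <= exp ((7 * M + 3 * M^2) * s)"
      by (rule order_trans[OF _ E]; use m0 in \<open>simp add: power2_eq_square power3_eq_cube algebra_simps\<close>)+
    then show ?thesis by (intro C3I[OF has_derivs3_compose[OF f(1) T] derivs_bounded_compose[OF f(2) TB]])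
        (use f(3) m0 in \<open>auto simp: B_def intro!: mult_left_mono\<close>)
  qed
  have "C3 (\<Sum>e\<in>(Basis :: 'a set). B + B) (\<lambda>x. \<Sum>e\<in>Basis.
      g (x - s *\<^sub>R b x + sqrt (2 * real DIM('a) * s) *\<^sub>R e) +
      g (x - s *\<^sub>R b x + (- sqrt (2 * real DIM('a) * s)) *\<^sub>R e))" by (intro C3_sum C3_add shift)
  from C3_cmult[OF this, of "1 / (2 * DIM('a))"] show ?thesis by (simp add: euler_step_def[abs_def] B_def)
qed

definition lap2 :: "('a::euclidean_space => 'a => 'a => real) => 'a => real" where
  "lap2 f2 x = (\<Sum>e\<in>Basis. f2 x e e)"

lemma lap2_lipschitz:
  fixes f :: "'a::euclidean_space => real"
  assumes f: "has_derivs3 f f1 f2 f3" and A: "derivs_bounded A A A f1 f2 f3"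
  shows "\<bar>lap2 f2 (y + h) - lap2 f2 y\<bar> <= real DIM('a) * A * norm h"
proof -
  have "\<bar>lap2 f2 (y + h) - lap2 f2 y\<bar> <= (\<Sum>e\<in>(Basis::'a set). A * norm h)" unfolding lap2_def sum_subtractf[symmetric]
    by (intro order_trans[OF sum_abs] sum_mono order_trans[OF C3_taylor(3)[OF f A, unfolded real_norm_def]]) simp
  then show ?thesis by simp
qed

lemma lap2_bound:
  assumes A: "derivs_bounded A A A f1 f2 (f3 :: 'a::euclidean_space => 'a => 'a => 'a => real)"
  shows "\<bar>lap2 f2 x\<bar> <= real DIM('a) * A"
proof -
  have "\<bar>lap2 f2 x\<bar> <= (\<Sum>e\<in>(Basis::'a set). A)" unfolding lap2_def
  proof (intro order_trans[OF sum_abs] sum_mono)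
    fix e :: 'a assume "e \<in> Basis"
    moreover have "norm (f2 x e e) <= A * norm e * norm e" using A by (simp add: derivs_bounded_def)
    ultimately show "\<bar>f2 x e e\<bar> <= A" by simp
  qed
  then show ?thesis by simp
qed

text \<open>Taylor's formula at the drifted point y = x - s b(x): opposite jumps cancel the first
  order and leave s times the Laplacian at y with an error of order s^(3/2); going from y back to x
  produces the drift term. The second bound stops one order earlier; it is linear in |b(x)|, so that
  its square stays integrable on \<open>P2\<close> for drifts of linear growth.\<close>

lemma euler_step_expansion:
  fixes h :: "'a::euclidean_space => real" and s :: real
  assumes f: "has_derivs3 h f1 f2 f3" and A: "derivs_bounded A A A f1 f2 f3" "0 <= A"
    and s: "0 <= s"
  shows "\<bar>euler_step s b h x - h x - s * (lap2 f2 x - f1 x (b x))\<bar> <=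
      2 * real DIM('a) * A * s * (sqrt (2 * real DIM('a) * s) + s * (1 + (norm (b x))^2))"
    and "\<bar>euler_step s b h x - h x\<bar> <= 2 * real DIM('a) * A * s * (1 + norm (b x))"
proof -
  define d where "d = real DIM('a)"
  have d1: "1 <= d" unfolding d_def using DIM_positive[where 'a = 'a] by linarith
  define z where "z = sqrt (2 * d * s)"
  have z2: "z * z = 2 * d * s" and z0: "0 <= z" using s d1 by (auto simp: z_def)
  define y where "y = x - s *\<^sub>R b x"
  define n where "n = norm (b x)"
  have l: "linear (f1 y)" "linear (f1 x)" "linear (f2 y u)" "linear (\<lambda>u. f2 y u v)" for u v using has_derivs3_linear[OF f] by auto
  have *: "\<bar>h (y + z *\<^sub>R e) + h (y + (- z) *\<^sub>R e) - 2 * h y - z * z * f2 y e e\<bar> <= 2 * A * (z * z * z)"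
    "\<bar>h (y + z *\<^sub>R e) + h (y + (- z) *\<^sub>R e) - 2 * h y\<bar> <= 2 * A * (z * z)" if e: "e \<in> Basis" for e
  proof -
    have "\<bar>h (y + z *\<^sub>R e) - h y - z * f1 y e - (1/2) * (z * z * f2 y e e)\<bar> <= A * (z * z * z)"
      using C3_taylor2[OF f A(1), of y "z *\<^sub>R e"] e z0
      by (simp add: linear_scale[OF l(1)] linear_scale[OF l(3)] linear_scale[OF l(4)] mult_ac)
    moreover have "\<bar>h (y + (-z) *\<^sub>R e) - h y + z * f1 y e - (1/2) * (z * z * f2 y e e)\<bar> <= A * (z * z * z)"
      using C3_taylor2[OF f A(1), of y "(-z) *\<^sub>R e"] e z0
      by (simp only: linear_scale[OF l(1)] linear_scale[OF l(3)] linear_scale[OF l(4)]) (simp add: mult_ac)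
    ultimately show "\<bar>h (y + z *\<^sub>R e) + h (y + (- z) *\<^sub>R e) - 2 * h y - z * z * f2 y e e\<bar> <= 2 * A * (z * z * z)" by linarith
    have "\<bar>h (y + z *\<^sub>R e) - h y - z * f1 y e\<bar> <= A * (z * z)" using C3_taylor(4)[OF f A(1), of y "z *\<^sub>R e"] e z0
      by (simp add: linear_scale[OF l(1)] mult_ac)
    moreover have "\<bar>h (y + (-z) *\<^sub>R e) - h y + z * f1 y e\<bar> <= A * (z * z)" using C3_taylor(4)[OF f A(1), of y "(-z) *\<^sub>R e"] e z0
      by (simp only: linear_scale[OF l(1)]) (simp add: mult_ac)
    ultimately show "\<bar>h (y + z *\<^sub>R e) + h (y + (- z) *\<^sub>R e) - 2 * h y\<bar> <= 2 * A * (z * z)" by linarith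
  qed
  define g where "g e = h (y + z *\<^sub>R e) + h (y + (- z) *\<^sub>R e) - 2 * h y" for e
  have "euler_step s b h x = ((\<Sum>e\<in>Basis. g e) + (\<Sum>e\<in>(Basis::'a set). 2 * h y)) / (2 * d)"
    unfolding sum.distrib[symmetric] by (simp add: euler_step_def g_def z_def y_def d_def)
  then have avg: "(\<Sum>e\<in>Basis. g e) = 2 * d * (euler_step s b h x - h y)" using d1 by (simp add: field_simps flip: d_def)
  have cancel: "\<bar>2 * d * u\<bar> <= 2 * d * v ==> \<bar>u\<bar> <= v" for u v using d1 by (simp add: abs_mult)
  have "\<bar>\<Sum>e\<in>Basis. g e - z * z * f2 y e e\<bar> <= (\<Sum>e\<in>(Basis :: 'a set). 2 * A * (z * z * z))"
    unfolding g_def by (intro order_trans[OF sum_abs] sum_mono *)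
  also have "(\<Sum>e\<in>(Basis :: 'a set). 2 * A * (z * z * z)) = 2 * d * (A * (2 * d * s * z))" unfolding z2 by (simp add: d_def)
  also have "(\<Sum>e\<in>Basis. g e - z * z * f2 y e e) = 2 * d * (euler_step s b h x - h y - s * lap2 f2 y)"
    unfolding sum_subtractf sum_distrib_left[symmetric] lap2_def[symmetric] avg z2 by (simp add: algebra_simps)
  finally have 1: "\<bar>euler_step s b h x - h y - s * lap2 f2 y\<bar> <= A * (2 * d * s * z)" by (rule cancel)
  have "\<bar>\<Sum>e\<in>Basis. g e\<bar> <= (\<Sum>e\<in>(Basis :: 'a set). 2 * A * (z * z))" unfolding g_def by (intro order_trans[OF sum_abs] sum_mono *)
  also have "(\<Sum>e\<in>(Basis :: 'a set). 2 * A * (z * z)) = 2 * d * (A * (2 * d * s))" unfolding z2 by (simp add: d_def)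
  finally have 2: "\<bar>euler_step s b h x - h y\<bar> <= A * (2 * d * s)" unfolding avg by (rule cancel)
  have y: "y = x + (-s) *\<^sub>R b x" by (simp add: y_def)
  have 3: "\<bar>lap2 f2 y - lap2 f2 x\<bar> <= d * A * (s * n)"
    using lap2_lipschitz[OF f A(1), of x "(-s) *\<^sub>R b x"] s by (simp add: y n_def d_def)
  have 4: "\<bar>h y - h x + s * f1 x (b x)\<bar> <= A * (s * n) * (s * n)" using C3_taylor(4)[OF f A(1), of x "(-s) *\<^sub>R b x"] s
    by (simp only: linear_scale[OF l(2)] y) (simp add: n_def)
  have 5: "\<bar>h y - h x\<bar> <= A * (s * n)" using C3_taylor(1)[OF f A(1), of x "(-s) *\<^sub>R b x"] s by (simp add: y n_def)
  have n0: "0 <= n" by (simp add: n_def)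
  have "\<bar>s * lap2 f2 y - s * lap2 f2 x\<bar> <= s * (d * A * (s * n))"
    using 3 s by (simp add: abs_mult mult_left_mono flip: right_diff_distrib)
  with 1 4 have "\<bar>euler_step s b h x - h x - s * (lap2 f2 x - f1 x (b x))\<bar> <=
     A * (2 * d * s * z) + s * (d * A * (s * n)) + A * (s * n) * (s * n)" unfolding right_diff_distrib by linarith
  also have "... = A * s * (2 * d * z + s * (d * n + n * n))" by (simp add: algebra_simps)
  also have "... <= A * s * (2 * d * z + s * (2 * d * (1 + n^2)))"
  proof -
    have "n <= 1 + n * n" using sum_power2_ge_zero[of "n - 1/2" 0] by (simp add: power2_eq_square algebra_simps)
    then have "d * n <= d * (1 + n * n)" using d1 by (intro mult_left_mono) auto
    moreover have "1 * (n * n) <= d * (1 + n * n)" using d1 by (intro mult_mono) auto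
    ultimately have "d * n + n * n <= 2 * d * (1 + n^2)" by (simp add: power2_eq_square)
    then show ?thesis using A(2) s by (intro mult_left_mono add_left_mono) auto
  qed
  finally show "\<bar>euler_step s b h x - h x - s * (lap2 f2 x - f1 x (b x))\<bar> <=
      2 * real DIM('a) * A * s * (sqrt (2 * real DIM('a) * s) + s * (1 + (norm (b x))^2))"
    by (simp add: n_def d_def z_def algebra_simps)
  have "\<bar>euler_step s b h x - h x\<bar> <= A * s * (2 * d + n)" using 2 5 by (simp add: algebra_simps)
  also have "... <= A * s * (2 * d * (1 + n))"
    using mult_right_mono[of 1 "2 * d" n] d1 n0 A(2) s by (intro mult_left_mono) (auto simp: distrib_left)
  finally show "\<bar>euler_step s b h x - h x\<bar> <= 2 * real DIM('a) * A * s * (1 + norm (b x))" by (simp add: n_def d_def mult_ac)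
qed

section \<open>Approximation by test functions\<close>

definition expinv :: "real poly => real => real" where
  "expinv p t = (if t > 0 then poly p (1 / t) * exp (- (1 / t)) else 0)"

lemma poly_div_exp_tendsto_0: "((\<lambda>s. poly p s * exp (- s)) \<longlongrightarrow> (0::real)) at_top"
proof -
  have "((\<lambda>s. \<Sum>i\<le>degree p. coeff p i * (s ^ i / exp s)) \<longlongrightarrow> (\<Sum>i\<le>degree p. coeff p i * 0)) at_top"
    by (intro tendsto_intros tendsto_power_div_exp_0)
  then show ?thesis by (simp add: poly_altdef sum_distrib_right sum_divide_distrib exp_minus field_simps)
qed

lemma expinv_tendsto_0: "(expinv p \<longlongrightarrow> 0) (at 0)"
proof -
  have "((\<lambda>t. poly p (1 / t) * exp (- (1 / t))) \<longlongrightarrow> 0) (at_right (0::real))"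
    using filterlim_compose[OF poly_div_exp_tendsto_0 filterlim_inverse_at_top_right] by (simp add: inverse_eq_divide)
  then have "(expinv p \<longlongrightarrow> 0) (at_right 0)"
    by (rule Lim_transform_eventually) (auto simp: expinv_def eventually_at_right_field intro: exI[of _ 1])
  moreover have "(expinv p \<longlongrightarrow> 0) (at_left 0)"
    by (rule tendsto_eventually) (auto simp: expinv_def eventually_at_left_field intro: exI[of _ "-1"])
  ultimately show ?thesis by (simp add: filterlim_at_split)
qed

text \<open>The derivative of p(1/t) exp(-1/t) is (1/t)^2 (p - p')(1/t) exp(-1/t). The family is
  closed under differentiation, so a single limit at 0 settles smoothness to all orders.\<close>

lemma expinv_has_derivative:
  "(expinv p has_real_derivative expinv (monom 1 2 * (p - pderiv p)) t) (at t)"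
proof (cases t "0 :: real" rule: linorder_cases)
  case greater
  have "((\<lambda>t. poly p (1 / t) * exp (- (1 / t))) has_real_derivative
     expinv (monom 1 2 * (p - pderiv p)) t) (at t)" using greater
    by (auto intro!: derivative_eq_intros DERIV_chain2[OF poly_DERIV]
        simp: expinv_def poly_monom field_simps power2_eq_square)
  then show ?thesis by (rule DERIV_cong_ev[OF refl _ refl, THEN iffD1, rotated])
      (use greater in \<open>auto simp: expinv_def eventually_nhds intro!: exI[of _ "{0<..}"]\<close>)
next
  case less
  have "((\<lambda>t. 0) has_real_derivative expinv (monom 1 2 * (p - pderiv p)) t) (at t)" using less by (simp add: expinv_def)
  then show ?thesis by (rule DERIV_cong_ev[OF refl _ refl, THEN iffD1, rotated])
      (use less in \<open>auto simp: expinv_def eventually_nhds intro!: exI[of _ "{..<0}"]\<close>)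
next
  case equal
  \<comment> \<open>At 0 the difference quotient is (1/h) p(1/h) exp(-1/h), that is, the function
    belonging to the polynomial X p, which is \<open>pCons 0 p\<close>.\<close>
  have "((\<lambda>h. expinv (pCons 0 p) h) \<longlongrightarrow> 0) (at 0)" by (rule expinv_tendsto_0)
  moreover have "expinv (pCons 0 p) h = (expinv p (0 + h) - expinv p 0) / h" for h by (simp add: expinv_def)
  ultimately show ?thesis unfolding equal by (simp add: DERIV_def) (simp add: expinv_def)
qed

text \<open>An algebra generated by one-dimensional profiles and stable under directional
  derivatives: membership stands for a whole hierarchy of C^k statements.\<close>

inductive_set smooth_alg :: "('a::euclidean_space => real) set" where
  smooth_alg_expinv: "(\<lambda>x. expinv p (a + x \<bullet> v)) \<in> smooth_alg"
| smooth_alg_const: "(\<lambda>x. c) \<in> smooth_alg"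
| smooth_alg_add: "f \<in> smooth_alg ==> g \<in> smooth_alg ==> (\<lambda>x. f x + g x) \<in> smooth_alg"
| smooth_alg_mult: "f \<in> smooth_alg ==> g \<in> smooth_alg ==> (\<lambda>x. f x * g x) \<in> smooth_alg"

lemma smooth_alg_derivative:
  assumes "f \<in> smooth_alg"
  shows "\<exists>f'. (\<forall>x. (f has_derivative f' x) (at x)) \<and> (\<forall>u. (\<lambda>x. f' x u) \<in> smooth_alg)" using assms
proof induction
  case (smooth_alg_expinv p a v)
  have "((\<lambda>x. expinv p (a + x \<bullet> v)) has_derivative (\<lambda>u. (u \<bullet> v) * expinv (monom 1 2 * (p - pderiv p)) (a + x \<bullet> v))) (at x)" for x
  proof (rule has_derivative_compose[where g = "expinv p" and f = "\<lambda>x. a + x \<bullet> v" and f' = "\<lambda>u. u \<bullet> v", THEN has_derivative_eq_rhs])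
    show "((\<lambda>x. a + x \<bullet> v) has_derivative (\<lambda>u. u \<bullet> v)) (at x)" by (auto intro!: derivative_eq_intros)
    show "(expinv p has_derivative (*) (expinv (monom 1 2 * (p - pderiv p)) (a + x \<bullet> v))) (at (a + x \<bullet> v))"
      using expinv_has_derivative by (simp add: has_field_derivative_def)
  qed (simp add: mult.commute)
  moreover have "(\<lambda>x. (u \<bullet> v) * expinv (monom 1 2 * (p - pderiv p)) (a + x \<bullet> v)) \<in> smooth_alg" for u by (intro smooth_alg.intros)
  ultimately show ?case by (intro exI[of _ "\<lambda>x u. (u \<bullet> v) * expinv (monom 1 2 * (p - pderiv p)) (a + x \<bullet> v)"] conjI allI)
next
  case (smooth_alg_const c)
  show ?case by (intro exI[of _ "\<lambda>_ _. 0"]) (auto intro!: smooth_alg.intros)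
next
  case (smooth_alg_add f g)
  then obtain f' g' where *: "\<And>x. (f has_derivative f' x) (at x)" "\<And>u. (\<lambda>x. f' x u) \<in> smooth_alg"
     "\<And>x. (g has_derivative g' x) (at x)" "\<And>u. (\<lambda>x. g' x u) \<in> smooth_alg" by blast
  then show ?case by (intro exI[of _ "\<lambda>x u. f' x u + g' x u"]) (auto intro!: smooth_alg.intros has_derivative_add)
next
  case (smooth_alg_mult f g)
  then obtain f' g' where *: "\<And>x. (f has_derivative f' x) (at x)" "\<And>u. (\<lambda>x. f' x u) \<in> smooth_alg"
     "\<And>x. (g has_derivative g' x) (at x)" "\<And>u. (\<lambda>x. g' x u) \<in> smooth_alg" by blast
  then show ?case by (intro exI[of _ "\<lambda>x u. f x * g' x u + f' x u * g x"])
     (use smooth_alg_mult.hyps in \<open>auto intro!: smooth_alg.intros has_derivative_mult\<close>)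
qed

lemma smooth_alg_affine:
  assumes "f \<in> smooth_alg" shows "(\<lambda>x. f (c *\<^sub>R x)) \<in> smooth_alg" using assms
proof induction
  case (smooth_alg_expinv p a v)
  show ?case using smooth_alg.smooth_alg_expinv[of p a "c *\<^sub>R v"] by simp
qed (auto intro: smooth_alg.intros)

lemma smooth_alg_prod:
  assumes "\<And>i. i \<in> I ==> f i \<in> smooth_alg" shows "(\<lambda>x. \<Prod>i\<in>I. f i x) \<in> smooth_alg"
  using assms by (induction I rule: infinite_finite_induct) (auto intro!: smooth_alg.intros)

lemma smooth_alg_continuous:
  assumes "f \<in> smooth_alg" shows "continuous_on UNIV f" using smooth_alg_derivative[OF assms]
  by (metis has_derivative_continuous_on has_derivative_at_withinI UNIV_I)

text \<open>In a set that is stable under directional derivatives every iterated derivative is again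
  a member, hence differentiable and continuous.\<close>

lemma Ck_coinduct:
  fixes f :: "'a::euclidean_space => 'b::real_normed_vector"
  assumes S: "\<And>f. f \<in> S ==> \<exists>f'. (\<forall>x. (f has_derivative f' x) (at x)) \<and> (\<forall>u. (\<lambda>x. f' x u) \<in> S)"
    and f: "f \<in> S"
  shows "Ck k f"
proof -
  have iter: "iter_deriv vs f \<in> S" for vs
  proof (induction vs)
    case (Cons v vs)
    obtain f' where f': "\<And>x. (iter_deriv vs f has_derivative f' x) (at x)" "\<And>u. (\<lambda>x. f' x u) \<in> S" using S[OF Cons.IH] by blast
    have "frechet_derivative (iter_deriv vs f) (at x) = f' x" for x using frechet_derivative_at[OF f'(1)] by simp
    then show ?case using f'(2) by simp
  qed (simp add: f)
  show ?thesis unfolding Ck_def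
    using S[OF iter] by (metis differentiable_def has_derivative_continuous_on has_derivative_at_withinI UNIV_I)
qed

definition supported_in :: "real => ('a::euclidean_space => 'b::zero) => bool" where
  "supported_in R f \<longleftrightarrow> (\<forall>x. norm x > R --> f x = 0)"

lemma supported_in_derivative:
  assumes f: "supported_in R f" and d: "\<And>x. (f has_derivative f' x) (at x)"
  shows "supported_in R (\<lambda>x. f' x u)" unfolding supported_in_def
proof (intro allI impI)
  fix x :: 'a assume x: "R < norm x"
  have "((\<lambda>_. 0) has_derivative f' x) (at x)"
  proof (rule has_derivative_transform_eventually[OF d])
    have "open {x :: 'a. R < norm x}" by (simp add: open_Collect_less continuous_on_norm_id)
    then show "\<forall>\<^sub>F y in at x within UNIV. f y = 0"
      using f x by (auto simp: eventually_at_topological supported_in_def intro!: exI[of _ "{x. R < norm x}"])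
  qed (use f x in \<open>auto simp: supported_in_def\<close>)
  then have "f' x = (\<lambda>_. 0)" using has_derivative_unique has_derivative_const by blast
  then show "f' x u = 0" by simp
qed

lemma supported_in_bounded:
  fixes f :: "'a::euclidean_space => real"
  assumes f: "supported_in R f" and c: "continuous_on UNIV f"
  shows "\<exists>K\<ge>0. \<forall>x. \<bar>f x\<bar> <= K"
proof -
  have "compact (f ` cball 0 R)" by (intro compact_continuous_image continuous_on_subset[OF c]) auto
  then obtain K where K: "\<forall>x\<in>cball 0 R. \<bar>f x\<bar> <= K" using compact_imp_bounded[of "f ` cball 0 R"] by (auto simp: bounded_iff)
  show ?thesis
  proof (intro exI[of _ "max K 0"] conjI allI)
    show "\<bar>f x\<bar> <= max K 0" for x using K f by (cases "norm x <= R") (auto simp: supported_in_def max.coboundedI1)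
  qed simp
qed

text \<open>Each pair of factors vanishes unless |x . b| < 1, so the support is the unit cube;
  comparison with the 1-norm places it in the ball of radius DIM.\<close>

definition bump :: "'a::euclidean_space => real" where
  "bump x = (\<Prod>b\<in>Basis. expinv 1 (1 + x \<bullet> b) * expinv 1 (1 + x \<bullet> (- b)))"

lemma bump_smooth: "bump \<in> smooth_alg" unfolding bump_def[abs_def] by (intro smooth_alg_prod smooth_alg_mult smooth_alg_expinv)

lemma bump_nonneg: "0 <= bump x" unfolding bump_def by (intro prod_nonneg) (auto simp: expinv_def)

lemma bump_0: "0 < bump 0" unfolding bump_def by (intro prod_pos) (auto simp: expinv_def)

lemma bump_supported: "supported_in DIM('a) (bump :: 'a::euclidean_space => real)" unfolding supported_in_def
proof (intro allI impI)
  fix x :: 'a assume x: "real DIM('a) < norm x"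
  have "\<exists>b\<in>Basis. 1 <= \<bar>x \<bullet> b\<bar>"
  proof (rule ccontr)
    assume "\<not> ?thesis"
    then have "(\<Sum>b\<in>Basis. \<bar>x \<bullet> b\<bar>) <= (\<Sum>b\<in>(Basis::'a set). 1)" by (intro sum_mono) force
    with norm_le_l1[of x] x show False by simp
  qed
  then obtain b where "b \<in> Basis" "1 <= \<bar>x \<bullet> b\<bar>" by blast
  then have "\<exists>b\<in>Basis. expinv 1 (1 + x \<bullet> b) * expinv 1 (1 + x \<bullet> (- b)) = 0" by (intro bexI[of _ b]) (auto simp: expinv_def)
  then show "bump x = 0" unfolding bump_def by (simp add: prod_zero_iff)
qed

text \<open>Along basis vectors the derivatives are continuous with compact support, and there are
  only finitely many of them up to order three. Multilinearity extends their bounds to all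
  directions at the price of a factor DIM per slot.\<close>

lemma smooth_alg_C3:
  fixes k :: "'a::euclidean_space => real"
  assumes k: "k \<in> smooth_alg" "supported_in R k"
  obtains A k1 k2 k3 where "0 <= A" "has_derivs3 k k1 k2 k3" "derivs_bounded A A A k1 k2 k3"
    "\<And>x. \<bar>k x\<bar> <= A"
    "\<And>u. (\<lambda>x. k1 x u) \<in> smooth_alg" "\<And>u. supported_in R (\<lambda>x. k1 x u)"
proof -
  have "\<forall>g :: 'a => real. \<exists>g'. g \<in> smooth_alg --> supported_in R g --> (\<forall>x. (g has_derivative g' x) (at x)) \<and>
      (\<forall>u. (\<lambda>x. g' x u) \<in> smooth_alg \<and> supported_in R (\<lambda>x. g' x u))"
  proof
    fix g :: "'a => real"
    show "\<exists>g'. g \<in> smooth_alg --> supported_in R g --> (\<forall>x. (g has_derivative g' x) (at x)) \<and>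
      (\<forall>u. (\<lambda>x. g' x u) \<in> smooth_alg \<and> supported_in R (\<lambda>x. g' x u))"
    proof (cases "g \<in> smooth_alg")
      case True
      from smooth_alg_derivative[OF this] obtain g' where
        "\<And>x. (g has_derivative g' x) (at x)" "\<And>u. (\<lambda>x. g' x u) \<in> smooth_alg" by blast
      then show ?thesis using supported_in_derivative[of R g g'] by (intro exI[of _ g']) simp
    qed simp
  qed
  \<comment> \<open>The derivative is chosen separately for every function, hence for every fixed
    list of earlier directions; linearity across directions is recovered from
    \<open>has_derivs3\<close> afterwards.\<close>
  from choice[OF this] obtain D where D0: "\<forall>g :: 'a => real. g \<in> smooth_alg --> supported_in R g -->
      (\<forall>x. (g has_derivative D g x) (at x)) \<and> (\<forall>u. (\<lambda>x. D g x u) \<in> smooth_alg \<and> supported_in R (\<lambda>x. D g x u))" ..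
  note D = D0[THEN spec, THEN mp, THEN mp]
  define k1 where "k1 = D k"
  define k2 where "k2 x u v = D (\<lambda>x. k1 x u) x v" for x u v
  define k3 where "k3 x u v w = D (\<lambda>x. k2 x u v) x w" for x u v w
  note s0 = k
  have s1: "(\<lambda>x. k1 x u) \<in> smooth_alg" "supported_in R (\<lambda>x. k1 x u)" for u using D[OF s0] by (auto simp: k1_def)
  have s2: "(\<lambda>x. k2 x u v) \<in> smooth_alg" "supported_in R (\<lambda>x. k2 x u v)" for u v using D[OF s1] by (auto simp: k2_def)
  have s3: "(\<lambda>x. k3 x u v w) \<in> smooth_alg" "supported_in R (\<lambda>x. k3 x u v w)" for u v w using D[OF s2] by (auto simp: k3_def)
  have d: "has_derivs3 k k1 k2 k3" unfolding has_derivs3_def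
  proof (intro conjI allI)
    fix u v x
    have "k2 x u = D (\<lambda>x. k1 x u) x" "k3 x u v = D (\<lambda>x. k2 x u v) x" by (simp_all add: k2_def k3_def fun_eq_iff)
    then show "(k has_derivative k1 x) (at x)" "((\<lambda>x. k1 x u) has_derivative k2 x u) (at x)"
      "((\<lambda>x. k2 x u v) has_derivative k3 x u v) (at x)" using D[OF s0] D[OF s1, of u] D[OF s2, of u v] by (simp_all add: k1_def)
  qed
  note l = has_derivs3_linear[OF d]
  have lin_bound: "\<bar>g u\<bar> <= real DIM('a) * M * norm u" if "linear g" "\<And>b. b \<in> Basis ==> \<bar>g b\<bar> <= M" "0 <= M"
    for g :: "'a => real" and M u
  proof -
    have "\<bar>g u\<bar> <= (\<Sum>b\<in>Basis. \<bar>(u \<bullet> b) *\<^sub>R g b\<bar>)" unfolding linear_euclidean_sum[OF that(1), of u] by (rule sum_abs)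
    also have "... <= (\<Sum>b\<in>(Basis::'a set). norm u * M)"
      using that(2,3) Basis_le_norm by (intro sum_mono) (auto simp: abs_mult intro!: mult_mono)
    finally show ?thesis by (simp add: mult_ac)
  qed
  obtain K0 where K0: "0 <= K0" "\<And>x. \<bar>k x\<bar> <= K0" using supported_in_bounded[OF s0(2) smooth_alg_continuous[OF s0(1)]] by blast
  have ex1: "\<forall>u. \<exists>K\<ge>0. \<forall>x. \<bar>k1 x u\<bar> <= K" using supported_in_bounded[OF s1(2) smooth_alg_continuous[OF s1(1)]] by blast
  then obtain K1 where K1: "\<And>u. 0 <= K1 u" "\<And>x u. \<bar>k1 x u\<bar> <= K1 u" by metis
  have ex2: "\<forall>u v. \<exists>K\<ge>0. \<forall>x. \<bar>k2 x u v\<bar> <= K" using supported_in_bounded[OF s2(2) smooth_alg_continuous[OF s2(1)]] by blast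
  then obtain K2 where K2: "\<And>u v. 0 <= K2 u v" "\<And>x u v. \<bar>k2 x u v\<bar> <= K2 u v" by metis
  have ex3: "\<forall>u v w. \<exists>K\<ge>0. \<forall>x. \<bar>k3 x u v w\<bar> <= K" using supported_in_bounded[OF s3(2) smooth_alg_continuous[OF s3(1)]] by blast
  then obtain K3 where K3: "\<And>u v w. 0 <= K3 u v w" "\<And>x u v w. \<bar>k3 x u v w\<bar> <= K3 u v w" by metis
  define M where "M = K0 + (\<Sum>a\<in>(Basis::'a set). K1 a) + (\<Sum>(a, b)\<in>Basis \<times> (Basis::'a set). K2 a b) +
    (\<Sum>(a, b, c)\<in>Basis \<times> Basis \<times> (Basis::'a set). K3 a b c)"
  have nn: "0 <= (\<Sum>a\<in>(Basis::'a set). K1 a)" "0 <= (\<Sum>(a, b)\<in>Basis \<times> (Basis::'a set). K2 a b)"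
    "0 <= (\<Sum>(a, b, c)\<in>Basis \<times> Basis \<times> (Basis::'a set). K3 a b c)"
    by (intro sum_nonneg; use K1 K2 K3 in auto)+
  have M0: "0 <= M" and MK0: "K0 <= M" unfolding M_def using nn K0(1) by linarith+
  have K1M: "K1 a <= M" if "a \<in> Basis" for a
    using member_le_sum[of a Basis K1] that K1 nn K0(1) by (simp add: M_def)
  have K2M: "K2 a b <= M" if "a \<in> Basis" "b \<in> Basis" for a b
    using member_le_sum[of "(a, b)" "Basis \<times> Basis" "\<lambda>(a, b). K2 a b"] that K2 nn K0(1) by (auto simp: M_def split_beta)
  have Mabc: "K3 a b c <= M" if "a \<in> Basis" "b \<in> Basis" "c \<in> Basis" for a b c
    using member_le_sum[of "(a, b, c)" "Basis \<times> Basis \<times> Basis" "\<lambda>(a, b, c). K3 a b c"] that K3 nn K0(1)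
    by (auto simp: M_def split_beta)
  define d where "d = real DIM('a)"
  have d1: "1 <= d" unfolding d_def using DIM_positive[where 'a = 'a] by linarith
  define A where "A = d * (d * (d * M))"
  have "x <= d * x" "0 <= d * x" if "0 <= x" for x using mult_right_mono[OF d1 that] that by simp_all
  then have dM: "M <= d * M" "d * M <= d * (d * M)" "d * (d * M) <= A" unfolding A_def using M0 by auto
  have A0: "0 <= A" and KA: "\<bar>k x\<bar> <= A" for x using dM M0 MK0 K0(2)[of x] by linarith+
  have b1: "\<bar>k1 x u\<bar> <= d * M * norm u" for x u
    unfolding d_def by (rule lin_bound[OF l(1)]) (use M0 order_trans[OF K1(2) K1M] in auto)
  have b2a: "\<bar>k2 x u b\<bar> <= d * M * norm u" if "b \<in> Basis" for x u b
    unfolding d_def by (rule lin_bound[OF l(3)]) (use M0 order_trans[OF K2(2) K2M] that in auto)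
  have b2: "\<bar>k2 x u v\<bar> <= d * (d * M * norm u) * norm v" for x u v
    unfolding d_def by (rule lin_bound[OF l(2) b2a[unfolded d_def]]) (use M0 in auto)
  have b3a: "\<bar>k3 x u b c\<bar> <= d * M * norm u" if "b \<in> Basis" "c \<in> Basis" for x u b c
    unfolding d_def by (rule lin_bound[OF l(5)]) (use M0 order_trans[OF K3(2) Mabc] that in auto)
  have b3b: "\<bar>k3 x u v c\<bar> <= d * (d * M * norm u) * norm v" if "c \<in> Basis" for x u v c
    unfolding d_def by (rule lin_bound[OF l(6) b3a[unfolded d_def]]) (use M0 that in auto)
  have b3: "\<bar>k3 x u v w\<bar> <= d * (d * (d * M * norm u) * norm v) * norm w" for x u v w
    unfolding d_def by (rule lin_bound[OF l(4) b3b[unfolded d_def]]) (use M0 in auto)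
  have "derivs_bounded A A A k1 k2 k3" unfolding derivs_bounded_def real_norm_def
  proof (intro conjI allI)
    fix x u v w :: 'a
    show "\<bar>k1 x u\<bar> <= A * norm u" using b1[of x u] mult_right_mono[of "d * M" A "norm u"] dM by auto
    have "d * (d * M) * (norm u * norm v) <= A * (norm u * norm v)" using dM by (intro mult_right_mono) auto
    then show "\<bar>k2 x u v\<bar> <= A * norm u * norm v" using b2[of x u v] by (simp add: mult_ac)
    show "\<bar>k3 x u v w\<bar> <= A * norm u * norm v * norm w" using b3[of x u v w] by (simp add: A_def mult_ac)
  qed
  with that[OF A0 d] KA s1 show ?thesis by blast
qed

section \<open>Convolution, mollifiers and cut-offs\<close>

definition conv :: "('a::euclidean_space => real) => ('a => real) => 'a => real" where
  "conv f k x = (LINT y|lborel. f y * k (x - y))"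

lemma distr_lborel_reflect: "distr lborel borel (\<lambda>y. x - y) = (lborel :: 'a::euclidean_space measure)"
  using lborel_affine[of "-1" x] by (simp add: density_1)

lemma conv_commute:
  assumes [measurable]: "f \<in> borel_measurable borel" "k \<in> borel_measurable borel"
  shows "conv f k x = conv k f x"
proof -
  have "conv f k x = (LINT y|(distr lborel borel (\<lambda>y. x - y)). f y * k (x - y))" by (simp add: distr_lborel_reflect conv_def)
  also have "... = conv k f x" by (subst integral_distr) (auto simp: conv_def mult.commute)
  finally show ?thesis .
qed

lemma conv_integrable:
  fixes f :: "'a::euclidean_space => real"
  assumes f: "integrable lborel f" and k: "continuous_on UNIV k" "\<And>x. \<bar>k x\<bar> <= B"
  shows "integrable lborel (\<lambda>y. f y * k (x - y))"
proof (rule Bochner_Integration.integrable_bound[where f = "\<lambda>y. B * f y"])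
  show "integrable lborel (\<lambda>y. B * f y)" using f by simp
  have [measurable]: "k \<in> borel_measurable borel" by (rule borel_measurable_continuous_onI[OF k(1)])
  show "(\<lambda>y. f y * k (x - y)) \<in> borel_measurable lborel" using f by measurable
  show "AE y in lborel. norm (f y * k (x - y)) <= norm (B * f y)"
  proof (intro AE_I2)
    fix y
    have "\<bar>k (x - y)\<bar> <= \<bar>B\<bar>" using k(2)[of "x - y"] by linarith
    then show "norm (f y * k (x - y)) <= norm (B * f y)"
      using mult_right_mono[of "\<bar>k (x - y)\<bar>" "\<bar>B\<bar>" "\<bar>f y\<bar>"] by (simp add: abs_mult mult.commute)
  qed
qed

lemma conv_bound:
  assumes f: "integrable lborel f" and k: "continuous_on UNIV k" "\<And>x. \<bar>k x\<bar> <= B"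
  shows "\<bar>conv f k x\<bar> <= B * (LINT y|lborel. \<bar>f y\<bar>)"
proof -
  have "\<bar>conv f k x\<bar> <= (LINT y|lborel. \<bar>f y * k (x - y)\<bar>)" unfolding conv_def by (rule integral_abs_bound)
  also have "... <= (LINT y|lborel. B * \<bar>f y\<bar>)"
  proof (intro integral_mono)
    show "integrable lborel (\<lambda>y. \<bar>f y * k (x - y)\<bar>)" using conv_integrable[OF assms, of x] by (rule integrable_abs)
    show "integrable lborel (\<lambda>y. B * \<bar>f y\<bar>)" using f by simp
    show "\<bar>f y * k (x - y)\<bar> <= B * \<bar>f y\<bar>" for y
      using mult_right_mono[OF k(2)[of "x - y"], of "\<bar>f y\<bar>"] by (simp add: abs_mult mult.commute)
  qed
  finally show ?thesis by simp
qed

lemma has_derivative_quadratic: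
  fixes f :: "'a::euclidean_space => 'b::real_normed_vector"
  assumes l: "linear L" and q: "\<And>h. norm h < 1 ==> norm (f (x + h) - f x - L h) <= K * norm h * norm h"
  shows "(f has_derivative L) (at x)"
proof (rule has_derivativeI_sandwich[where e = 1 and H = "\<lambda>y. K * norm (y - x)"])
  show "bounded_linear L" using l by (rule linear_conv_bounded_linear[THEN iffD1])
  show "((\<lambda>y. K * norm (y - x)) \<longlongrightarrow> 0) (at x)" by (auto intro!: tendsto_eq_intros)
  fix y assume "y \<in> UNIV" "y \<noteq> x" "dist y x < 1"
  then show "norm (f y - f x - L (y - x)) / norm (y - x) <= K * norm (y - x)"
    using q[of "y - x"] by (simp add: divide_simps dist_norm)
qed simp

text \<open>All derivatives fall on the second factor. Its Taylor remainder is bounded uniformly in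
  the point, so it can be integrated against |f| as it stands, and differentiation under the
  integral becomes an inequality.\<close>

lemma conv_has_derivative:
  assumes f: "integrable lborel f" and d: "\<And>x. (k has_derivative k1 x) (at x)"
    and B: "\<And>x. \<bar>k x\<bar> <= B" "\<And>x u. \<bar>k1 x u\<bar> <= B * norm u" "\<And>u. continuous_on UNIV (\<lambda>x. k1 x u)"
    and q: "\<And>x h. \<bar>k (x + h) - k x - k1 x h\<bar> <= B * norm h * norm h"
  shows "(conv f k has_derivative (\<lambda>u. conv f (\<lambda>x. k1 x u) x)) (at x)"
proof (rule has_derivative_quadratic[where K = "B * (LINT y|lborel. \<bar>f y\<bar>)"])
  have l: "linear (k1 x)" for x by (rule has_derivative_linear[OF d])
  have c: "continuous_on UNIV k" by (metis d has_derivative_continuous_on has_derivative_at_withinI UNIV_I)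
  have i0: "integrable lborel (\<lambda>y. f y * k (x - y))" for x by (rule conv_integrable[OF f c B(1)])
  have i1: "integrable lborel (\<lambda>y. f y * k1 (x - y) u)" for x u by (rule conv_integrable[OF f B(3,2)])
  show "linear (\<lambda>u. conv f (\<lambda>x. k1 x u) x)"
    by (rule linearI) (simp_all add: conv_def linear_add[OF l] linear_scale[OF l] distrib_left i1 mult.left_commute)
  fix h
  have "conv f k (x + h) - conv f k x - conv f (\<lambda>x. k1 x h) x =
      conv f (\<lambda>x. k (x + h) - k x - k1 x h) x"
    using i0[of "x + h"] i0[of x] i1[of x h] by (simp add: conv_def right_diff_distrib add_diff_eq diff_add_eq)
  also have "\<bar>...\<bar> <= (B * norm h * norm h) * (LINT y|lborel. \<bar>f y\<bar>)"
    by (intro conv_bound f q continuous_intros B(3) continuous_on_compose2[OF c]) auto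
  finally show "norm (conv f k (x + h) - conv f k x - conv f (\<lambda>x. k1 x h) x) <=
      B * (LINT y|lborel. \<bar>f y\<bar>) * norm h * norm h" by (simp add: mult_ac)
qed


lemma conv_smooth_derivative:
  fixes k :: "'a::euclidean_space => real"
  assumes k: "k \<in> smooth_alg" "supported_in R k" "\<And>x. (k has_derivative k1 x) (at x)"
    and f: "integrable lborel f"
  shows "(conv f k has_derivative (\<lambda>u. conv f (\<lambda>x. k1 x u) x)) (at x)"
    and "(\<lambda>x. k1 x u) \<in> smooth_alg" "supported_in R (\<lambda>x. k1 x u)"
proof -
  obtain A k1' k2 k3 where A: "0 <= A" "has_derivs3 k k1' k2 k3" "derivs_bounded A A A k1' k2 k3"
    "\<And>x. \<bar>k x\<bar> <= A" "\<And>u. (\<lambda>x. k1' x u) \<in> smooth_alg" "\<And>u. supported_in R (\<lambda>x. k1' x u)" using smooth_alg_C3[OF k(1,2)] by blast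
  have eq: "k1' = k1" using has_derivs3D(1)[OF A(2)] k(3) has_derivative_unique by blast
  show "(\<lambda>x. k1 x u) \<in> smooth_alg" "supported_in R (\<lambda>x. k1 x u)" using A eq by auto
  show "(conv f k has_derivative (\<lambda>u. conv f (\<lambda>x. k1 x u) x)) (at x)"
  proof (rule conv_has_derivative[OF f k(3), where B = A])
    show "\<bar>k (x + h) - k x - k1 x h\<bar> <= A * norm h * norm h" for x h using C3_taylor(4)[OF A(2,3), of x h] by (simp add: eq)
    show "\<bar>k1 x u\<bar> <= A * norm u" for x u using A(3) by (simp add: eq derivs_bounded_def)
    show "continuous_on UNIV (\<lambda>x. k1 x u)" for u using smooth_alg_continuous[OF A(5)] by (simp add: eq)
  qed (rule A(4))
qed

lemma conv_smooth_C3: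
  fixes k :: "'a::euclidean_space => real"
  assumes k: "k \<in> smooth_alg" "supported_in R k" and f: "integrable lborel f"
  shows "\<exists>A. C3 A (conv f k)"
proof -
  obtain A k1 k2 k3 where A: "0 <= A" "has_derivs3 k k1 k2 k3" "derivs_bounded A A A k1 k2 k3"
    "\<And>x. \<bar>k x\<bar> <= A" "\<And>u. (\<lambda>x. k1 x u) \<in> smooth_alg" "\<And>u. supported_in R (\<lambda>x. k1 x u)" using smooth_alg_C3[OF k(1,2)] by blast
  note d = has_derivs3D[OF A(2)]
  note s1 = conv_smooth_derivative[OF k d(1) f]
  have s2: "(conv f (\<lambda>x. k1 x u) has_derivative (\<lambda>v. conv f (\<lambda>x. k2 x u v) x)) (at x)"
    "(\<lambda>x. k2 x u v) \<in> smooth_alg" "supported_in R (\<lambda>x. k2 x u v)" for u v x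
    by (rule conv_smooth_derivative[where k = "\<lambda>x. k1 x u" and ?k1.0 = "\<lambda>x. k2 x u"]; (rule s1 d f))+
  have s3: "(conv f (\<lambda>x. k2 x u v) has_derivative (\<lambda>w. conv f (\<lambda>x. k3 x u v w) x)) (at x)"
    "(\<lambda>x. k3 x u v w) \<in> smooth_alg" "supported_in R (\<lambda>x. k3 x u v w)" for u v w x
    by (rule conv_smooth_derivative[where k = "\<lambda>x. k2 x u v" and ?k1.0 = "\<lambda>x. k3 x u v"]; (rule s2 d f))+
  have "has_derivs3 (conv f k) (\<lambda>x u. conv f (\<lambda>x. k1 x u) x) (\<lambda>x u v. conv f (\<lambda>x. k2 x u v) x)
      (\<lambda>x u v w. conv f (\<lambda>x. k3 x u v w) x)" unfolding has_derivs3_def by (intro conjI allI s1(1) s2(1) s3(1))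
  moreover define B where "B = A * (LINT y|lborel. \<bar>f y\<bar>)"
  have "derivs_bounded B B B (\<lambda>x u. conv f (\<lambda>x. k1 x u) x) (\<lambda>x u v. conv f (\<lambda>x. k2 x u v) x)
      (\<lambda>x u v w. conv f (\<lambda>x. k3 x u v w) x)" unfolding derivs_bounded_def real_norm_def
  proof (intro conjI allI)
    fix x u v w :: 'a
    show "\<bar>conv f (\<lambda>x. k1 x u) x\<bar> <= B * norm u" using conv_bound[OF f smooth_alg_continuous[OF s1(2)], of u "A * norm u" x] A(3)
      by (simp add: B_def derivs_bounded_def mult_ac)
    show "\<bar>conv f (\<lambda>x. k2 x u v) x\<bar> <= B * norm u * norm v"
      using conv_bound[OF f smooth_alg_continuous[OF s2(2)], of u v "A * norm u * norm v" x] A(3)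
      by (simp add: B_def derivs_bounded_def mult_ac)
    show "\<bar>conv f (\<lambda>x. k3 x u v w) x\<bar> <= B * norm u * norm v * norm w"
      using conv_bound[OF f smooth_alg_continuous[OF s3(2)], of u v w "A * norm u * norm v * norm w" x] A(3)
      by (simp add: B_def derivs_bounded_def mult_ac)
  qed
  moreover have "0 <= B" unfolding B_def using A(1) by simp
  ultimately show ?thesis unfolding C3_def by blast
qed

lemma integrable_supported_in:
  fixes f :: "'a::euclidean_space => real"
  assumes "supported_in R f" "continuous_on UNIV f"
  shows "integrable lborel f"
proof -
  have "integrable lborel (\<lambda>x. indicator (cball 0 R) x *\<^sub>R f x)"
    by (intro borel_integrable_compact continuous_on_subset[OF assms(2)]) auto
  moreover have "(\<lambda>x. indicator (cball 0 R) x *\<^sub>R f x) = f"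
    using assms(1) by (auto simp: supported_in_def indicator_def fun_eq_iff)
  ultimately show ?thesis by simp
qed

text \<open>The convolutions of a fixed \<open>f\<close> with compactly supported members of
  \<open>smooth_alg\<close> form a set stable under derivatives, so \<open>Ck_coinduct\<close>
  applies; the radii of the supports add up.\<close>

lemma conv_test_function:
  fixes f k :: "'a::euclidean_space => real"
  assumes f: "supported_in r f" "continuous_on UNIV f"
    and k: "k \<in> smooth_alg" "supported_in R k"
  shows "test_function (conv f k)" unfolding test_function_def
proof (intro conjI allI)
  note int_f = integrable_supported_in[OF f]
  show "Ck n (conv f k)" for n
  proof (rule Ck_coinduct[where S = "{conv f k | k. k \<in> smooth_alg \<and> supported_in R k}"])
    fix g assume "g \<in> {conv f k | k. k \<in> smooth_alg \<and> supported_in R k}"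
    then obtain k where g: "g = conv f k" and k: "k \<in> smooth_alg" "supported_in R k" by blast
    obtain k1 where "\<And>x. (k has_derivative k1 x) (at x)" using smooth_alg_derivative[OF k(1)] by blast
    note s = conv_smooth_derivative[OF k this int_f]
    show "\<exists>g'. (\<forall>x. (g has_derivative g' x) (at x)) \<and> (\<forall>u. (\<lambda>x. g' x u) \<in> {conv f k | k. k \<in> smooth_alg \<and> supported_in R k})"
      unfolding g by (intro exI[of _ "\<lambda>x u. conv f (\<lambda>x. k1 x u) x"]) (use s in auto)
  qed (use k in auto)
  have "conv f k x = 0" if x: "norm x > r + R" for x
  proof -
    have "f y * k (x - y) = 0" for y
      using f(1) k(2) x norm_triangle_ineq2[of x y] by (cases "norm y > r") (auto simp: supported_in_def)
    then have "(\<lambda>y. f y * k (x - y)) = (\<lambda>_. 0)" by (rule ext)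
    then show ?thesis by (simp add: conv_def)
  qed
  then have "{x. conv f k x \<noteq> 0} \<subseteq> cball 0 (r + R)" by (force simp: not_less)
  then show "compact (closure {x. conv f k x \<noteq> 0})" using bounded_subset[OF bounded_cball] by (simp add: compact_closure)
qed

text \<open>The bound on the third derivative is weakened to a Lipschitz condition on the second
  one. A third derivative taken from \<open>has_derivs3\<close> may fail to be continuous, so the
  convolution lemmas do not apply to it, while the Lipschitz condition passes through a
  convolution.\<close>

definition C2L :: "real => ('a::euclidean_space => real) => ('a => 'a => real) => ('a => 'a => 'a => real) => bool" where
  "C2L A f f1 f2 \<longleftrightarrow> 0 <= A \<and> (\<forall>x. (f has_derivative f1 x) (at x)) \<and> (\<forall>u x. ((\<lambda>x. f1 x u) has_derivative f2 x u) (at x)) \<and>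
     (\<forall>x u. \<bar>f1 x u\<bar> <= A * norm u) \<and> (\<forall>x u v. \<bar>f2 x u v\<bar> <= A * norm u * norm v) \<and>
     (\<forall>x h u v. \<bar>f2 (x + h) u v - f2 x u v\<bar> <= A * norm u * norm v * norm h)"

lemma C2L_of_derivs3:
  assumes "has_derivs3 f f1 f2 f3" "derivs_bounded A A A f1 f2 f3" "0 <= A"
  shows "C2L A f f1 f2" using assms C3_taylor(3)[OF assms(1,2)] by (auto simp: C2L_def has_derivs3_def derivs_bounded_def)

lemma C2L_D:
  assumes "C2L A f f1 f2"
  shows "0 <= A" "(f has_derivative f1 x) (at x)" "((\<lambda>x. f1 x u) has_derivative f2 x u) (at x)"
    "\<bar>f1 x u\<bar> <= A * norm u" "\<bar>f2 x u v\<bar> <= A * norm u * norm v"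
    "\<bar>f2 (x + h) u v - f2 x u v\<bar> <= A * norm u * norm v * norm h"
    "\<bar>f (x + h) - f x\<bar> <= A * norm h" "\<bar>f1 (x + h) u - f1 x u\<bar> <= A * norm u * norm h"
    "\<bar>f (x + h) - f x - f1 x h\<bar> <= A * norm h * norm h"
    "\<bar>f1 (x + h) u - f1 x u - f2 x u h\<bar> <= A * norm u * norm h * norm h"
    "continuous_on UNIV f" "continuous_on UNIV (\<lambda>x. f1 x u)" "continuous_on UNIV (\<lambda>x. f2 x u v)"
    "linear (f1 x)" "linear (f2 x u)"
proof -
  note d = assms[unfolded C2L_def]
  show "0 <= A" "(f has_derivative f1 x) (at x)" "((\<lambda>x. f1 x u) has_derivative f2 x u) (at x)"
    "\<bar>f1 x u\<bar> <= A * norm u" "\<bar>f2 x u v\<bar> <= A * norm u * norm v"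
    "\<bar>f2 (x + h) u v - f2 x u v\<bar> <= A * norm u * norm v * norm h" using d by auto
  show "linear (f1 x)" "linear (f2 x u)" using d has_derivative_linear by blast+
  show "\<bar>f (x + h) - f x\<bar> <= A * norm h" using lipschitz_of_has_derivative[of f f1 A x h] d by auto
  show L: "\<bar>f1 (x + h) u - f1 x u\<bar> <= A * norm u * norm h" for x h u
    using lipschitz_of_has_derivative[of "\<lambda>x. f1 x u" "\<lambda>x. f2 x u" "A * norm u" x h] d by auto
  show "\<bar>f (x + h) - f x - f1 x h\<bar> <= A * norm h * norm h"
    using taylor1_of_has_derivative[of f f1 A x h] d L by (auto simp: mult_ac)
  show "\<bar>f1 (x + h) u - f1 x u - f2 x u h\<bar> <= A * norm u * norm h * norm h"
  proof (rule taylor1_of_has_derivative[of "\<lambda>x. f1 x u" "\<lambda>x. f2 x u" "A * norm u" x h, unfolded real_norm_def])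
    fix x h v :: 'a
    have "\<bar>f2 (x + h) u v - f2 x u v\<bar> <= A * norm u * norm v * norm h" using d by blast
    then show "\<bar>f2 (x + h) u v - f2 x u v\<bar> <= A * norm u * norm h * norm v" by (simp add: mult_ac)
  qed (simp add: d)
  show "continuous_on UNIV f" by (rule has_derivative_continuous_on[where f' = f1]) (simp add: d)
  show "continuous_on UNIV (\<lambda>x. f1 x u)" by (rule has_derivative_continuous_on[where f' = "\<lambda>x. f2 x u"]) (simp add: d)
  have "(A * norm u * norm v)-lipschitz_on UNIV (\<lambda>x. f2 x u v)"
  proof (rule lipschitz_onI)
    fix x y :: 'a
    have "\<bar>f2 (y + (x - y)) u v - f2 y u v\<bar> <= A * norm u * norm v * norm (x - y)" using d by blast
    then show "dist (f2 x u v) (f2 y u v) <= A * norm u * norm v * dist x y" by (simp add: dist_norm)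
  qed (use d in auto)
  then show "continuous_on UNIV (\<lambda>x. f2 x u v)" by (rule lipschitz_on_continuous_on)
qed

lemma conv_shift_diff:
  assumes "integrable lborel f" "continuous_on UNIV k" "\<And>x. \<bar>k x\<bar> <= B"
  shows "conv f k (x + h) - conv f k x = conv f (\<lambda>x. k (x + h) - k x) x"
  using conv_integrable[OF assms, of "x + h"] conv_integrable[OF assms, of x]
  by (simp add: conv_def right_diff_distrib add_diff_eq diff_add_eq)

lemma C2L_conv:
  assumes e: "integrable lborel e" and f: "C2L A f f1 f2" and bdd: "\<And>x. \<bar>f x\<bar> <= A"
  shows "C2L (A * (LINT y|lborel. \<bar>e y\<bar>)) (conv e f) (\<lambda>x u. conv e (\<lambda>x. f1 x u) x) (\<lambda>x u v. conv e (\<lambda>x. f2 x u v) x)"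
  unfolding C2L_def
proof (intro conjI allI)
  note d = C2L_D[OF f]
  show "0 <= A * (LINT y|lborel. \<bar>e y\<bar>)" using d(1) by simp
  fix x u v h :: 'a
  show "(conv e f has_derivative (\<lambda>u. conv e (\<lambda>x. f1 x u) x)) (at x)" using d by (intro conv_has_derivative[OF e d(2) bdd]) auto
  show "((\<lambda>x. conv e (\<lambda>x. f1 x u) x) has_derivative (\<lambda>v. conv e (\<lambda>x. f2 x u v) x)) (at x)"
    using d by (intro conv_has_derivative[OF e d(3), where B = "A * norm u"]) auto
  show "\<bar>conv e (\<lambda>x. f1 x u) x\<bar> <= A * (LINT y|lborel. \<bar>e y\<bar>) * norm u"
    using conv_bound[OF e d(12) d(4), of u x] by (simp add: mult_ac)
  show "\<bar>conv e (\<lambda>x. f2 x u v) x\<bar> <= A * (LINT y|lborel. \<bar>e y\<bar>) * norm u * norm v"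
    using conv_bound[OF e d(13) d(5), of u v x] by (simp add: mult_ac)
  have "\<bar>conv e (\<lambda>x. f2 (x + h) u v - f2 x u v) x\<bar> <= A * norm u * norm v * norm h * (LINT y|lborel. \<bar>e y\<bar>)"
    using d by (intro conv_bound[OF e] continuous_intros continuous_on_compose2[OF d(13)]) auto
  then show "\<bar>conv e (\<lambda>x. f2 x u v) (x + h) - conv e (\<lambda>x. f2 x u v) x\<bar> <=
      A * (LINT y|lborel. \<bar>e y\<bar>) * norm u * norm v * norm h" unfolding conv_shift_diff[OF e d(13) d(5)] by (simp add: mult_ac)
qed

text \<open>A local average inherits any bound on |k - a|. Since \<open>a\<close> is free, one
  statement serves both for convergence, where \<open>a\<close> is a value of the function, and for
  invariance of an interval, where \<open>a\<close> is its midpoint.\<close>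

lemma conv_approx:
  assumes d: "integrable lborel d" "\<And>y. 0 <= d y" "(LINT y|lborel. d y) = 1" "supported_in r d"
    and k: "continuous_on UNIV k" "\<And>x. \<bar>k x\<bar> <= B"
    and e: "\<And>y. norm y <= r ==> \<bar>k (x - y) - a\<bar> <= e"
  shows "\<bar>conv d k x - a\<bar> <= e"
proof -
  note i = conv_integrable[OF d(1) k, of x]
  have "conv d k x - a = (LINT y|lborel. d y * k (x - y)) - (LINT y|lborel. a * d y)" using d(3) by (simp add: conv_def)
  also have "... = (LINT y|lborel. d y * (k (x - y) - a))"
    using i d(1) by (subst Bochner_Integration.integral_diff[symmetric]) (auto simp: algebra_simps)
  also have "\<bar>...\<bar> <= (LINT y|lborel. \<bar>d y * (k (x - y) - a)\<bar>)" by (rule integral_abs_bound)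
  also have "... <= (LINT y|lborel. e * d y)"
  proof (rule integral_mono)
    show "integrable lborel (\<lambda>y. \<bar>d y * (k (x - y) - a)\<bar>)" using i d(1) by (auto simp: right_diff_distrib)
    show "integrable lborel (\<lambda>y. e * d y)" using d by simp
    fix y show "\<bar>d y * (k (x - y) - a)\<bar> <= e * d y" using e[of y] d(2)[of y] d(4) mult_right_mono[of "\<bar>k (x - y) - a\<bar>" e "d y"]
      by (cases "norm y <= r") (auto simp: supported_in_def abs_mult mult.commute)
  qed
  finally show ?thesis using d(3) by simp
qed

definition mollifier :: "nat => 'a::euclidean_space => real" where
  "mollifier n x = bump (real (Suc n) *\<^sub>R x) / (LINT y|(lborel :: 'a measure). bump (real (Suc n) *\<^sub>R y))"

lemma mollifier:
  fixes n :: nat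
  shows "mollifier n \<in> (smooth_alg :: ('a::euclidean_space => real) set)"
    and "\<And>x :: 'a. 0 <= mollifier n x"
    and "supported_in (real DIM('a) / real (Suc n)) (mollifier n :: 'a => real)"
    and "integrable lborel (mollifier n :: 'a => real)"
    and "(LINT y|(lborel :: 'a measure). mollifier n y) = 1"
proof -
  define b where "b x = bump (real (Suc n) *\<^sub>R x)" for x :: 'a
  have b: "b \<in> smooth_alg" unfolding b_def by (rule smooth_alg_affine[OF bump_smooth])
  have bc: "continuous_on UNIV b" by (rule smooth_alg_continuous[OF b])
  have b0: "0 <= b x" for x by (simp add: b_def bump_nonneg)
  have bs: "supported_in (real DIM('a) / real (Suc n)) b"
    using bump_supported[where 'a = 'a] by (simp add: supported_in_def b_def field_simps del: of_nat_Suc)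
  have bi: "integrable lborel b" by (rule integrable_supported_in[OF bs bc])
  \<comment> \<open>Normalisation is possible because the set where \<open>b\<close> is positive is
    open and contains 0, hence is not negligible.\<close>
  have "0 < (LINT y|lborel. b y)"
  proof -
    have "(LINT y|lborel. b y) \<noteq> 0"
    proof
      assume "(LINT y|lborel. b y) = 0"
      then have "AE x in lborel. b x = 0" using bi b0 by (subst (asm) integral_nonneg_eq_0_iff_AE) auto
      then have "{x. b x > 0} \<in> null_sets lborel"
      proof (subst AE_iff_null_sets)
        show "{x. 0 < b x} \<in> sets lborel" using bc by (auto intro!: borel_open open_Collect_less continuous_intros)
      qed (auto elim!: eventually_mono)
      then have "negligible {x. b x > 0}" by (simp add: negligible_iff_null_sets null_sets_completionI)
      moreover have "open {x. b x > 0}" using bc by (intro open_Collect_less continuous_intros)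
      moreover have "0 \<in> {x. b x > 0}" using bump_0 by (simp add: b_def)
      ultimately show False using open_not_negligible by blast
    qed
    then show ?thesis using b0 by (simp add: order_less_le)
  qed
  note pos = this
  have m: "mollifier n = (\<lambda>x. (1 / (LINT y|lborel. b y)) * b x)" by (simp add: mollifier_def b_def fun_eq_iff)
  show "mollifier n \<in> (smooth_alg :: ('a => real) set)" unfolding m by (rule smooth_alg.smooth_alg_mult[OF smooth_alg_const b])
  show "\<And>x :: 'a. 0 <= mollifier n x"
     "supported_in (real DIM('a) / real (Suc n)) (mollifier n :: 'a => real)"
     "integrable lborel (mollifier n :: 'a => real)"
     "(LINT y|(lborel :: 'a measure). mollifier n y) = 1" unfolding m using b0 bs bi pos by (auto simp: supported_in_def)
qed

lemma has_derivs3_mult: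
  fixes f g :: "'a::euclidean_space => real"
  assumes f: "has_derivs3 f f1 f2 f3" and g: "has_derivs3 g g1 g2 g3"
  shows "has_derivs3 (\<lambda>x. f x * g x) (\<lambda>x u. f x * g1 x u + f1 x u * g x)
    (\<lambda>x u v. f x * g2 x u v + f1 x v * g1 x u + (f1 x u * g1 x v + f2 x u v * g x))
    (\<lambda>x u v w. f x * g3 x u v w + f1 x w * g2 x u v + (f1 x v * g2 x u w + f2 x v w * g1 x u) +
       (f1 x u * g2 x v w + f2 x u w * g1 x v + (f2 x u v * g1 x w + f3 x u v w * g x)))"
  using has_derivs3D[OF f] has_derivs3D[OF g]
  unfolding has_derivs3_def by (intro conjI allI has_derivative_add has_derivative_mult)

text \<open>At order three the Leibniz rule has eight terms, each at most A B times the norms of the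
  directions; 8 covers the lower orders too.\<close>

lemma derivs_bounded_mult:
  fixes f g :: "'a::euclidean_space => real"
  assumes f: "derivs_bounded A A A f1 f2 f3" "\<And>x. \<bar>f x\<bar> <= A"
    and g: "derivs_bounded B B B g1 g2 g3" "\<And>x. \<bar>g x\<bar> <= B"
  shows "derivs_bounded (8 * A * B) (8 * A * B) (8 * A * B) (\<lambda>x u. f x * g1 x u + f1 x u * g x)
    (\<lambda>x u v. f x * g2 x u v + f1 x v * g1 x u + (f1 x u * g1 x v + f2 x u v * g x))
    (\<lambda>x u v w. f x * g3 x u v w + f1 x w * g2 x u v + (f1 x v * g2 x u w + f2 x v w * g1 x u) +
       (f1 x u * g2 x v w + f2 x u w * g1 x v + (f2 x u v * g1 x w + f3 x u v w * g x)))"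
proof -
  have A0: "0 <= A" and B0: "0 <= B" using f(2) g(2) abs_ge_zero order_trans by blast+
  have m: "\<bar>a * b\<bar> <= (A * r) * (B * s)" if "\<bar>a\<bar> <= A * r" "\<bar>b\<bar> <= B * s" for a b r s
    using that unfolding abs_mult by (intro mult_mono) (auto intro: order_trans[OF abs_ge_zero])
  note F = f(2) f(1)[unfolded derivs_bounded_def real_norm_def, THEN conjunct1, rule_format]
     f(1)[unfolded derivs_bounded_def real_norm_def, THEN conjunct2, THEN conjunct1, rule_format, unfolded mult.assoc]
     f(1)[unfolded derivs_bounded_def real_norm_def, THEN conjunct2, THEN conjunct2, rule_format, unfolded mult.assoc]
  note G = g(2) g(1)[unfolded derivs_bounded_def real_norm_def, THEN conjunct1, rule_format]
     g(1)[unfolded derivs_bounded_def real_norm_def, THEN conjunct2, THEN conjunct1, rule_format, unfolded mult.assoc]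
     g(1)[unfolded derivs_bounded_def real_norm_def, THEN conjunct2, THEN conjunct2, rule_format, unfolded mult.assoc]
  have F0: "\<bar>f x\<bar> <= A * 1" and G0: "\<bar>g x\<bar> <= B * 1" for x using F(1) G(1) by auto
  show ?thesis unfolding derivs_bounded_def real_norm_def
  proof (intro conjI allI)
    fix x u v w :: 'a
    have AB: "0 <= A * B * norm u" "0 <= A * B * norm u * norm v" using A0 B0 by auto
    have "\<bar>f x * g1 x u + f1 x u * g x\<bar> <= A * 1 * (B * norm u) + (A * norm u) * (B * 1)"
      by (intro order_trans[OF abs_triangle_ineq] add_mono m F0 G0 F G)
    also have "... = 2 * (A * B * norm u)" by (simp add: algebra_simps)
    finally show "\<bar>f x * g1 x u + f1 x u * g x\<bar> <= 8 * A * B * norm u" using AB by simp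
    have "\<bar>f x * g2 x u v + f1 x v * g1 x u + (f1 x u * g1 x v + f2 x u v * g x)\<bar> <=
      ((A * 1) * (B * (norm u * norm v)) + (A * norm v) * (B * norm u)) +
       ((A * norm u) * (B * norm v) + (A * (norm u * norm v)) * (B * 1))"
      by (intro order_trans[OF abs_triangle_ineq] add_mono m F0 G0 F G)
    also have "... = 4 * (A * B * norm u * norm v)" by (simp add: algebra_simps)
    finally show "\<bar>f x * g2 x u v + f1 x v * g1 x u + (f1 x u * g1 x v + f2 x u v * g x)\<bar> <=
        8 * A * B * norm u * norm v" using AB by simp
    have "\<bar>f x * g3 x u v w + f1 x w * g2 x u v + (f1 x v * g2 x u w + f2 x v w * g1 x u) +
       (f1 x u * g2 x v w + f2 x u w * g1 x v + (f2 x u v * g1 x w + f3 x u v w * g x))\<bar> <=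
      ((A * 1) * (B * (norm u * (norm v * norm w))) + (A * norm w) * (B * (norm u * norm v)) +
        ((A * norm v) * (B * (norm u * norm w)) + (A * (norm v * norm w)) * (B * norm u))) +
      ((A * norm u) * (B * (norm v * norm w)) + (A * (norm u * norm w)) * (B * norm v) +
        ((A * (norm u * norm v)) * (B * norm w) + (A * (norm u * (norm v * norm w))) * (B * 1)))"
      by (intro order_trans[OF abs_triangle_ineq] add_mono m F0 G0 F G)
    also have "... = 8 * A * B * norm u * norm v * norm w" by (simp add: algebra_simps)
    finally show "\<bar>f x * g3 x u v w + f1 x w * g2 x u v + (f1 x v * g2 x u w + f2 x v w * g1 x u) +
       (f1 x u * g2 x v w + f2 x u w * g1 x v + (f2 x u v * g1 x w + f3 x u v w * g x))\<bar> <=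
       8 * A * B * norm u * norm v * norm w" .
  qed
qed

text \<open>Dilations of one bump, normalised to 1 at the origin: a dilation by n + 1 divides the
  first derivative by n + 1, and the mean value inequality gives the last estimate. An upper bound
  by 1 is not among the claims.\<close>

lemma cutoff_exists:
  obtains B and q :: "nat => 'a::euclidean_space => real" and q1 q2 q3 where "0 <= B"
    "\<And>n. has_derivs3 (q n) (q1 n) (q2 n) (q3 n)" "\<And>n. derivs_bounded B B B (q1 n) (q2 n) (q3 n)"
    "\<And>n x. \<bar>q n x\<bar> <= B" "\<And>n x. 0 <= q n x" "\<And>n. continuous_on UNIV (q n)"
    "\<And>n. \<exists>R. supported_in R (q n)"
    "\<And>x. (\<lambda>n. q n x) \<longlonglongrightarrow> 1" "\<And>x u. (\<lambda>n. q1 n x u) \<longlonglongrightarrow> 0" "\<And>x u v. (\<lambda>n. q2 n x u v) \<longlonglongrightarrow> 0"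
    "\<And>n x. \<bar>q n x - 1\<bar> <= B * norm x / Suc n"
proof -
  define k where "k x = (1 / bump (0 :: 'a)) * bump x" for x :: 'a
  have k1: "k \<in> smooth_alg" unfolding k_def[abs_def] by (rule smooth_alg.smooth_alg_mult[OF smooth_alg_const bump_smooth])
  have k: "k \<in> smooth_alg" "supported_in (real DIM('a)) k"
    using k1 bump_supported[where 'a = 'a] by (simp_all add: supported_in_def k_def)
  obtain B k1 k2 k3 where B: "0 <= B" "has_derivs3 k k1 k2 k3" "derivs_bounded B B B k1 k2 k3"
    "\<And>x. \<bar>k x\<bar> <= B" "\<And>u. (\<lambda>x. k1 x u) \<in> smooth_alg" "\<And>u. supported_in (real DIM('a)) (\<lambda>x. k1 x u)"
    using smooth_alg_C3[OF k] by blast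
  define c where "c n = 1 / real (Suc n)" for n
  have c: "0 < c n" "c n <= 1" for n by (auto simp: c_def)
  have c0: "c \<longlonglongrightarrow> 0" unfolding c_def[abs_def] by (rule LIMSEQ_inverse_real_of_nat[unfolded inverse_eq_divide])
  define T1 where "T1 n = (\<lambda>(x::'a) u. c n *\<^sub>R u :: 'a)" for n
  have T: "has_derivs3 (\<lambda>x. c n *\<^sub>R x :: 'a) (T1 n) (\<lambda>_ _ _. 0) (\<lambda>_ _ _ _. 0)" for n
    by (auto simp: has_derivs3_def T1_def intro!: derivative_eq_intros)
  have TB: "derivs_bounded 1 0 0 (T1 n) (\<lambda>(_::'a) (_::'a) (_::'a). (0::'a)) (\<lambda>_ _ _ _. 0)" for n
    using c by (auto simp: derivs_bounded_def T1_def order_less_imp_le mult_left_le_one_le)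
  note l = has_derivs3_linear[OF B(2)]
  note d = has_derivs3_compose[OF B(2) T]
  note b = derivs_bounded_compose[OF B(3) TB B(1), simplified]
  show ?thesis
  proof (rule that[OF B(1) d b])
    fix n :: nat and x u v :: 'a
    show "\<bar>k (c n *\<^sub>R x)\<bar> <= B" by (rule B(4))
    show "0 <= k (c n *\<^sub>R x)" by (simp add: k_def bump_nonneg)
    show "continuous_on UNIV (\<lambda>x. k (c n *\<^sub>R x))" by (rule smooth_alg_continuous[OF smooth_alg_affine[OF k(1)]])
    have "supported_in (real DIM('a) * real (Suc n)) (\<lambda>x. k (c n *\<^sub>R x))"
      using k(2) by (simp add: supported_in_def c_def field_simps del: of_nat_Suc)
    then show "\<exists>R. supported_in R (\<lambda>x. k (c n *\<^sub>R x))" ..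
    show k1: "\<bar>k (c n *\<^sub>R x) - 1\<bar> <= B * norm x / Suc n" for n x
      using C3_taylor(1)[OF B(2,3), of 0 "c n *\<^sub>R x"] bump_0[where 'a = 'a] c[of n] by (simp add: k_def) (simp add: c_def)
    have "(\<lambda>n. (B * norm x) * c n) \<longlonglongrightarrow> (B * norm x) * 0" by (intro tendsto_intros c0)
    then have "(\<lambda>n. B * norm x / Suc n) \<longlonglongrightarrow> 0" by (simp add: c_def)
    then have "(\<lambda>n. k (c n *\<^sub>R x) - 1) \<longlonglongrightarrow> 0" by (rule Lim_null_comparison[rotated]) (use k1 in auto)
    then show "(\<lambda>n. k (c n *\<^sub>R x)) \<longlonglongrightarrow> 1" by (simp add: LIM_zero_iff)
    have "(\<lambda>n. (B * norm u) * c n) \<longlonglongrightarrow> (B * norm u) * 0" by (intro tendsto_intros c0)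
    then have "(\<lambda>n. (B * norm u) * c n) \<longlonglongrightarrow> 0" by simp
    then show "(\<lambda>n. k1 (c n *\<^sub>R x) (T1 n x u)) \<longlonglongrightarrow> 0"
    proof (rule Lim_null_comparison[rotated], intro always_eventually allI)
      fix n
      have "\<bar>k1 (c n *\<^sub>R x) (T1 n x u)\<bar> <= B * norm (T1 n x u)" using B(3) by (auto simp: derivs_bounded_def)
      then show "norm (k1 (c n *\<^sub>R x) (T1 n x u)) <= B * norm u * c n" using c[of n] by (simp add: T1_def mult_ac)
    qed
    have "(\<lambda>n. (B * norm u * norm v) * c n) \<longlonglongrightarrow> (B * norm u * norm v) * 0" by (intro tendsto_intros c0)
    then have "(\<lambda>n. (B * norm u * norm v) * c n) \<longlonglongrightarrow> 0" by simp
    then have "(\<lambda>n. k2 (c n *\<^sub>R x) (T1 n x u) (T1 n x v)) \<longlonglongrightarrow> 0"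
    proof (rule Lim_null_comparison[rotated], intro always_eventually allI)
      fix n
      have "\<bar>k2 (c n *\<^sub>R x) (T1 n x u) (T1 n x v)\<bar> <= B * norm (T1 n x u) * norm (T1 n x v)"
        using B(3) by (auto simp: derivs_bounded_def)
      also have "... = B * norm u * norm v * c n * c n" using c[of n] by (simp add: T1_def)
      also have "... <= B * norm u * norm v * c n * 1" using c[of n] B(1) by (intro mult_left_mono) auto
      finally show "norm (k2 (c n *\<^sub>R x) (T1 n x u) (T1 n x v)) <= B * norm u * norm v * c n" by simp
    qed
    then show "(\<lambda>n. k2 (c n *\<^sub>R x) (T1 n x u) (T1 n x v) + k1 (c n *\<^sub>R x) 0) \<longlonglongrightarrow> 0" by (simp add: linear_0[OF l(1)])
  qed
qed

lemma tendsto_of_abs_bounds: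
  fixes a b :: "nat => real"
  assumes "\<And>n. \<bar>a n - b n\<bar> <= e n" "e \<longlonglongrightarrow> 0" "b \<longlonglongrightarrow> l"
  shows "a \<longlonglongrightarrow> l"
proof -
  have "(\<lambda>n. a n - b n) \<longlonglongrightarrow> 0" by (rule Lim_null_comparison[OF _ assms(2)]) (use assms(1) in auto)
  from tendsto_add[OF this assms(3)] show ?thesis by simp
qed

text \<open>Cutting off makes the support compact, mollifying makes the result smooth. The factor
  \<open>B\<close> comes from the cut-off alone: losing the same factor for every function is what
  keeps later estimates uniform over all functions with a common constant \<open>A\<close>.\<close>

lemma test_function_approx:
  "\<exists>B\<ge>0. \<forall>A (h :: 'a::euclidean_space => real) f1 f2 f3. has_derivs3 h f1 f2 f3 --> derivs_bounded A A A f1 f2 f3 -->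
      (\<forall>x. \<bar>h x\<bar> <= A) --> (\<exists>w w1 w2. (\<forall>n. test_function (w n) \<and> C2L (B * A) (w n) (w1 n) (w2 n)) \<and>
        (\<forall>n x. \<bar>w n x\<bar> <= B * A) \<and> (\<forall>x. (\<lambda>n. w n x) \<longlonglongrightarrow> h x) \<and>
        (\<forall>x u. (\<lambda>n. w1 n x u) \<longlonglongrightarrow> f1 x u) \<and> (\<forall>x u v. (\<lambda>n. w2 n x u v) \<longlonglongrightarrow> f2 x u v))"
proof -
  obtain B and \<kappa> :: "nat => 'a::euclidean_space => real" and \<kappa>1 \<kappa>2 \<kappa>3 where \<kappa>: "0 <= B"
    "\<And>n. has_derivs3 (\<kappa> n) (\<kappa>1 n) (\<kappa>2 n) (\<kappa>3 n)" "\<And>n. derivs_bounded B B B (\<kappa>1 n) (\<kappa>2 n) (\<kappa>3 n)"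
    "\<And>n x. \<bar>\<kappa> n x\<bar> <= B" "\<And>n x. 0 <= \<kappa> n x" "\<And>n. continuous_on UNIV (\<kappa> n)"
    "\<And>n. \<exists>R. supported_in R (\<kappa> n)"
    "\<And>x. (\<lambda>n. \<kappa> n x) \<longlonglongrightarrow> 1" "\<And>x u. (\<lambda>n. \<kappa>1 n x u) \<longlonglongrightarrow> 0" "\<And>x u v. (\<lambda>n. \<kappa>2 n x u v) \<longlonglongrightarrow> 0"
    "\<And>n x. \<bar>\<kappa> n x - 1\<bar> <= B * norm x / Suc n" using cutoff_exists by blast
  show ?thesis
  proof (intro exI[of _ "8 * B"] conjI allI impI)
    show "0 <= 8 * B" using \<kappa>(1) by simp
    fix A and h :: "'a => real" and f1 f2 f3
    assume f0: "has_derivs3 h f1 f2 f3" "derivs_bounded A A A f1 f2 f3" "\<forall>x. \<bar>h x\<bar> <= A"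
    note f = f0(1,2) f0(3)[rule_format]
    define r where "r n = real DIM('a) / real (Suc n)" for n
    have r0: "r \<longlonglongrightarrow> 0" unfolding r_def[abs_def] using tendsto_mult[OF tendsto_const LIMSEQ_inverse_real_of_nat, of "real DIM('a)"]
      by (simp add: divide_inverse)
    define A' where "A' = 8 * A * B"
    have A0: "0 <= A" using f(3) abs_ge_zero order_trans by blast
    have A'0: "0 <= A'" and AA: "A * B <= A'" using A0 \<kappa>(1) by (auto simp: A'_def)
    define g where "g n x = h x * \<kappa> n x" for n x
    define g1 where "g1 n x u = h x * \<kappa>1 n x u + f1 x u * \<kappa> n x" for n x u
    define g2 where "g2 n x u v = h x * \<kappa>2 n x u v + f1 x v * \<kappa>1 n x u + (f1 x u * \<kappa>1 n x v + f2 x u v * \<kappa> n x)" for n x u v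
    have g: "C2L A' (g n) (g1 n) (g2 n)" for n unfolding g_def[abs_def] g1_def[abs_def] g2_def[abs_def] A'_def
      by (rule C2L_of_derivs3[OF has_derivs3_mult[OF f(1) \<kappa>(2)] derivs_bounded_mult[OF f(2,3) \<kappa>(3,4)]]) (use A0 \<kappa>(1) in simp)
    have gb: "\<bar>g n x\<bar> <= A'" for n x
    proof -
      have "\<bar>g n x\<bar> <= A * B" unfolding g_def abs_mult using f(3) \<kappa>(4) A0 by (intro mult_mono) auto
      then show ?thesis using AA by linarith
    qed
    note gd = C2L_D[OF g]
    define w where "w n = conv (mollifier n) (g n)" for n
    define w1 where "w1 n x u = conv (mollifier n) (\<lambda>x. g1 n x u) x" for n x u
    define w2 where "w2 n x u v = conv (mollifier n) (\<lambda>x. g2 n x u v) x" for n x u v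
    note m = mollifier[where 'a = 'a]
    have "test_function (w n)" for n
    proof -
      obtain R where R: "supported_in R (\<kappa> n)" using \<kappa>(7) by blast
      then have "supported_in R (g n)" by (simp add: supported_in_def g_def)
      from conv_test_function[OF this gd(11) m(1,3)]
      have "test_function (conv (g n) (mollifier n))" .
      moreover have "conv (g n) (mollifier n) = w n" unfolding w_def using gd(11) smooth_alg_continuous[OF m(1)]
        by (intro ext conv_commute) (auto intro: borel_measurable_continuous_onI)
      ultimately show ?thesis by simp
    qed
    moreover have "C2L (8 * B * A) (w n) (w1 n) (w2 n)" for n
    proof -
      have "(LINT y|(lborel :: 'a measure). \<bar>mollifier n y\<bar>) = 1" using m(2,5) by simp
      then show ?thesis using C2L_conv[OF m(4) g gb, of n n]
        unfolding w_def[abs_def] w1_def[abs_def] w2_def[abs_def] by (simp add: A'_def mult_ac)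
    qed
    moreover have "\<bar>w n x\<bar> <= 8 * B * A" for n x
      using conv_bound[OF m(4) gd(11) gb, of n n x] m(2,5) by (simp add: w_def A'_def mult_ac)
    moreover have "(\<lambda>n. w n x) \<longlonglongrightarrow> h x" for x
    proof (rule tendsto_of_abs_bounds[where b = "\<lambda>n. g n x" and e = "\<lambda>n. A' * r n"])
      fix n show "\<bar>w n x - g n x\<bar> <= A' * r n" unfolding w_def
      proof (rule conv_approx[OF m(4,2,5,3) gd(11) gb])
        fix y :: 'a assume "norm y <= real DIM('a) / real (Suc n)"
        then have "A' * norm y <= A' * r n" using A'0 by (intro mult_left_mono) (auto simp: r_def)
        then show "\<bar>g n (x - y) - g n x\<bar> <= A' * r n" using gd(7)[of n x "- y"] by simp
      qed
    next
      show "(\<lambda>n. A' * r n) \<longlonglongrightarrow> 0" using tendsto_mult[OF tendsto_const r0, of A'] by simp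
      show "(\<lambda>n. g n x) \<longlonglongrightarrow> h x" unfolding g_def using tendsto_mult[OF tendsto_const \<kappa>(8), of "h x"] by simp
    qed
    moreover have "(\<lambda>n. w1 n x u) \<longlonglongrightarrow> f1 x u" for x u
    proof (rule tendsto_of_abs_bounds[where b = "\<lambda>n. g1 n x u" and e = "\<lambda>n. (A' * norm u) * r n"])
      fix n show "\<bar>w1 n x u - g1 n x u\<bar> <= (A' * norm u) * r n" unfolding w1_def
      proof (rule conv_approx[OF m(4,2,5,3) gd(12,4)])
        fix y :: 'a assume "norm y <= real DIM('a) / real (Suc n)"
        then have "(A' * norm u) * norm y <= (A' * norm u) * r n" using A'0 by (intro mult_left_mono) (auto simp: r_def)
        then show "\<bar>g1 n (x - y) u - g1 n x u\<bar> <= (A' * norm u) * r n" using gd(8)[of n x "- y" u] by simp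
      qed
    next
      show "(\<lambda>n. (A' * norm u) * r n) \<longlonglongrightarrow> 0" using tendsto_mult[OF tendsto_const r0, of "A' * norm u"] by simp
      have "(\<lambda>n. g1 n x u) \<longlonglongrightarrow> h x * 0 + f1 x u * 1" unfolding g1_def by (intro tendsto_intros \<kappa>)
      then show "(\<lambda>n. g1 n x u) \<longlonglongrightarrow> f1 x u" by simp
    qed
    moreover have "(\<lambda>n. w2 n x u v) \<longlonglongrightarrow> f2 x u v" for x u v
    proof (rule tendsto_of_abs_bounds[where b = "\<lambda>n. g2 n x u v" and e = "\<lambda>n. (A' * norm u * norm v) * r n"])
      fix n show "\<bar>w2 n x u v - g2 n x u v\<bar> <= (A' * norm u * norm v) * r n" unfolding w2_def
      proof (rule conv_approx[OF m(4,2,5,3) gd(13,5)])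
        fix y :: 'a assume "norm y <= real DIM('a) / real (Suc n)"
        then have "(A' * norm u * norm v) * norm y <= (A' * norm u * norm v) * r n"
          using A'0 by (intro mult_left_mono) (auto simp: r_def)
        then show "\<bar>g2 n (x - y) u v - g2 n x u v\<bar> <= (A' * norm u * norm v) * r n" using gd(6)[of n x "- y" u v] by simp
      qed
    next
      show "(\<lambda>n. (A' * norm u * norm v) * r n) \<longlonglongrightarrow> 0" using tendsto_mult[OF tendsto_const r0, of "A' * norm u * norm v"] by simp
      have "(\<lambda>n. g2 n x u v) \<longlonglongrightarrow> h x * 0 + f1 x v * 0 + (f1 x u * 0 + f2 x u v * 1)" unfolding g2_def by (intro tendsto_intros \<kappa>)
      then show "(\<lambda>n. g2 n x u v) \<longlonglongrightarrow> f2 x u v" by simp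
    qed
    ultimately show "\<exists>w w1 w2. (\<forall>n. test_function (w n) \<and> C2L (8 * B * A) (w n) (w1 n) (w2 n)) \<and>
        (\<forall>n x. \<bar>w n x\<bar> <= 8 * B * A) \<and> (\<forall>x. (\<lambda>n. w n x) \<longlonglongrightarrow> h x) \<and>
        (\<forall>x u. (\<lambda>n. w1 n x u) \<longlonglongrightarrow> f1 x u) \<and> (\<forall>x u v. (\<lambda>n. w2 n x u v) \<longlonglongrightarrow> f2 x u v)"
      by (intro exI[of _ w] exI[of _ w1] exI[of _ w2] conjI allI)
  qed
qed

text \<open>The bounds c and C have to survive, since test functions must stay in a compact subset
  of (0, \<infinity>). Hence f - c is cut off, truncated at D = C - c and averaged, operations that
  keep the interval [0, D].\<close>

lemma C3_approx_continuous:
  fixes f :: "'a::euclidean_space => real"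
  assumes f: "continuous_on UNIV f" "\<And>x. c <= f x" "\<And>x. f x <= C"
  obtains g where "\<And>n. \<exists>A. C3 A (g n)" "\<And>n x. c <= g n x" "\<And>n x. g n x <= C" "\<And>x. (\<lambda>n. g n x) \<longlonglongrightarrow> f x"
proof -
  obtain B and \<kappa> :: "nat => 'a::euclidean_space => real" and \<kappa>1 \<kappa>2 \<kappa>3 where \<kappa>: "0 <= B"
    "\<And>n. has_derivs3 (\<kappa> n) (\<kappa>1 n) (\<kappa>2 n) (\<kappa>3 n)" "\<And>n. derivs_bounded B B B (\<kappa>1 n) (\<kappa>2 n) (\<kappa>3 n)"
    "\<And>n x. \<bar>\<kappa> n x\<bar> <= B" "\<And>n x. 0 <= \<kappa> n x" "\<And>n. continuous_on UNIV (\<kappa> n)"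
    "\<And>n. \<exists>R. supported_in R (\<kappa> n)"
    "\<And>x. (\<lambda>n. \<kappa> n x) \<longlonglongrightarrow> 1" "\<And>x u. (\<lambda>n. \<kappa>1 n x u) \<longlonglongrightarrow> 0" "\<And>x u v. (\<lambda>n. \<kappa>2 n x u v) \<longlonglongrightarrow> 0"
    "\<And>n x. \<bar>\<kappa> n x - 1\<bar> <= B * norm x / Suc n" using cutoff_exists by blast
  define D where "D = C - c"
  define r where "r n = real DIM('a) / real (Suc n)" for n
  have r0: "r \<longlonglongrightarrow> 0" unfolding r_def[abs_def] using tendsto_mult[OF tendsto_const LIMSEQ_inverse_real_of_nat, of "real DIM('a)"]
    by (simp add: divide_inverse)
  \<comment> \<open>The cut-off is not known to be at most 1, so the product is truncated at D; this
    cannot increase the distance to f - c, which itself lies below D.\<close>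
  define k where "k n x = min ((f x - c) * \<kappa> n x) D" for n x
  have D0: "0 <= D" using f(2,3)[of 0] by (simp add: D_def)
  have k0: "0 <= k n x" "k n x <= D" for n x using f(2)[of x] \<kappa>(5)[of n x] D0 by (auto simp: k_def)
  have kb: "\<bar>k n x\<bar> <= D" for n x using k0[of n x] by simp
  have kc: "continuous_on UNIV (k n)" for n unfolding k_def by (intro continuous_intros f \<kappa>)
  note m = mollifier[where 'a = 'a]
  have ki: "integrable lborel (k n)" for n
  proof -
    obtain R where "supported_in R (\<kappa> n)" using \<kappa>(7) by blast
    then have "supported_in R (k n)" using D0 by (simp add: supported_in_def k_def)
    then show ?thesis using kc by (rule integrable_supported_in)
  qed
  define g where "g n x = c + conv (mollifier n) (k n) x" for n x
  have comm: "conv (k n) (mollifier n) = conv (mollifier n) (k n)" for n using kc smooth_alg_continuous[OF m(1)]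
    by (intro ext conv_commute) (auto intro: borel_measurable_continuous_onI)
  show ?thesis
  proof (rule that[of g])
    fix n x
    obtain A where "C3 A (conv (mollifier n) (k n))" using conv_smooth_C3[OF m(1,3) ki, of n n] unfolding comm by blast
    from C3_add[OF C3_const[of 0 c] this] show "\<exists>A. C3 A (g n)" by (auto simp: g_def[abs_def])
    have "\<bar>conv (mollifier n) (k n) x - D / 2\<bar> <= D / 2"
      using k0 by (intro conv_approx[OF m(4,2,5,3) kc kb] abs_leI) (auto simp: field_simps)
    then show "c <= g n x" "g n x <= C" by (auto simp: g_def D_def abs_le_iff field_simps)
  next
    fix x
    have "(\<lambda>n. conv (mollifier n) (k n) x) \<longlonglongrightarrow> f x - c"
    proof (rule LIMSEQ_I)
      fix e :: real assume e: "0 < e"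
      have "isCont f x" using f(1) by (simp add: continuous_on_eq_continuous_at)
      then obtain s where s: "0 < s" "\<And>y. dist y x < s ==> dist (f y) (f x) < e / 2"
        unfolding continuous_at_eps_delta using e by (metis half_gt_zero)
      have "(\<lambda>n. D * (B * (norm x + s) / real (Suc n))) \<longlonglongrightarrow> 0"
        using tendsto_mult[OF tendsto_const LIMSEQ_inverse_real_of_nat, of "D * (B * (norm x + s))"]
        by (simp add: divide_inverse mult.assoc)
      then have "\<forall>\<^sub>F n in sequentially. D * (B * (norm x + s) / real (Suc n)) < e / 2"
        using e by (intro order_tendstoD(2)[of _ 0]) auto
      moreover have "\<forall>\<^sub>F n in sequentially. r n < s" using r0 s by (intro order_tendstoD(2)[of _ 0]) auto
      ultimately obtain N where N: "\<And>n. N <= n ==> D * (B * (norm x + s) / real (Suc n)) < e / 2 \<and> r n < s"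
        unfolding eventually_sequentially by (metis (no_types, lifting) nat_le_linear order_trans)
      define e' where "e' n = e / 2 + D * (B * (norm x + s) / real (Suc n))" for n
      have close: "\<bar>conv (mollifier n) (k n) x - (f x - c)\<bar> <= e' n" if n: "N <= n" for n
      proof (rule conv_approx[OF m(4,2,5,3) kc kb])
        fix y :: 'a assume y: "norm y <= real DIM('a) / real (Suc n)"
        then have ys: "norm y < s" using N[OF n] by (auto simp: r_def)
        then have a: "\<bar>f (x - y) - f x\<bar> < e / 2" using s(2)[of "x - y"] by (simp add: dist_norm)
        have b: "0 <= f (x - y) - c" "f (x - y) - c <= D" using f(2,3)[of "x - y"] by (auto simp: D_def)
        have "\<bar>k n (x - y) - (f (x - y) - c)\<bar> <= \<bar>(f (x - y) - c) * \<kappa> n (x - y) - (f (x - y) - c)\<bar>" using b by (auto simp: k_def)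
        also have "... = (f (x - y) - c) * \<bar>\<kappa> n (x - y) - 1\<bar>"
        proof -
          have "(f (x - y) - c) * \<kappa> n (x - y) - (f (x - y) - c) = (f (x - y) - c) * (\<kappa> n (x - y) - 1)"
            by (simp add: right_diff_distrib)
          then show ?thesis using b(1) by (simp add: abs_mult)
        qed
        also have "... <= D * (B * norm (x - y) / Suc n)" using b D0 \<kappa>(11) by (intro mult_mono) auto
        also have "... <= D * (B * (norm x + s) / Suc n)" using D0 \<kappa>(1) ys norm_triangle_ineq4[of x y]
          by (intro mult_left_mono divide_right_mono) auto
        finally show "\<bar>k n (x - y) - (f x - c)\<bar> <= e' n" using a unfolding e'_def by linarith
      qed
      have "norm (conv (mollifier n) (k n) x - (f x - c)) < e" if n: "N <= n" for n
        using close[OF n] N[OF n] unfolding e'_def real_norm_def by linarith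
      then show "\<exists>N. \<forall>n\<ge>N. norm (conv (mollifier n) (k n) x - (f x - c)) < e" by blast
    qed
    from tendsto_add[OF tendsto_const[of c] this] show "(\<lambda>n. g n x) \<longlonglongrightarrow> f x" by (simp add: g_def)
  qed
qed

section \<open>Wasserstein distances\<close>

lemma le_one_plus_square: "t <= 1 + t^2" for t :: real
  using zero_le_power2[of "t - 1/2"] by (simp add: power2_eq_square algebra_simps)

lemma P2_D:
  assumes "m \<in> P2"
  shows "prob_space m" "sets m = sets borel" "space m = UNIV" "integrable m (\<lambda>x. (norm x)^2)"
    "integrable m norm" "integrable m (\<lambda>x. c :: real)"
proof -
  show *: "prob_space m" "sets m = sets borel" "integrable m (\<lambda>x. (norm x)^2)" using assms by (auto simp: P2_def)
  show "space m = UNIV" using sets_eq_imp_space_eq[OF *(2)] by simp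
  interpret prob_space m by fact
  show "integrable m (\<lambda>x. c :: real)" by simp
  show "integrable m norm"
  proof (rule Bochner_Integration.integrable_bound[where f = "\<lambda>x. 1 + (norm x)^2"])
    show "AE x in m. norm (norm x) <= norm (1 + (norm x)^2)" by (intro AE_I2) (simp add: le_one_plus_square)
    show "norm \<in> borel_measurable m" using *(2) by (simp cong: measurable_cong_sets)
  qed (use * in simp)
qed

lemma P2_integrable_quadratic:
  fixes f :: "'a::euclidean_space => real"
  assumes m: "m \<in> P2" and f: "f \<in> borel_measurable borel" "\<And>x. \<bar>f x\<bar> <= C * (1 + (norm x)^2)"
  shows "integrable m f"
proof (rule Bochner_Integration.integrable_bound[where f = "\<lambda>x. C * (1 + (norm x)^2)"])
  show "integrable m (\<lambda>x. C * (1 + (norm x)^2))" using P2_D(4,6)[OF m] by simp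
  show "f \<in> borel_measurable m" using f(1) P2_D(2)[OF m] by (simp cong: measurable_cong_sets)
  show "AE x in m. norm (f x) <= norm (C * (1 + (norm x)^2))" using f(2) by (auto intro!: AE_I2 order_trans[OF f(2) abs_ge_self])
qed

lemma couplings_D:
  assumes "q \<in> couplings m m'"
  shows "prob_space q" "sets q = sets (borel \<Otimes>\<^sub>M borel)"
    "distr q borel fst = m" "distr q borel snd = m'"
    "fst \<in> measurable q borel" "snd \<in> measurable q borel"
    "sets m = sets borel" "sets m' = sets borel"
proof -
  show *: "prob_space q" "sets q = sets (borel \<Otimes>\<^sub>M borel)" "distr q borel fst = m" "distr q borel snd = m'"
    using assms by (auto simp: couplings_def)
  show "fst \<in> measurable q borel" "snd \<in> measurable q borel" unfolding measurable_cong_sets[OF *(2) refl] by auto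
  show "sets m = sets borel" "sets m' = sets borel" using *(3,4) by auto
qed

lemma coupling_marginal_integral:
  fixes f :: "'a::euclidean_space => real"
  assumes q: "q \<in> couplings m m'" and f: "f \<in> borel_measurable borel"
  shows "(LINT z|q. f (fst z)) = (LINT x|m. f x)" "(LINT z|q. f (snd z)) = (LINT x|m'. f x)"
    "integrable q (\<lambda>z. f (fst z)) = integrable m f" "integrable q (\<lambda>z. f (snd z)) = integrable m' f"
  using couplings_D[OF q] f integral_distr[of fst q borel f] integral_distr[of snd q borel f]
    integrable_distr_eq[of fst q borel f] integrable_distr_eq[of snd q borel f] by auto

lemma coupling_marginal_nn_integral:
  fixes f :: "'a::euclidean_space => ennreal"
  assumes q: "q \<in> couplings m m'" and f: "f \<in> borel_measurable borel"
  shows "(\<integral>\<^sup>+z. f (fst z) \<partial>q) = (\<integral>\<^sup>+x. f x \<partial>m)" "(\<integral>\<^sup>+z. f (snd z) \<partial>q) = (\<integral>\<^sup>+x. f x \<partial>m')"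
  using couplings_D[OF q] f nn_integral_distr[of fst q borel f] nn_integral_distr[of snd q borel f] by auto

lemma couplingI:
  assumes "prob_space q" "sets q = sets (borel \<Otimes>\<^sub>M borel)" and m: "sets m = sets borel" "sets m' = sets borel"
    and 1: "\<And>A. A \<in> sets borel ==> emeasure q (fst -` A) = emeasure m A"
    and 2: "\<And>A. A \<in> sets borel ==> emeasure q (snd -` A) = emeasure m' A"
  shows "q \<in> couplings m m'"
proof -
  have meas: "fst \<in> measurable q borel" "snd \<in> measurable q borel" unfolding measurable_cong_sets[OF assms(2) refl] by auto
  have sp: "space q = UNIV" using sets_eq_imp_space_eq[OF assms(2)] by (simp add: space_pair_measure)
  have "distr q borel fst = m" "distr q borel snd = m'" using m 1 2 meas sp by (auto intro!: measure_eqI simp: emeasure_distr)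
  then show ?thesis using assms(1,2) by (simp add: couplings_def)
qed

text \<open>Independence provides a coupling of finite cost, so that the infimum in \<open>W\<close>
  is finite on \<open>P2\<close> and \<open>enn2real\<close> does not collapse it to 0.\<close>

lemma product_coupling:
  assumes "m \<in> P2" "m' \<in> P2"
  shows "m \<Otimes>\<^sub>M m' \<in> couplings m m'"
proof (rule couplingI)
  note d = P2_D[OF assms(1)] and d' = P2_D[OF assms(2)]
  interpret m: prob_space m by (rule d)
  interpret m': prob_space m' by (rule d')
  interpret pair_prob_space m m' ..
  show "prob_space (m \<Otimes>\<^sub>M m')" by (rule P.prob_space_axioms)
  show "sets (m \<Otimes>\<^sub>M m') = sets (borel \<Otimes>\<^sub>M borel)" using d(2) d'(2) by (rule sets_pair_measure_cong)
  show "sets m = sets borel" "sets m' = sets borel" by (fact d d')+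
  fix A :: "'a set" assume A: "A \<in> sets borel"
  have "fst -` A = A \<times> (UNIV :: 'a set)" "snd -` A = (UNIV :: 'a set) \<times> A" by auto
  then show "emeasure (m \<Otimes>\<^sub>M m') (fst -` A) = emeasure m A" "emeasure (m \<Otimes>\<^sub>M m') (snd -` A) = emeasure m' A"
    using A d(2) d'(2) m.emeasure_space_1 m'.emeasure_space_1 by (simp_all add: m'.emeasure_pair_measure_Times d(3) d'(3))
qed

lemma coupling_integrable:
  assumes q: "q \<in> couplings m m'" and m: "m \<in> P2" "m' \<in> P2"
  shows "integrable q (\<lambda>z. (dist (fst z) (snd z))^2)" "integrable q (\<lambda>z. dist (fst z) (snd z))"
    "(\<lambda>z. dist (fst z) (snd z)) \<in> borel_measurable q"
proof -
  note c = couplings_D[OF q]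
  show meas: "(\<lambda>z. dist (fst z) (snd z)) \<in> borel_measurable q" using c(5,6) by simp
  interpret prob_space q by (rule c)
  have i: "integrable q (\<lambda>z. (norm (fst z))^2)" "integrable q (\<lambda>z. (norm (snd z))^2)"
    using coupling_marginal_integral(3,4)[OF q, of "\<lambda>x. (norm x)^2"] P2_D(4)[OF m(1)] P2_D(4)[OF m(2)] by auto
  show 2: "integrable q (\<lambda>z. (dist (fst z) (snd z))^2)"
  proof (rule Bochner_Integration.integrable_bound[where f = "\<lambda>z. 2 * (norm (fst z))^2 + 2 * (norm (snd z))^2"])
    show "AE z in q. norm ((dist (fst z) (snd z))^2) <= norm (2 * (norm (fst z))^2 + 2 * (norm (snd z))^2)"
    proof (intro AE_I2)
      fix z :: "'a \<times> 'a"
      have "(dist (fst z) (snd z))^2 <= (norm (fst z) + norm (snd z))^2"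
        using norm_triangle_ineq4[of "fst z" "snd z"] by (intro power_mono) (auto simp: dist_norm)
      also have "... <= 2 * (norm (fst z))^2 + 2 * (norm (snd z))^2"
        using zero_le_power2[of "norm (fst z) - norm (snd z)"] by (simp add: power2_eq_square algebra_simps)
      finally show "norm ((dist (fst z) (snd z))^2) <= norm (2 * (norm (fst z))^2 + 2 * (norm (snd z))^2)" by simp
    qed
  qed (use i meas in auto)
  show "integrable q (\<lambda>z. dist (fst z) (snd z))"
  proof (rule Bochner_Integration.integrable_bound[where f = "\<lambda>z. 1 + (dist (fst z) (snd z))^2"])
    show "AE z in q. norm (dist (fst z) (snd z)) <= norm (1 + (dist (fst z) (snd z))^2)"
      by (intro AE_I2) (simp add: le_one_plus_square)
  qed (use 2 meas in auto)
qed

lemma dist_powr_12: "dist x y powr 1 = dist x y" "dist x y powr 2 = (dist x y)^2" by (cases "x = y"; simp)+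

lemma W_le_coupling:
  assumes q: "q \<in> couplings m m'" and m: "m \<in> P2" "m' \<in> P2"
  shows "W 1 m m' <= (LINT z|q. dist (fst z) (snd z))"
    "(W 2 m m')^2 <= (LINT z|q. (dist (fst z) (snd z))^2)"
proof -
  note i = coupling_integrable[OF assms]
  have "enn2real (INF q\<in>couplings m m'. \<integral>\<^sup>+ z. ennreal (dist (fst z) (snd z)) \<partial>q) <=
      enn2real (\<integral>\<^sup>+ z. ennreal (dist (fst z) (snd z)) \<partial>q)"
    by (intro enn2real_mono INF_lower q) (simp add: nn_integral_eq_integral[OF i(2)])
  then show "W 1 m m' <= (LINT z|q. dist (fst z) (snd z))" by (simp add: W_def dist_powr_12 nn_integral_eq_integral[OF i(2)])
  have "enn2real (INF q\<in>couplings m m'. \<integral>\<^sup>+ z. ennreal ((dist (fst z) (snd z))^2) \<partial>q) <=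
      enn2real (\<integral>\<^sup>+ z. ennreal ((dist (fst z) (snd z))^2) \<partial>q)"
    by (intro enn2real_mono INF_lower q) (simp add: nn_integral_eq_integral[OF i(1)])
  then show "(W 2 m m')^2 <= (LINT z|q. (dist (fst z) (snd z))^2)"
    by (simp add: W_def dist_powr_12 nn_integral_eq_integral[OF i(1)] powr_half_sqrt)
qed

lemma W_nonneg [simp]: "0 <= W p m m'" by (simp add: W_def)

text \<open>An infimum provides couplings of cost strictly below any larger number; such couplings
  take the place of optimal ones, which is why later estimates assume a strict bound on the
  distance.\<close>

lemma W_coupling:
  assumes m: "m \<in> P2" "m' \<in> P2"
  shows "W 1 m m' < c ==> \<exists>q\<in>couplings m m'. (LINT z|q. dist (fst z) (snd z)) < c"
    "W 2 m m' < c ==> \<exists>q\<in>couplings m m'. (LINT z|q. (dist (fst z) (snd z))^2) < c^2"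
proof -
  have fin: "(INF q\<in>couplings m m'. \<integral>\<^sup>+ z. ennreal (f z) \<partial>q) < \<infinity>"
    if "\<And>q. q \<in> couplings m m' ==> integrable q f" "\<And>z. 0 <= f z" for f :: "'a \<times> 'a => real" using product_coupling[OF m] that
    by (intro le_less_trans[OF INF_lower[OF product_coupling[OF m]]]) (simp add: nn_integral_eq_integral)
  have sel: "\<exists>q\<in>couplings m m'. (LINT z|q. f z) < c"
    if f: "\<And>q. q \<in> couplings m m' ==> integrable q f" "\<And>z. 0 <= f z"
      and c: "enn2real (INF q\<in>couplings m m'. \<integral>\<^sup>+ z. ennreal (f z) \<partial>q) < c" for f :: "'a \<times> 'a => real" and c
  proof -
    have c0: "0 < c" using c enn2real_nonneg order_le_less_trans by blast
    have "(INF q\<in>couplings m m'. \<integral>\<^sup>+ z. ennreal (f z) \<partial>q) < ennreal c" using fin[OF f] c by (simp add: enn2real_less_iff less_top)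
    then obtain q where q: "q \<in> couplings m m'" "(\<integral>\<^sup>+ z. ennreal (f z) \<partial>q) < ennreal c" by (auto simp: INF_less_iff)
    then show ?thesis using f c0 by (intro bexI[of _ q]) (auto simp: nn_integral_eq_integral ennreal_less_iff)
  qed
  show "W 1 m m' < c ==> \<exists>q\<in>couplings m m'. (LINT z|q. dist (fst z) (snd z)) < c"
    using coupling_integrable(2)[OF _ m] by (intro sel) (auto simp: W_def dist_powr_12)
  assume "W 2 m m' < c"
  then have "sqrt (enn2real (INF q\<in>couplings m m'. \<integral>\<^sup>+ z. ennreal ((dist (fst z) (snd z))^2) \<partial>q)) < c"
    by (simp add: W_def dist_powr_12 powr_half_sqrt)
  then have "(sqrt (enn2real (INF q\<in>couplings m m'. \<integral>\<^sup>+ z. ennreal ((dist (fst z) (snd z))^2) \<partial>q)))^2 < c^2"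
    by (intro power_strict_mono) auto
  then show "\<exists>q\<in>couplings m m'. (LINT z|q. (dist (fst z) (snd z))^2) < c^2"
    using coupling_integrable(1)[OF _ m] by (intro sel) auto
qed

text \<open>Pointwise r <= d/2 + r^2/(2 d) takes the place of the Cauchy-Schwarz inequality; for a
  coupling of quadratic cost below d^2 each summand contributes at most d/2.\<close>

lemma W1_le_of_W2_less:
  assumes m: "m \<in> P2" "m' \<in> P2" and d: "W 2 m m' < d"
  shows "W 1 m m' <= d"
proof -
  have d0: "0 < d" using d W_nonneg[of 2 m m'] by linarith
  obtain q where q: "q \<in> couplings m m'" "(LINT z|q. (dist (fst z) (snd z))^2) < d^2" using W_coupling(2)[OF m d] by blast
  note i = coupling_integrable[OF q(1) m]
  interpret prob_space q by (rule couplings_D[OF q(1)])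
  have "W 1 m m' <= (LINT z|q. dist (fst z) (snd z))" by (rule W_le_coupling[OF q(1) m])
  also have "... <= (LINT z|q. d / 2 + (dist (fst z) (snd z))^2 / (2 * d))"
  proof (rule integral_mono)
    fix z :: "'a \<times> 'a"
    have "0 <= (d - dist (fst z) (snd z))^2 / (2 * d)" using d0 by simp
    also have "... = d / 2 + (dist (fst z) (snd z))^2 / (2 * d) - dist (fst z) (snd z)"
      using d0 by (simp add: field_simps power2_eq_square)
    finally show "dist (fst z) (snd z) <= d / 2 + (dist (fst z) (snd z))^2 / (2 * d)" by simp
  qed (use i in auto)
  also have "... = d / 2 + (LINT z|q. (dist (fst z) (snd z))^2) / (2 * d)" using i by (simp add: prob_space)
  also have "... <= d / 2 + d^2 / (2 * d)" using q(2) d0 by (intro add_left_mono divide_right_mono) auto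
  also have "... = d" using d0 by (simp add: power2_eq_square)
  finally show ?thesis .
qed

lemma second_moment_of_W2_less:
  assumes m: "m \<in> P2" "m' \<in> P2" and d: "W 2 m m' < d"
  shows "(LINT x|m. (norm x)^2) <= 2 * d^2 + 2 * (LINT x|m'. (norm x)^2)"
proof -
  obtain q where q: "q \<in> couplings m m'" "(LINT z|q. (dist (fst z) (snd z))^2) < d^2" using W_coupling(2)[OF m d] by blast
  note i = coupling_integrable[OF q(1) m]
  note mi = coupling_marginal_integral[OF q(1), of "\<lambda>x. (norm x)^2", simplified]
  have i': "integrable q (\<lambda>z. (norm (fst z))^2)" "integrable q (\<lambda>z. (norm (snd z))^2)" using mi(3,4) P2_D(4) m by auto
  have "(LINT x|m. (norm x)^2) = (LINT z|q. (norm (fst z))^2)" using mi by simp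
  also have "... <= (LINT z|q. 2 * (dist (fst z) (snd z))^2 + 2 * (norm (snd z))^2)"
  proof (rule integral_mono)
    fix z :: "'a \<times> 'a"
    have "norm (fst z) <= dist (fst z) (snd z) + norm (snd z)"
      using norm_triangle_ineq[of "fst z - snd z" "snd z"] by (simp add: dist_norm)
    then have "(norm (fst z))^2 <= (dist (fst z) (snd z) + norm (snd z))^2" by (intro power_mono) auto
    also have "... <= 2 * (dist (fst z) (snd z))^2 + 2 * (norm (snd z))^2"
      using zero_le_power2[of "dist (fst z) (snd z) - norm (snd z)"] by (simp add: power2_eq_square algebra_simps)
    finally show "(norm (fst z))^2 <= 2 * (dist (fst z) (snd z))^2 + 2 * (norm (snd z))^2" .
  qed (use i i' in auto)
  also have "... <= 2 * d^2 + 2 * (LINT x|m'. (norm x)^2)" using i i' mi q(2) by simp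
  finally show ?thesis .
qed

text \<open>The Lipschitz constant may grow linearly, as it does for the generator applied to a test
  function. Young's inequality with weight d splits (1 + |y|) |x - y| into d times a second moment
  and a quadratic cost divided by d, both of order d.\<close>

lemma integral_diff_of_W2_less:
  fixes f :: "'a::euclidean_space => real"
  assumes m: "m \<in> P2" "m' \<in> P2" and d: "W 2 m m' < d"
    and f: "f \<in> borel_measurable borel" "\<And>x y. \<bar>f x - f y\<bar> <= K * (1 + norm y) * dist x y" and K: "0 <= K"
  shows "\<bar>(LINT x|m. f x) - (LINT x|m'. f x)\<bar> <= K * (2 * d * (1 + (LINT x|m'. (norm x)^2)))"
    "integrable m f" "integrable m' f"
proof -
  have d0: "0 < d" using d W_nonneg[of 2 m m'] by linarith
  have fb: "\<bar>f x\<bar> <= (\<bar>f 0\<bar> + K) * (1 + (norm x)^2)" for x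
  proof -
    have n: "norm x <= 1 + (norm x)^2" by (rule le_one_plus_square)
    have "\<bar>f x\<bar> <= \<bar>f 0\<bar> * 1 + K * norm x" using f(2)[of x 0] by simp
    also have "... <= \<bar>f 0\<bar> * (1 + (norm x)^2) + K * (1 + (norm x)^2)" using K n by (intro add_mono mult_left_mono) auto
    finally show ?thesis by (simp add: distrib_right)
  qed
  show fi: "integrable m f" "integrable m' f" by (rule P2_integrable_quadratic[OF _ f(1) fb]; fact)+
  obtain q where q: "q \<in> couplings m m'" "(LINT z|q. (dist (fst z) (snd z))^2) < d^2" using W_coupling(2)[OF m d] by blast
  note i = coupling_integrable[OF q(1) m]
  note mi = coupling_marginal_integral[OF q(1)]
  interpret prob_space q by (rule couplings_D[OF q(1)])
  have i': "integrable q (\<lambda>z. (norm (snd z))^2)" using mi(4)[of "\<lambda>x. (norm x)^2"] P2_D(4) m by simp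
  have fi': "integrable q (\<lambda>z. f (fst z))" "integrable q (\<lambda>z. f (snd z))" using mi(3,4)[OF f(1)] fi by auto
  have "\<bar>(LINT x|m. f x) - (LINT x|m'. f x)\<bar> = \<bar>\<integral>z. f (fst z) - f (snd z) \<partial>q\<bar>" using mi(1,2)[OF f(1)] fi' by simp
  also have "... <= (LINT z|q. \<bar>f (fst z) - f (snd z)\<bar>)" by (rule integral_abs_bound)
  also have "... <= (LINT z|q. K * (d * (1 + (norm (snd z))^2) + (dist (fst z) (snd z))^2 / (2 * d)))"
  proof (rule integral_mono)
    fix z :: "'a \<times> 'a"
    let ?d = "dist (fst z) (snd z)" and ?n = "norm (snd z)"
    have "0 <= (d * (1 + ?n) - ?d)^2 / (2 * d)" using d0 by simp
    also have "... = d * (1 + ?n)^2 / 2 + ?d^2 / (2 * d) - (1 + ?n) * ?d" using d0 by (simp add: field_simps power2_eq_square)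
    finally have "(1 + ?n) * ?d <= d * ((1 + ?n)^2 / 2) + ?d^2 / (2 * d)" by simp
    also have "... <= d * (1 + ?n^2) + ?d^2 / (2 * d)" using d0 zero_le_power2[of "1 - ?n"]
      by (intro add_right_mono mult_left_mono) (auto simp: power2_eq_square field_simps)
    finally have "K * ((1 + ?n) * ?d) <= K * (d * (1 + ?n^2) + ?d^2 / (2 * d))" using K by (rule mult_left_mono)
    then show "\<bar>f (fst z) - f (snd z)\<bar> <= K * (d * (1 + ?n^2) + ?d^2 / (2 * d))"
      using f(2)[of "fst z" "snd z"] by (simp add: mult.assoc)
  qed (use i i' fi' in auto)
  also have "... = K * (d * (1 + (LINT x|m'. (norm x)^2)) + (LINT z|q. (dist (fst z) (snd z))^2) / (2 * d))"
    using i i' mi(2)[of "\<lambda>x. (norm x)^2"] by (simp add: prob_space)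
  also have "... <= K * (2 * d * (1 + (LINT x|m'. (norm x)^2)))"
  proof (rule mult_left_mono[OF _ K])
    have "(LINT z|q. (dist (fst z) (snd z))^2) / (2 * d) <= d^2 / (2 * d)" using q(2) d0 by (intro divide_right_mono) auto
    also have "... = d * (1 / 2)" using d0 by (simp add: power2_eq_square)
    also have "... <= d * (1 + (LINT x|m'. (norm x)^2))"
    proof (rule mult_left_mono)
      have "0 <= (LINT x|m'. (norm x)^2)" by simp
      then show "1 / 2 <= 1 + (LINT x|m'. (norm x)^2)" by linarith
    qed (use d0 in simp)
    finally show "d * (1 + (LINT x|m'. (norm x)^2)) + (LINT z|q. (dist (fst z) (snd z))^2) / (2 * d) <=
        2 * d * (1 + (LINT x|m'. (norm x)^2))" by simp
  qed
  finally show "\<bar>(LINT x|m. f x) - (LINT x|m'. f x)\<bar> <= K * (2 * d * (1 + (LINT x|m'. (norm x)^2)))" .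
qed

section \<open>Symmetry, gluing and the triangle inequality for W1\<close>

lemma W1_commute_le:
  assumes m: "m \<in> P2" "m' \<in> P2"
  shows "W 1 m' m <= W 1 m m'"
proof (rule field_le_epsilon)
  fix e :: real assume "0 < e"
  then obtain q where q: "q \<in> couplings m m'" "(LINT z|q. dist (fst z) (snd z)) < W 1 m m' + e"
    using W_coupling(1)[OF m, of "W 1 m m' + e"] by auto
  note c = couplings_D[OF q(1)]
  have sw[measurable]: "prod.swap \<in> measurable q (borel \<Otimes>\<^sub>M borel)" unfolding prod.swap_def using c(5,6) by simp
  define q' where "q' = distr q (borel \<Otimes>\<^sub>M borel) prod.swap"
  have "q' \<in> couplings m' m" unfolding couplings_def q'_def using c prob_space.prob_space_distr[OF c(1) sw]
    by (auto simp: distr_distr comp_def prod.swap_def)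
  from W_le_coupling(1)[OF this m(2,1)] have "W 1 m' m <= (LINT z|q'. dist (fst z) (snd z))" .
  also have "... = (LINT z|q. dist (fst z) (snd z))" unfolding q'_def by (subst integral_distr[OF sw]) (auto simp: dist_commute)
  finally show "W 1 m' m <= W 1 m m' + e" using q(2) by linarith
qed

text \<open>The cells replace a disintegration in the gluing of couplings.\<close>

lemma cell_index_exists:
  assumes "0 < e"
  obtains j :: "'a::euclidean_space => nat" where "j \<in> measurable borel (count_space UNIV)"
    "\<And>x y. j x = j y ==> dist x y < e"
proof -
  obtain D :: "'a set" where D: "countable D" "\<And>X. open X ==> X \<noteq> {} ==> \<exists>d\<in>D. d \<in> X" using countable_dense_setE by blast
  define a where "a = from_nat_into D"
  define j where "j x = (LEAST i. dist (a i) x < e / 2)" for x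
  have j: "dist (a (j x)) x < e / 2" for x
  proof -
    obtain d where d: "d \<in> D" "d \<in> ball x (e / 2)" using D(2)[of "ball x (e / 2)"] assms by auto
    then obtain i where "a i = d" using from_nat_into_surj[OF D(1)] by (auto simp: a_def)
    then have "dist (a i) x < e / 2" using d by (simp add: dist_commute)
    then show ?thesis unfolding j_def by (rule LeastI)
  qed
  show ?thesis
  proof (rule that[of j])
    have [measurable]: "Measurable.pred borel (\<lambda>x. dist (a i) x < e / 2)" for i by measurable
    show "j \<in> measurable borel (count_space UNIV)" unfolding j_def by measurable
    show "dist x y < e" if "j x = j y" for x y using j[of x] j[of y] dist_triangle_half_r[of "a (j x)" x e y] that by simp
  qed
qed

text \<open>The product of \<open>q1\<close> and \<open>q2\<close> is reweighted by 1/w_i where both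
  middle points lie in cell i of mass w_i, and by 0 where their cells differ. With the first pair
  fixed the weight integrates to 1 over the second, and conversely, so both marginals survive
  exactly; the middle points agree only up to their cell.\<close>

lemma approximate_gluing:
  fixes m1 m2 m3 :: "'a::euclidean_space measure"
  assumes q1: "q1 \<in> couplings m1 m2" and q2: "q2 \<in> couplings m2 m3"
    and l[measurable]: "l \<in> measurable borel (count_space (UNIV :: nat set))"
  shows "\<exists>G. sets G = sets (q1 \<Otimes>\<^sub>M q2) \<and> (\<forall>f\<in>borel_measurable (borel \<Otimes>\<^sub>M borel). (\<integral>\<^sup>+z. f (fst z) \<partial>G) = (\<integral>\<^sup>+z. f z \<partial>q1) \<and>
        (\<integral>\<^sup>+z. f (snd z) \<partial>G) = (\<integral>\<^sup>+z. f z \<partial>q2)) \<and> (AE z in G. l (snd (fst z)) = l (fst (snd z)))"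
proof -
  note c1 = couplings_D[OF q1] and c2 = couplings_D[OF q2]
  have s1[measurable_cong]: "sets q1 = sets (borel \<Otimes>\<^sub>M borel)"
    and s2[measurable_cong]: "sets q2 = sets (borel \<Otimes>\<^sub>M borel)" by (fact c1 c2)+
  interpret p1: prob_space q1 by (rule c1)
  interpret p2: prob_space q2 by (rule c2)
  interpret pair_prob_space q1 q2 ..
  have m2: "sets m2 = sets borel" by (rule c1)
  have "prob_space (distr q1 borel snd)" by (rule prob_space.prob_space_distr[OF c1(1,6)])
  then interpret m2: prob_space m2 using c1(4) by simp
  define w where "w i = measure m2 {y. l y = i}" for i
  have w0: "0 <= w i" for i by (simp add: w_def)
  have [measurable]: "{y. l y = i} \<in> sets borel" for i
  proof -
    have "{y \<in> space borel. l y = i} \<in> sets borel" by measurable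
    then show ?thesis by simp
  qed
  have mass1: "emeasure q1 {z. l (snd z) = i} = ennreal (w i)" for i
  proof -
    have "emeasure m2 {y. l y = i} = emeasure q1 (snd -` {y. l y = i} \<inter> space q1)"
      unfolding c1(4)[symmetric] by (rule emeasure_distr) (use c1 in auto)
    moreover have "space q1 = UNIV" using sets_eq_imp_space_eq[OF s1] by (simp add: space_pair_measure)
    moreover have "snd -` {y. l y = i} = {z :: 'a \<times> 'a. l (snd z) = i}" by auto
    ultimately show ?thesis by (simp add: w_def m2.emeasure_eq_measure)
  qed
  have mass2: "emeasure q2 {z. l (fst z) = i} = ennreal (w i)" for i
  proof -
    have "emeasure m2 {y. l y = i} = emeasure q2 (fst -` {y. l y = i} \<inter> space q2)"
      unfolding c2(3)[symmetric] by (rule emeasure_distr) (use c2 in auto)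
    moreover have "space q2 = UNIV" using sets_eq_imp_space_eq[OF s2] by (simp add: space_pair_measure)
    moreover have "fst -` {y. l y = i} = {z :: 'a \<times> 'a. l (fst z) = i}" by auto
    ultimately show ?thesis by (simp add: w_def m2.emeasure_eq_measure)
  qed
  define k where "k i j = (if i = j \<and> 0 < w i then ennreal (1 / w i) else 0)" for i j :: nat
  define g where "g z = k (l (snd (fst z))) (l (fst (snd z)))" for z :: "('a \<times> 'a) \<times> ('a \<times> 'a)"
  have "(\<lambda>p. k (fst p) (snd p)) \<in> borel_measurable (count_space UNIV \<Otimes>\<^sub>M count_space UNIV)" by (simp add: pair_measure_countable)
  moreover have "(\<lambda>z. (l (snd (fst z)), l (fst (snd z)))) \<in> measurable (q1 \<Otimes>\<^sub>M q2) (count_space UNIV \<Otimes>\<^sub>M count_space UNIV)"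
    by measurable
  ultimately have [measurable]: "g \<in> borel_measurable (q1 \<Otimes>\<^sub>M q2)"
    unfolding g_def[abs_def] by (auto dest: measurable_compose[rotated])
  define G where "G = density (q1 \<Otimes>\<^sub>M q2) g"
  have set1[measurable]: "{z. l (snd z) = i} \<in> sets q1" for i
  proof -
    have "{z \<in> space q1. l (snd z) = i} \<in> sets q1" by measurable
    then show ?thesis using sets_eq_imp_space_eq[OF s1] by (simp add: space_pair_measure)
  qed
  have set2[measurable]: "{z. l (fst z) = i} \<in> sets q2" for i
  proof -
    have "{z \<in> space q2. l (fst z) = i} \<in> sets q2" by measurable
    then show ?thesis using sets_eq_imp_space_eq[OF s2] by (simp add: space_pair_measure)
  qed
  have ki: "k i j = ennreal (1 / w i) * indicator {i} j" if "0 < w i" for i j using that by (auto simp: k_def indicator_def)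
  have kj: "k i j = ennreal (1 / w j) * indicator {j} i" if "0 < w j" for i j using that by (auto simp: k_def indicator_def)
  have one: "ennreal (1 / w i) * ennreal (w i) = 1" if "0 < w i" for i using that by (simp flip: ennreal_mult)
  have int2: "(\<integral>\<^sup>+z2. g (z1, z2) \<partial>q2) = 1" if "0 < w (l (snd z1))" for z1
  proof -
    have "(\<integral>\<^sup>+z2. g (z1, z2) \<partial>q2) = (\<integral>\<^sup>+z2. ennreal (1 / w (l (snd z1))) * indicator {z. l (fst z) = l (snd z1)} z2 \<partial>q2)"
      by (intro nn_integral_cong) (auto simp: g_def ki[OF that] indicator_def)
    also have "... = 1" using one[OF that] by (simp add: nn_integral_cmult mass2)
    finally show ?thesis .
  qed
  have int1: "(\<integral>\<^sup>+z1. g (z1, z2) \<partial>q1) = 1" if "0 < w (l (fst z2))" for z2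
  proof -
    have "(\<integral>\<^sup>+z1. g (z1, z2) \<partial>q1) = (\<integral>\<^sup>+z1. ennreal (1 / w (l (fst z2))) * indicator {z. l (snd z) = l (fst z2)} z1 \<partial>q1)"
      by (intro nn_integral_cong) (auto simp: g_def kj[OF that] indicator_def)
    also have "... = 1" using one[OF that] by (simp add: nn_integral_cmult mass1)
    finally show ?thesis .
  qed
  \<comment> \<open>In a cell of mass 0 the weight is 0 and cannot integrate to 1; such cells are
    charged by neither coupling, and there are countably many of them.\<close>
  have "AE z in q1. l (snd z) = i --> 0 < w i" for i
  proof (cases "w i = 0")
    case True
    then show ?thesis using mass1[of i] set1[of i] by (intro AE_I[where N = "{z. l (snd z) = i}"]) auto
  qed (use w0[of i] in auto)
  then have "AE z in q1. \<forall>i. l (snd z) = i --> 0 < w i" by (subst AE_all_countable) blast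
  then have AE1: "AE z in q1. 0 < w (l (snd z))" by (rule eventually_mono) blast
  have "AE z in q2. l (fst z) = i --> 0 < w i" for i
  proof (cases "w i = 0")
    case True
    then show ?thesis using mass2[of i] set2[of i] by (intro AE_I[where N = "{z. l (fst z) = i}"]) auto
  qed (use w0[of i] in auto)
  then have "AE z in q2. \<forall>i. l (fst z) = i --> 0 < w i" by (subst AE_all_countable) blast
  then have AE2: "AE z in q2. 0 < w (l (fst z))" by (rule eventually_mono) blast
  show ?thesis
  proof (intro exI[of _ G] conjI ballI)
    show "sets G = sets (q1 \<Otimes>\<^sub>M q2)" by (simp add: G_def)
    show "AE z in G. l (snd (fst z)) = l (fst (snd z))"
      unfolding G_def by (subst AE_density) (auto simp: g_def k_def intro!: AE_I2 split: if_splits)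
  next
    fix f :: "'a \<times> 'a => ennreal" assume [measurable]: "f \<in> borel_measurable (borel \<Otimes>\<^sub>M borel)"
    have "(\<integral>\<^sup>+z. f (fst z) \<partial>G) = (\<integral>\<^sup>+z. g z * f (fst z) \<partial>(q1 \<Otimes>\<^sub>M q2))" unfolding G_def by (rule nn_integral_density) measurable
    also have "... = (\<integral>\<^sup>+z1. (\<integral>\<^sup>+z2. g (z1, z2) * f z1 \<partial>q2) \<partial>q1)" by (subst p2.nn_integral_fst[symmetric]) simp_all
    also have "... = (\<integral>\<^sup>+z1. (\<integral>\<^sup>+z2. g (z1, z2) \<partial>q2) * f z1 \<partial>q1)" by (intro nn_integral_cong nn_integral_multc) measurable
    also have "... = (\<integral>\<^sup>+z1. f z1 \<partial>q1)" using AE1 by (intro nn_integral_cong_AE) (auto simp: int2)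
    finally show "(\<integral>\<^sup>+z. f (fst z) \<partial>G) = (\<integral>\<^sup>+z. f z \<partial>q1)" .
    have "(\<integral>\<^sup>+z. f (snd z) \<partial>G) = (\<integral>\<^sup>+z. g z * f (snd z) \<partial>(q1 \<Otimes>\<^sub>M q2))" unfolding G_def by (rule nn_integral_density) measurable
    also have "... = (\<integral>\<^sup>+z2. (\<integral>\<^sup>+z1. g (z1, z2) * f z2 \<partial>q1) \<partial>q2)" by (subst nn_integral_snd[symmetric]) simp_all
    also have "... = (\<integral>\<^sup>+z2. (\<integral>\<^sup>+z1. g (z1, z2) \<partial>q1) * f z2 \<partial>q2)" by (intro nn_integral_cong nn_integral_multc) measurable
    also have "... = (\<integral>\<^sup>+z2. f z2 \<partial>q2)" using AE2 by (intro nn_integral_cong_AE) (auto simp: int1)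
    finally show "(\<integral>\<^sup>+z. f (snd z) \<partial>G) = (\<integral>\<^sup>+z. f z \<partial>q2)" .
  qed
qed

text \<open>The two near-optimal couplings lose e/3 each, and the gap between the glued middle
  points, which share a cell, is below the last e/3.\<close>

lemma W1_triangle:
  assumes m: "m1 \<in> P2" "m2 \<in> P2" "m3 \<in> P2"
  shows "W 1 m1 m3 <= W 1 m1 m2 + W 1 m2 m3"
proof (rule field_le_epsilon)
  fix e :: real assume e: "0 < e"
  obtain q1 where q1: "q1 \<in> couplings m1 m2" "(LINT z|q1. dist (fst z) (snd z)) < W 1 m1 m2 + e / 3"
    using W_coupling(1)[OF m(1,2), of "W 1 m1 m2 + e / 3"] e by auto
  obtain q2 where q2: "q2 \<in> couplings m2 m3" "(LINT z|q2. dist (fst z) (snd z)) < W 1 m2 m3 + e / 3"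
    using W_coupling(1)[OF m(2,3), of "W 1 m2 m3 + e / 3"] e by auto
  obtain i :: "'a => nat" where i: "i \<in> measurable borel (count_space UNIV)"
    "\<And>x y. i x = i y ==> dist x y < e / 3" using cell_index_exists[of "e / 3"] e by auto
  from approximate_gluing[OF q1(1) q2(1) i(1)] obtain G where G0: "sets G = sets (q1 \<Otimes>\<^sub>M q2) \<and>
    (\<forall>f\<in>borel_measurable (borel \<Otimes>\<^sub>M borel). (\<integral>\<^sup>+z. f (fst z) \<partial>G) = (\<integral>\<^sup>+z. f z \<partial>q1) \<and> (\<integral>\<^sup>+z. f (snd z) \<partial>G) = (\<integral>\<^sup>+z. f z \<partial>q2)) \<and>
    (AE z in G. i (snd (fst z)) = i (fst (snd z)))" ..
  note G = G0[THEN conjunct1] G0[THEN conjunct2, THEN conjunct1, THEN bspec, THEN conjunct1]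
    G0[THEN conjunct2, THEN conjunct1, THEN bspec, THEN conjunct2] G0[THEN conjunct2, THEN conjunct2]
  note c1 = couplings_D[OF q1(1)] and c2 = couplings_D[OF q2(1)]
  interpret p1: prob_space q1 by (rule c1)
  have sG: "sets G = sets ((borel \<Otimes>\<^sub>M borel) \<Otimes>\<^sub>M (borel \<Otimes>\<^sub>M borel))" unfolding G(1) by (intro sets_pair_measure_cong c1 c2)
  have spG: "space G = UNIV" using sets_eq_imp_space_eq[OF sG] by (simp add: space_pair_measure)
  have meas[measurable]: "(\<lambda>z. (fst (fst z), snd (snd z))) \<in> measurable G (borel \<Otimes>\<^sub>M borel)"
    "fst \<in> measurable G (borel \<Otimes>\<^sub>M borel)" "snd \<in> measurable G (borel \<Otimes>\<^sub>M borel)"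
    unfolding measurable_cong_sets[OF sG refl] by measurable
  define c where "c = distr G (borel \<Otimes>\<^sub>M borel) (\<lambda>z. (fst (fst z), snd (snd z)))"
  have "emeasure G (space G) = 1" using G(2)[of "\<lambda>_. 1"] p1.emeasure_space_1 by simp
  then interpret G: prob_space G by (intro prob_spaceI)
  have em: "(\<integral>\<^sup>+z. indicator A (f z) \<partial>G) = emeasure G (f -` A)"
    if "f \<in> measurable G borel" "A \<in> sets borel" for f :: "_ => 'a" and A
  proof -
    have "f -` A \<in> sets G" using measurable_sets[OF that] spG by simp
    moreover have "(\<lambda>z. indicator A (f z)) = (indicator (f -` A) :: _ => ennreal)" by (auto simp: indicator_def)
    ultimately show ?thesis by simp
  qed
  have "c \<in> couplings m1 m3"
  proof (rule couplingI)
    show "prob_space c" unfolding c_def by (rule G.prob_space_distr[OF meas(1)])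
    show "sets c = sets (borel \<Otimes>\<^sub>M borel)" by (simp add: c_def)
    show "sets m1 = sets borel" "sets m3 = sets borel" by (fact c1 c2)+
    fix A :: "'a set" assume A[measurable]: "A \<in> sets borel"
    have "emeasure c (fst -` A) = emeasure G ((\<lambda>z. fst (fst z)) -` A)"
    proof -
      have "fst -` A \<in> sets (borel \<Otimes>\<^sub>M borel :: ('a \<times> 'a) measure)"
      proof -
        have "fst -` A = A \<times> (UNIV :: 'a set)" by auto
        moreover have "A \<times> (UNIV :: 'a set) \<in> sets (borel \<Otimes>\<^sub>M borel)" using A by (intro pair_measureI) auto
        ultimately show ?thesis by simp
      qed
      then show ?thesis unfolding c_def
        by (subst emeasure_distr[OF meas(1)]) (auto simp: spG intro!: arg_cong[where f = "emeasure G"])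
    qed
    also have "... = (\<integral>\<^sup>+z. indicator A (fst (fst z)) \<partial>G)" by (rule em[symmetric]) measurable
    also have "... = (\<integral>\<^sup>+z. indicator A (fst z) \<partial>q1)" by (rule G(2)) measurable
    also have "... = emeasure m1 A" using coupling_marginal_nn_integral(1)[OF q1(1), of "indicator A"] c1 by simp
    finally show "emeasure c (fst -` A) = emeasure m1 A" .
    have "emeasure c (snd -` A) = emeasure G ((\<lambda>z. snd (snd z)) -` A)"
    proof -
      have "snd -` A \<in> sets (borel \<Otimes>\<^sub>M borel :: ('a \<times> 'a) measure)"
      proof -
        have "snd -` A = (UNIV :: 'a set) \<times> A" by auto
        moreover have "(UNIV :: 'a set) \<times> A \<in> sets (borel \<Otimes>\<^sub>M borel)" using A by (intro pair_measureI) auto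
        ultimately show ?thesis by simp
      qed
      then show ?thesis unfolding c_def
        by (subst emeasure_distr[OF meas(1)]) (auto simp: spG intro!: arg_cong[where f = "emeasure G"])
    qed
    also have "... = (\<integral>\<^sup>+z. indicator A (snd (snd z)) \<partial>G)" by (rule em[symmetric]) measurable
    also have "... = (\<integral>\<^sup>+z. indicator A (snd z) \<partial>q2)" by (rule G(3)) measurable
    also have "... = emeasure m3 A" using coupling_marginal_nn_integral(2)[OF q2(1), of "indicator A"] c2 by simp
    finally show "emeasure c (snd -` A) = emeasure m3 A" .
  qed
  note c = this
  have nn: "(\<integral>\<^sup>+z. ennreal (dist (fst z) (snd z)) \<partial>q) = ennreal (LINT z|q. dist (fst z) (snd z))"
    if "q \<in> couplings a b" "a \<in> P2" "b \<in> P2" for q and a b :: "'a measure"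
    using coupling_integrable(2)[OF that] by (rule nn_integral_eq_integral) auto
  have "ennreal (LINT z|c. dist (fst z) (snd z)) = (\<integral>\<^sup>+z. ennreal (dist (fst z) (snd z)) \<partial>c)" using nn[OF c m(1,3)] by simp
  also have "... = (\<integral>\<^sup>+z. ennreal (dist (fst (fst z)) (snd (snd z))) \<partial>G)"
    unfolding c_def by (subst nn_integral_distr[OF meas(1)]) auto
  also have "... <= (\<integral>\<^sup>+z. ennreal (dist (fst (fst z)) (snd (fst z))) + ennreal (dist (fst (snd z)) (snd (snd z))) + ennreal (e / 3) \<partial>G)"
  proof (rule nn_integral_mono_AE, rule AE_mp[OF G(4)], intro AE_I2 impI)
    fix z :: "('a \<times> 'a) \<times> ('a \<times> 'a)" assume "i (snd (fst z)) = i (fst (snd z))"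
    then have "dist (snd (fst z)) (fst (snd z)) < e / 3" by (rule i(2))
    then have "dist (fst (fst z)) (snd (snd z)) <= dist (fst (fst z)) (snd (fst z)) + dist (fst (snd z)) (snd (snd z)) + e / 3"
      using dist_triangle[of "fst (fst z)" "snd (snd z)" "snd (fst z)"]
        dist_triangle[of "snd (fst z)" "snd (snd z)" "fst (snd z)"] by linarith
    then show "ennreal (dist (fst (fst z)) (snd (snd z))) <= ennreal (dist (fst (fst z)) (snd (fst z))) +
        ennreal (dist (fst (snd z)) (snd (snd z))) + ennreal (e / 3)" using e by (simp flip: ennreal_plus add: ennreal_leI)
  qed
  also have "... = (\<integral>\<^sup>+z. ennreal (dist (fst (fst z)) (snd (fst z))) \<partial>G) +
      (\<integral>\<^sup>+z. ennreal (dist (fst (snd z)) (snd (snd z))) \<partial>G) + ennreal (e / 3)"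
    using G.emeasure_space_1 by (simp add: nn_integral_add)
  also have "... = ennreal (LINT z|q1. dist (fst z) (snd z)) + ennreal (LINT z|q2. dist (fst z) (snd z)) + ennreal (e / 3)"
    using G(2)[of "\<lambda>z. ennreal (dist (fst z) (snd z))"] G(3)[of "\<lambda>z. ennreal (dist (fst z) (snd z))"]
      nn[OF q1(1) m(1,2)] nn[OF q2(1) m(2,3)] by simp
  also have "... = ennreal ((LINT z|q1. dist (fst z) (snd z)) + (LINT z|q2. dist (fst z) (snd z)) + e / 3)"
    using e by (simp flip: ennreal_plus)
  finally have "(LINT z|c. dist (fst z) (snd z)) <= (LINT z|q1. dist (fst z) (snd z)) + (LINT z|q2. dist (fst z) (snd z)) + e / 3"
    using e by (subst (asm) ennreal_le_iff) (auto intro!: add_nonneg_nonneg)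
  then show "W 1 m1 m3 <= W 1 m1 m2 + W 1 m2 m3 + e" using W_le_coupling(1)[OF c m(1,3)] q1(2) q2(2) by linarith
qed

lemma W1_diff_le:
  assumes "m1 \<in> P2" "m2 \<in> P2" "m3 \<in> P2"
  shows "\<bar>W 1 m1 m3 - W 1 m2 m3\<bar> <= W 1 m1 m2"
  using W1_triangle[OF assms] W1_triangle[of m2 m1 m3] W1_commute_le[of m1 m2] assms by auto

section \<open>The minimizer of the free energy\<close>

lemma space_mix [simp]: "space (mix t m m') = UNIV" using sets_eq_imp_space_eq[OF sets_mix] by simp

lemma nn_integral_mix:
  assumes m[simp]: "sets m = sets borel" "sets m' = sets borel" and f: "f \<in> borel_measurable borel"
  shows "(\<integral>\<^sup>+x. f x \<partial>(mix t m m')) = ennreal (1 - t) * (\<integral>\<^sup>+x. f x \<partial>m) + ennreal t * (\<integral>\<^sup>+x. f x \<partial>m')"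
proof -
  have sp[simp]: "space m = UNIV" "space m' = UNIV" using sets_eq_imp_space_eq[OF m(1)] sets_eq_imp_space_eq[OF m(2)] by auto
  note meas = measurable_cong_sets[OF m(1) refl] measurable_cong_sets[OF m(2) refl]
    measurable_cong_sets[OF sets_mix refl]
  show ?thesis using f
  proof (induct rule: borel_measurable_induct)
    case (cong f g)
    then have "f = g" by auto
    then show ?case using cong by simp
  next
    case (set A)
    then show ?case by (simp add: emeasure_mix)
  next
    case (mult u c)
    then show ?case by (simp add: nn_integral_cmult meas distrib_left mult.left_commute)
  next
    case (add u v)
    then show ?case by (simp add: nn_integral_add meas distrib_left add_ac)
  next
    case (seq U)
    have inc: "incseq (\<lambda>i. \<integral>\<^sup>+x. U i x \<partial>M)" for M using \<open>incseq U\<close> by (intro incseq_nn_integral)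
    have "(\<integral>\<^sup>+x. (SUP i. U i x) \<partial>(mix t m m')) = (SUP i. \<integral>\<^sup>+x. U i x \<partial>(mix t m m'))"
      using seq by (intro nn_integral_monotone_convergence_SUP) (auto simp: meas)
    also have "... = (SUP i. ennreal (1 - t) * (\<integral>\<^sup>+x. U i x \<partial>m) + ennreal t * (\<integral>\<^sup>+x. U i x \<partial>m'))" using seq(3) by simp
    also have "... = (SUP i. ennreal (1 - t) * (\<integral>\<^sup>+x. U i x \<partial>m)) + (SUP i. ennreal t * (\<integral>\<^sup>+x. U i x \<partial>m'))"
      using inc[of m] inc[of m'] by (intro ennreal_SUP_add) (auto simp: incseq_def intro!: mult_left_mono)
    also have "... = ennreal (1 - t) * (SUP i. \<integral>\<^sup>+x. U i x \<partial>m) + ennreal t * (SUP i. \<integral>\<^sup>+x. U i x \<partial>m')"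
      by (simp add: SUP_mult_left_ennreal)
    also have "... = ennreal (1 - t) * (\<integral>\<^sup>+x. (SUP i. U i x) \<partial>m) + ennreal t * (\<integral>\<^sup>+x. (SUP i. U i x) \<partial>m')"
      using seq by (simp add: nn_integral_monotone_convergence_SUP meas)
    finally show ?case by (simp add: SUP_apply[abs_def])
  qed
qed

lemma integral_mix:
  fixes f :: "'a::euclidean_space => real"
  assumes m: "sets m = sets borel" "sets m' = sets borel" and t: "0 <= t" "t <= 1"
    and f: "f \<in> borel_measurable borel" "integrable m f" "integrable m' f"
  shows "integrable (mix t m m') f"
    "(LINT x|(mix t m m'). f x) = (1 - t) * (LINT x|m. f x) + t * (LINT x|m'. f x)"
proof -
  have fm: "f \<in> borel_measurable (mix t m m')" unfolding measurable_cong_sets[OF sets_mix refl] by (rule f(1))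
  have fin: "(\<integral>\<^sup>+x. ennreal (norm (f x)) \<partial>m) < \<infinity>" "(\<integral>\<^sup>+x. ennreal (norm (f x)) \<partial>m') < \<infinity>"
    using f(2,3) by (simp_all add: integrable_iff_bounded)
  show i: "integrable (mix t m m') f" unfolding integrable_iff_bounded using fin fm f(1)
    by (simp add: nn_integral_mix[OF m] ennreal_mult_less_top)
  have fin': "(\<integral>\<^sup>+x. ennreal (f x) \<partial>M) < \<infinity>" "(\<integral>\<^sup>+x. ennreal (- f x) \<partial>M) < \<infinity>" if "integrable M f" for M
    using that by (simp_all add: real_integrable_def less_top)
  have pos: "enn2real (\<integral>\<^sup>+x. ennreal (g x) \<partial>(mix t m m')) =
      (1 - t) * enn2real (\<integral>\<^sup>+x. ennreal (g x) \<partial>m) + t * enn2real (\<integral>\<^sup>+x. ennreal (g x) \<partial>m')"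
    if "g \<in> borel_measurable borel" "(\<integral>\<^sup>+x. ennreal (g x) \<partial>m) < \<infinity>" "(\<integral>\<^sup>+x. ennreal (g x) \<partial>m') < \<infinity>" for g
    using that t by (simp add: nn_integral_mix[OF m] enn2real_plus ennreal_mult_less_top enn2real_mult)
  have fneg: "(\<lambda>x. - f x) \<in> borel_measurable borel" using f(1) by simp
  show "(LINT x|(mix t m m'). f x) = (1 - t) * (LINT x|m. f x) + t * (LINT x|m'. f x)"
    unfolding real_lebesgue_integral_def[OF i] real_lebesgue_integral_def[OF f(2)] real_lebesgue_integral_def[OF f(3)]
      pos[OF f(1) fin'(1)[OF f(2)] fin'(1)[OF f(3)]] pos[OF fneg fin'(2)[OF f(2)] fin'(2)[OF f(3)]] by (simp add: algebra_simps)
qed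

lemma prob_space_mix:
  assumes m: "sets m = sets borel" "sets m' = sets borel" "prob_space m" "prob_space m'"
    and t: "0 <= t" "t <= 1"
  shows "prob_space (mix t m m')"
proof (rule prob_spaceI)
  have "emeasure m UNIV = 1" "emeasure m' UNIV = 1"
    using prob_space.emeasure_space_1[OF m(3)] prob_space.emeasure_space_1[OF m(4)]
      sets_eq_imp_space_eq[OF m(1)] sets_eq_imp_space_eq[OF m(2)] by auto
  then show "emeasure (mix t m m') (space (mix t m m')) = 1" using t by (simp add: emeasure_mix m flip: ennreal_plus)
qed

lemma mix_P2:
  assumes m: "m \<in> P2" "m' \<in> P2" and t: "0 <= t" "t <= 1"
  shows "mix t m m' \<in> P2" unfolding P2_def using P2_D[OF m(1)] P2_D[OF m(2)] t by (auto intro!: prob_space_mix integral_mix)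

lemma mix_0: "sets m = sets borel ==> sets m' = sets borel ==> mix 0 m m' = m" by (intro measure_eqI) (auto simp: emeasure_mix)

lemma mix_flip:
  assumes "sets m = sets borel" "sets m' = sets borel" shows "mix (1 - t) m m' = mix t m' m"
  using assms by (intro measure_eqI) (auto simp: emeasure_mix add.commute)

lemma mix_mix:
  assumes m: "sets m = sets borel" "sets m' = sets borel" and t: "0 <= t" "t <= 1" "0 <= s" "s <= 1"
  shows "mix s m (mix t m m') = mix (s * t) m m'"
proof (rule measure_eqI)
  fix A assume "A \<in> sets (mix s m (mix t m m'))"
  then have A: "A \<in> sets borel" by simp
  have st: "s * t <= 1" using t by (simp add: mult_le_one)
  have "s * t <= s" using t by (simp add: mult_left_le)
  then have "ennreal (1 - s) + ennreal s * ennreal (1 - t) = ennreal (1 - s * t)"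
    using t st by (simp add: algebra_simps flip: ennreal_mult ennreal_plus)
  moreover have "ennreal s * ennreal t = ennreal (s * t)" using t by (simp add: ennreal_mult)
  ultimately show "emeasure (mix s m (mix t m m')) A = emeasure (mix (s * t) m m') A"
    using A m by (simp add: emeasure_mix distrib_left add.assoc[symmetric] flip: mult.assoc distrib_right)
qed simp

text \<open>A transport plan: the share 1 - t stays at rest on the diagonal and the share t moves
  independently. Its cost is t times a constant.\<close>

lemma W2_mix_le:
  assumes m: "m \<in> P2" "m' \<in> P2" and t: "0 <= t" "t <= 1"
  shows "(W 2 m (mix t m m'))^2 <= t * (LINT z|(m \<Otimes>\<^sub>M m'). (dist (fst z) (snd z))^2)"
proof -
  note d = P2_D[OF m(1)] and d' = P2_D[OF m(2)]
  interpret m: prob_space m by (rule d)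
  interpret m': prob_space m' by (rule d')
  interpret pair_prob_space m m' ..
  define \<Delta> where "\<Delta> = distr m (borel :: ('a \<times> 'a) measure) (\<lambda>x. (x, x))"
  have dm: "(\<lambda>x. (x, x)) \<in> measurable m (borel :: ('a \<times> 'a) measure)"
    unfolding borel_prod[symmetric] measurable_cong_sets[OF d(2) refl] by measurable
  have s\<Delta>: "sets \<Delta> = sets borel" by (simp add: \<Delta>_def)
  have c: "m \<Otimes>\<^sub>M m' \<in> couplings m m'" by (rule product_coupling[OF m])
  have sP: "sets (m \<Otimes>\<^sub>M m') = sets borel" using couplings_D(2)[OF c] unfolding borel_prod .
  have p\<Delta>: "prob_space \<Delta>" unfolding \<Delta>_def by (rule m.prob_space_distr[OF dm])
  define v where "v = mix t \<Delta> (m \<Otimes>\<^sub>M m')"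
  have meas: "(\<lambda>z :: 'a \<times> 'a. (dist (fst z) (snd z))^2) \<in> borel_measurable borel"
    by (auto intro!: borel_measurable_continuous_onI continuous_intros)
  have g: "v \<in> couplings m (mix t m m')"
  proof (rule couplingI)
    show "prob_space v" unfolding v_def using s\<Delta> sP p\<Delta> P.prob_space_axioms t by (intro prob_space_mix)
    show "sets v = sets (borel \<Otimes>\<^sub>M borel)" unfolding borel_prod v_def by simp
    show "sets m = sets borel" "sets (mix t m m') = sets borel" using d by auto
    fix A :: "'a set" assume A: "A \<in> sets borel"
    have FA: "fst -` A \<in> sets (borel :: ('a \<times> 'a) measure)" "snd -` A \<in> sets (borel :: ('a \<times> 'a) measure)"
      using measurable_sets[OF borel_measurable_continuous_onI[OF continuous_on_fst[OF continuous_on_id]] A]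
        measurable_sets[OF borel_measurable_continuous_onI[OF continuous_on_snd[OF continuous_on_id]] A] by auto
    have \<Delta>A: "emeasure \<Delta> (fst -` A) = emeasure m A" "emeasure \<Delta> (snd -` A) = emeasure m A"
      unfolding \<Delta>_def using FA d(3) by (auto simp: emeasure_distr[OF dm] intro!: arg_cong[where f = "emeasure m"])
    have PA: "emeasure (m \<Otimes>\<^sub>M m') (fst -` A) = emeasure m A" "emeasure (m \<Otimes>\<^sub>M m') (snd -` A) = emeasure m' A"
    proof -
      have "fst -` A = A \<times> (UNIV :: 'a set)" "snd -` A = (UNIV :: 'a set) \<times> A" by auto
      then show "emeasure (m \<Otimes>\<^sub>M m') (fst -` A) = emeasure m A" "emeasure (m \<Otimes>\<^sub>M m') (snd -` A) = emeasure m' A"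
        using A d(2) d'(2) m.emeasure_space_1 m'.emeasure_space_1 by (simp_all add: m'.emeasure_pair_measure_Times d(3) d'(3))
    qed
    have "ennreal (1 - t) + ennreal t = 1" using t by (simp flip: ennreal_plus)
    then show "emeasure v (fst -` A) = emeasure m A"
      unfolding v_def by (simp add: emeasure_mix s\<Delta> sP FA \<Delta>A PA flip: distrib_right)
    show "emeasure v (snd -` A) = emeasure (mix t m m') A"
      unfolding v_def emeasure_mix[OF s\<Delta> sP FA(2)] emeasure_mix[OF d(2) d'(2) A] \<Delta>A PA ..
  qed
  have \<Delta>i: "integrable \<Delta> (\<lambda>z. (dist (fst z) (snd z))^2)" "(LINT z|(\<Delta>). (dist (fst z) (snd z))^2) = 0"
    unfolding \<Delta>_def using meas by (auto simp: integrable_distr_eq[OF dm] integral_distr[OF dm])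
  have "(W 2 m (mix t m m'))^2 <= (LINT z|v. (dist (fst z) (snd z))^2)" by (rule W_le_coupling(2)[OF g m(1) mix_P2[OF m t]])
  also have "... = (1 - t) * (LINT z|(\<Delta>). (dist (fst z) (snd z))^2) + t * (LINT z|(m \<Otimes>\<^sub>M m'). (dist (fst z) (snd z))^2)"
    unfolding v_def using integral_mix(2)[OF s\<Delta> sP t meas \<Delta>i(1) coupling_integrable(1)[OF c m]] .
  finally show ?thesis by (simp add: \<Delta>i)
qed

lemma W2_mix_less:
  assumes m: "m \<in> P2" "m' \<in> P2" and d: "0 < d"
  shows "\<exists>e>0. \<forall>t. 0 <= t \<and> t <= 1 \<and> t < e --> W 2 m (mix t m m') < d"
proof -
  define C where "C = (LINT z|(m \<Otimes>\<^sub>M m'). (dist (fst z) (snd z))^2)"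
  have C0: "0 <= C" by (simp add: C_def)
  show ?thesis
  proof (intro exI[of _ "d^2 / (C + 1)"] conjI allI impI)
    fix t assume t: "0 <= t \<and> t <= 1 \<and> t < d^2 / (C + 1)"
    then have "t * (C + 1) < d^2" using C0 by (simp add: pos_less_divide_eq)
    then have "t * C < d^2" using t by (simp add: distrib_left)
    then have "(W 2 m (mix t m m'))^2 < d^2" using W2_mix_le[OF m, of t] t by (simp add: C_def)
    then show "W 2 m (mix t m m') < d" using d by (auto dest: power_less_imp_less_base)
  qed (use d C0 in auto)
qed

text \<open>Continuity along a segment: a point to the right (left) of \<open>s\<close> is a mixture of the point at \<open>s\<close>
  with the right (left) endpoint.\<close>

lemma W2_mix_continuous:
  assumes m: "m \<in> P2" "m' \<in> P2" and s: "0 <= s" "s <= 1" and d: "0 < d"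
  shows "\<exists>e>0. \<forall>t. 0 <= t \<and> t <= 1 \<and> \<bar>t - s\<bar> < e --> W 2 (mix s m m') (mix t m m') < d"
proof -
  have right: "\<exists>e>0. \<forall>t. s <= t \<and> t <= 1 \<and> t - s < e --> W 2 (mix s m m') (mix t m m') < d"
    if m: "m \<in> P2" "m' \<in> P2" and s: "0 <= s" "s <= 1" for m m' :: "'a measure" and s
  proof -
    note b = P2_D(2)[OF m(1)] P2_D(2)[OF m(2)]
    have ms: "mix s m m' \<in> P2" by (rule mix_P2[OF m s])
    obtain e where e: "0 < e" "\<And>u. 0 <= u ==> u <= 1 ==> u < e ==> W 2 (mix s m m') (mix u (mix s m m') m') < d"
      using W2_mix_less[OF ms m(2) d] by blast
    show ?thesis
    proof (cases "s = 1")
      case True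
      have "W 2 (mix s m m') (mix 0 (mix s m m') m') < d" using e by simp
      then have "W 2 (mix s m m') (mix s m m') < d" using b by (simp add: mix_0)
      then show ?thesis using True by (intro exI[of _ 1]) (auto dest: antisym)
    next
      case False
      then have s1: "0 < 1 - s" using s by simp
      show ?thesis
      proof (intro exI[of _ "e * (1 - s)"] conjI allI impI)
        fix t assume t: "s <= t \<and> t <= 1 \<and> t - s < e * (1 - s)"
        \<comment> \<open>The weight with (1 - u) (1 - s) = 1 - t. Exchanging the endpoints twice
          turns the mixture of the point at s with the right endpoint into an iterated mixture to
          which \<open>mix_mix\<close> applies.\<close>
        define u where "u = (t - s) / (1 - s)"
        have u: "0 <= u" "u <= 1" "u < e" using t s1 by (auto simp: u_def divide_simps)
        have us: "u * (1 - s) = t - s" using s1 by (simp add: u_def)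
        have "mix u (mix s m m') m' = mix (1 - u) m' (mix (1 - s) m' m)"
          using mix_flip[of m' "mix s m m'" u] mix_flip[of m' m s] b by simp
        also have "... = mix ((1 - u) * (1 - s)) m' m" using u s b by (intro mix_mix) auto
        also have "(1 - u) * (1 - s) = 1 - t" using us by (simp add: algebra_simps)
        also have "mix (1 - t) m' m = mix t m m'" using mix_flip b by blast
        finally show "W 2 (mix s m m') (mix t m m') < d" using e(2)[OF u] by simp
      qed (use e s1 in simp)
    qed
  qed
  obtain e1 where e1: "0 < e1" "\<And>t. s <= t ==> t <= 1 ==> t - s < e1 ==> W 2 (mix s m m') (mix t m m') < d"
    using right[OF m s] by blast
  have "0 <= 1 - s" "1 - s <= 1" using s by auto
  from right[OF m(2,1) this] obtain e2 where e2: "0 < e2"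
    "\<And>t. 1 - s <= t ==> t <= 1 ==> t - (1 - s) < e2 ==> W 2 (mix (1 - s) m' m) (mix t m' m) < d" by blast
  show ?thesis
  proof (intro exI[of _ "min e1 e2"] conjI allI impI)
    fix t assume t: "0 <= t \<and> t <= 1 \<and> \<bar>t - s\<bar> < min e1 e2"
    show "W 2 (mix s m m') (mix t m m') < d"
    proof (cases "s <= t")
      case True
      then show ?thesis using e1(2)[of t] t by auto
    next
      case False
      then have "W 2 (mix (1 - s) m' m) (mix (1 - t) m' m) < d" using t by (intro e2) auto
      then show ?thesis using mix_flip[of m' m] P2_D(2)[OF m(1)] P2_D(2)[OF m(2)] by simp
    qed
  qed (use e1 e2 in auto)
qed

section \<open>Entropy of densities\<close>

text \<open>Convexity of a ln a in the form of a tangent at b. As \<open>ln 0 = 0\<close>, the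
  product 0 ln 0 has its usual value 0 and the case a = 0 reads -b <= 0.\<close>

lemma xlnx_ge_tangent:
  fixes a b :: real assumes "0 <= a" "0 < b"
  shows "a * ln b + a - b <= a * ln a"
proof (cases "a = 0")
  case False
  with assms have a: "0 < a" by simp
  have "ln (b / a) <= b / a - 1" using a assms by (intro ln_le_minus_one) auto
  then have "a * (ln b - ln a) <= a * (b / a - 1)" using a assms by (intro mult_left_mono) (auto simp: ln_div)
  then show ?thesis using a by (simp add: algebra_simps)
qed (use assms in auto)

text \<open>Strict convexity; it recovers a density from a vanishing relative entropy.\<close>

lemma xlnx_eq_tangent:
  fixes a b :: real assumes "0 <= a" "0 < b" "a * ln a <= a * ln b + a - b"
  shows "a = b"
proof -
  have a: "0 < a" using assms by (cases "a = 0") auto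
  have "a * (b / a - 1) <= a * ln (b / a)" using a assms by (simp add: ln_div algebra_simps)
  then have "b / a - 1 <= ln (b / a)" using a by simp
  then have "ln (b / a) = b / a - 1" using a assms by (intro antisym ln_le_minus_one) auto
  then have "b / a = 1" using a assms by (intro ln_eq_minus_one) auto
  then show ?thesis using a by simp
qed

lemma xlnx_convex:
  fixes a b :: real assumes "0 <= a" "0 <= b" "0 <= t" "t <= 1"
  shows "((1 - t) * a + t * b) * ln ((1 - t) * a + t * b) <= (1 - t) * (a * ln a) + t * (b * ln b)"
proof -
  define y where "y = (1 - t) * a + t * b"
  have y0: "0 <= y" unfolding y_def using assms by (intro add_nonneg_nonneg mult_nonneg_nonneg) auto
  have "y * ln y <= (1 - t) * (a * ln a) + t * (b * ln b)"
  proof (cases "y = 0")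
    case True
    then have "(1 - t) * a = 0" "t * b = 0" unfolding y_def using assms
      by (metis add_nonneg_eq_0_iff diff_ge_0_iff_ge mult_nonneg_nonneg)+
    then show ?thesis using True by auto
  next
    case False
    then have y: "0 < y" using y0 by simp
    have "(1 - t) * (a * ln y + a - y) + t * (b * ln y + b - y) <= (1 - t) * (a * ln a) + t * (b * ln b)"
      using assms y by (intro add_mono mult_left_mono xlnx_ge_tangent) auto
    moreover have "(1 - t) * (a * ln y + a - y) + t * (b * ln y + b - y) = y * ln y" by (simp add: y_def algebra_simps)
    ultimately show ?thesis by simp
  qed
  then show ?thesis by (simp add: y_def)
qed

lemma H_density:
  fixes g :: "'a::euclidean_space => real"
  assumes m: "m = density lborel (\<lambda>x. ennreal (g x))" and g[measurable]: "g \<in> borel_measurable borel" "\<And>x. 0 <= g x"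
  shows "H m = eintegral lborel (\<lambda>x. ereal (g x * ln (g x)))"
proof -
  have ac: "absolutely_continuous lborel m" unfolding m by (rule absolutely_continuousI_density) simp
  have "AE x in lborel. ennreal (g x) = RN_deriv lborel m x"
    using m by (intro sigma_finite_measure.RN_deriv_unique[OF lborel.sigma_finite_measure_axioms]) auto
  then have ae: "AE x in lborel. enn2ereal (RN_deriv lborel m x) * elog (RN_deriv lborel m x) = ereal (g x * ln (g x))"
  proof (rule eventually_mono)
    fix x assume "ennreal (g x) = RN_deriv lborel m x"
    then have "enn2ereal (RN_deriv lborel m x) * elog (RN_deriv lborel m x) = ereal (g x) * elog (ennreal (g x))"
      using g(2)[of x] by (simp flip: enn2ereal_ennreal)
    also have "... = ereal (g x * ln (g x))" using g(2)[of x] by (cases "g x = 0") (auto simp: elog_def ennreal_eq_0_iff)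
    finally show "enn2ereal (RN_deriv lborel m x) * elog (RN_deriv lborel m x) = ereal (g x * ln (g x))" .
  qed
  show ?thesis unfolding H_def if_P[OF ac] eintegral_def
    using ae by (intro arg_cong2[where f = "(-)"] arg_cong[where f = enn2ereal] nn_integral_cong_AE) auto
qed

lemma eintegral_real:
  assumes "integrable M f" shows "eintegral M (\<lambda>x. ereal (f x)) = ereal (LINT x|M. f x)"
proof -
  have "(\<integral>\<^sup>+ x. ennreal (f x) \<partial>M) \<noteq> \<infinity>" "(\<integral>\<^sup>+ x. ennreal (- f x) \<partial>M) \<noteq> \<infinity>" using assms by (auto simp: real_integrable_def)
  then obtain a b where ab: "(\<integral>\<^sup>+ x. ennreal (f x) \<partial>M) = ennreal a" "0 <= a"
    "(\<integral>\<^sup>+ x. ennreal (- f x) \<partial>M) = ennreal b" "0 <= b" by (metis ennreal_cases infinity_ennreal_def)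
  show ?thesis unfolding eintegral_def real_lebesgue_integral_def[OF assms] using ab by simp
qed

text \<open>The potential \<open>U\<close> provides the integrable lower bound of \<open>g log g\<close>.\<close>

lemma xlnx_integrable:
  fixes g U :: "'a::euclidean_space => real"
  assumes g[measurable]: "g \<in> borel_measurable borel" "\<And>x. 0 <= g x" "integrable lborel g" "integrable lborel (\<lambda>x. g x * U x)"
    and U: "integrable lborel (\<lambda>x. exp (- U x))"
  shows "(\<integral>\<^sup>+x. ennreal (- (g x * ln (g x))) \<partial>lborel) < \<infinity>"
    and "(\<integral>\<^sup>+x. ennreal (g x * ln (g x)) \<partial>lborel) < \<infinity> ==> integrable lborel (\<lambda>x. g x * ln (g x))"
    and "(\<And>x. g x * ln (g x) <= k x) ==> integrable lborel k ==> integrable lborel (\<lambda>x. g x * ln (g x))"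
proof -
  have i: "integrable lborel (\<lambda>x. g x * U x - g x + exp (- U x))" using g U by simp
  have le: "- (g x * ln (g x)) <= g x * U x - g x + exp (- U x)" for x
    using xlnx_ge_tangent[OF g(2)[of x], of "exp (- U x)"] by simp
  have "(\<integral>\<^sup>+x. ennreal (- (g x * ln (g x))) \<partial>lborel) <= (\<integral>\<^sup>+x. ennreal (g x * U x - g x + exp (- U x)) \<partial>lborel)"
    by (intro nn_integral_mono ennreal_leI le)
  also have "... < \<infinity>" using i by (auto simp: real_integrable_def less_top)
  finally show neg: "(\<integral>\<^sup>+x. ennreal (- (g x * ln (g x))) \<partial>lborel) < \<infinity>" .
  show *: "integrable lborel (\<lambda>x. g x * ln (g x))" if "(\<integral>\<^sup>+x. ennreal (g x * ln (g x)) \<partial>lborel) < \<infinity>"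
    using that neg by (auto simp: real_integrable_def)
  assume k: "\<And>x. g x * ln (g x) <= k x" "integrable lborel k"
  have "(\<integral>\<^sup>+x. ennreal (g x * ln (g x)) \<partial>lborel) <= (\<integral>\<^sup>+x. ennreal (k x) \<partial>lborel)" by (intro nn_integral_mono ennreal_leI k)
  also have "... < \<infinity>" using k by (auto simp: real_integrable_def less_top)
  finally show "integrable lborel (\<lambda>x. g x * ln (g x))" by (rule *)
qed

text \<open>The negative part of g ln g is integrable because U is m-integrable and exp(-U) is
  Lebesgue integrable. Finiteness of \<open>H\<close> then forces the positive part to be
  integrable, and the extended integral becomes an ordinary one.\<close>

lemma finite_H_density:
  fixes m :: "'a::euclidean_space measure" and U :: "'a => real"
  assumes m: "m \<in> P2" and H: "H m < \<infinity>"
    and U: "U \<in> borel_measurable borel" "integrable m U" "integrable lborel (\<lambda>x. exp (- U x))"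
  obtains g where "m = density lborel (\<lambda>x. ennreal (g x))" "g \<in> borel_measurable borel" "\<And>x. 0 <= g x"
    "integrable lborel (\<lambda>x. g x * ln (g x))" "H m = ereal (LINT x|lborel. g x * ln (g x))"
proof -
  note d = P2_D[OF m]
  interpret m: prob_space m by (rule d)
  have ac: "absolutely_continuous lborel m" using H by (auto simp: H_def split: if_splits)
  have fin: "AE x in lborel. RN_deriv lborel m x \<noteq> \<infinity>"
    by (rule sigma_finite_measure.RN_deriv_finite[OF lborel.sigma_finite_measure_axioms _ ac]) (use d m.sigma_finite_measure_axioms in auto)
  define g where "g x = enn2real (RN_deriv lborel m x)" for x
  have gm[measurable]: "g \<in> borel_measurable borel" unfolding g_def[abs_def] using borel_measurable_RN_deriv[of lborel m] by simp
  have "m = density lborel (RN_deriv lborel m)" using sigma_finite_measure.density_RN_deriv[OF lborel.sigma_finite_measure_axioms ac] d by simp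
  also have "... = density lborel (\<lambda>x. ennreal (g x))" using fin by (intro density_cong) (auto simp: g_def less_top)
  finally have mg: "m = density lborel (\<lambda>x. ennreal (g x))" .
  have g0: "0 <= g x" for x by (simp add: g_def)
  have gi: "integrable lborel g" using m.integrable_const[of "1 :: real"] unfolding mg
    by (subst (asm) integrable_density) (auto simp: g0)
  have gU: "integrable lborel (\<lambda>x. g x * U x)" using U(1,2) unfolding mg by (subst (asm) integrable_density) (auto simp: g0)
  note x = xlnx_integrable[OF gm g0 gi gU U(3)]
  have Hm: "H m = eintegral lborel (\<lambda>x. ereal (g x * ln (g x)))" by (rule H_density[OF mg gm g0])
  have "(\<integral>\<^sup>+x. ennreal (g x * ln (g x)) \<partial>lborel) < \<infinity>"
  proof (rule ccontr)
    assume "\<not> ?thesis"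
    then have "(\<integral>\<^sup>+x. ennreal (g x * ln (g x)) \<partial>lborel) = \<infinity>" by (metis less_top infinity_ennreal_def)
    moreover obtain b where "(\<integral>\<^sup>+x. ennreal (- (g x * ln (g x))) \<partial>lborel) = ennreal b" "0 <= b"
      using x(1) by (auto simp: less_top_ennreal)
    ultimately have "H m = \<infinity>" unfolding Hm eintegral_def by simp
    then show False using H by simp
  qed
  then have i: "integrable lborel (\<lambda>x. g x * ln (g x))" by (rule x(2))
  show ?thesis by (rule that[OF mg gm g0 i]) (simp add: Hm eintegral_real[OF i])
qed


section \<open>First variation of F along segments\<close>

lemma lfd_growth_mix:
  assumes lfd: "linear_functional_derivative F dF" and m: "m \<in> P2" "m' \<in> P2"
  obtains C where "\<And>s x. 0 <= s ==> s <= 1 ==> \<bar>dF (mix s m m') x\<bar> <= C * (1 + (norm x)^2)"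
proof -
  define C0 where "C0 = (LINT z|(m \<Otimes>\<^sub>M m'). (dist (fst z) (snd z))^2)"
  have C0: "0 <= C0" by (simp add: C0_def)
  have W: "W 2 m (mix s m m') <= sqrt C0" if "0 <= s" "s <= 1" for s
  proof (rule real_le_rsqrt)
    have "s * C0 <= 1 * C0" using that C0 by (intro mult_right_mono)
    then show "(W 2 m (mix s m m'))^2 <= C0" using W2_mix_le[OF m that] by (simp add: C0_def)
  qed
  obtain C where C: "\<forall>n\<in>P2. W 2 m n <= sqrt C0 --> (\<forall>x. \<bar>dF n x\<bar> <= C * (1 + (norm x)^2))"
    using lfd m(1) unfolding linear_functional_derivative_def by meson
  show ?thesis by (rule that[of C]) (use C W mix_P2[OF m] in blast)
qed

text \<open>Joint continuity gives the pointwise limit, and quadratic growth, uniform on the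
  W2-bounded segment, gives the dominating function.\<close>

lemma lfd_integral_continuous:
  fixes dF :: "'a::euclidean_space measure => 'a => real"
  assumes lfd: "linear_functional_derivative F dF" and cont: "\<And>m. m \<in> P2 ==> continuous_on UNIV (dF m)"
    and m: "m \<in> P2" "m' \<in> P2" and n: "n \<in> P2"
  shows "continuous_on {0..1} (\<lambda>s. LINT x|n. dF (mix s m m') x)"
proof (rule continuous_on_sequentiallyI)
  fix u :: "nat => real" and a assume u: "\<forall>n. u n \<in> {0..1}" and a: "a \<in> {0..1}" and lim: "u \<longlonglongrightarrow> a"
  obtain C where C: "\<And>s x. 0 <= s ==> s <= 1 ==> \<bar>dF (mix s m m') x\<bar> <= C * (1 + (norm x)^2)" using lfd_growth_mix[OF lfd m] by blast
  have P: "mix s m m' \<in> P2" if "s \<in> {0..1}" for s using mix_P2[OF m] that by simp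
  have meas: "dF (mix s m m') \<in> borel_measurable n" if "s \<in> {0..1}" for s
    using borel_measurable_continuous_onI[OF cont[OF P[OF that]]] measurable_cong_sets[OF P2_D(2)[OF n] refl] by blast
  show "(\<lambda>k. LINT x|n. dF (mix (u k) m m') x) \<longlonglongrightarrow> (LINT x|n. dF (mix a m m') x)"
  proof (rule integral_dominated_convergence[where w = "\<lambda>x. C * (1 + (norm x)^2)"])
    show "integrable n (\<lambda>x. C * (1 + (norm x)^2))" using P2_D(4,6)[OF n] by simp
    show "dF (mix a m m') \<in> borel_measurable n" "\<And>k. dF (mix (u k) m m') \<in> borel_measurable n" using meas a u by auto
    show "AE x in n. norm (dF (mix (u k) m m') x) <= C * (1 + (norm x)^2)" for k using C u by (intro AE_I2) auto
    show "AE x in n. (\<lambda>k. dF (mix (u k) m m') x) \<longlonglongrightarrow> dF (mix a m m') x"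
    proof (intro AE_I2 LIMSEQ_I)
      fix x and e :: real assume "0 < e"
      then obtain d where d: "0 < d" "\<And>m'' x'. m'' \<in> P2 ==> W 2 (mix a m m') m'' < d ==> dist x x' < d ==>
          \<bar>dF m'' x' - dF (mix a m m') x\<bar> < e" using lfd P[OF a] unfolding linear_functional_derivative_def by meson
      obtain c where c: "0 < c" "\<And>t. 0 <= t ==> t <= 1 ==> \<bar>t - a\<bar> < c ==> W 2 (mix a m m') (mix t m m') < d"
        using W2_mix_continuous[OF m, of a d] a d(1) by auto
      obtain N where N: "\<And>k. N <= k ==> \<bar>u k - a\<bar> < c" using LIMSEQ_D[OF lim c(1)] by auto
      have "norm (dF (mix (u k) m m') x - dF (mix a m m') x) < e" if k: "N <= k" for k
      proof -
        have "W 2 (mix a m m') (mix (u k) m m') < d" using u N[OF k] by (intro c) auto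
        then show ?thesis using d(2)[of "mix (u k) m m'" x] P u d(1) by simp
      qed
      then show "\<exists>N. \<forall>k\<ge>N. norm (dF (mix (u k) m m') x - dF (mix a m m') x) < e" by blast
    qed
  qed
qed

text \<open>Let J(s) be the integral of dF at the point s of the segment against m' - m. The
  defining identity, applied between m and the point t, becomes F(m_t) - F(m) = t times the integral
  of J(z t) over z in [0, 1], since the shorter segment is a rescaled one and m_t - m = t (m' - m).
  Continuity of J at 0 concludes.\<close>

lemma lfd_upper_derivative:
  fixes dF :: "'a::euclidean_space measure => 'a => real"
  assumes lfd: "linear_functional_derivative F dF" and cont: "\<And>m. m \<in> P2 ==> continuous_on UNIV (dF m)"
    and m: "m \<in> P2" "m' \<in> P2" and e: "0 < e"
  shows "\<exists>t. 0 < t \<and> t <= 1 \<and> F (mix t m m') - F m <= t * ((LINT x|m'. dF m x) - (LINT x|m. dF m x) + e)"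
proof -
  define J where "J s = (LINT x|m'. dF (mix s m m') x) - (LINT x|m. dF (mix s m m') x)" for s
  note b = P2_D(2)[OF m(1)] P2_D(2)[OF m(2)]
  have Jc: "continuous_on {0..1} J" unfolding J_def using lfd_integral_continuous[OF lfd cont m] m by (intro continuous_intros)
  then obtain d where d: "0 < d" "\<And>s. s \<in> {0..1} ==> dist s 0 < d ==> dist (J s) (J 0) < e"
    unfolding continuous_on_iff using e by (metis atLeastAtMost_iff order_refl zero_le_one)
  define t where "t = min 1 (d / 2)"
  have t: "0 < t" "t <= 1" "t < d" using d(1) by (auto simp: t_def)
  have n: "mix t m m' \<in> P2" using mix_P2[OF m] t by simp
  obtain C where C: "\<And>s x. 0 <= s ==> s <= 1 ==> \<bar>dF (mix s m m') x\<bar> <= C * (1 + (norm x)^2)" using lfd_growth_mix[OF lfd m] by blast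
  have inner: "(LINT x|(mix t m m'). dF (mix z m (mix t m m')) x) - (LINT x|m. dF (mix z m (mix t m m')) x) = t * J (z * t)"
    if z: "z \<in> {0..1}" for z
  proof -
    have zt: "0 <= z * t" "z * t <= 1" using z t by (auto simp: mult_le_one)
    have eq: "mix z m (mix t m m') = mix (z * t) m m'" using z t b by (intro mix_mix) auto
    have meas: "dF (mix (z * t) m m') \<in> borel_measurable borel"
      by (rule borel_measurable_continuous_onI[OF cont[OF mix_P2[OF m zt]]])
    have i: "integrable m (dF (mix (z * t) m m'))" "integrable m' (dF (mix (z * t) m m'))"
      using P2_integrable_quadratic[OF _ meas C[OF zt]] m by auto
    show ?thesis unfolding eq using integral_mix(2)[OF b _ _ meas i, of t] t by (simp add: J_def algebra_simps)
  qed
  have range: "z * t \<in> {0..1}" "dist (z * t) 0 < d" if "z \<in> {0..1}" for z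
  proof -
    have "z * t <= 1 * t" using that t by (intro mult_right_mono) auto
    then have le: "z * t <= t" by simp
    have ge: "0 <= z * t" using that t by simp
    show "z * t \<in> {0..1}" unfolding atLeastAtMost_iff using le ge t by linarith
    show "dist (z * t) 0 < d" unfolding dist_real_def using le ge t by linarith
  qed
  have "F (mix t m m') - F m = (LBINT z:{0..1}. t * J (z * t))" using lfd m(1) n inner unfolding linear_functional_derivative_def
    by (subst set_lebesgue_integral_cong[where g = "\<lambda>z. (LINT x|(mix t m m'). dF (mix z m (mix t m m')) x) -
        (LINT x|m. dF (mix z m (mix t m m')) x)"]) auto
  also have "... <= (LBINT z:{0..1::real}. t * (J 0 + e))"
  proof (rule set_integral_mono)
    have "continuous_on {0..1} (\<lambda>z. t * J (z * t))"
      by (intro continuous_intros continuous_on_compose2[OF Jc]) (use range(1) in auto)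
    then show "set_integrable lborel {0..1} (\<lambda>z. t * J (z * t))" by (rule borel_integrable_atLeastAtMost')
    show "set_integrable lborel {0..1::real} (\<lambda>z. t * (J 0 + e))" by (rule borel_integrable_atLeastAtMost') simp
    fix z :: real assume z: "z \<in> {0..1}"
    have "J (z * t) <= J 0 + e" using d(2)[OF range(1)[OF z] range(2)[OF z]] unfolding dist_real_def by linarith
    then show "t * J (z * t) <= t * (J 0 + e)" using t by simp
  qed
  also have "... = t * (J 0 + e)" by (simp add: set_lebesgue_integral_def)
  finally show ?thesis using t b by (intro exI[of _ t]) (simp add: J_def mix_0)
qed


section \<open>The minimizer is a Gibbs measure\<close>

lemma real_densityD:
  fixes g :: "'a::euclidean_space => real"
  assumes m: "prob_space m" "m = density lborel (\<lambda>x. ennreal (g x))" and g[measurable]: "g \<in> borel_measurable borel" "\<And>x. 0 <= g x"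
  shows "integrable lborel g" "(LINT x|lborel. g x) = 1"
    "f \<in> borel_measurable borel ==> integrable m f = integrable lborel (\<lambda>x. g x * f x)"
    "f \<in> borel_measurable borel ==> (LINT x|m. f x) = (LINT x|lborel. g x * (f x :: real))"
proof -
  interpret m: prob_space m by fact
  have i1: "integrable m (\<lambda>x. 1 :: real)" "(LINT x|m. 1) = (1 :: real)" using m.prob_space by auto
  show "integrable lborel g" using i1(1) unfolding m(2) by (subst (asm) integrable_density) (auto simp: g)
  show "(LINT x|lborel. g x) = 1" using i1(2) unfolding m(2) by (subst (asm) integral_density) (auto simp: g)
  show "f \<in> borel_measurable borel ==> integrable m f = integrable lborel (\<lambda>x. g x * f x)"
    unfolding m(2) by (subst integrable_density) (auto simp: g)
  show "f \<in> borel_measurable borel ==> (LINT x|m. f x) = (LINT x|lborel. g x * f x)"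
    unfolding m(2) by (subst integral_density) (auto simp: g)
qed

lemma exp_integral_pos:
  fixes U :: "'a::euclidean_space => real"
  assumes "integrable lborel (\<lambda>x. exp (- U x))" "continuous_on UNIV U" "0 < R"
  shows "0 < (LINT x|lborel. indicator (ball 0 R) x * exp (- U x))" "0 < (LINT x|lborel. exp (- U x))"
proof -
  have i: "integrable lborel (\<lambda>x. indicator (ball 0 R) x * exp (- U x))"
    using integrable_mult_indicator[OF _ assms(1), of "ball 0 R"] by simp
  have "(LINT x|lborel. indicator (ball 0 R) x * exp (- U x)) \<noteq> 0"
  proof
    assume "(LINT x|lborel. indicator (ball 0 R) x * exp (- U x)) = 0"
    then have "AE x in lborel. indicator (ball 0 R) x * exp (- U x) = 0" using i by (subst (asm) integral_nonneg_eq_0_iff_AE) auto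
    then have "AE x in lborel. x \<notin> ball (0 :: 'a) R" by (auto simp: indicator_def split: if_splits elim!: eventually_mono)
    then have "ball (0 :: 'a) R \<in> null_sets lborel" by (subst AE_iff_null_sets) auto
    then have "negligible (ball (0 :: 'a) R)" by (simp add: negligible_iff_null_sets null_sets_completionI)
    then show False using open_not_negligible[of "ball (0 :: 'a) R"] assms(3) by auto
  qed
  moreover have "0 <= (LINT x|lborel. indicator (ball 0 R) x * exp (- U x))" by simp
  ultimately show pos: "0 < (LINT x|lborel. indicator (ball 0 R) x * exp (- U x))" by linarith
  also have "... <= (LINT x|lborel. exp (- U x))" using i assms(1) by (intro integral_mono) (auto simp: indicator_def)
  finally show "0 < (LINT x|lborel. exp (- U x))" .
qed

text \<open>The test measure conditioned to a ball has compact support, hence lies in P2 without any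
  moment bound on the Gibbs measure itself.\<close>

lemma conditioned_gibbs:
  fixes U :: "'a::euclidean_space => real"
  assumes i: "integrable lborel (\<lambda>x. exp (- U x))" and c: "continuous_on UNIV U" and R: "0 < R"
  defines "Z \<equiv> (LINT x|lborel. indicator (ball 0 R) x * exp (- U x))"
  defines "h \<equiv> \<lambda>x. indicator (ball 0 R) x * exp (- U x) / Z"
  shows "density lborel (\<lambda>x. ennreal (h x)) \<in> P2" "h \<in> borel_measurable borel" "\<And>x. 0 <= h x"
    "integrable lborel (\<lambda>x. h x * ln (h x))"
    "(LINT x|(density lborel (\<lambda>x. ennreal (h x))). U x) + (LINT x|lborel. h x * ln (h x)) = - ln Z"
proof -
  have Z: "0 < Z" unfolding Z_def by (rule exp_integral_pos[OF i c R])
  have [measurable]: "U \<in> borel_measurable borel" by (rule borel_measurable_continuous_onI[OF c])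
  show hm[measurable]: "h \<in> borel_measurable borel" unfolding h_def
    by (intro borel_measurable_divide borel_measurable_times borel_measurable_indicator borel_measurable_const
        borel_measurable_continuous_onI continuous_intros c) auto
  show h0: "0 <= h x" for x using Z by (auto simp: h_def indicator_def)
  have "integrable lborel (\<lambda>x. indicator (ball 0 R) x * exp (- U x))"
    using integrable_mult_indicator[OF _ i, of "ball 0 R"] by simp
  then have hi: "integrable lborel h" unfolding h_def by simp
  have h1: "(LINT x|lborel. h x) = 1" using Z by (simp add: h_def flip: Z_def)
  let ?n = "density lborel (\<lambda>x. ennreal (h x))"
  have pn: "prob_space ?n"
  proof (rule prob_spaceI)
    have "emeasure ?n (space ?n) = (\<integral>\<^sup>+x. ennreal (h x) \<partial>lborel)" by (simp add: emeasure_density)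
    also have "... = 1" using nn_integral_eq_integral[OF hi] h0 h1 by simp
    finally show "emeasure ?n (space ?n) = 1" .
  qed
  obtain K where K: "\<forall>x\<in>cball 0 R. \<bar>U x\<bar> <= K"
    using compact_imp_bounded[OF compact_continuous_image[OF continuous_on_subset[OF c subset_UNIV] compact_cball[of 0 R]]]
    by (auto simp: bounded_iff)
  have bdd: "integrable lborel (\<lambda>x. h x * f x)"
    if "f \<in> borel_measurable borel" "\<And>x. x \<in> cball 0 R ==> \<bar>f x\<bar> <= B" for f and B :: real
  proof (rule Bochner_Integration.integrable_bound[where f = "\<lambda>x. B * h x"])
    show "integrable lborel (\<lambda>x. B * h x)" using hi by simp
    show "(\<lambda>x. h x * f x) \<in> borel_measurable lborel" using that(1) by simp
    show "AE x in lborel. norm (h x * f x) <= norm (B * h x)"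
    proof (intro AE_I2)
      fix x
      show "norm (h x * f x) <= norm (B * h x)"
      proof (cases "x \<in> cball 0 R")
        case True
        then have "\<bar>f x\<bar> <= \<bar>B\<bar>" using that(2)[of x] by linarith
        then show ?thesis using h0[of x] mult_right_mono[of "\<bar>f x\<bar>" "\<bar>B\<bar>" "h x"] by (simp add: abs_mult mult.commute)
      next
        case False
        then show ?thesis by (simp add: h_def)
      qed
    qed
  qed
  have "integrable lborel (\<lambda>x. h x * (norm x)^2)" by (rule bdd[where B = "R^2"]) (auto intro: power_mono)
  then show "?n \<in> P2" unfolding P2_def using pn real_densityD(3)[OF pn refl hm h0, of "\<lambda>x. (norm x)^2"] by simp
  have lnh: "h x * ln (h x) = h x * (- U x - ln Z)" for x using Z by (cases "x \<in> ball 0 R") (auto simp: h_def ln_div)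
  have iU: "integrable lborel (\<lambda>x. h x * U x)" by (rule bdd[where B = K]) (use K in auto)
  show "integrable lborel (\<lambda>x. h x * ln (h x))" unfolding lnh using iU hi by (simp add: right_diff_distrib)
  show "(LINT x|(?n). U x) + (LINT x|lborel. h x * ln (h x)) = - ln Z"
    unfolding lnh using iU hi h1 real_densityD(4)[OF pn refl hm h0, of U] by (simp add: right_diff_distrib)
qed

text \<open>Convexity of a ln a integrated over space; \<open>U\<close> guarantees that the entropy
  of the mixture is an honest integral.\<close>

lemma H_mix_le:
  fixes g h U :: "'a::euclidean_space => real"
  assumes P: "m \<in> P2" "n \<in> P2"
    and g: "m = density lborel (\<lambda>x. ennreal (g x))" "g \<in> borel_measurable borel" "\<And>x. 0 <= g x" "integrable lborel (\<lambda>x. g x * ln (g x))"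
    and h: "n = density lborel (\<lambda>x. ennreal (h x))" "h \<in> borel_measurable borel" "\<And>x. 0 <= h x" "integrable lborel (\<lambda>x. h x * ln (h x))"
    and U: "U \<in> borel_measurable borel" "integrable m U" "integrable n U" "integrable lborel (\<lambda>x. exp (- U x))"
    and t: "0 <= t" "t <= 1"
  shows "H (mix t m n) <= ereal ((1 - t) * (LINT x|lborel. g x * ln (g x)) + t * (LINT x|lborel. h x * ln (h x)))"
proof -
  note [measurable] = g(2) h(2)
  define f where "f x = (1 - t) * g x + t * h x" for x
  have f[measurable]: "f \<in> borel_measurable borel" unfolding f_def by measurable
  have f0: "0 <= f x" for x using g(3)[of x] h(3)[of x] t by (simp add: f_def)
  have mf: "mix t m n = density lborel (\<lambda>x. ennreal (f x))"
  proof (rule measure_eqI)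
    fix A assume "A \<in> sets (mix t m n)"
    then have A[measurable]: "A \<in> sets borel" by simp
    have "ennreal (f x) * indicator A x = ennreal (1 - t) * (ennreal (g x) * indicator A x) + ennreal t * (ennreal (h x) * indicator A x)" for x
      using t g(3)[of x] h(3)[of x] by (simp add: f_def ennreal_mult distrib_right mult.assoc)
    then show "emeasure (mix t m n) A = emeasure (density lborel (\<lambda>x. ennreal (f x))) A" using P2_D(2)[OF P(1)] P2_D(2)[OF P(2)]
      by (simp add: emeasure_mix) (simp add: g(1) h(1) emeasure_density nn_integral_add nn_integral_cmult)
  qed simp
  have pm: "prob_space (mix t m n)" using P2_D(1)[OF mix_P2[OF P t]] .
  have "integrable (mix t m n) U" using integral_mix(1)[OF P2_D(2)[OF P(1)] P2_D(2)[OF P(2)] t U(1-3)] .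
  then have fU: "integrable lborel (\<lambda>x. f x * U x)" using real_densityD(3)[OF pm mf f f0 U(1)] by simp
  have le: "f x * ln (f x) <= (1 - t) * (g x * ln (g x)) + t * (h x * ln (h x))" for x
    unfolding f_def by (rule xlnx_convex[OF g(3) h(3) t])
  have i: "integrable lborel (\<lambda>x. (1 - t) * (g x * ln (g x)) + t * (h x * ln (h x)))" using g(4) h(4) by simp
  have fi: "integrable lborel (\<lambda>x. f x * ln (f x))"
    by (rule xlnx_integrable(3)[OF f f0 real_densityD(1)[OF pm mf f f0] fU U(4) le i])
  have "H (mix t m n) = ereal (LINT x|lborel. f x * ln (f x))" unfolding H_density[OF mf f f0] by (rule eintegral_real[OF fi])
  also have "(LINT x|lborel. f x * ln (f x)) <= (LINT x|lborel. (1 - t) * (g x * ln (g x)) + t * (h x * ln (h x)))"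
    by (rule integral_mono[OF fi i le])
  also have "... = (1 - t) * (LINT x|lborel. g x * ln (g x)) + t * (LINT x|lborel. h x * ln (h x))" using g(4) h(4) by simp
  finally show ?thesis by simp
qed

text \<open>First-order optimality at m in the direction of the Gibbs measure conditioned to a ball
  of radius R bounds E = int U dm + H(m) by the same quantity for that measure, which is -ln Z_R.
  With R to infinity, E + ln Z0 <= 0. But E + ln Z0 is the relative entropy of m with respect to the
  Gibbs measure, so it vanishes and the densities agree.\<close>

lemma minimizer_eq_hat:
  fixes dF :: "'a::euclidean_space measure => 'a => real"
  assumes lfd: "linear_functional_derivative F dF" and cont: "\<And>m. m \<in> P2 ==> continuous_on UNIV (dF m)"
    and min: "free_energy_minimizer F m" and i: "integrable lborel (\<lambda>x. exp (- dF m x))"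
  shows "m = hat dF m"
proof -
  define U where "U = dF m"
  have m: "m \<in> P2" and minE: "\<And>n. n \<in> P2 ==> free_energy F m <= free_energy F n"
    using min by (auto simp: free_energy_minimizer_def)
  have Uc: "continuous_on UNIV U" unfolding U_def by (rule cont[OF m])
  have Um[measurable]: "U \<in> borel_measurable borel" by (rule borel_measurable_continuous_onI[OF Uc])
  have Ui: "integrable lborel (\<lambda>x. exp (- U x))" using i by (simp add: U_def)
  obtain C where C: "\<And>s x. 0 <= s ==> s <= 1 ==> \<bar>dF (mix s m m) x\<bar> <= C * (1 + (norm x)^2)"
    using lfd_growth_mix[OF lfd m m] by blast
  have UC: "\<bar>U x\<bar> <= C * (1 + (norm x)^2)" for x using C[of 0 x] P2_D(2)[OF m] by (simp add: mix_0 U_def)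
  have UP: "integrable n U" if "n \<in> P2" for n using P2_integrable_quadratic[OF that Um UC] .
  define Z where "Z R = (LINT x|lborel. indicator (ball 0 R) x * exp (- U x))" for R
  define h where "h R x = indicator (ball 0 R) x * exp (- U x) / Z R" for R x
  define n where "n R = density lborel (\<lambda>x. ennreal (h R x))" for R
  have hR: "n R \<in> P2" "h R \<in> borel_measurable borel" "0 <= h R x" "integrable lborel (\<lambda>x. h R x * ln (h R x))"
    "(LINT x|(n R). U x) + (LINT x|lborel. h R x * ln (h R x)) = - ln (Z R)" if "0 < R" for R x
    unfolding n_def h_def Z_def using conditioned_gibbs[OF Ui Uc that] by auto
  have Hn: "H (n R) = ereal (LINT x|lborel. h R x * ln (h R x))" if "0 < R" for R
    using H_density[OF n_def hR(2,3)[OF that]] eintegral_real[OF hR(4)[OF that]] by simp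
  have "free_energy F m <= free_energy F (n 1)" by (rule minE[OF hR(1)]) simp
  also have "... < \<infinity>" by (simp add: free_energy_def Hn)
  finally have "H m < \<infinity>" by (auto simp: free_energy_def)
  then obtain g where g: "m = density lborel (\<lambda>x. ennreal (g x))" "g \<in> borel_measurable borel" "\<And>x. 0 <= g x"
    "integrable lborel (\<lambda>x. g x * ln (g x))" "H m = ereal (LINT x|lborel. g x * ln (g x))"
    using finite_H_density[OF m _ Um UP[OF m] Ui] by blast
  note [measurable] = g(2)
  have gP: "integrable lborel g" "(LINT x|lborel. g x) = 1" "integrable lborel (\<lambda>x. g x * U x)"
    "(LINT x|m. U x) = (LINT x|lborel. g x * U x)" using real_densityD[OF P2_D(1)[OF m] g(1-3)] UP[OF m] by auto
  define E where "E = (LINT x|m. U x) + (LINT x|lborel. g x * ln (g x))"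
  have E_le: "E <= - ln (Z R)" if R: "0 < R" for R
  proof (rule field_le_epsilon)
    fix e :: real assume "0 < e"
    then obtain t where t: "0 < t" "t <= 1"
      "F (mix t m (n R)) - F m <= t * ((LINT x|(n R). U x) - (LINT x|m. U x) + e)"
      using lfd_upper_derivative[OF lfd cont m hR(1)[OF R]] by (auto simp: U_def)
    have "ereal (F m + (LINT x|lborel. g x * ln (g x))) = free_energy F m" by (simp add: free_energy_def g(5))
    also have "... <= free_energy F (mix t m (n R))" using mix_P2[OF m hR(1)[OF R]] t by (intro minE) auto
    also have "... <= ereal (F (mix t m (n R))) +
        ereal ((1 - t) * (LINT x|lborel. g x * ln (g x)) + t * (LINT x|lborel. h R x * ln (h R x)))"
      unfolding free_energy_def using t
      by (intro add_left_mono H_mix_le[OF m hR(1)[OF R] g(1-4) n_def hR(2-4)[OF R] Um UP[OF m] UP[OF hR(1)[OF R]] Ui]) auto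
    finally have "F m + (LINT x|lborel. g x * ln (g x)) <= F (mix t m (n R)) +
        ((1 - t) * (LINT x|lborel. g x * ln (g x)) + t * (LINT x|lborel. h R x * ln (h R x)))" by simp
    with t(3) have "0 <= t * (((LINT x|(n R). U x) + (LINT x|lborel. h R x * ln (h R x))) - E + e)"
      by (simp add: E_def algebra_simps)
    then have "0 <= - ln (Z R) - E + e" unfolding hR(5)[OF R] using t(1) by (simp add: zero_le_mult_iff)
    then show "E <= - ln (Z R) + e" by simp
  qed
  define Z0 where "Z0 = (LINT x|lborel. exp (- U x))"
  have Z0: "0 < Z0" unfolding Z0_def using exp_integral_pos(2)[OF Ui Uc, of 1] by simp
  have "(\<lambda>k. Z (real (Suc k))) \<longlonglongrightarrow> Z0" unfolding Z_def Z0_def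
  proof (rule integral_dominated_convergence[where w = "\<lambda>x. exp (- U x)"])
    show "AE x in lborel. (\<lambda>k. indicator (ball 0 (real (Suc k))) x * exp (- U x)) \<longlonglongrightarrow> exp (- U x)"
    proof (intro AE_I2 tendsto_eventually)
      fix x :: 'a
      obtain N :: nat where "norm x < real N" using reals_Archimedean2 by blast
      then show "\<forall>\<^sub>F k in sequentially. indicator (ball 0 (real (Suc k))) x * exp (- U x) = exp (- U x)"
        by (intro eventually_sequentiallyI[of N]) auto
    qed
  qed (use Ui in \<open>auto simp: indicator_def\<close>)
  then have "(\<lambda>k. - ln (Z (real (Suc k)))) \<longlonglongrightarrow> - ln Z0" using Z0 by (intro tendsto_intros) auto
  then have E_le0: "E <= - ln Z0" by (rule LIMSEQ_le_const) (use E_le in \<open>auto intro!: exI[of _ 0]\<close>)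
  define k where "k x = exp (- U x) / Z0" for x
  have k: "0 < k x" "ln (k x) = - U x - ln Z0" for x using Z0 by (auto simp: k_def ln_div)
  have ki: "integrable lborel k" "(LINT x|lborel. k x) = 1" using Ui Z0 by (auto simp: k_def[abs_def] simp flip: Z0_def)
  \<comment> \<open>The integrand of the relative entropy with the correction k - g, whose integral
    is 0 and which makes the integrand nonnegative at every point.\<close>
  define X where "X x = g x * ln (g x) - (g x * ln (k x) + g x - k x)" for x
  have X0: "0 <= X x" for x using xlnx_ge_tangent[OF g(3)[of x] k(1)[of x]] by (simp add: X_def)
  have X': "X x = g x * ln (g x) + g x * U x + ln Z0 * g x - g x + k x" for x by (simp add: X_def k algebra_simps)
  have Xi: "integrable lborel X" unfolding X'[abs_def] using g(4) gP ki by simp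
  have "(LINT x|lborel. X x) = E + ln Z0" unfolding X' using g(4) gP ki by (simp add: E_def)
  moreover have "0 <= (LINT x|lborel. X x)" using X0 by simp
  ultimately have "(LINT x|lborel. X x) = 0" using E_le0 by linarith
  then have "AE x in lborel. X x = 0" using Xi X0 by (subst (asm) integral_nonneg_eq_0_iff_AE) auto
  then have "AE x in lborel. g x = k x"
  proof (rule eventually_mono)
    fix x assume "X x = 0"
    then show "g x = k x" by (intro xlnx_eq_tangent[OF g(3) k(1)]) (simp add: X_def)
  qed
  then have "m = density lborel (\<lambda>x. ennreal (k x))" unfolding g(1)
    by (intro density_cong) (auto simp: k_def[abs_def] elim!: eventually_mono)
  then show ?thesis by (simp add: hat_def k_def Z0_def U_def)
qed

section \<open>Logarithmic norms under Euler steps\<close>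

lemma taylor_second_derivative_bound:
  fixes f :: "real => real"
  assumes f: "\<And>z. z \<in> {a..b} ==> (f has_real_derivative f' z) (at z)"
    and f': "\<And>z. z \<in> {a..b} ==> (f' has_real_derivative f'' z) (at z)"
    and M: "\<And>z. z \<in> {a..b} ==> \<bar>f'' z\<bar> <= M" and xy: "x \<in> {a..b}" "y \<in> {a..b}"
  shows "\<bar>f y - f x - f' x * (y - x)\<bar> <= M * (y - x)^2"
proof -
  have M0: "0 <= M" using M[OF xy(1)] by linarith
  have seg: "closed_segment x y \<subseteq> {a..b}" using xy by (auto simp: closed_segment_eq_real_ivl split: if_splits)
  have L: "\<bar>f' z - f' x\<bar> <= M * \<bar>y - x\<bar>" if z: "z \<in> closed_segment x y" for z
  proof -
    have "norm (f' z - f' x) <= M * norm (z - x)" by (rule field_differentiable_bound[where S = "{a..b}" and f' = f''])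
        (use f' M xy z seg in \<open>auto intro: has_field_derivative_at_within\<close>)
    also have "... <= M * \<bar>y - x\<bar>" using z M0 by (intro mult_left_mono) (auto simp: closed_segment_eq_real_ivl split: if_splits)
    finally show ?thesis by simp
  qed
  have "norm ((f y - f' x * y) - (f x - f' x * x)) <= (M * \<bar>y - x\<bar>) * norm (y - x)"
  proof (rule field_differentiable_bound[where S = "closed_segment x y" and f' = "\<lambda>z. f' z - f' x"])
    fix z assume z: "z \<in> closed_segment x y"
    then have "(f has_real_derivative f' z) (at z)" using f seg by blast
    then have "((\<lambda>z. f z - f' x * z) has_real_derivative f' z - f' x) (at z)" by (auto intro!: derivative_eq_intros)
    then show "((\<lambda>z. f z - f' x * z) has_real_derivative f' z - f' x) (at z within closed_segment x y)"
      by (rule has_field_derivative_at_within)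
    show "norm (f' z - f' x) <= M * \<bar>y - x\<bar>" using L[OF z] by simp
  qed auto
  then show ?thesis by (simp add: algebra_simps power2_eq_square abs_mult_self_eq)
qed

lemma powr_bounds:
  fixes x :: real assumes "0 < x" "\<bar>ln x\<bar> <= L" "\<bar>p\<bar> <= P"
  shows "exp (- (P * L)) <= x powr p" "x powr p <= exp (P * L)"
proof -
  have "\<bar>p * ln x\<bar> <= P * L" unfolding abs_mult using assms by (intro mult_mono) auto
  then show "exp (- (P * L)) <= x powr p" "x powr p <= exp (P * L)" using assms(1) by (auto simp: powr_def abs_le_iff)
qed

lemma ln_bound_interval:
  fixes x :: real assumes "0 < x" shows "\<bar>ln x\<bar> <= L \<longleftrightarrow> x \<in> {exp (- L)..exp L}"
proof -
  obtain y where "x = exp y" using assms by (metis exp_ln)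
  then show ?thesis by (auto simp: abs_le_iff)
qed

text \<open>The remainder keeps the factor |r|: \<open>log_norm\<close> divides by the exponent, and
  this factor makes the resulting estimates uniform as the exponent passes 0.\<close>

lemma powr_base_taylor:
  fixes x y :: real
  assumes "0 < x" "\<bar>ln x\<bar> <= L" "0 < y" "\<bar>ln y\<bar> <= L" "\<bar>r\<bar> <= R"
  shows "\<bar>y powr r - x powr r - r * x powr (r - 1) * (y - x)\<bar> <= \<bar>r\<bar> * ((R + 1) * exp ((R + 2) * L)) * (y - x)^2"
proof (rule taylor_second_derivative_bound[where a = "exp (- L)" and b = "exp L" and f' = "\<lambda>z. r * z powr (r - 1)"
      and f'' = "\<lambda>z. r * ((r - 1) * z powr (r - 2))"])
  fix z assume z: "z \<in> {exp (- L)..exp L}"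
  then have z0: "0 < z" using exp_gt_zero[of "- L"] by (simp del: exp_gt_zero)
  show "((\<lambda>z. z powr r) has_real_derivative r * z powr (r - 1)) (at z)" using z0 by (auto intro!: derivative_eq_intros)
  show "((\<lambda>z. r * z powr (r - 1)) has_real_derivative r * ((r - 1) * z powr (r - 2))) (at z)"
    using z0 by (auto intro!: derivative_eq_intros)
  have zp: "z powr (r - 2) <= exp ((R + 2) * L)" using ln_bound_interval[OF z0, of L] z z0 assms(5) by (intro powr_bounds) auto
  have "\<bar>r - 1\<bar> * z powr (r - 2) <= (R + 1) * exp ((R + 2) * L)" using assms(5) zp by (intro mult_mono) auto
  then show "\<bar>r * ((r - 1) * z powr (r - 2))\<bar> <= \<bar>r\<bar> * ((R + 1) * exp ((R + 2) * L))" by (simp add: abs_mult mult_left_mono)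
qed (use assms ln_bound_interval in auto)

lemma ln_taylor:
  fixes x y :: real
  assumes "0 < x" "\<bar>ln x\<bar> <= L" "0 < y" "\<bar>ln y\<bar> <= L"
  shows "\<bar>ln y - ln x - (y - x) / x\<bar> <= exp (2 * L) * (y - x)^2"
proof -
  have "\<bar>ln y - ln x - inverse x * (y - x)\<bar> <= exp (2 * L) * (y - x)^2"
  proof (rule taylor_second_derivative_bound[where a = "exp (- L)" and b = "exp L" and f' = inverse
      and f'' = "\<lambda>z. - (inverse z * inverse z)"])
    fix z assume z: "z \<in> {exp (- L)..exp L}"
    then have z0: "0 < z" using exp_gt_zero[of "- L"] by (simp del: exp_gt_zero)
    show "(ln has_real_derivative inverse z) (at z)" using z0 by (auto intro!: derivative_eq_intros simp: divide_inverse)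
    show "(inverse has_real_derivative - (inverse z * inverse z)) (at z)" using z0 by (auto intro!: derivative_eq_intros)
    have "inverse z <= inverse (exp (- L))" using z by (intro le_imp_inverse_le) auto
    then have "inverse z <= exp L" by (simp add: exp_minus)
    then have "inverse z * inverse z <= exp L * exp L" using z0 by (intro mult_mono) auto
    then show "\<bar>- (inverse z * inverse z)\<bar> <= exp (2 * L)" using z0 by (simp add: abs_mult flip: exp_add)
  qed (use assms ln_bound_interval in auto)
  then show ?thesis by (simp add: divide_inverse mult.commute)
qed

lemma powr_exponent_taylor:
  fixes x :: real
  assumes x: "0 < x" "\<bar>ln x\<bar> <= L" and p: "\<bar>p\<bar> <= P" "\<bar>r\<bar> <= P"
  shows "\<bar>x powr r - x powr p - x powr p * ln x * (r - p)\<bar> <= L^2 * exp (P * L) * (r - p)^2"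
    "\<bar>x powr r - x powr p\<bar> <= L * exp (P * L) * \<bar>r - p\<bar>"
proof -
  have L0: "0 <= L" using x(2) by linarith
  have d: "((\<lambda>p. x powr p) has_real_derivative x powr z * ln x) (at z)" for z using x by (auto intro!: derivative_eq_intros)
  have b: "x powr z <= exp (P * L)" if "z \<in> {-P..P}" for z using that by (intro powr_bounds x) auto
  have b': "\<bar>x powr z * ln x\<bar> <= L * exp (P * L)" if "z \<in> {-P..P}" for z
    unfolding abs_mult using mult_mono[OF b[OF that] x(2)] L0 by (simp add: mult.commute)
  show "\<bar>x powr r - x powr p - x powr p * ln x * (r - p)\<bar> <= L^2 * exp (P * L) * (r - p)^2"
  proof (rule taylor_second_derivative_bound[where a = "-P" and b = P and f = "\<lambda>p. x powr p" and f' = "\<lambda>z. x powr z * ln x"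
      and f'' = "\<lambda>z. x powr z * ln x * ln x"])
    fix z assume z: "z \<in> {-P..P}"
    show "((\<lambda>p. x powr p) has_real_derivative x powr z * ln x) (at z)" by (rule d)
    show "((\<lambda>z. x powr z * ln x) has_real_derivative x powr z * ln x * ln x) (at z)" by (rule DERIV_cmult_right[OF d])
    have "\<bar>x powr z * ln x\<bar> * \<bar>ln x\<bar> <= L * exp (P * L) * L" using b'[OF z] x L0 by (intro mult_mono) auto
    then show "\<bar>x powr z * ln x * ln x\<bar> <= L^2 * exp (P * L)" by (simp add: abs_mult power2_eq_square mult_ac)
  qed (use p in auto)
  have "norm (x powr r - x powr p) <= L * exp (P * L) * norm (r - p)"
    by (rule field_differentiable_bound[where S = "{-P..P}" and f = "\<lambda>p. x powr p" and f' = "\<lambda>z. x powr z * ln x"])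
      (use d b' p in \<open>auto intro: has_field_derivative_at_within\<close>)
  then show "\<bar>x powr r - x powr p\<bar> <= L * exp (P * L) * \<bar>r - p\<bar>" by simp
qed

section \<open>Logarithmic norms as functions of the function and of the exponent\<close>

text \<open>The value at p = 0, the logarithm of the geometric mean, is the continuous extension of
  the other case, as \<open>log_norm_continuous\<close> shows.\<close>

definition log_norm :: "'a measure => real => ('a => real) => real" where
  "log_norm M p \<phi> = (if p = 0 then (LINT x|M. ln (\<phi> x)) else ln (LINT x|M. \<phi> x powr p) / p)"

text \<open>Values in [exp(-L), exp L]: the logarithm and every real power are then bounded, so that
  integrability is automatic for all exponents.\<close>

definition log_bounded :: "'a measure => real => ('a => real) => bool" where
  "log_bounded M L \<phi> \<longleftrightarrow> \<phi> \<in> borel_measurable M \<and> (\<forall>x. 0 < \<phi> x \<and> \<bar>ln (\<phi> x)\<bar> <= L)"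

lemma log_boundedD:
  assumes "log_bounded M L f"
  shows "f \<in> borel_measurable M" "0 < f x" "\<bar>ln (f x)\<bar> <= L" "0 <= L"
    "\<bar>p\<bar> <= P ==> exp (- (P * L)) <= f x powr p" "\<bar>p\<bar> <= P ==> f x powr p <= exp (P * L)"
proof -
  show *: "f \<in> borel_measurable M" "0 < f x" "\<bar>ln (f x)\<bar> <= L" using assms by (auto simp: log_bounded_def)
  show "0 <= L" using *(3) by linarith
  show "\<bar>p\<bar> <= P ==> exp (- (P * L)) <= f x powr p" "\<bar>p\<bar> <= P ==> f x powr p <= exp (P * L)" using powr_bounds[OF *(2,3)] by auto
qed

lemma (in prob_space) integrable_bounded:
  fixes f :: "'a => real"
  assumes "f \<in> borel_measurable M" "\<And>x. \<bar>f x\<bar> <= B"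
  shows "integrable M f" using assms by (intro integrable_const_bound[where B = B]) auto

lemma (in prob_space) integral_between:
  fixes f :: "'a => real"
  assumes "integrable M f" "\<And>x. a <= f x" "\<And>x. f x <= b"
  shows "a <= (LINT x|M. f x)" "(LINT x|M. f x) <= b"
  using integral_mono[of M "\<lambda>_. a" f] integral_mono[of M f "\<lambda>_. b"] assms by (auto simp: prob_space)

lemma (in prob_space) log_bounded_powr:
  assumes f: "log_bounded M L f"
  shows "integrable M (\<lambda>x. f x powr p)" "\<bar>p\<bar> <= P ==> exp (- (P * L)) <= (LINT x|M. f x powr p)"
    "\<bar>p\<bar> <= P ==> (LINT x|M. f x powr p) <= exp (P * L)" "0 < (LINT x|M. f x powr p)"
proof -
  note d = log_boundedD[OF f]
  note [measurable] = d(1)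
  show i: "integrable M (\<lambda>x. f x powr p)" for p by (rule integrable_bounded[where B = "exp (\<bar>p\<bar> * L)"]) (use d in auto)
  show lb: "\<bar>p\<bar> <= P ==> exp (- (P * L)) <= (LINT x|M. f x powr p)" for p P by (rule integral_between(1)[OF i]) (use d in auto)
  show "\<bar>p\<bar> <= P ==> (LINT x|M. f x powr p) <= exp (P * L)" by (rule integral_between(2)[OF i]) (use d in auto)
  show "0 < (LINT x|M. f x powr p)" using lb[of p "\<bar>p\<bar>"] exp_gt_zero less_le_trans by blast
qed

lemma (in prob_space) log_bounded_ln:
  assumes f: "log_bounded M L f"
  shows "integrable M (\<lambda>x. ln (f x))" "integrable M (\<lambda>x. f x powr p * ln (f x))"
proof -
  note d = log_boundedD[OF f]
  note [measurable] = d(1)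
  show "integrable M (\<lambda>x. ln (f x))" by (rule integrable_bounded[where B = L]) (use d in auto)
  have b: "\<bar>f x powr p * ln (f x)\<bar> <= exp (\<bar>p\<bar> * L) * L" for x
    unfolding abs_mult using d(3)[of x] d(4) d(6)[of p "\<bar>p\<bar>" x] by (intro mult_mono) auto
  show "integrable M (\<lambda>x. f x powr p * ln (f x))" by (rule integrable_bounded[OF _ b]) measurable
qed

text \<open>The variance of |f| is nonnegative.\<close>

lemma (in prob_space) square_integral_le:
  fixes f :: "'a => real"
  assumes "integrable M f" "integrable M (\<lambda>x. (f x)^2)"
  shows "(LINT x|M. \<bar>f x\<bar>)^2 <= (LINT x|M. (f x)^2)"
proof -
  define a where "a = (LINT x|M. \<bar>f x\<bar>)"
  have "0 <= (LINT x|M. (\<bar>f x\<bar> - a)^2)" by simp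
  also have "... = (LINT x|M. (f x)^2 - 2 * a * \<bar>f x\<bar> + a^2)"
    by (intro Bochner_Integration.integral_cong) (auto simp: power2_diff)
  also have "... = (LINT x|M. (f x)^2) - a^2" using assms by (simp add: prob_space flip: a_def) (simp add: power2_eq_square)
  finally show ?thesis by (simp add: a_def)
qed

text \<open>First-order expansion in the function, with an error quadratic in L^2 and uniform over
  |r| <= R. For nonzero r the norm is ln(N)/r, and every error term below carries a factor |r| that
  cancels the division. For r = 0 the logarithm is expanded directly, which accounts for the summand
  exp(2 L).\<close>

lemma (in prob_space) log_norm_function_expansion:
  assumes f: "log_bounded M L f" and g: "log_bounded M L g" and r: "\<bar>r\<bar> <= R"
  shows "\<bar>log_norm M r g - log_norm M r f - (LINT x|M. f x powr (r - 1) * (g x - f x)) / (LINT x|M. f x powr r)\<bar> <=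
     ((R + 1) * exp ((R + 2) * L) * exp (R * L) + R * exp (2 * (R * L)) * ((R + 1) * exp ((R + 2) * L) * (2 * exp L) + exp ((R + 1) * L))^2 + exp (2 * L)) *
     (LINT x|M. (g x - f x)^2)"
proof -
  note d = log_boundedD[OF f] and e = log_boundedD[OF g]
  note [measurable] = d(1) e(1)
  have R0: "0 <= R" using r by linarith
  define K1 where "K1 = (R + 1) * exp ((R + 2) * L)"
  define K3 where "K3 = K1 * (2 * exp L) + exp ((R + 1) * L)"
  define I where "I = (LINT x|M. (g x - f x)^2)"
  have K0: "0 <= K1" "0 <= K3" using R0 by (auto simp: K1_def K3_def)
  have I0: "0 <= I" by (simp add: I_def)
  have up: "f x <= exp L" "g x <= exp L" for x
    using ln_bound_interval[OF d(2)[of x], of L] d(3)[of x] ln_bound_interval[OF e(2)[of x], of L] e(3)[of x] by auto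
  have db: "\<bar>g x - f x\<bar> <= 2 * exp L" for x using up[of x] d(2)[of x] e(2)[of x] by simp
  have di: "integrable M (\<lambda>x. g x - f x)" by (rule integrable_bounded[OF _ db]) measurable
  have d2: "integrable M (\<lambda>x. (g x - f x)^2)"
  proof (rule integrable_bounded)
    show "\<bar>(g x - f x)^2\<bar> <= (2 * exp L)^2" for x using power_mono[OF db[of x], of 2] by simp
  qed measurable
  have pd: "integrable M (\<lambda>x. f x powr (r - 1) * (g x - f x))"
  proof (rule integrable_bounded)
    show "\<bar>f x powr (r - 1) * (g x - f x)\<bar> <= exp (\<bar>r - 1\<bar> * L) * (2 * exp L)" for x
      unfolding abs_mult using d(6)[of "r - 1" "\<bar>r - 1\<bar>" x] db[of x] by (intro mult_mono) auto
  qed measurable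
  define D where "D = (LINT x|M. f x powr (r - 1) * (g x - f x))"
  define N where "N = (LINT x|M. f x powr r)"
  define N' where "N' = (LINT x|M. g x powr r)"
  have Nb: "exp (- (R * L)) <= N" "N <= exp (R * L)" "exp (- (R * L)) <= N'" "N' <= exp (R * L)" "0 < N" "0 < N'"
    unfolding N_def N'_def using log_bounded_powr(2-4)[OF f] log_bounded_powr(2-4)[OF g] r by auto
  have "\<bar>log_norm M r g - log_norm M r f - D / N\<bar> <= (K1 * exp (R * L) + R * exp (2 * (R * L)) * K3^2 + exp (2 * L)) * I"
  proof (cases "r = 0")
    case True
    have N1: "N = 1" using True d(2) by (simp add: N_def prob_space less_imp_neq[symmetric])
    have "log_norm M r g - log_norm M r f - D / N = (LINT x|M. ln (g x) - ln (f x) - (g x - f x) / f x)"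
    proof -
      have "(LINT x|M. ln (g x) - ln (f x) - (g x - f x) / f x) =
        (LINT x|M. ln (g x) - ln (f x) - f x powr (r - 1) * (g x - f x))"
      proof (intro Bochner_Integration.integral_cong refl)
        fix x
        have "f x powr (r - 1) = 1 / f x" using True d(2)[of x] by (simp add: powr_minus_divide)
        then show "ln (g x) - ln (f x) - (g x - f x) / f x = ln (g x) - ln (f x) - f x powr (r - 1) * (g x - f x)" by simp
      qed
      then show ?thesis using True N1 log_bounded_ln(1)[OF f] log_bounded_ln(1)[OF g] pd by (simp add: log_norm_def D_def)
    qed
    also have "\<bar>...\<bar> <= (LINT x|M. \<bar>ln (g x) - ln (f x) - (g x - f x) / f x\<bar>)" by (rule integral_abs_bound)
    also have "... <= (LINT x|M. exp (2 * L) * (g x - f x)^2)"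
    proof (rule integral_mono')
      show "integrable M (\<lambda>x. exp (2 * L) * (g x - f x)^2)" using d2 by simp
      show "\<bar>ln (g x) - ln (f x) - (g x - f x) / f x\<bar> <= exp (2 * L) * (g x - f x)^2" for x by (rule ln_taylor[OF d(2,3) e(2,3)])
    qed simp
    also have "... = exp (2 * L) * I" by (simp add: I_def)
    also have "... <= (K1 * exp (R * L) + R * exp (2 * (R * L)) * K3^2 + exp (2 * L)) * I"
      using I0 K0 R0 by (intro mult_right_mono) auto
    finally show ?thesis .
  next
    case False
    have bt: "\<bar>g x powr r - f x powr r - r * f x powr (r - 1) * (g x - f x)\<bar> <= \<bar>r\<bar> * K1 * (g x - f x)^2" for x
      using powr_base_taylor[OF d(2)[of x] d(3)[of x] e(2)[of x] e(3)[of x] r] by (simp only: K1_def)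
    have E1: "\<bar>N' - N - r * D\<bar> <= \<bar>r\<bar> * K1 * I"
    proof -
      have eq: "N' - N - r * D = (LINT x|M. g x powr r - f x powr r - r * f x powr (r - 1) * (g x - f x))"
        using log_bounded_powr(1)[OF f, of r] log_bounded_powr(1)[OF g, of r] pd by (simp add: N_def N'_def D_def mult.assoc)
      have "\<bar>N' - N - r * D\<bar> <= (LINT x|M. \<bar>g x powr r - f x powr r - r * f x powr (r - 1) * (g x - f x)\<bar>)"
        unfolding eq by (rule integral_abs_bound)
      also have "... <= (LINT x|M. \<bar>r\<bar> * K1 * (g x - f x)^2)"
      proof (rule integral_mono')
        show "integrable M (\<lambda>x. \<bar>r\<bar> * K1 * (g x - f x)^2)" by (intro integrable_mult_right d2)
      qed (use bt K0 in auto)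
      finally show ?thesis by (simp add: I_def)
    qed
    \<comment> \<open>A first-order bound proportional to |r|. Integrated and squared it bounds (N'
      - N)^2, the error made in expanding ln N, with a factor r^2.\<close>
    have pw: "\<bar>g x powr r - f x powr r\<bar> <= \<bar>r\<bar> * K3 * \<bar>g x - f x\<bar>" for x
    proof -
      have "\<bar>g x powr r - f x powr r - r * f x powr (r - 1) * (g x - f x)\<bar> <= \<bar>r\<bar> * K1 * (g x - f x)^2" by (rule bt)
      also have "... = \<bar>r\<bar> * (K1 * \<bar>g x - f x\<bar>) * \<bar>g x - f x\<bar>" by (simp add: power2_eq_square)
      also have "... <= \<bar>r\<bar> * (K1 * (2 * exp L)) * \<bar>g x - f x\<bar>" using db[of x] K0 by (intro mult_right_mono mult_left_mono) auto
      finally have "\<bar>g x powr r - f x powr r - r * f x powr (r - 1) * (g x - f x)\<bar> <= \<bar>r\<bar> * (K1 * (2 * exp L)) * \<bar>g x - f x\<bar>" .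
      moreover have "\<bar>r * f x powr (r - 1) * (g x - f x)\<bar> <= \<bar>r\<bar> * exp ((R + 1) * L) * \<bar>g x - f x\<bar>"
        unfolding abs_mult using d(6)[of "r - 1" "R + 1" x] r by (intro mult_right_mono mult_left_mono) auto
      ultimately show ?thesis unfolding K3_def distrib_left distrib_right by linarith
    qed
    have "\<bar>N' - N\<bar> = \<bar>\<integral>x. g x powr r - f x powr r \<partial>M\<bar>"
      using log_bounded_powr(1)[OF f, of r] log_bounded_powr(1)[OF g, of r] by (simp add: N_def N'_def)
    also have "... <= (LINT x|M. \<bar>g x powr r - f x powr r\<bar>)" by (rule integral_abs_bound)
    also have "... <= (LINT x|M. \<bar>r\<bar> * K3 * \<bar>g x - f x\<bar>)" by (rule integral_mono') (use di pw K0 in auto)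
    finally have "\<bar>N' - N\<bar> <= \<bar>r\<bar> * K3 * (LINT x|M. \<bar>g x - f x\<bar>)" by simp
    then have "\<bar>N' - N\<bar>^2 <= (\<bar>r\<bar> * K3 * (LINT x|M. \<bar>g x - f x\<bar>))^2" by (intro power_mono) auto
    also have "... = (\<bar>r\<bar> * K3)^2 * (LINT x|M. \<bar>g x - f x\<bar>)^2" by (rule power_mult_distrib)
    also have "... <= (\<bar>r\<bar> * K3)^2 * I" unfolding I_def by (intro mult_left_mono square_integral_le di d2) simp
    finally have E2: "(N' - N)^2 <= \<bar>r\<bar> * (\<bar>r\<bar> * K3^2 * I)" by (simp add: power2_eq_square mult_ac)
    have lnb: "\<bar>ln N\<bar> <= R * L" "\<bar>ln N'\<bar> <= R * L" using Nb ln_bound_interval[of N "R * L"] ln_bound_interval[of N' "R * L"] by auto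
    have "\<bar>ln N' - ln N - (N' - N) / N\<bar> <= exp (2 * (R * L)) * (N' - N)^2" by (rule ln_taylor[OF Nb(5) lnb(1) Nb(6) lnb(2)])
    also have "... <= exp (2 * (R * L)) * (\<bar>r\<bar> * (\<bar>r\<bar> * K3^2 * I))" by (intro mult_left_mono E2) simp
    finally have A: "\<bar>ln N' - ln N - (N' - N) / N\<bar> <= \<bar>r\<bar> * (\<bar>r\<bar> * exp (2 * (R * L)) * K3^2 * I)" by (simp add: mult_ac)
    have "\<bar>(N' - N) / N - r * D / N\<bar> = \<bar>N' - N - r * D\<bar> * (1 / N)" using Nb by (simp flip: diff_divide_distrib)
    also have "... <= (\<bar>r\<bar> * K1 * I) * exp (R * L)"
    proof (intro mult_mono E1)
      have "1 / N <= 1 / exp (- (R * L))" using Nb by (intro divide_left_mono) auto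
      then show "1 / N <= exp (R * L)" by (simp add: exp_minus field_simps)
    qed (use Nb I0 K0 in auto)
    finally have B: "\<bar>(N' - N) / N - r * D / N\<bar> <= \<bar>r\<bar> * (K1 * exp (R * L) * I)" by (simp add: mult_ac)
    have "\<bar>r\<bar> * \<bar>log_norm M r g - log_norm M r f - D / N\<bar> = \<bar>ln N' - ln N - r * D / N\<bar>"
      unfolding abs_mult[symmetric] using False by (simp add: log_norm_def N_def N'_def right_diff_distrib)
    also have "... <= \<bar>r\<bar> * (\<bar>r\<bar> * exp (2 * (R * L)) * K3^2 * I) + \<bar>r\<bar> * (K1 * exp (R * L) * I)" using A B by linarith
    also have "... = \<bar>r\<bar> * ((K1 * exp (R * L) + \<bar>r\<bar> * exp (2 * (R * L)) * K3^2) * I)" by (simp add: algebra_simps)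
    finally have "\<bar>log_norm M r g - log_norm M r f - D / N\<bar> <= (K1 * exp (R * L) + \<bar>r\<bar> * exp (2 * (R * L)) * K3^2) * I"
      using False by simp
    also have "... <= (K1 * exp (R * L) + R * exp (2 * (R * L)) * K3^2 + exp (2 * L)) * I"
    proof -
      have "\<bar>r\<bar> * exp (2 * (R * L)) * K3^2 <= R * exp (2 * (R * L)) * K3^2" using r by (intro mult_right_mono) auto
      then have "K1 * exp (R * L) + \<bar>r\<bar> * exp (2 * (R * L)) * K3^2 <= K1 * exp (R * L) + R * exp (2 * (R * L)) * K3^2 + exp (2 * L)"
        using exp_ge_zero[of "2 * L"] by linarith
      then show ?thesis using I0 by (rule mult_right_mono)
    qed
    finally show ?thesis .
  qed
  then show ?thesis by (simp add: K1_def K3_def D_def N_def I_def)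
qed

lemma (in prob_space) integral_powr_has_derivative:
  assumes f: "log_bounded M L f"
  shows "((\<lambda>p. LINT x|M. f x powr p) has_real_derivative (LINT x|M. f x powr p * ln (f x))) (at p)"
proof -
  note d = log_boundedD[OF f]
  define J where "J p = (LINT x|M. f x powr p)" for p
  define J' where "J' = (LINT x|M. f x powr p * ln (f x))"
  define K where "K = L^2 * exp ((\<bar>p\<bar> + 1) * L)"
  have "(J has_derivative (\<lambda>h. J' * h)) (at p)"
  proof (rule has_derivative_quadratic[where K = K])
    show "linear (\<lambda>h. J' * h)" by (simp add: linear_times)
    fix h :: real assume h: "norm h < 1"
    have eq: "J (p + h) - J p - J' * h = (LINT x|M. f x powr (p + h) - f x powr p - f x powr p * ln (f x) * h)"
      using log_bounded_powr(1)[OF f] log_bounded_ln(2)[OF f] by (simp add: J_def J'_def)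
    have "\<bar>J (p + h) - J p - J' * h\<bar> <= (LINT x|M. \<bar>f x powr (p + h) - f x powr p - f x powr p * ln (f x) * h\<bar>)"
      unfolding eq by (rule integral_abs_bound)
    also have "... <= (LINT x|M. K * h^2)"
    proof (rule integral_mono')
      fix x
      have "\<bar>p\<bar> <= \<bar>p\<bar> + 1" "\<bar>p + h\<bar> <= \<bar>p\<bar> + 1" using h by auto
      from powr_exponent_taylor(1)[OF d(2,3) this, of x]
      show "\<bar>f x powr (p + h) - f x powr p - f x powr p * ln (f x) * h\<bar> <= K * h^2" by (simp add: K_def)
    qed (auto simp: K_def)
    also have "... = K * norm h * norm h" by (simp add: prob_space power2_eq_square)
    finally show "norm (J (p + h) - J p - J' * h) <= K * norm h * norm h" by simp
  qed
  then show ?thesis by (simp add: has_field_derivative_def J_def[abs_def] J'_def)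
qed

text \<open>The link with functional inequalities: the derivative in the exponent is the entropy of
  f^p up to normalisation, with f^p written as the square of f^(p/2) to fit the logarithmic Sobolev
  inequality.\<close>

lemma (in prob_space) log_norm_has_derivative:
  assumes f: "log_bounded M L f" and p: "p \<noteq> 0"
  shows "((\<lambda>p. log_norm M p f) has_real_derivative
     Ent M (\<lambda>x. (f x powr (p / 2))^2) / (p^2 * (LINT x|M. f x powr p))) (at p)"
proof -
  note d = log_boundedD[OF f]
  define J where "J p = (LINT x|M. f x powr p)" for p
  define J' where "J' = (LINT x|M. f x powr p * ln (f x))"
  have J: "(J has_real_derivative J') (at p)" using integral_powr_has_derivative[OF f] by (simp add: J_def[abs_def] J'_def)
  have J0: "0 < J p" unfolding J_def by (rule log_bounded_powr(4)[OF f])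
  have sq: "(f x powr (p / 2))^2 = f x powr p" for x by (simp add: power2_eq_square flip: powr_add)
  have Ent: "Ent M (\<lambda>x. (f x powr (p / 2))^2) = p * J' - J p * ln (J p)"
    unfolding sq Ent_def J_def[symmetric] using d(2) by (simp add: ln_powr J'_def mult.left_commute)
  have "((\<lambda>p. ln (J p) / p) has_real_derivative ((J' / J p) * p - ln (J p)) / (p * p)) (at p)"
    using p J0 by (auto intro!: derivative_eq_intros J simp: field_simps)
  also have "((J' / J p) * p - ln (J p)) / (p * p) = (p * J' - J p * ln (J p)) / (p^2 * J p)"
    using p J0 by (simp add: field_simps power2_eq_square)
  finally have "((\<lambda>p. ln (J p) / p) has_real_derivative Ent M (\<lambda>x. (f x powr (p / 2))^2) / (p^2 * J p)) (at p)" by (simp add: Ent)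
  then show ?thesis unfolding J_def[symmetric]
    by (rule has_field_derivative_transform_within_open[where S = "- {0}"]) (use p in \<open>auto simp: log_norm_def J_def\<close>)
qed

text \<open>At p = 0 the quotient ln(int f^p)/p is a difference quotient of p -> ln(int f^p), whose
  derivative at 0 is int ln f.\<close>

lemma (in prob_space) log_norm_continuous:
  assumes f: "log_bounded M L f"
  shows "isCont (\<lambda>p. log_norm M p f) p"
proof (cases "p = 0")
  case False
  then show ?thesis using log_norm_has_derivative[OF f] DERIV_isCont by blast
next
  case True
  note d = log_boundedD[OF f]
  have one: "(LINT x|M. f x powr 0) = 1" using d(2) by (simp add: prob_space less_imp_neq[symmetric])
  have "(LINT x|M. f x powr 0 * ln (f x)) = (LINT x|M. ln (f x))" using d(2) by (simp add: less_imp_neq[symmetric])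
  then have "((\<lambda>p. ln (LINT x|M. f x powr p)) has_real_derivative (LINT x|M. ln (f x))) (at 0)"
    using DERIV_chain2[OF DERIV_ln integral_powr_has_derivative[OF f, of 0]] one by simp
  then have "((\<lambda>p. ln (LINT x|M. f x powr p) / p) \<longlongrightarrow> (LINT x|M. ln (f x))) (at 0)" unfolding DERIV_def add_0 one by simp
  then have "((\<lambda>p. log_norm M p f) \<longlongrightarrow> (LINT x|M. ln (f x))) (at 0)"
    by (rule Lim_transform_eventually) (auto simp: log_norm_def eventually_at_filter)
  then show ?thesis using True by (simp add: isCont_def log_norm_def)
qed

text \<open>Jensen's inequality, by integrating the tangent of x ln x at the mean.\<close>

lemma (in prob_space) Ent_nonneg:
  assumes "integrable M f" "integrable M (\<lambda>x. f x * ln (f x))" "\<And>x. 0 <= f x" "0 < (LINT x|M. f x)"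
  shows "0 <= Ent M f"
proof -
  define a where "a = (LINT x|M. f x)"
  have "(LINT x|M. f x * ln a + f x - a) <= (LINT x|M. f x * ln (f x))"
    using assms by (intro integral_mono xlnx_ge_tangent) (auto simp: a_def)
  then show ?thesis using assms(1) by (simp add: Ent_def prob_space flip: a_def)
qed

text \<open>The derivative formula divides by p^2, so the mean value theorem is used on either side
  of 0 and the pieces are joined by continuity. Nonnegativity of the entropy gives monotonicity, the
  bound on it the Lipschitz estimate.\<close>

lemma (in prob_space) log_norm_exponent_bounds:
  assumes f: "log_bounded M L f" and ab: "a <= b" and B0: "0 <= B"
    and B: "\<And>p. p \<in> {a..b} ==> p \<noteq> 0 ==> Ent M (\<lambda>x. (f x powr (p / 2))^2) <= B * (p^2 * (LINT x|M. f x powr p))"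
  shows "log_norm M a f <= log_norm M b f" "log_norm M b f - log_norm M a f <= B * (b - a)"
proof -
  note d = log_boundedD[OF f]
  define J where "J p = (LINT x|M. f x powr p)" for p
  have J0: "0 < J p" for p unfolding J_def by (rule log_bounded_powr(4)[OF f])
  define E where "E p = Ent M (\<lambda>x. (f x powr (p / 2))^2) / (p^2 * J p)" for p
  have sq: "(f x powr (p / 2))^2 = f x powr p" for x p by (simp add: power2_eq_square flip: powr_add)
  have E0: "0 <= E p" for p
  proof -
    have "integrable M (\<lambda>x. f x powr p * ln (f x powr p))"
      using log_bounded_ln(2)[OF f, of p] d(2) by (simp add: ln_powr mult.left_commute)
    then have "0 <= Ent M (\<lambda>x. f x powr p)" using log_bounded_powr(1,4)[OF f] by (intro Ent_nonneg) auto
    then show ?thesis using J0[of p] by (simp add: E_def sq)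
  qed
  have EB: "E p <= B" if "p \<in> {a..b}" "p \<noteq> 0" for p
    unfolding E_def using B[OF that] J0[of p] that by (simp add: pos_divide_le_eq J_def)
  have piece: "log_norm M s f <= log_norm M t f \<and> log_norm M t f - log_norm M s f <= B * (t - s)"
    if st: "a <= s" "s <= t" "t <= b" "0 \<notin> {s<..<t}" for s t
  proof (cases "s = t")
    case False
    then have "s < t" using st by simp
    moreover have "continuous_on {s..t} (\<lambda>p. log_norm M p f)"
      using log_norm_continuous[OF f] by (intro continuous_at_imp_continuous_on) auto
    moreover have "((\<lambda>p. log_norm M p f) has_derivative (\<lambda>h. E p * h)) (at p)" if "s < p" "p < t" for p
    proof -
      have "p \<noteq> 0" using that st(4) by auto
      from log_norm_has_derivative[OF f this] show ?thesis unfolding has_field_derivative_def E_def J_def .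
    qed
    ultimately obtain y where y: "s < y" "y < t" "log_norm M t f - log_norm M s f = E y * (t - s)"
      using mvt[of s t "\<lambda>p. log_norm M p f" "\<lambda>p h. E p * h"] by auto
    have "y \<in> {a..b}" "y \<noteq> 0" using y st by auto
    then have "(t - s) * E y <= (t - s) * B" using EB st by (intro mult_left_mono) auto
    moreover have "0 <= (t - s) * E y" using E0[of y] st by simp
    ultimately show ?thesis using y(3) by (simp add: mult.commute)
  qed simp
  show "log_norm M a f <= log_norm M b f" "log_norm M b f - log_norm M a f <= B * (b - a)"
  proof (atomize(full), cases "0 \<in> {a<..<b}")
    case True
    then have "0 \<notin> {a<..<0}" "0 \<notin> {0<..<b}" by auto
    then show "log_norm M a f <= log_norm M b f \<and> log_norm M b f - log_norm M a f <= B * (b - a)"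
      using piece[of a 0] piece[of 0 b] True by (auto simp: algebra_simps)
  next
    case False
    then show "log_norm M a f <= log_norm M b f \<and> log_norm M b f - log_norm M a f <= B * (b - a)" using piece[of a b] ab by simp
  qed
qed

text \<open>By translation invariance the increments of an integrable function have integral zero; Fubini turns
  them into the integral of the directional derivative.\<close>

lemma integral_directional_derivative_eq_0:
  fixes w :: "'a::euclidean_space => real"
  assumes d: "\<And>x. (w has_derivative w' x) (at x)" and c: "continuous_on UNIV (\<lambda>x. w' x e)"
    and i: "integrable lborel w" "integrable lborel (\<lambda>x. w' x e)"
  shows "(LINT x|lborel. w' x e) = 0"
proof -
  define D where "D = (\<lambda>x. w' x e)"
  have Dc: "continuous_on UNIV D" using c by (simp add: D_def)
  have Dm[measurable]: "D \<in> borel_measurable borel" by (rule borel_measurable_continuous_onI[OF Dc])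
  have l: "linear (w' x)" for x by (rule has_derivative_linear[OF d])
  have tr: "integrable lborel (\<lambda>x. f (x + a))" "(LINT x|lborel. f (x + a)) = (LINT x|lborel. f x)"
    if "integrable lborel f" for f :: "'a => real" and a
  proof -
    have [measurable]: "f \<in> borel_measurable borel" using borel_measurable_integrable[OF that] by simp
    have "integrable (distr lborel borel ((+) a)) f" using that by (simp add: lborel_distr_plus)
    then show "integrable lborel (\<lambda>x. f (x + a))" by (subst (asm) integrable_distr_eq) (auto simp: add.commute)
    have "(LINT x|lborel. f x) = (LINT x|(distr lborel borel ((+) a)). f x)" by (simp add: lborel_distr_plus)
    also have "... = (LINT x|lborel. f (x + a))" by (subst integral_distr) (auto simp: add.commute)
    finally show "(LINT x|lborel. f (x + a)) = (LINT x|lborel. f x)" by simp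
  qed
  \<comment> \<open>The unit interval as a probability space: after Fubini the inner integral does
    not depend on s, and averaging over s leaves it unchanged.\<close>
  define I where "I = restrict_space lborel {0..1::real}"
  have emI: "emeasure I (space I) = 1" by (simp add: I_def space_restrict_space emeasure_restrict_space)
  interpret I: prob_space I by (rule prob_spaceI[OF emI])
  interpret P: pair_sigma_finite "lborel :: 'a measure" I ..
  have ftc: "w (x + e) - w x = (LINT s|I. D (x + s *\<^sub>R e))" for x
  proof -
    have "((\<lambda>s. w (x + s *\<^sub>R e)) has_vector_derivative D (x + s *\<^sub>R e)) (at s within {0..1})" for s
    proof -
      have "((\<lambda>s. w (x + s *\<^sub>R e)) has_derivative (\<lambda>r. w' (x + s *\<^sub>R e) (r *\<^sub>R e))) (at s)"
        by (rule has_derivative_compose[OF _ d]) (auto intro!: derivative_eq_intros)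
      then show ?thesis by (simp add: has_vector_derivative_def D_def linear_scale[OF l] has_derivative_at_withinI)
    qed
    moreover have "continuous_on {0..1} (\<lambda>s. D (x + s *\<^sub>R e))" by (intro continuous_on_compose2[OF Dc] continuous_intros) auto
    ultimately have "(LBINT s:{0..1}. D (x + s *\<^sub>R e)) = w (x + 1 *\<^sub>R e) - w (x + 0 *\<^sub>R e)"
      unfolding set_lebesgue_integral_def by (intro integral_FTC_atLeastAtMost) auto
    then show ?thesis unfolding I_def by (simp add: integral_restrict_space set_lebesgue_integral_def)
  qed
  have [measurable]: "(\<lambda>p. D (fst p + snd p *\<^sub>R e)) \<in> borel_measurable (lborel \<Otimes>\<^sub>M I)"
  proof (rule measurable_compose[OF _ Dm])
    have [measurable]: "(\<lambda>s. s) \<in> borel_measurable I" unfolding I_def by (intro measurable_restrict_space1) simp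
    have "snd \<in> measurable (lborel \<Otimes>\<^sub>M I) borel" using measurable_compose[OF measurable_snd, of "\<lambda>s. s" I borel lborel] by simp
    then show "(\<lambda>p. fst p + snd p *\<^sub>R e) \<in> borel_measurable (lborel \<Otimes>\<^sub>M I)" by measurable
  qed
  have Di: "integrable lborel D" using i(2) by (simp add: D_def)
  have nD: "integrable lborel (\<lambda>x. norm (D x))" using Di by simp
  have "integrable (I \<Otimes>\<^sub>M lborel) (\<lambda>(s, x). D (x + s *\<^sub>R e))"
  proof (rule pair_sigma_finite.Fubini_integrable)
    show "pair_sigma_finite I (lborel :: 'a measure)" ..
    show "(\<lambda>(s, x). D (x + s *\<^sub>R e)) \<in> borel_measurable (I \<Otimes>\<^sub>M lborel)"
      using measurable_pair_swap[of "\<lambda>p. D (fst p + snd p *\<^sub>R e)" lborel I borel] by (simp add: case_prod_beta')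
    show "integrable I (\<lambda>s. LINT x|lborel. norm (case (s, x) of (s, x) => D (x + s *\<^sub>R e)))" using tr(2)[OF nD] by simp
    show "AE s in I. integrable lborel (\<lambda>x. case (s, x) of (s, x) => D (x + s *\<^sub>R e))" using tr(1)[OF Di] by simp
  qed
  then have "(LINT x|lborel. (LINT s|I. D (x + s *\<^sub>R e))) = (LINT s|I. (LINT x|lborel. D (x + s *\<^sub>R e)))"
    using pair_sigma_finite.Fubini_integral[of I "lborel :: 'a measure" "\<lambda>s x. D (x + s *\<^sub>R e)"]
    by (simp add: pair_sigma_finite_def I.sigma_finite_measure_axioms lborel.sigma_finite_measure_axioms)
  also have "... = (LINT x|lborel. D x)" using tr(2)[OF Di] by (simp add: I.prob_space)
  finally have "(LINT x|lborel. D x) = (LINT x|lborel. w (x + e) - w x)" by (simp add: ftc)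
  also have "... = 0" using tr[OF i(1), of e] i(1) by simp
  finally show ?thesis by (simp add: D_def)
qed

section \<open>Gibbs measures: integration by parts and the logarithmic Sobolev inequality\<close>

definition grad :: "('a::euclidean_space => 'a => real) => 'a => 'a" where
  "grad f1 x = (\<Sum>e\<in>Basis. f1 x e *\<^sub>R e)"

lemma inner_grad:
  assumes "linear (g x)" shows "u \<bullet> grad g x = g x u"
  using linear_euclidean_sum[OF assms, of u] by (simp add: grad_def inner_sum_right mult.commute)

lemma grad_bounds:
  assumes l: "linear (g x)" and b: "\<And>u. \<bar>g x u\<bar> <= A * norm u" and A: "0 <= A"
  shows "norm (grad g x) <= A" "\<bar>g x u\<bar> <= norm (grad g x) * norm u"
    "(norm (grad g x))^2 = (\<Sum>e\<in>Basis. (g x e)^2)"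
proof -
  note ig = inner_grad[of g x, OF l]
  have "(norm (grad g x))^2 = g x (grad g x)" using ig[of "grad g x"] by (simp add: power2_norm_eq_inner)
  also have "... <= A * norm (grad g x)" using b[of "grad g x"] by linarith
  finally have "norm (grad g x) * norm (grad g x) <= A * norm (grad g x)" by (simp add: power2_eq_square)
  then show "norm (grad g x) <= A" using A by (cases "grad g x = 0") auto
  show "\<bar>g x u\<bar> <= norm (grad g x) * norm u" using Cauchy_Schwarz_ineq2[of u "grad g x"] ig[of u] by (simp add: mult.commute)
  have ge: "grad g x \<bullet> e = g x e" for e using ig[of e] by (simp add: inner_commute)
  have "(norm (grad g x))^2 = grad g x \<bullet> grad g x" by (rule power2_norm_eq_inner)
  also have "... = (\<Sum>e\<in>Basis. (grad g x \<bullet> e) * (grad g x \<bullet> e))" by (rule euclidean_inner)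
  finally show "(norm (grad g x))^2 = (\<Sum>e\<in>Basis. (g x e)^2)" by (simp add: ge power2_eq_square)
qed

text \<open>What is retained of the minimizer once it is known to be a Gibbs measure. The linear
  growth recorded by \<open>KB\<close> makes the drift terms integrable, because measures in
  \<open>P2\<close> have first moments.\<close>

locale gibbs_measure =
  fixes \<mu> :: "'a::euclidean_space measure" and U :: "'a => real" and B :: "'a => 'a" and Z \<rho> KB :: real
  assumes P2: "\<mu> \<in> P2" and density: "\<mu> = density lborel (\<lambda>x. ennreal (exp (- U x) / Z))" and Z: "0 < Z"
    and U: "\<And>x. GDERIV U x :> B x" and B: "continuous_on UNIV B" "\<And>x. norm (B x) <= KB * (1 + norm x)"
    and lsi: "log_sobolev \<rho> \<mu>" and \<rho>: "0 < \<rho>"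
begin

sublocale prob_space \<mu> by (rule P2_D(1)[OF P2])

lemma sets_\<mu> [measurable_cong, simp]: "sets \<mu> = sets borel" by (rule P2_D(2)[OF P2])

lemma measurable_continuous: "continuous_on UNIV f ==> f \<in> borel_measurable \<mu>" for f :: "'a => 'b::topological_space"
  unfolding measurable_cong_sets[OF sets_\<mu> refl] by (rule borel_measurable_continuous_onI)

text \<open>Integration by parts one coordinate at a time: with k the Gibbs density, k times
  \<open>T e\<close> is the derivative along e of F^(r-1) (d_e F) k, so its Lebesgue integral is 0.
  Summed over e, the three terms of \<open>T\<close> are r - 1 times the weighted energy, the
  Laplacian, and the drift that comes from differentiating k.\<close>

lemma integral_generator:
  assumes F: "C2L A F F1 F2" and lb: "log_bounded \<mu> L F"
  shows "(LINT x|\<mu>. F x powr (r - 1) * (lap2 F2 x - F1 x (B x))) = (1 - r) * (LINT x|\<mu>. F x powr (r - 2) * (norm (grad F1 x))^2)"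
    and "integrable \<mu> (\<lambda>x. F x powr (r - 1) * (lap2 F2 x - F1 x (B x)))"
    and "integrable \<mu> (\<lambda>x. F x powr (r - 2) * (norm (grad F1 x))^2)"
proof -
  note d = C2L_D[OF F] and l = log_boundedD[OF lb]
  define k where "k x = exp (- U x) / Z" for x
  have Ud: "(U has_derivative (\<lambda>h. h \<bullet> B x)) (at x)" for x using U by (simp add: gderiv_def)
  have Uc: "continuous_on UNIV U" by (rule has_derivative_continuous_on) (rule has_derivative_at_withinI[OF Ud])
  have kc: "continuous_on UNIV k" unfolding k_def using Z by (intro continuous_intros Uc) auto
  have k0: "0 <= k x" for x using Z by (simp add: k_def)
  have \<mu>k: "\<mu> = density lborel (\<lambda>x. ennreal (k x))" unfolding k_def by (rule density)
  note rd = real_densityD[OF P2_D(1)[OF P2] \<mu>k borel_measurable_continuous_onI[OF kc] k0]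
  have pc: "continuous_on UNIV (\<lambda>x. F x powr s)" for s
    using l(2) by (intro continuous_intros d) (simp add: less_imp_neq[symmetric])
  define T where "T e x = (r - 1) * (F x powr (r - 2) * (F1 x e)^2) + F x powr (r - 1) * F2 x e e -
      F x powr (r - 1) * F1 x e * (e \<bullet> B x)" for e x
  have lin: "integrable \<mu> (\<lambda>x. 1 + norm x)" using P2_D(5,6)[OF P2] by simp
  have pb: "F x powr s <= exp (\<bar>s\<bar> * L)" for x s by (rule l(6)) simp
  have bd: "integrable \<mu> f" if "continuous_on UNIV f" "\<And>x. \<bar>f x\<bar> <= K * (1 + norm x)" for f :: "'a => real" and K
    by (rule Bochner_Integration.integrable_bound[where f = "\<lambda>x. K * (1 + norm x)"])
      (use that lin measurable_continuous in \<open>auto intro!: AE_I2 order_trans[OF that(2) abs_ge_self]\<close>)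
  have Bi: "integrable \<mu> (\<lambda>x. g x * (v \<bullet> B x))" if "continuous_on UNIV g" "\<And>x. \<bar>g x\<bar> <= K" for g :: "'a => real" and K v
  proof (rule bd)
    show "continuous_on UNIV (\<lambda>x. g x * (v \<bullet> B x))" by (intro continuous_intros that B)
    fix x
    have "\<bar>v \<bullet> B x\<bar> <= norm v * (KB * (1 + norm x))"
      using Cauchy_Schwarz_ineq2[of v "B x"] mult_left_mono[OF B(2)[of x], of "norm v"] by simp
    then have "\<bar>g x\<bar> * \<bar>v \<bullet> B x\<bar> <= K * (norm v * (KB * (1 + norm x)))" using that(2)[of x] by (intro mult_mono) auto
    then show "\<bar>g x * (v \<bullet> B x)\<bar> <= (K * norm v * KB) * (1 + norm x)" by (simp add: abs_mult mult.assoc)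
  qed
  have bi: "integrable \<mu> f" if "continuous_on UNIV f" "\<And>x. \<bar>f x\<bar> <= K" for f :: "'a => real" and K
    by (rule integrable_bounded[OF measurable_continuous[OF that(1)] that(2)])
  have b1: "\<bar>F x powr s * F1 x e\<bar> <= exp (\<bar>s\<bar> * L) * A" if "e \<in> Basis" for x s e
    unfolding abs_mult using pb[of x s] d(4)[of x e] that by (intro mult_mono) auto
  have c1: "continuous_on UNIV (\<lambda>x. F x powr s * F1 x e)" for s e by (intro continuous_intros pc d)
  have i1: "integrable \<mu> (\<lambda>x. F x powr (r - 2) * (F1 x e)^2)" if e: "e \<in> Basis" for e
  proof (rule bi)
    show "continuous_on UNIV (\<lambda>x. F x powr (r - 2) * (F1 x e)^2)" by (intro continuous_intros pc d)
    show "\<bar>F x powr (r - 2) * (F1 x e)^2\<bar> <= exp (\<bar>r - 2\<bar> * L) * A^2" for x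
      unfolding abs_mult using pb[of x "r - 2"] power_mono[OF d(4)[of x e], of 2] e by (intro mult_mono) auto
  qed
  have i2: "integrable \<mu> (\<lambda>x. F x powr (r - 1) * F2 x e e)" if e: "e \<in> Basis" for e
  proof (rule bi)
    show "continuous_on UNIV (\<lambda>x. F x powr (r - 1) * F2 x e e)" by (intro continuous_intros pc d)
    show "\<bar>F x powr (r - 1) * F2 x e e\<bar> <= exp (\<bar>r - 1\<bar> * L) * A" for x
      unfolding abs_mult using pb[of x "r - 1"] d(5)[of x e e] e by (intro mult_mono) auto
  qed
  have i3: "integrable \<mu> (\<lambda>x. F x powr (r - 1) * F1 x e * (e \<bullet> B x))" if e: "e \<in> Basis" for e by (rule Bi[OF c1 b1[OF e]])
  have Tz: "(LINT x|\<mu>. T e x) = 0" if e: "e \<in> Basis" for e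
  proof -
    define w where "w x = F x powr (r - 1) * F1 x e * k x" for x
    define w' where "w' x u = F x powr (r - 1) * F1 x e * (- (u \<bullet> B x) * k x) +
      (F x powr (r - 1) * F2 x e u + (r - 1) * F x powr (r - 2) * F1 x u * F1 x e) * k x" for x u
    have w: "(w has_derivative w' x) (at x)" for x
    proof -
      have "((\<lambda>z. z powr (r - 1)) has_real_derivative (r - 1) * F x powr (r - 2)) (at (F x))"
        using l(2)[of x] by (auto intro!: derivative_eq_intros)
      from has_derivative_compose[OF d(2) this[unfolded has_field_derivative_def]]
      have p: "((\<lambda>x. F x powr (r - 1)) has_derivative (\<lambda>u. (r - 1) * F x powr (r - 2) * F1 x u)) (at x)" by simp
      have "((\<lambda>x. exp (- U x) / Z) has_derivative (\<lambda>u. - (u \<bullet> B x) * (exp (- U x) / Z))) (at x)"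
        using Z by (auto intro!: derivative_eq_intros Ud)
      then have k: "(k has_derivative (\<lambda>u. - (u \<bullet> B x) * k x)) (at x)" by (simp add: k_def[abs_def])
      show ?thesis unfolding w_def w'_def by (intro has_derivative_mult p k d(3))
    qed
    have eq: "w' x e = k x * T e x" for x by (simp add: w'_def T_def algebra_simps power2_eq_square)
    have Tc: "continuous_on UNIV (T e)" unfolding T_def by (intro continuous_intros pc d B)
    have Ti: "integrable \<mu> (T e)" unfolding T_def using i1[OF e] i2[OF e] i3[OF e] by simp
    have wi: "integrable \<mu> (\<lambda>x. F x powr (r - 1) * F1 x e)" by (rule bi[OF c1 b1[OF e]])
    have "(LINT x|lborel. w' x e) = 0"
    proof (rule integral_directional_derivative_eq_0[OF w])
      show "continuous_on UNIV (\<lambda>x. w' x e)" unfolding eq by (intro continuous_intros kc Tc)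
      show "integrable lborel (\<lambda>x. w' x e)" unfolding eq using rd(3)[OF borel_measurable_continuous_onI[OF Tc]] Ti by simp
      show "integrable lborel w" unfolding w_def
        using rd(3)[OF borel_measurable_continuous_onI[OF c1[of "r - 1" e]]] wi by (simp add: mult_ac)
    qed
    then show ?thesis unfolding eq using rd(4)[OF borel_measurable_continuous_onI[OF Tc]] by simp
  qed
  have g: "(norm (grad F1 x))^2 = (\<Sum>e\<in>Basis. (F1 x e)^2)" for x by (rule grad_bounds(3)[of F1 x A, OF d(14) d(4) d(1)])
  have f1B: "F1 x (B x) = (\<Sum>e\<in>Basis. F1 x e * (e \<bullet> B x))" for x
    using linear_euclidean_sum[OF d(14)[of x], of "B x"] by (simp add: inner_commute mult.commute)
  have s1: "F x powr (r - 2) * (norm (grad F1 x))^2 = (\<Sum>e\<in>Basis. F x powr (r - 2) * (F1 x e)^2)" for x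
    by (simp add: g sum_distrib_left)
  have s2: "F x powr (r - 1) * (lap2 F2 x - F1 x (B x)) =
     (\<Sum>e\<in>Basis. F x powr (r - 1) * F2 x e e - F x powr (r - 1) * F1 x e * (e \<bullet> B x))" for x
    by (simp add: lap2_def f1B right_diff_distrib sum_distrib_left sum_subtractf mult.assoc)
  show "integrable \<mu> (\<lambda>x. F x powr (r - 1) * (lap2 F2 x - F1 x (B x)))"
    unfolding s2 using i2 i3 by (intro Bochner_Integration.integrable_sum Bochner_Integration.integrable_diff)
  show "integrable \<mu> (\<lambda>x. F x powr (r - 2) * (norm (grad F1 x))^2)"
    unfolding s1 using i1 by (intro Bochner_Integration.integrable_sum)
  have e0: "(LINT x|\<mu>. F x powr (r - 1) * F2 x e e - F x powr (r - 1) * F1 x e * (e \<bullet> B x)) =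
      (1 - r) * (LINT x|\<mu>. F x powr (r - 2) * (F1 x e)^2)" (is "?X = (1 - r) * ?G") if e: "e \<in> Basis" for e
  proof -
    have "(LINT x|\<mu>. T e x) = (LINT x|\<mu>. (r - 1) * (F x powr (r - 2) * (F1 x e)^2) +
        (F x powr (r - 1) * F2 x e e - F x powr (r - 1) * F1 x e * (e \<bullet> B x)))" by (simp add: T_def add_diff_eq)
    also have "... = (r - 1) * ?G + ?X" using i1[OF e] i2[OF e] i3[OF e]
      by (subst Bochner_Integration.integral_add) (auto intro: Bochner_Integration.integrable_diff)
    finally have "(r - 1) * ?G + ?X = 0" using Tz[OF e] by linarith
    then show ?thesis unfolding left_diff_distrib by linarith
  qed
  have "(LINT x|\<mu>. F x powr (r - 1) * (lap2 F2 x - F1 x (B x))) = (\<Sum>e\<in>Basis. (1 - r) * (LINT x|\<mu>. F x powr (r - 2) * (F1 x e)^2))"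
    unfolding s2
  proof (subst Bochner_Integration.integral_sum)
    show "integrable \<mu> (\<lambda>x. F x powr (r - 1) * F2 x e e - F x powr (r - 1) * F1 x e * (e \<bullet> B x))" if "e \<in> Basis" for e
      using i2[OF that] i3[OF that] by (rule Bochner_Integration.integrable_diff)
  qed (intro sum.cong refl e0)
  also have "... = (1 - r) * (LINT x|\<mu>. F x powr (r - 2) * (norm (grad F1 x))^2)"
    unfolding s1 using i1 by (subst Bochner_Integration.integral_sum) (simp_all add: sum_distrib_left)
  finally show "(LINT x|\<mu>. F x powr (r - 1) * (lap2 F2 x - F1 x (B x))) =
      (1 - r) * (LINT x|\<mu>. F x powr (r - 2) * (norm (grad F1 x))^2)" .
qed

text \<open>The inequality is applied to f^(p/2), whose squared gradient is p^2/4 f^(p-2) |grad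
  f|^2; the two-sided bound on f makes this an admissible function for every real p.\<close>

lemma lsi_powr:
  assumes f: "C2L A f f1 f2" and lb: "log_bounded \<mu> L f"
  shows "Ent \<mu> (\<lambda>x. (f x powr (p / 2))^2) <= p^2 / (4 * \<rho>) * (LINT x|\<mu>. f x powr (p - 2) * (norm (grad f1 x))^2)"
proof -
  note d = C2L_D[OF f] and l = log_boundedD[OF lb]
  define g where "g x = ((p / 2) * f x powr (p / 2 - 1)) *\<^sub>R grad f1 x" for x
  have pc: "continuous_on UNIV (\<lambda>x. f x powr s)" for s
    using l(2) by (intro continuous_intros d) (simp add: less_imp_neq[symmetric])
  have gd: "GDERIV (\<lambda>x. f x powr (p / 2)) x :> g x" for x
  proof -
    have "((\<lambda>z. z powr (p / 2)) has_real_derivative (p / 2) * f x powr (p / 2 - 1)) (at (f x))"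
      using l(2)[of x] by (auto intro!: derivative_eq_intros)
    from has_derivative_compose[OF d(2) this[unfolded has_field_derivative_def]]
    show ?thesis by (simp add: gderiv_def g_def inner_grad[of f1 x, OF d(14)])
  qed
  have pb: "f x powr s <= exp (\<bar>s\<bar> * L)" for x s by (rule l(6)) simp
  have gb: "norm (g x) <= \<bar>p / 2\<bar> * exp (\<bar>p / 2 - 1\<bar> * L) * A" for x
    unfolding g_def norm_scaleR abs_mult using pb[of x "p / 2 - 1"] grad_bounds(1)[of f1 x A, OF d(14) d(4) d(1)]
    by (intro mult_mono) auto
  have "\<rho> * Ent \<mu> (\<lambda>x. (f x powr (p / 2))^2) <= (LINT x|\<mu>. (norm (g x))^2)"
  proof (rule lsi[unfolded log_sobolev_def, rule_format], intro conjI allI gd)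
    show "continuous_on UNIV g" unfolding g_def grad_def by (intro continuous_intros pc d)
    show "bounded (range (\<lambda>x. f x powr (p / 2)))"
      using pb[of _ "p / 2"] by (auto simp: bounded_iff intro!: exI[of _ "exp (\<bar>p / 2\<bar> * L)"])
    show "bounded (range g)"
    proof (rule boundedI)
      fix v assume "v \<in> range g"
      then obtain x where "v = g x" by blast
      then show "norm v <= \<bar>p / 2\<bar> * exp (\<bar>p / 2 - 1\<bar> * L) * A" using gb[of x] by simp
    qed
  qed
  also have "(\<lambda>x. (norm (g x))^2) = (\<lambda>x. p^2 / 4 * (f x powr (p - 2) * (norm (grad f1 x))^2))"
  proof
    fix x
    have "(f x powr (p / 2 - 1))^2 = f x powr (p - 2)" by (simp add: power2_eq_square flip: powr_add)
    then show "(norm (g x))^2 = p^2 / 4 * (f x powr (p - 2) * (norm (grad f1 x))^2)"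
      by (simp add: g_def power_mult_distrib power_divide)
  qed
  finally have "\<rho> * Ent \<mu> (\<lambda>x. (f x powr (p / 2))^2) <= p^2 / 4 * (LINT x|\<mu>. f x powr (p - 2) * (norm (grad f1 x))^2)" by simp
  then show ?thesis using \<rho> by (simp add: field_simps)
qed

end

section \<open>One Euler step with a moving exponent\<close>

definition expansion_const :: "real => real => real" where
  "expansion_const R L = (R + 1) * exp ((R + 2) * L) * exp (R * L) +
     R * exp (2 * (R * L)) * ((R + 1) * exp ((R + 2) * L) * (2 * exp L) + exp ((R + 1) * L))^2 + exp (2 * L)"

lemma expansion_const_nonneg: "0 <= R ==> 0 <= expansion_const R L" by (simp add: expansion_const_def)

context gibbs_measure
begin

text \<open>The Dirichlet energy of \<phi>^(r/2) without its factor r^2/4, so that it remains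
  meaningful at r = 0.\<close>

definition energy :: "('a => 'a => real) => ('a => real) => real => real" where
  "energy \<phi>1 \<phi> r = (LINT x|\<mu>. \<phi> x powr (r - 2) * (norm (grad \<phi>1 x))^2)"

lemma integral_powr_mult_diff_le:
  assumes lb: "log_bounded \<mu> L g" and r: "\<bar>r\<bar> <= R"
    and f: "integrable \<mu> (\<lambda>x. g x powr r * f x)" and k: "integrable \<mu> k" "\<And>x. \<bar>f x\<bar> <= k x"
  shows "\<bar>\<integral>x. g x powr r * f x \<partial>\<mu>\<bar> <= exp (R * L) * (LINT x|\<mu>. k x)"
proof -
  have "\<bar>\<integral>x. g x powr r * f x \<partial>\<mu>\<bar> <= (LINT x|\<mu>. \<bar>g x powr r * f x\<bar>)" by (rule integral_abs_bound)
  also have "... <= (LINT x|\<mu>. exp (R * L) * k x)"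
  proof (rule integral_mono')
    show "integrable \<mu> (\<lambda>x. exp (R * L) * k x)" using k(1) by simp
    show "\<bar>g x powr r * f x\<bar> <= exp (R * L) * k x" for x
      unfolding abs_mult using log_boundedD(6)[OF lb r, of x] k(2)[of x] by (intro mult_mono) auto
    show "0 <= exp (R * L) * k x" for x using order_trans[OF abs_ge_zero k(2)[of x]] by simp
  qed
  finally show ?thesis by simp
qed

text \<open>The step adds t times the generator up to an error t^(3/2), and
  \<open>log_norm_function_expansion\<close> converts this into a change of the norm; its quadratic
  error is of order t^2. Everything is measured by t sqrt t, which is o(t), with a constant that
  sees the function only through A and L.\<close>

lemma function_step:
  fixes t :: real
  assumes f: "has_derivs3 h h1 h2 h3" "derivs_bounded A A A h1 h2 h3" "0 <= A"
    and lb: "log_bounded \<mu> L h" "log_bounded \<mu> L (euler_step t b h)" and t: "0 <= t" "t <= 1"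
    and b: "continuous_on UNIV b" "integrable \<mu> (\<lambda>x. (1 + norm (b x))^2)" "(LINT x|\<mu>. (1 + norm (b x))^2) <= S"
    and r: "\<bar>r\<bar> <= R"
  shows "\<bar>log_norm \<mu> r (euler_step t b h) - log_norm \<mu> r h -
      t * ((LINT x|\<mu>. h x powr (r - 1) * (lap2 h2 x - h1 x (b x))) / (LINT x|\<mu>. h x powr r))\<bar> <=
      (expansion_const R L * (2 * real DIM('a) * A)^2 * S +
       exp ((R + 1) * L) * exp (R * L) * (2 * real DIM('a) * A * (sqrt (2 * real DIM('a)) + S))) * (t * sqrt t)"
    and "integrable \<mu> (\<lambda>x. h x powr (r - 1) * (lap2 h2 x - h1 x (b x)))"
proof -
  note cl = C2L_D[OF C2L_of_derivs3[OF f]]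
  note d = log_boundedD[OF lb(1)]
  define D where "D = real DIM('a)"
  define u where "u = euler_step t b h"
  define n where "n x = norm (b x)" for x
  have R0: "0 <= R" using r by linarith
  have D0: "0 <= D" by (simp add: D_def)
  have ts: "t <= sqrt t" using t by (intro real_le_rsqrt) (auto simp: power2_eq_square mult_left_le)
  have pc: "continuous_on UNIV (\<lambda>x. h x powr s)" for s
    using d(2) by (intro continuous_intros cl) (simp add: less_imp_neq[symmetric])
  have um: "u \<in> borel_measurable \<mu>" unfolding u_def by (rule log_boundedD(1)[OF lb(2)])
  have Lc: "continuous_on UNIV (\<lambda>x. lap2 h2 x - h1 x (b x))"
  proof -
    have eq: "h1 x (b x) = (\<Sum>e\<in>Basis. (b x \<bullet> e) * h1 x e)" for x using linear_euclidean_sum[OF cl(14)[of x], of "b x"] by simp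
    show ?thesis unfolding eq lap2_def by (intro continuous_intros cl b)
  qed
  have nb: "n x <= (1 + n x)^2" "1 <= (1 + n x)^2" "1 + (n x)^2 <= (1 + n x)^2" for x
  proof -
    have "0 <= n x" by (simp add: n_def)
    then show "n x <= (1 + n x)^2" "1 <= (1 + n x)^2" "1 + (n x)^2 <= (1 + n x)^2" by (simp_all add: power2_eq_square algebra_simps)
  qed
  have ni: "integrable \<mu> (\<lambda>x. (1 + n x)^2)" using b(2) by (simp add: n_def)
  have S0: "(LINT x|\<mu>. (1 + n x)^2) <= S" using b(3) by (simp add: n_def)
  have Lb: "\<bar>lap2 h2 x - h1 x (b x)\<bar> <= (D * A + A) * (1 + n x)^2" for x
  proof -
    have "\<bar>lap2 h2 x - h1 x (b x)\<bar> <= D * A + A * n x" using lap2_bound[OF f(2), of x] cl(4)[of x "b x"] by (simp add: D_def n_def)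
    also have "... <= D * A * (1 + n x)^2 + A * (1 + n x)^2"
      using nb[of x] D0 f(3) mult_left_mono[of 1 "(1 + n x)^2" "D * A"] by (intro add_mono mult_left_mono) auto
    finally show ?thesis by (simp add: distrib_right)
  qed
  have iL: "integrable \<mu> (\<lambda>x. lap2 h2 x - h1 x (b x))"
    by (rule Bochner_Integration.integrable_bound[where f = "\<lambda>x. (D * A + A) * (1 + n x)^2"])
      (use ni measurable_continuous[OF Lc] Lb in \<open>auto intro!: AE_I2 order_trans[OF Lb abs_ge_self]\<close>)
  have ib: "integrable \<mu> (\<lambda>x. h x powr s * g x)" if g: "integrable \<mu> g" for s g
  proof (rule Bochner_Integration.integrable_bound[where f = "\<lambda>x. exp (\<bar>s\<bar> * L) * g x"])
    show "(\<lambda>x. h x powr s * g x) \<in> borel_measurable \<mu>" using g measurable_continuous[OF pc] by simp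
    show "AE x in \<mu>. norm (h x powr s * g x) <= norm (exp (\<bar>s\<bar> * L) * g x)"
      using d(6)[of s "\<bar>s\<bar>"] by (auto intro!: AE_I2 mult_right_mono simp: abs_mult)
  qed (use g in simp)
  show i2: "integrable \<mu> (\<lambda>x. h x powr (r - 1) * (lap2 h2 x - h1 x (b x)))" by (rule ib[OF iL])
  define E where "E x = u x - h x - t * (lap2 h2 x - h1 x (b x))" for x
  have diff: "\<bar>u x - h x\<bar> <= 2 * D * A * t * (1 + n x)" for x
    unfolding u_def D_def n_def by (rule euler_step_expansion(2)[OF f t(1)])
  have up: "h x <= exp L" "u x <= exp L" "0 < h x" "0 < u x" for x
    using ln_bound_interval[OF d(2)[of x], of L] d(2,3)[of x] log_boundedD(2,3)[OF lb(2), of x]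
      ln_bound_interval[of "u x" L] by (auto simp: u_def)
  have di: "integrable \<mu> (\<lambda>x. u x - h x)"
  proof (rule integrable_bounded)
    show "\<bar>u x - h x\<bar> <= exp L" for x using up[of x] by linarith
  qed (use um d(1) in simp)
  define c where "c = 2 * D * A"
  have c0: "0 <= c" using D0 f(3) by (simp add: c_def)
  have Eb: "\<bar>E x\<bar> <= c * (t * sqrt t) * (sqrt (2 * D) + (1 + n x)^2)" for x
  proof -
    have "\<bar>E x\<bar> <= 2 * D * A * t * (sqrt (2 * D * t) + t * (1 + (n x)^2))"
      unfolding E_def u_def D_def n_def by (rule euler_step_expansion(1)[OF f t(1)])
    also have "... <= 2 * D * A * t * (sqrt t * sqrt (2 * D) + sqrt t * (1 + n x)^2)"
      using nb(3)[of x] t ts D0 f(3) by (intro mult_left_mono add_mono mult_mono) (auto simp: real_sqrt_mult)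
    finally show ?thesis by (simp add: c_def algebra_simps)
  qed
  have Ei: "integrable \<mu> E" unfolding E_def using di iL by simp
  define X where "X = (LINT x|\<mu>. h x powr (r - 1) * (u x - h x))"
  define Y where "Y = (LINT x|\<mu>. h x powr (r - 1) * (lap2 h2 x - h1 x (b x)))"
  define N where "N = (LINT x|\<mu>. h x powr r)"
  have N0: "0 < N" unfolding N_def by (rule log_bounded_powr(4)[OF lb(1)])
  have N1: "1 / N <= exp (R * L)"
  proof -
    have "1 / N <= 1 / exp (- (R * L))" using log_bounded_powr(2)[OF lb(1) r] N0 by (intro divide_left_mono) (auto simp: N_def)
    then show ?thesis by (simp add: exp_minus field_simps)
  qed
  have XY: "X - t * Y = (LINT x|\<mu>. h x powr (r - 1) * E x)" unfolding X_def Y_def E_def using ib[OF di, of "r - 1"] i2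
    by (simp add: right_diff_distrib[of _ "_ - _" "t * _"] mult.left_commute)
  have kk: "integrable \<mu> (\<lambda>x. c * (t * sqrt t) * (sqrt (2 * D) + (1 + n x)^2))" using ni by simp
  have r1: "\<bar>r - 1\<bar> <= R + 1" using r by linarith
  have "\<bar>X - t * Y\<bar> <= exp ((R + 1) * L) * (LINT x|\<mu>. c * (t * sqrt t) * (sqrt (2 * D) + (1 + n x)^2))"
    unfolding XY by (rule integral_powr_mult_diff_le[OF lb(1) r1 ib[OF Ei] kk Eb])
  also have "(LINT x|\<mu>. c * (t * sqrt t) * (sqrt (2 * D) + (1 + n x)^2)) =
      c * (t * sqrt t) * (sqrt (2 * D) + (LINT x|\<mu>. (1 + n x)^2))" using ni by (simp add: prob_space)
  also have "exp ((R + 1) * L) * ... <= exp ((R + 1) * L) * (c * (t * sqrt t) * (sqrt (2 * D) + S))"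
    using S0 c0 t by (intro mult_left_mono add_left_mono) auto
  finally have XYb: "\<bar>X - t * Y\<bar> <= exp ((R + 1) * L) * (c * (t * sqrt t) * (sqrt (2 * D) + S))" .
  have "\<bar>X / N - t * (Y / N)\<bar> = \<bar>X - t * Y\<bar> * (1 / N)" using N0 by (simp add: abs_divide flip: diff_divide_distrib)
  also have "... <= (exp ((R + 1) * L) * (c * (t * sqrt t) * (sqrt (2 * D) + S))) * exp (R * L)"
    using XYb N1 N0 order_trans[OF abs_ge_zero XYb] by (intro mult_mono) auto
  finally have 1: "\<bar>X / N - t * (Y / N)\<bar> <= exp ((R + 1) * L) * exp (R * L) * (c * (sqrt (2 * D) + S)) * (t * sqrt t)"
    by (simp add: mult_ac)
  have "(LINT x|\<mu>. (u x - h x)^2) <= (LINT x|\<mu>. c^2 * (t * sqrt t) * (1 + n x)^2)"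
  proof (rule integral_mono')
    show "integrable \<mu> (\<lambda>x. c^2 * (t * sqrt t) * (1 + n x)^2)" using ni by simp
    fix x
    have "(u x - h x)^2 = \<bar>u x - h x\<bar>^2" by simp
    also have "... <= (c * t * (1 + n x))^2" using diff[of x] by (intro power_mono) (auto simp: c_def)
    also have "... = c^2 * (t * t) * (1 + n x)^2" by (simp add: power2_eq_square mult_ac)
    also have "... <= c^2 * (t * sqrt t) * (1 + n x)^2" using t ts by (intro mult_right_mono mult_left_mono) auto
    finally show "(u x - h x)^2 <= c^2 * (t * sqrt t) * (1 + n x)^2" .
  qed (use t in auto)
  also have "... <= c^2 * (t * sqrt t) * S" using S0 t by (simp add: mult_left_mono)
  finally have sq: "(LINT x|\<mu>. (u x - h x)^2) <= c^2 * (t * sqrt t) * S" .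
  have "\<bar>log_norm \<mu> r u - log_norm \<mu> r h - X / N\<bar> <= expansion_const R L * (LINT x|\<mu>. (u x - h x)^2)"
    unfolding expansion_const_def X_def N_def by (rule log_norm_function_expansion[OF lb(1) lb(2)[folded u_def] r])
  also have "... <= expansion_const R L * (c^2 * (t * sqrt t) * S)" by (intro mult_left_mono sq expansion_const_nonneg R0)
  finally have 2: "\<bar>log_norm \<mu> r u - log_norm \<mu> r h - X / N\<bar> <= expansion_const R L * c^2 * S * (t * sqrt t)" by (simp add: mult_ac)
  have "\<bar>log_norm \<mu> r u - log_norm \<mu> r h - t * (Y / N)\<bar> <=
     (expansion_const R L * c^2 * S + exp ((R + 1) * L) * exp (R * L) * (c * (sqrt (2 * D) + S))) * (t * sqrt t)"
    using 1 2 unfolding distrib_right by linarith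
  then show "\<bar>log_norm \<mu> r (euler_step t b h) - log_norm \<mu> r h -
      t * ((LINT x|\<mu>. h x powr (r - 1) * (lap2 h2 x - h1 x (b x))) / (LINT x|\<mu>. h x powr r))\<bar> <=
      (expansion_const R L * (2 * real DIM('a) * A)^2 * S +
       exp ((R + 1) * L) * exp (R * L) * (2 * real DIM('a) * A * (sqrt (2 * real DIM('a)) + S))) * (t * sqrt t)"
    by (simp add: u_def Y_def N_def c_def D_def)
qed

text \<open>By log-Sobolev the slope of the log norm at an exponent p is at most G(p) / (4 \<rho>
  N(p)), G being the weighted energy. The ratio is replaced by its value at \<open>r\<close>, the
  exponent at which the generator is evaluated; this costs a multiple of |r - r'|, hence a
  second-order term in the end.\<close>

lemma exponent_step:
  assumes f: "C2L A f f1 f2" and lb: "log_bounded \<mu> L f" and r: "\<bar>r\<bar> <= R" "\<bar>r'\<bar> <= R"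
  shows "\<bar>log_norm \<mu> r f - log_norm \<mu> r' f\<bar> <= \<bar>r - r'\<bar> * ((energy f1 f r / (LINT x|\<mu>. f x powr r) +
      (A^2 * (L * exp ((R + 2) * L)) * exp (R * L) + exp ((R + 2) * L) * A^2 * (L * exp (R * L)) * (exp (R * L) * exp (R * L))) * \<bar>r - r'\<bar>) / (4 * \<rho>))"
proof -
  note d = C2L_D[OF f] and l = log_boundedD[OF lb]
  define N where "N p = (LINT x|\<mu>. f x powr p)" for p
  define G where "G p = energy f1 f p" for p
  \<comment> \<open>First summand: the variation of G in the exponent times a bound for 1/N. Second
    summand: a bound for G, times the variation of N, times a bound for 1/N^2.\<close>
  define K where "K = A^2 * (L * exp ((R + 2) * L)) * exp (R * L) + exp ((R + 2) * L) * A^2 * (L * exp (R * L)) * (exp (R * L) * exp (R * L))"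
  have L0: "0 <= L" by (rule l(4))
  have K0: "0 <= K" unfolding K_def using L0 by simp
  have N0: "0 < N p" for p unfolding N_def by (rule log_bounded_powr(4)[OF lb])
  have N1: "1 / N p <= exp (R * L)" if "\<bar>p\<bar> <= R" for p
  proof -
    have "1 / N p <= 1 / exp (- (R * L))" using log_bounded_powr(2)[OF lb that] N0 by (intro divide_left_mono) (auto simp: N_def)
    then show ?thesis by (simp add: exp_minus field_simps)
  qed
  have g2: "(norm (grad f1 x))^2 <= A^2" for x using grad_bounds(1)[of f1 x A, OF d(14) d(4) d(1)] by (intro power_mono) auto
  note Gi = integral_generator(3)[OF f lb]
  have G0: "0 <= G p" for p unfolding G_def energy_def by (intro integral_nonneg_AE) auto
  have Gb: "G p <= exp ((R + 2) * L) * A^2" if "\<bar>p\<bar> <= R" for p unfolding G_def energy_def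
  proof (rule integral_between(2)[OF Gi])
    have "\<bar>p - 2\<bar> <= R + 2" using that by linarith
    then show "f x powr (p - 2) * (norm (grad f1 x))^2 <= exp ((R + 2) * L) * A^2" for x
      using l(6)[of "p - 2" "R + 2" x] g2[of x] by (intro mult_mono) auto
    show "0 <= f x powr (p - 2) * (norm (grad f1 x))^2" for x by simp
  qed
  have Gd: "\<bar>G p - G r\<bar> <= A^2 * (L * exp ((R + 2) * L)) * \<bar>p - r\<bar>" if p: "\<bar>p\<bar> <= R" for p
  proof -
    have eq: "G p - G r = (LINT x|\<mu>. f x powr (p - 2) * (norm (grad f1 x))^2 - f x powr (r - 2) * (norm (grad f1 x))^2)"
      using Gi[of p] Gi[of r] by (simp add: G_def energy_def)
    have "\<bar>G p - G r\<bar> <= (LINT x|\<mu>. \<bar>f x powr (p - 2) * (norm (grad f1 x))^2 - f x powr (r - 2) * (norm (grad f1 x))^2\<bar>)"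
      unfolding eq by (rule integral_abs_bound)
    also have "... <= (LINT x|\<mu>. A^2 * (L * exp ((R + 2) * L)) * \<bar>p - r\<bar>)"
    proof (rule integral_mono')
      fix x
      have "\<bar>r - 2\<bar> <= R + 2" "\<bar>p - 2\<bar> <= R + 2" using p r by linarith+
      from powr_exponent_taylor(2)[OF l(2,3) this, of x]
      have "\<bar>f x powr (p - 2) - f x powr (r - 2)\<bar> <= L * exp ((R + 2) * L) * \<bar>p - r\<bar>" by simp
      then have "\<bar>f x powr (p - 2) - f x powr (r - 2)\<bar> * (norm (grad f1 x))^2 <= (L * exp ((R + 2) * L) * \<bar>p - r\<bar>) * A^2"
        using g2[of x] L0 by (intro mult_mono) auto
      moreover have "\<bar>f x powr (p - 2) * (norm (grad f1 x))^2 - f x powr (r - 2) * (norm (grad f1 x))^2\<bar> =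
          \<bar>f x powr (p - 2) - f x powr (r - 2)\<bar> * (norm (grad f1 x))^2" by (simp add: abs_mult flip: left_diff_distrib)
      ultimately show "\<bar>f x powr (p - 2) * (norm (grad f1 x))^2 - f x powr (r - 2) * (norm (grad f1 x))^2\<bar> <=
          A^2 * (L * exp ((R + 2) * L)) * \<bar>p - r\<bar>" by (simp add: mult_ac)
    qed (use L0 in auto)
    finally show ?thesis by (simp add: prob_space)
  qed
  have Nd: "\<bar>N p - N r\<bar> <= L * exp (R * L) * \<bar>p - r\<bar>" if p: "\<bar>p\<bar> <= R" for p
  proof -
    have eq: "N p - N r = (LINT x|\<mu>. f x powr p - f x powr r)" using log_bounded_powr(1)[OF lb] by (simp add: N_def)
    have "\<bar>N p - N r\<bar> <= (LINT x|\<mu>. \<bar>f x powr p - f x powr r\<bar>)" unfolding eq by (rule integral_abs_bound)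
    also have "... <= (LINT x|\<mu>. L * exp (R * L) * \<bar>p - r\<bar>)"
      by (rule integral_mono') (use powr_exponent_taylor(2)[OF l(2,3) r(1) p] L0 in auto)
    finally show ?thesis by (simp add: prob_space)
  qed
  have ratio: "G p / N p <= G r / N r + K * \<bar>r - r'\<bar>" if p: "\<bar>p\<bar> <= R" "\<bar>p - r\<bar> <= \<bar>r - r'\<bar>" for p
  proof -
    have "G p / N p - G r / N r = (G p - G r) * (1 / N p) + G r * (N r - N p) * ((1 / N p) * (1 / N r))"
      using N0[of p] N0[of r] by (simp add: field_simps)
    also have "... <= (A^2 * (L * exp ((R + 2) * L)) * \<bar>p - r\<bar>) * exp (R * L) +
        (exp ((R + 2) * L) * A^2) * (L * exp (R * L) * \<bar>p - r\<bar>) * (exp (R * L) * exp (R * L))"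
    proof (intro add_mono)
      have "(G p - G r) * (1 / N p) <= \<bar>G p - G r\<bar> * (1 / N p)" using N0[of p] by (intro mult_right_mono) auto
      also have "... <= (A^2 * (L * exp ((R + 2) * L)) * \<bar>p - r\<bar>) * exp (R * L)"
        using Gd[OF p(1)] N1[OF p(1)] N0[of p] L0 by (intro mult_mono) auto
      finally show "(G p - G r) * (1 / N p) <= (A^2 * (L * exp ((R + 2) * L)) * \<bar>p - r\<bar>) * exp (R * L)" .
      have "G r * (N r - N p) <= G r * \<bar>N p - N r\<bar>" using G0[of r] by (intro mult_left_mono) auto
      also have "... <= (exp ((R + 2) * L) * A^2) * (L * exp (R * L) * \<bar>p - r\<bar>)"
        using Gb[OF r(1)] Nd[OF p(1)] G0[of r] by (intro mult_mono) auto
      finally have a: "G r * (N r - N p) <= (exp ((R + 2) * L) * A^2) * (L * exp (R * L) * \<bar>p - r\<bar>)" .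
      have b: "(1 / N p) * (1 / N r) <= exp (R * L) * exp (R * L)"
        using N1[OF p(1)] N1[OF r(1)] N0[of p] N0[of r] by (intro mult_mono) auto
      have "G r * (N r - N p) * ((1 / N p) * (1 / N r)) <= (exp ((R + 2) * L) * A^2) * (L * exp (R * L) * \<bar>p - r\<bar>) * ((1 / N p) * (1 / N r))"
        using N0[of p] N0[of r] by (intro mult_right_mono a) auto
      also have "... <= (exp ((R + 2) * L) * A^2) * (L * exp (R * L) * \<bar>p - r\<bar>) * (exp (R * L) * exp (R * L))"
        using L0 by (intro mult_left_mono b) auto
      finally show "G r * (N r - N p) * ((1 / N p) * (1 / N r)) <=
          (exp ((R + 2) * L) * A^2) * (L * exp (R * L) * \<bar>p - r\<bar>) * (exp (R * L) * exp (R * L))" .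
    qed
    also have "... = K * \<bar>p - r\<bar>" by (simp add: K_def algebra_simps)
    also have "... <= K * \<bar>r - r'\<bar>" using p(2) K0 by (intro mult_left_mono)
    finally show ?thesis by simp
  qed
  define Bd where "Bd = (G r / N r + K * \<bar>r - r'\<bar>) / (4 * \<rho>)"
  have Bd0: "0 <= Bd" unfolding Bd_def using G0[of r] N0[of r] K0 \<rho> by simp
  have ent: "Ent \<mu> (\<lambda>x. (f x powr (p / 2))^2) <= Bd * (p^2 * N p)"
    if p: "p \<in> {min r r'..max r r'}" for p
  proof -
    have p': "\<bar>p\<bar> <= R" "\<bar>p - r\<bar> <= \<bar>r - r'\<bar>" using p r by (auto simp: min_def max_def split: if_splits)
    have "Ent \<mu> (\<lambda>x. (f x powr (p / 2))^2) <= p^2 / (4 * \<rho>) * G p" unfolding G_def energy_def by (rule lsi_powr[OF f lb])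
    also have "... = p^2 / (4 * \<rho>) * (N p * (G p / N p))" using N0[of p] by simp
    also have "... <= p^2 / (4 * \<rho>) * (N p * (G r / N r + K * \<bar>r - r'\<bar>))"
      using ratio[OF p'] N0[of p] \<rho> by (intro mult_left_mono) auto
    finally show ?thesis by (simp add: Bd_def mult_ac)
  qed
  have "log_norm \<mu> (min r r') f <= log_norm \<mu> (max r r') f \<and>
      log_norm \<mu> (max r r') f - log_norm \<mu> (min r r') f <= Bd * (max r r' - min r r')"
    using log_norm_exponent_bounds[OF lb _ Bd0, of "min r r'" "max r r'"] ent by (auto simp: N_def)
  then have "\<bar>log_norm \<mu> r f - log_norm \<mu> r' f\<bar> <= \<bar>r - r'\<bar> * Bd" by (auto simp: min_def max_def mult.commute split: if_splits)
  then show ?thesis by (simp only: Bd_def G_def N_def K_def)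
qed

text \<open>The drift b is compared with the drift B of the Gibbs measure. The part with B gives -|r
  - 1| G by \<open>integral_generator\<close>; the difference, at most w, is split by Young's
  inequality with weight c = \<epsilon> |r - 1|. The sign s of r - 1 merges the cases r > 1 and r <
  1.\<close>

lemma generator_step:
  assumes \<phi>: "C2L A \<phi> \<phi>1 \<phi>2" and lb: "log_bounded \<mu> L \<phi>"
    and i: "integrable \<mu> (\<lambda>x. \<phi> x powr (r - 1) * (lap2 \<phi>2 x - \<phi>1 x (b x)))"
    and w: "\<And>x. norm (b x - B x) <= w" and \<epsilon>: "0 < \<epsilon>" and r: "(s = 1 \<and> 1 < r) \<or> (s = - 1 \<and> r < (1::real))"
  shows "s * ((LINT x|\<mu>. \<phi> x powr (r - 1) * (lap2 \<phi>2 x - \<phi>1 x (b x))) / (LINT x|\<mu>. \<phi> x powr r)) <=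
     - ((1 - \<epsilon>) * \<bar>r - 1\<bar> * (energy \<phi>1 \<phi> r / (LINT x|\<mu>. \<phi> x powr r))) + w^2 / (4 * \<epsilon> * \<bar>r - 1\<bar>)"
proof -
  note d = C2L_D[OF \<phi>] and l = log_boundedD[OF lb]
  define N where "N = (LINT x|\<mu>. \<phi> x powr r)"
  define G where "G = energy \<phi>1 \<phi> r"
  define c where "c = \<epsilon> * \<bar>r - 1\<bar>"
  have c0: "0 < c" using \<epsilon> r by (auto simp: c_def)
  have N0: "0 < N" unfolding N_def by (rule log_bounded_powr(4)[OF lb])
  note ig = integral_generator[OF \<phi> lb, of r]
  have iN: "integrable \<mu> (\<lambda>x. \<phi> x powr r)" by (rule log_bounded_powr(1)[OF lb])
  have split: "\<phi> x powr (r - 1) * (lap2 \<phi>2 x - \<phi>1 x (b x)) =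
      \<phi> x powr (r - 1) * (lap2 \<phi>2 x - \<phi>1 x (B x)) + \<phi> x powr (r - 1) * \<phi>1 x (B x - b x)" for x
    by (simp add: linear_diff[OF d(14)] algebra_simps)
  have iD: "integrable \<mu> (\<lambda>x. \<phi> x powr (r - 1) * \<phi>1 x (B x - b x))"
    using Bochner_Integration.integrable_diff[OF i ig(2)] unfolding split by simp
  have pt: "s * (\<phi> x powr (r - 1) * \<phi>1 x (B x - b x)) <=
      c * (\<phi> x powr (r - 2) * (norm (grad \<phi>1 x))^2) + w^2 / (4 * c) * \<phi> x powr r" for x
  proof -
    define p where "p = \<phi> x powr (r - 2)"
    have p0: "0 <= p" by (simp add: p_def)
    have p1: "\<phi> x powr (r - 1) = p * \<phi> x" "\<phi> x powr r = p * (\<phi> x)^2"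
      using l(2)[of x] powr_add[of "\<phi> x" "r - 2" 1] powr_add[of "\<phi> x" "r - 2" 2] by (simp_all add: p_def)
    define g where "g = norm (grad \<phi>1 x)"
    have "\<bar>\<phi>1 x (B x - b x)\<bar> <= g * norm (B x - b x)" unfolding g_def by (rule grad_bounds(2)[of \<phi>1 x A, OF d(14) d(4) d(1)])
    also have "... <= g * w" using w[of x] by (intro mult_left_mono) (auto simp: g_def norm_minus_commute)
    finally have gw: "\<bar>\<phi>1 x (B x - b x)\<bar> <= g * w" .
    have s: "s * z <= \<bar>z\<bar>" for z using r by auto
    have p\<phi>: "0 <= p * \<phi> x" using p0 l(2)[of x] by simp
    have "s * (\<phi> x powr (r - 1) * \<phi>1 x (B x - b x)) = p * \<phi> x * (s * \<phi>1 x (B x - b x))" unfolding p1 by (simp only: mult_ac)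
    also have "... <= p * \<phi> x * \<bar>\<phi>1 x (B x - b x)\<bar>" by (rule mult_left_mono[OF s p\<phi>])
    also have "... <= p * \<phi> x * (g * w)" using gw p0 l(2)[of x] by (intro mult_left_mono) auto
    also have "... = p * (\<phi> x * (g * w))" by (simp add: mult_ac)
    also have "... <= p * (c * g^2 + w^2 / (4 * c) * (\<phi> x)^2)"
    proof (rule mult_left_mono[OF _ p0])
      have "0 <= (2 * c * g - w * \<phi> x)^2 / (4 * c)" using c0 by simp
      also have "... = c * g^2 + w^2 / (4 * c) * (\<phi> x)^2 - \<phi> x * (g * w)" using c0 by (simp add: field_simps power2_eq_square)
      finally show "\<phi> x * (g * w) <= c * g^2 + w^2 / (4 * c) * (\<phi> x)^2" by simp
    qed
    also have "... = c * (p * g^2) + w^2 / (4 * c) * (p * (\<phi> x)^2)" by (simp add: algebra_simps)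
    finally show ?thesis unfolding p1(2)[symmetric] g_def[symmetric] p_def[symmetric] .
  qed
  have "s * (LINT x|\<mu>. \<phi> x powr (r - 1) * \<phi>1 x (B x - b x)) = (LINT x|\<mu>. s * (\<phi> x powr (r - 1) * \<phi>1 x (B x - b x)))" by simp
  also have "... <= (LINT x|\<mu>. c * (\<phi> x powr (r - 2) * (norm (grad \<phi>1 x))^2) + w^2 / (4 * c) * \<phi> x powr r)"
  proof (rule integral_mono)
    show "integrable \<mu> (\<lambda>x. s * (\<phi> x powr (r - 1) * \<phi>1 x (B x - b x)))" using iD by simp
    show "integrable \<mu> (\<lambda>x. c * (\<phi> x powr (r - 2) * (norm (grad \<phi>1 x))^2) + w^2 / (4 * c) * \<phi> x powr r)"
      using ig(3) iN by (intro Bochner_Integration.integrable_add integrable_mult_right)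
  qed (rule pt)
  also have "... = c * G + w^2 / (4 * c) * N"
    using ig(3) iN by (subst Bochner_Integration.integral_add) (auto simp: G_def N_def energy_def)
  finally have drift: "s * (LINT x|\<mu>. \<phi> x powr (r - 1) * \<phi>1 x (B x - b x)) <= c * G + w^2 / (4 * c) * N" .
  have main: "s * (LINT x|\<mu>. \<phi> x powr (r - 1) * (lap2 \<phi>2 x - \<phi>1 x (b x))) <= - (\<bar>r - 1\<bar> * G) + (c * G + w^2 / (4 * c) * N)"
  proof -
    have "(LINT x|\<mu>. \<phi> x powr (r - 1) * (lap2 \<phi>2 x - \<phi>1 x (b x))) = (1 - r) * G + (LINT x|\<mu>. \<phi> x powr (r - 1) * \<phi>1 x (B x - b x))"
      unfolding split using Bochner_Integration.integral_add[OF ig(2) iD] ig(1) by (simp add: G_def energy_def)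
    moreover have "s * ((1 - r) * G) = - (\<bar>r - 1\<bar> * G)" using r by (auto simp: algebra_simps)
    ultimately show ?thesis using drift by (simp add: distrib_left)
  qed
  have "s * ((LINT x|\<mu>. \<phi> x powr (r - 1) * (lap2 \<phi>2 x - \<phi>1 x (b x))) / N) =
      (s * (LINT x|\<mu>. \<phi> x powr (r - 1) * (lap2 \<phi>2 x - \<phi>1 x (b x)))) / N" by simp
  also have "... <= (- (\<bar>r - 1\<bar> * G) + (c * G + w^2 / (4 * c) * N)) / N" using main N0 by (intro divide_right_mono) auto
  also have "... = - ((1 - \<epsilon>) * \<bar>r - 1\<bar> * (G / N)) + w^2 / (4 * c)"
  proof -
    have eq: "(- (\<bar>r - 1\<bar> * G) + (c * G + y * N)) / N = - ((\<bar>r - 1\<bar> - c) * (G / N)) + y" for y using N0 by (simp add: field_simps)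
    have "\<bar>r - 1\<bar> - c = (1 - \<epsilon>) * \<bar>r - 1\<bar>" by (simp add: c_def left_diff_distrib)
    then show ?thesis by (simp only: eq)
  qed
  finally show ?thesis by (simp add: N_def G_def c_def mult.assoc)
qed

text \<open>The constants of \<open>function_step\<close> and of \<open>exponent_step\<close>; the
  latter is weighted by the squared speed of the exponent, for which (R + 1) \<beta> is a
  bound.\<close>

definition step_const :: "real => real => real => real => real => real" where
  "step_const A L R S \<beta> = expansion_const R L * (2 * real DIM('a) * A)^2 * S +
       exp ((R + 1) * L) * exp (R * L) * (2 * real DIM('a) * A * (sqrt (2 * real DIM('a)) + S)) +
     (A^2 * (L * exp ((R + 2) * L)) * exp (R * L) + exp ((R + 2) * L) * A^2 * (L * exp (R * L)) * (exp (R * L) * exp (R * L))) / (4 * \<rho>) *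
      ((R + 1) * \<beta>)^2"

text \<open>Here the speed of the exponent is explained: a shift by |r - 1| 4 (1 - \<epsilon>)
  \<rho> t costs t (1 - \<epsilon>) |r - 1| G by log-Sobolev, exactly the energy that
  \<open>generator_step\<close> leaves unspent. Only the drift term and an o(t) remain.\<close>

lemma log_norm_euler_step:
  fixes t :: real
  assumes f: "has_derivs3 g g1 g2 g3" "derivs_bounded A A A g1 g2 g3" "0 <= A"
    and lb: "log_bounded \<mu> L g" "log_bounded \<mu> L (euler_step t b g)" and t: "0 <= t" "t <= 1"
    and b: "continuous_on UNIV b" "integrable \<mu> (\<lambda>x. (1 + norm (b x))^2)" "(LINT x|\<mu>. (1 + norm (b x))^2) <= S"
    and w: "\<And>x. norm (b x - B x) <= w" and \<epsilon>: "0 < \<epsilon>" "\<epsilon> <= 1"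
    and r: "(s = 1 \<and> 1 < r) \<or> (s = - 1 \<and> r < (1::real))" "\<bar>r\<bar> <= R" "\<bar>r'\<bar> <= R"
    and rr: "\<bar>r - r'\<bar> <= \<bar>r - 1\<bar> * (4 * (1 - \<epsilon>) * \<rho>) * t"
  shows "s * (log_norm \<mu> r (euler_step t b g) - log_norm \<mu> r' g) <=
    t * (w^2 / (4 * \<epsilon> * \<bar>r - 1\<bar>)) + step_const A L R S (4 * (1 - \<epsilon>) * \<rho>) * (t * sqrt t)"
proof -
  note C = C2L_of_derivs3[OF f]
  define h where "h = euler_step t b g"
  define N where "N = (LINT x|\<mu>. g x powr r)"
  define Y where "Y = (LINT x|\<mu>. g x powr (r - 1) * (lap2 g2 x - g1 x (b x))) / N"
  define G where "G = energy g1 g r / N"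
  define c where "c = 4 * (1 - \<epsilon>) * \<rho>"
  define K1 where "K1 = expansion_const R L * (2 * real DIM('a) * A)^2 * S +
       exp ((R + 1) * L) * exp (R * L) * (2 * real DIM('a) * A * (sqrt (2 * real DIM('a)) + S))"
  define K2 where "K2 = (A^2 * (L * exp ((R + 2) * L)) * exp (R * L) + exp ((R + 2) * L) * A^2 * (L * exp (R * L)) * (exp (R * L) * exp (R * L)))"
  have L0: "0 <= L" by (rule log_boundedD(4)[OF lb(1)])
  have K20: "0 <= K2" using L0 by (simp add: K2_def)
  have N0: "0 < N" unfolding N_def by (rule log_bounded_powr(4)[OF lb(1)])
  have G0: "0 <= G" unfolding G_def energy_def using N0 by (intro divide_nonneg_pos integral_nonneg_AE) auto
  have c0: "0 <= c" using \<epsilon> \<rho> by (simp add: c_def)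
  have ts: "t <= sqrt t" using t by (intro real_le_rsqrt) (auto simp: power2_eq_square mult_left_le)
  note fs = function_step[OF f lb t b r(2)]
  have s: "s * z <= \<bar>z\<bar>" for z using r by auto
  have 1: "s * (log_norm \<mu> r h - log_norm \<mu> r g - t * Y) <= K1 * (t * sqrt t)"
    by (rule order_trans[OF s]) (use fs(1) in \<open>simp only: h_def Y_def N_def K1_def\<close>)
  have "s * Y <= - ((1 - \<epsilon>) * \<bar>r - 1\<bar> * G) + w^2 / (4 * \<epsilon> * \<bar>r - 1\<bar>)"
    unfolding Y_def N_def G_def by (rule generator_step[OF C lb(1) fs(2) w \<epsilon>(1) r(1)])
  from mult_left_mono[OF this t(1)]
  have 2: "s * (t * Y) <= - (t * ((1 - \<epsilon>) * \<bar>r - 1\<bar> * G)) + t * (w^2 / (4 * \<epsilon> * \<bar>r - 1\<bar>))" by (simp add: algebra_simps)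
  define x where "x = \<bar>r - r'\<bar>"
  have x0: "0 <= x" by (simp add: x_def)
  have x1: "x <= \<bar>r - 1\<bar> * c * t" using rr by (simp add: x_def c_def)
  have "\<bar>r - 1\<bar> * c * t <= (R + 1) * c * t" using r(2) c0 t by (intro mult_right_mono) auto
  then have x2: "x^2 <= ((R + 1) * c * t)^2" using x0 x1 by (intro power_mono) auto
  have "s * (log_norm \<mu> r g - log_norm \<mu> r' g) <= x * ((G + K2 * x) / (4 * \<rho>))" by (rule order_trans[OF s])
      (use exponent_step[OF C lb(1) r(2,3)] in \<open>simp only: x_def G_def K2_def N_def\<close>)
  also have "... = x * (G / (4 * \<rho>)) + K2 / (4 * \<rho>) * x^2" using \<rho> by (simp add: field_simps power2_eq_square)
  also have "... <= (\<bar>r - 1\<bar> * c * t) * (G / (4 * \<rho>)) + K2 / (4 * \<rho>) * ((R + 1) * c * t)^2"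
    using x1 x2 G0 K20 \<rho> by (intro add_mono mult_right_mono mult_left_mono) auto
  also have "(\<bar>r - 1\<bar> * c * t) * (G / (4 * \<rho>)) = t * ((1 - \<epsilon>) * \<bar>r - 1\<bar> * G)" using \<rho> by (simp add: c_def)
  also have "K2 / (4 * \<rho>) * ((R + 1) * c * t)^2 = K2 / (4 * \<rho>) * ((R + 1) * c)^2 * (t * t)"
    by (simp add: power2_eq_square mult_ac)
  also have "... <= K2 / (4 * \<rho>) * ((R + 1) * c)^2 * (t * sqrt t)" using K20 \<rho> t ts by (intro mult_left_mono) auto
  finally have 3: "s * (log_norm \<mu> r g - log_norm \<mu> r' g) <= t * ((1 - \<epsilon>) * \<bar>r - 1\<bar> * G) + K2 / (4 * \<rho>) * ((R + 1) * c)^2 * (t * sqrt t)"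
    by simp
  have "s * (log_norm \<mu> r h - log_norm \<mu> r' g) = s * (log_norm \<mu> r h - log_norm \<mu> r g - t * Y) + s * (t * Y) +
      s * (log_norm \<mu> r g - log_norm \<mu> r' g)" by (simp add: algebra_simps)
  also have "... <= t * (w^2 / (4 * \<epsilon> * \<bar>r - 1\<bar>)) + (K1 + K2 / (4 * \<rho>) * ((R + 1) * c)^2) * (t * sqrt t)"
    using 1 2 3 unfolding distrib_right by linarith
  finally show ?thesis by (simp only: h_def step_const_def K1_def K2_def c_def)
qed

end

section \<open>Euler steps along the flow\<close>

lemma test_function_derivs:
  assumes g: "C2L A g g1 g2"
  shows "iter_deriv [v] g x = g1 x v" "laplacian g x = lap2 g2 x"
proof -
  note d = C2L_D[OF g]
  have 1: "frechet_derivative g (at x) = g1 x" for x using frechet_derivative_at[OF d(2)] by simp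
  show *: "iter_deriv [v] g x = g1 x v" for v x by (simp add: 1)
  have "frechet_derivative (\<lambda>x. g1 x v) (at x) = g2 x v" for x v using frechet_derivative_at[OF d(3)] by simp
  then have "iter_deriv [w, v] g x = g2 x v w" for v w x by (simp add: 1)
  then show "laplacian g x = lap2 g2 x" by (simp only: laplacian_def lap2_def)
qed

lemma C3_drift:
  fixes b :: "'a::euclidean_space => 'a"
  assumes "C3 M b"
  shows "continuous_on UNIV b" "norm (b x - b y) <= M * dist x y" "norm (b x) <= (norm (b 0) + M) * (1 + norm x)" "0 <= M"
proof -
  obtain b1 b2 b3 where b: "has_derivs3 b b1 b2 b3" "derivs_bounded M M M b1 b2 b3" "0 <= M" using assms by (auto simp: C3_def)
  show M: "0 <= M" by (rule b)
  show "continuous_on UNIV b" by (rule has_derivative_continuous_on[where f' = b1]) (use has_derivs3D(1)[OF b(1)] in auto)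
  show L: "norm (b x - b y) <= M * dist x y" for x y using C3_taylor(1)[OF b(1,2), of y "x - y"] by (simp add: dist_norm)
  have "norm (b x) <= norm (b x - b 0) + norm (b 0)" by (metis diff_add_cancel norm_triangle_ineq)
  also have "... <= M * norm x + norm (b 0)" using L[of x 0] by simp
  also have "... <= (norm (b 0) + M) * (1 + norm x)" using M by (simp add: algebra_simps)
  finally show "norm (b x) <= (norm (b 0) + M) * (1 + norm x)" .
qed

definition generator :: "('a::euclidean_space => 'a) => ('a => 'a => real) => ('a => 'a => 'a => real) => 'a => real" where
  "generator b f1 f2 x = lap2 f2 x - f1 x (b x)"

text \<open>Puts the generator applied to \<open>f\<close> into the class of integrands of
  \<open>integral_diff_of_W2_less\<close>. The weight sits on y alone, so that the second moment of
  one fixed measure enters.\<close>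

lemma generator_lipschitz:
  assumes f: "C2L A f f1 f2" and b: "C3 M (b :: 'a::euclidean_space => 'a)"
  shows "\<bar>generator b f1 f2 x - generator b f1 f2 y\<bar> <= (real DIM('a) * A + A * M + A * (norm (b 0) + M)) * (1 + norm y) * dist x y"
    and "\<bar>generator b f1 f2 x\<bar> <= (real DIM('a) * A + A * (norm (b 0) + M)) * (1 + norm x)"
    and "continuous_on UNIV (generator b f1 f2)"
proof -
  note d = C2L_D[OF f] and bd = C3_drift[OF b]
  have A0: "0 <= A" by (rule d)
  define D where "D = real DIM('a)"
  define n where "n = norm (b 0) + M"
  have n0: "0 <= n" "0 <= D" using bd(4) by (auto simp: n_def D_def)
  have lap: "\<bar>lap2 f2 x - lap2 f2 y\<bar> <= D * A * dist x y"
  proof -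
    have "\<bar>lap2 f2 x - lap2 f2 y\<bar> <= (\<Sum>e\<in>(Basis::'a set). \<bar>f2 x e e - f2 y e e\<bar>)"
      unfolding lap2_def sum_subtractf[symmetric] by (rule sum_abs)
    also have "... <= (\<Sum>e\<in>(Basis::'a set). A * dist x y)"
    proof (rule sum_mono)
      fix e :: 'a assume "e \<in> Basis"
      then show "\<bar>f2 x e e - f2 y e e\<bar> <= A * dist x y" using d(6)[of y "x - y" e e] by (simp add: dist_norm)
    qed
    finally show ?thesis by (simp add: D_def)
  qed
  have dr: "\<bar>f1 x (b x) - f1 y (b y)\<bar> <= A * M * dist x y + A * dist x y * (n * (1 + norm y))"
  proof -
    have "f1 x (b x) - f1 y (b y) = f1 x (b x - b y) + (f1 x (b y) - f1 y (b y))" by (simp add: linear_diff[OF d(14)])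
    moreover have "\<bar>f1 x (b x - b y)\<bar> <= A * M * dist x y"
      using order_trans[OF d(4) mult_left_mono[OF bd(2) A0], of x x y] by (simp add: mult.assoc)
    moreover have "\<bar>f1 x (b y) - f1 y (b y)\<bar> <= A * dist x y * (n * (1 + norm y))"
    proof -
      have "\<bar>f1 x (b y) - f1 y (b y)\<bar> <= A * norm (b y) * dist x y" using d(8)[of y "x - y" "b y"] by (simp add: dist_norm)
      also have "... = A * dist x y * norm (b y)" by simp
      also have "... <= A * dist x y * (n * (1 + norm y))" using bd(3)[of y] A0 by (intro mult_left_mono) (auto simp: n_def)
      finally show ?thesis .
    qed
    ultimately show ?thesis by linarith
  qed
  have "\<bar>generator b f1 f2 x - generator b f1 f2 y\<bar> <= (D * A + A * M) * dist x y * 1 + A * n * (1 + norm y) * dist x y"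
    using lap dr unfolding generator_def by (simp add: algebra_simps)
  also have "... <= (D * A + A * M) * dist x y * (1 + norm y) + A * n * (1 + norm y) * dist x y"
    using A0 bd(4) n0 by (intro add_right_mono mult_left_mono) auto
  finally show "\<bar>generator b f1 f2 x - generator b f1 f2 y\<bar> <= (real DIM('a) * A + A * M + A * (norm (b 0) + M)) * (1 + norm y) * dist x y"
    by (simp add: D_def n_def algebra_simps)
  have lb: "\<bar>lap2 f2 x\<bar> <= D * A"
  proof -
    have "\<bar>lap2 f2 x\<bar> <= (\<Sum>e\<in>(Basis::'a set). \<bar>f2 x e e\<bar>)" unfolding lap2_def by (rule sum_abs)
    also have "... <= (\<Sum>e\<in>(Basis::'a set). A)"
    proof (rule sum_mono)
      fix e :: 'a assume "e \<in> Basis"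
      then show "\<bar>f2 x e e\<bar> <= A" using d(5)[of x e e] by simp
    qed
    finally show ?thesis by (simp add: D_def)
  qed
  have "\<bar>f1 x (b x)\<bar> <= A * (n * (1 + norm x))" using order_trans[OF d(4) mult_left_mono[OF bd(3) A0], of x x] by (simp add: n_def)
  then have "\<bar>generator b f1 f2 x\<bar> <= D * A * 1 + A * (n * (1 + norm x))" using lb unfolding generator_def by linarith
  also have "... <= D * A * (1 + norm x) + A * (n * (1 + norm x))" using A0 n0 by (intro add_right_mono mult_left_mono) auto
  finally show "\<bar>generator b f1 f2 x\<bar> <= (real DIM('a) * A + A * (norm (b 0) + M)) * (1 + norm x)"
    by (simp add: D_def n_def algebra_simps)
  have eq: "f1 x (b x) = (\<Sum>e\<in>Basis. (b x \<bullet> e) * f1 x e)" for x using linear_euclidean_sum[OF d(14)[of x], of "b x"] by simp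
  show "continuous_on UNIV (generator b f1 f2)" unfolding generator_def eq lap2_def by (intro continuous_intros d bd)
qed

locale fokker_planck =
  fixes D :: "'a::euclidean_space measure => 'a => 'a" and m :: "real => 'a measure" and M Mmm :: real
  assumes D: "\<And>n. n \<in> P2 ==> C3 M (D n)"
    and lip: "\<And>n n' x. n \<in> P2 ==> n' \<in> P2 ==> norm (D n x - D n' x) <= Mmm * W 1 n n'" and Mmm: "0 <= Mmm"
    and sol: "fokker_planck_solution D m"
begin

lemma M0: "0 <= M" if "n \<in> P2" for n :: "'a measure" using C3_drift(4)[OF D[OF that]] .

lemma m_P2: "0 <= t ==> m t \<in> P2" using sol by (auto simp: fokker_planck_solution_def)

lemma W2_close:
  assumes t: "0 <= t" and d: "0 < d"
  obtains e where "0 < e" "\<And>s. 0 <= s ==> \<bar>s - t\<bar> < e ==> W 2 (m s) (m t) < d"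
proof -
  have mt: "m t \<in> P2" by (rule m_P2[OF t])
  \<comment> \<open>The filter at t leaves out t itself, so the distance of m_t to itself is treated
    separately; it is 0 by the segment estimate at weight 0.\<close>
  have "(W 2 (m t) (mix 0 (m t) (m t)))^2 <= 0" using W2_mix_le[OF mt mt, of 0] by simp
  then have self: "W 2 (m t) (m t) = 0" using P2_D(2)[OF mt] by (simp add: mix_0)
  have "((\<lambda>s. W 2 (m s) (m t)) \<longlongrightarrow> 0) (at t within {0..})" using sol t by (auto simp: fokker_planck_solution_def)
  from tendstoD[OF this d] obtain e where e: "0 < e"
     "\<And>s. s \<in> {0..} ==> s \<noteq> t ==> dist s t < e ==> dist (W 2 (m s) (m t)) 0 < d" unfolding eventually_at by blast
  have "W 2 (m s) (m t) < d" if "0 <= s" "\<bar>s - t\<bar> < e" for s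
    using e(2)[of s] that self d by (cases "s = t") (auto simp: dist_real_def)
  with e(1) show ?thesis by (rule that)
qed

definition second_moment :: "real => real" where
  "second_moment t = (LINT x|m t. (norm x)^2)"

text \<open>The neighbourhood is fixed before the function and sees it only through A. Changing the
  drift costs at most A Mmm W1; changing the measure is a W2 estimate. The version with moving drift
  serves the weak formulation, the one with drift frozen at t serves the Euler step.\<close>

lemma integral_generator_close:
  assumes t: "0 <= t" and c: "0 < c" and A: "0 <= A"
  shows "\<exists>e>0. \<forall>g g1 g2 u. C2L A g g1 g2 --> 0 <= u --> \<bar>u - t\<bar> < e -->
       \<bar>(LINT x|m u. generator (D (m u)) g1 g2 x) - (LINT x|m t. generator (D (m t)) g1 g2 x)\<bar> <= c \<and>
       \<bar>(LINT x|m u. generator (D (m t)) g1 g2 x) - (LINT x|m t. generator (D (m t)) g1 g2 x)\<bar> <= c"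
proof -
  note mt = m_P2[OF t]
  have M0: "0 <= M" by (rule M0[OF mt])
  define K where "K = real DIM('a) * A + A * M + A * (norm (D (m t) 0) + M)"
  have K0: "0 <= K" using A M0 by (simp add: K_def)
  define C where "C = A * Mmm + K * (2 * (1 + second_moment t))"
  have sm: "0 <= second_moment t" by (simp add: second_moment_def)
  have C0: "0 <= C" using A Mmm K0 sm by (simp add: C_def)
  define d where "d = c / (C + 1)"
  have d0: "0 < d" using c C0 by (simp add: d_def)
  have Cd: "C * d <= c"
  proof -
    have "C * d <= (C + 1) * d" using d0 by (intro mult_right_mono) auto
    also have "... = c" using C0 by (simp add: d_def)
    finally show ?thesis .
  qed
  obtain e where e: "0 < e" "\<And>s. 0 <= s ==> \<bar>s - t\<bar> < e ==> W 2 (m s) (m t) < d" using W2_close[OF t d0] by blast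
  have second: "\<bar>(LINT x|m u. generator (D (m t)) g1 g2 x) - (LINT x|m t. generator (D (m t)) g1 g2 x)\<bar> <= K * (2 * d * (1 + second_moment t))"
    if g: "C2L A g g1 g2" and u: "0 <= u" "\<bar>u - t\<bar> < e" for g g1 g2 u unfolding second_moment_def
    by (rule integral_diff_of_W2_less(1)[OF m_P2[OF u(1)] mt e(2)[OF u] borel_measurable_continuous_onI[OF generator_lipschitz(3)[OF g D[OF mt]]] _ K0])
      (use generator_lipschitz(1)[OF g D[OF mt]] in \<open>simp add: K_def\<close>)
  have gi: "integrable (m u) (generator (D n) g1 g2)"
    if g: "C2L A g g1 g2" and u: "0 <= u" and n: "n \<in> P2" for g g1 g2 u n
  proof (rule Bochner_Integration.integrable_bound)
    show "integrable (m u) (\<lambda>x. (real DIM('a) * A + A * (norm (D n 0) + M)) * (1 + norm x))"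
      using P2_D(5,6)[OF m_P2[OF u]] by simp
    show "generator (D n) g1 g2 \<in> borel_measurable (m u)" unfolding measurable_cong_sets[OF P2_D(2)[OF m_P2[OF u]] refl]
      by (rule borel_measurable_continuous_onI[OF generator_lipschitz(3)[OF g D[OF n]]])
    show "AE x in m u. norm (generator (D n) g1 g2 x) <= norm ((real DIM('a) * A + A * (norm (D n 0) + M)) * (1 + norm x))"
      using generator_lipschitz(2)[OF g D[OF n]] by (intro AE_I2) (simp add: order_trans[OF _ abs_ge_self])
  qed
  have first: "\<bar>(LINT x|m u. generator (D (m u)) g1 g2 x) - (LINT x|m u. generator (D (m t)) g1 g2 x)\<bar> <= A * Mmm * d"
    if g: "C2L A g g1 g2" and u: "0 <= u" "\<bar>u - t\<bar> < e" for g g1 g2 u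
  proof -
    note cd = C2L_D[OF g] and mu = m_P2[OF u(1)]
    interpret mu: prob_space "m u" by (rule P2_D(1)[OF mu])
    have W: "W 1 (m u) (m t) <= d" by (rule W1_le_of_W2_less[OF mu mt e(2)[OF u]])
    have pt: "\<bar>generator (D (m u)) g1 g2 x - generator (D (m t)) g1 g2 x\<bar> <= A * Mmm * d" for x
    proof -
      have "generator (D (m u)) g1 g2 x - generator (D (m t)) g1 g2 x = - g1 x (D (m u) x - D (m t) x)"
        by (simp add: generator_def linear_diff[OF cd(14)])
      then have "\<bar>generator (D (m u)) g1 g2 x - generator (D (m t)) g1 g2 x\<bar> <= A * norm (D (m u) x - D (m t) x)"
        using cd(4)[of x "D (m u) x - D (m t) x"] by simp
      also have "... <= A * (Mmm * d)"
        using order_trans[OF lip[OF mu mt, of x] mult_left_mono[OF W Mmm]] A by (intro mult_left_mono)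
      finally show ?thesis by (simp add: mult.assoc)
    qed
    have pt': "- (A * Mmm * d) <= generator (D (m u)) g1 g2 x - generator (D (m t)) g1 g2 x"
      "generator (D (m u)) g1 g2 x - generator (D (m t)) g1 g2 x <= A * Mmm * d" for x using pt[of x] by linarith+
    have "(LINT x|m u. generator (D (m u)) g1 g2 x) - (LINT x|m u. generator (D (m t)) g1 g2 x) =
       (LINT x|m u. generator (D (m u)) g1 g2 x - generator (D (m t)) g1 g2 x)" using gi[OF g u(1) mu] gi[OF g u(1) mt] by simp
    moreover have "- (A * Mmm * d) <= (LINT x|m u. generator (D (m u)) g1 g2 x - generator (D (m t)) g1 g2 x)"
      "(LINT x|m u. generator (D (m u)) g1 g2 x - generator (D (m t)) g1 g2 x) <= A * Mmm * d"
      by (rule mu.integral_between[OF Bochner_Integration.integrable_diff[OF gi[OF g u(1) mu] gi[OF g u(1) mt]] pt'])+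
    ultimately show ?thesis by linarith
  qed
  show ?thesis
  proof (intro exI[of _ e] conjI allI impI e(1))
    fix g :: "'a => real" and g1 g2 u
    assume g: "C2L A g g1 g2" and u: "0 <= u" "\<bar>u - t\<bar> < e"
    have *: "A * Mmm * d + K * (2 * d * (1 + second_moment t)) <= c" using Cd by (simp add: C_def algebra_simps)
    show "\<bar>(LINT x|m u. generator (D (m u)) g1 g2 x) - (LINT x|m t. generator (D (m t)) g1 g2 x)\<bar> <= c"
      using first[OF g u] second[OF g u] * by linarith
    have "0 <= A * Mmm * d" using A Mmm d0 by simp
    then show "\<bar>(LINT x|m u. generator (D (m t)) g1 g2 x) - (LINT x|m t. generator (D (m t)) g1 g2 x)\<bar> <= c"
      using second[OF g u] * by linarith
  qed
qed

text \<open>Supplies integrability in time of the right-hand side of the weak formulation, without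
  which its integral would be a default value.\<close>

lemma continuous_integral_generator:
  assumes g: "C2L A g g1 g2"
  shows "continuous_on {0..} (\<lambda>u. LINT x|m u. generator (D (m u)) g1 g2 x)" unfolding continuous_on_iff
proof (intro ballI allI impI)
  fix t c :: real assume "t \<in> {0..}" "0 < c"
  then have "0 <= t" "0 < c / 2" by auto
  from integral_generator_close[OF this C2L_D(1)[OF g]] obtain e where e0: "e > 0 \<and> (\<forall>g g1 g2 u. C2L A g g1 g2 --> 0 <= u --> \<bar>u - t\<bar> < e -->
       \<bar>(LINT x|m u. generator (D (m u)) g1 g2 x) - (LINT x|m t. generator (D (m t)) g1 g2 x)\<bar> <= c / 2 \<and>
       \<bar>(LINT x|m u. generator (D (m t)) g1 g2 x) - (LINT x|m t. generator (D (m t)) g1 g2 x)\<bar> <= c / 2)" ..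
  note e = e0[THEN conjunct1] e0[THEN conjunct2, rule_format, THEN conjunct1]
  have "dist (LINT x|m u. generator (D (m u)) g1 g2 x) (LINT x|m t. generator (D (m t)) g1 g2 x) < c"
    if "u \<in> {0..}" "dist u t < e" for u using e(2)[OF g, of u] that \<open>0 < c\<close> unfolding dist_real_def by auto
  with e(1) show "\<exists>d>0. \<forall>u\<in>{0..}. dist u t < d -->
      dist (LINT x|m u. generator (D (m u)) g1 g2 x) (LINT x|m t. generator (D (m t)) g1 g2 x) < c" by blast
qed

lemma test_function_increment:
  assumes h: "test_function h" "C2L A h h1 h2" and su: "0 <= s" "s <= u"
    and close: "\<And>v. s <= v ==> v <= u ==> \<bar>(LINT x|m v. generator (D (m v)) h1 h2 x) - a\<bar> <= e"
  shows "\<bar>(LINT x|m u. h x) - (LINT x|m s. h x) - (u - s) * a\<bar> <= e * (u - s)"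
proof -
  define g where "g v = (LINT x|m v. generator (D (m v)) h1 h2 x)" for v
  have eq: "(LINT x|m u. h x) - (LINT x|m s. h x) = (LBINT v:{s..u}. g v)"
    using sol h(1) su unfolding fokker_planck_solution_def g_def generator_def by (simp only: test_function_derivs[OF h(2)])
  have gi: "set_integrable lborel {s..u} g"
    by (intro borel_integrable_atLeastAtMost' continuous_on_subset[OF continuous_integral_generator[OF h(2), folded g_def]])
      (use su in auto)
  have ci: "set_integrable lborel {s..u} (\<lambda>v. c)" for c :: real by (intro borel_integrable_atLeastAtMost') simp
  have const: "(LBINT v:{s..u}. c) = (u - s) * c" for c :: real using su by (simp add: set_lebesgue_integral_def)
  have "(LBINT v:{s..u}. g v) <= (LBINT v:{s..u}. a + e)"
    using close by (intro set_integral_mono gi ci) (force simp: g_def abs_le_iff)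
  moreover have "(LBINT v:{s..u}. a - e) <= (LBINT v:{s..u}. g v)"
    using close by (intro set_integral_mono gi ci) (force simp: g_def abs_le_iff)
  ultimately show ?thesis unfolding eq const by (simp add: abs_le_iff algebra_simps)
qed

text \<open>The weak formulation is extended beyond compact supports by
  \<open>test_function_approx\<close>, all approximants sharing one constant and therefore one
  neighbourhood. The intervals contain t, the form of local estimate that bisection asks
  for.\<close>

lemma C3_increment:
  assumes t: "0 <= t" and d: "0 < d" and A: "0 <= A"
  shows "\<exists>e>0. \<forall>\<phi> \<phi>1 \<phi>2 \<phi>3 s u. has_derivs3 \<phi> \<phi>1 \<phi>2 \<phi>3 --> derivs_bounded A A A \<phi>1 \<phi>2 \<phi>3 --> (\<forall>x. \<bar>\<phi> x\<bar> <= A) -->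
      0 <= s --> s <= t --> t <= u --> u - s < e -->
       \<bar>(LINT x|m u. \<phi> x) - (LINT x|m s. \<phi> x) - (u - s) * (LINT x|m t. generator (D (m t)) \<phi>1 \<phi>2 x)\<bar> <= d * (u - s)"
proof -
  from test_function_approx[where 'a = 'a] obtain B where B0: "0 <= B \<and> (\<forall>A (\<phi> :: 'a => real) f1 f2 f3. has_derivs3 \<phi> f1 f2 f3 --> derivs_bounded A A A f1 f2 f3 -->
      (\<forall>x. \<bar>\<phi> x\<bar> <= A) --> (\<exists>g g1 g2. (\<forall>n. test_function (g n) \<and> C2L (B * A) (g n) (g1 n) (g2 n)) \<and>
        (\<forall>n x. \<bar>g n x\<bar> <= B * A) \<and> (\<forall>x. (\<lambda>n. g n x) \<longlonglongrightarrow> \<phi> x) \<and>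
        (\<forall>x u. (\<lambda>n. g1 n x u) \<longlonglongrightarrow> f1 x u) \<and> (\<forall>x u v. (\<lambda>n. g2 n x u v) \<longlonglongrightarrow> f2 x u v)))" ..
  note B = B0[THEN conjunct1] and approx = B0[THEN conjunct2, THEN spec, THEN spec, THEN spec, THEN spec, THEN spec, THEN mp, THEN mp, THEN mp]
  have BA: "0 <= B * A" using A B by simp
  from integral_generator_close[OF t d BA] obtain e where e0: "e > 0 \<and> (\<forall>g g1 g2 u. C2L (B * A) g g1 g2 --> 0 <= u --> \<bar>u - t\<bar> < e -->
       \<bar>(LINT x|m u. generator (D (m u)) g1 g2 x) - (LINT x|m t. generator (D (m t)) g1 g2 x)\<bar> <= d \<and>
       \<bar>(LINT x|m u. generator (D (m t)) g1 g2 x) - (LINT x|m t. generator (D (m t)) g1 g2 x)\<bar> <= d)" ..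
  note e = e0[THEN conjunct1] e0[THEN conjunct2, rule_format, THEN conjunct1]
  show ?thesis
  proof (intro exI[of _ e] conjI allI impI e(1))
    fix \<phi> :: "'a => real" and \<phi>1 \<phi>2 \<phi>3 s u
    assume \<phi>: "has_derivs3 \<phi> \<phi>1 \<phi>2 \<phi>3" "derivs_bounded A A A \<phi>1 \<phi>2 \<phi>3" "\<forall>x. \<bar>\<phi> x\<bar> <= A"
      and su: "0 <= s" "s <= t" "t <= u" "u - s < e"
    from approx[OF \<phi>] obtain g g1 g2 where g0: "(\<forall>n. test_function (g n) \<and> C2L (B * A) (g n) (g1 n) (g2 n)) \<and>
        (\<forall>n x. \<bar>g n x\<bar> <= B * A) \<and> (\<forall>x. (\<lambda>n. g n x) \<longlonglongrightarrow> \<phi> x) \<and>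
        (\<forall>x u. (\<lambda>n. g1 n x u) \<longlonglongrightarrow> \<phi>1 x u) \<and> (\<forall>x u v. (\<lambda>n. g2 n x u v) \<longlonglongrightarrow> \<phi>2 x u v)" by (elim exE)
    then have g: "test_function (g n)" "C2L (B * A) (g n) (g1 n) (g2 n)" "\<bar>g n x\<bar> <= B * A"
      "(\<lambda>n. g n x) \<longlonglongrightarrow> \<phi> x" "(\<lambda>n. g1 n x v) \<longlonglongrightarrow> \<phi>1 x v" "(\<lambda>n. g2 n x v w) \<longlonglongrightarrow> \<phi>2 x v w" for n x v w by simp_all
    have inc: "\<bar>(LINT x|m u. g n x) - (LINT x|m s. g n x) - (u - s) * (LINT x|m t. generator (D (m t)) (g1 n) (g2 n) x)\<bar> <= d * (u - s)" for n
      using su e(2)[OF g(2)[of n]] by (intro test_function_increment[OF g(1,2)]) auto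
    have C\<phi>: "C2L A \<phi> \<phi>1 \<phi>2" by (rule C2L_of_derivs3[OF \<phi>(1,2) A])
    have meas: "f \<in> borel_measurable (m v)" if "continuous_on UNIV f" "0 <= v" for f :: "'a => real" and v
      unfolding measurable_cong_sets[OF P2_D(2)[OF m_P2[OF that(2)]] refl] by (rule borel_measurable_continuous_onI[OF that(1)])
    have lim0: "(\<lambda>n. LINT x|m v. g n x) \<longlonglongrightarrow> (LINT x|m v. \<phi> x)" if v: "0 <= v" for v
    proof (rule integral_dominated_convergence[where w = "\<lambda>_. B * A"])
      show "integrable (m v) (\<lambda>_. B * A)" by (rule P2_D(6)[OF m_P2[OF v]])
    qed (use g(3,4) meas[OF C2L_D(11)[OF C\<phi>] v] meas[OF C2L_D(11)[OF g(2)] v] in auto)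
    note mt = m_P2[OF t]
    have lim1: "(\<lambda>n. LINT x|m t. generator (D (m t)) (g1 n) (g2 n) x) \<longlonglongrightarrow> (LINT x|m t. generator (D (m t)) \<phi>1 \<phi>2 x)"
    proof (rule integral_dominated_convergence[where w = "\<lambda>x. (real DIM('a) * (B * A) + (B * A) * (norm (D (m t) 0) + M)) * (1 + norm x)"])
      show "integrable (m t) (\<lambda>x. (real DIM('a) * (B * A) + (B * A) * (norm (D (m t) 0) + M)) * (1 + norm x))"
        using P2_D(5,6)[OF mt] by simp
      show "generator (D (m t)) \<phi>1 \<phi>2 \<in> borel_measurable (m t)" by (rule meas[OF generator_lipschitz(3)[OF C\<phi> D[OF mt]] t])
      show "generator (D (m t)) (g1 n) (g2 n) \<in> borel_measurable (m t)" for n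
        by (rule meas[OF generator_lipschitz(3)[OF g(2) D[OF mt]] t])
      show "AE x in m t. norm (generator (D (m t)) (g1 n) (g2 n) x) <= (real DIM('a) * (B * A) + (B * A) * (norm (D (m t) 0) + M)) * (1 + norm x)" for n
        using generator_lipschitz(2)[OF g(2) D[OF mt]] by (intro AE_I2) simp
      show "AE x in m t. (\<lambda>n. generator (D (m t)) (g1 n) (g2 n) x) \<longlonglongrightarrow> generator (D (m t)) \<phi>1 \<phi>2 x"
        unfolding generator_def lap2_def by (intro AE_I2 tendsto_intros g(5,6))
    qed
    have "(\<lambda>n. \<bar>(LINT x|m u. g n x) - (LINT x|m s. g n x) - (u - s) * (LINT x|m t. generator (D (m t)) (g1 n) (g2 n) x)\<bar>) \<longlonglongrightarrow>
       \<bar>(LINT x|m u. \<phi> x) - (LINT x|m s. \<phi> x) - (u - s) * (LINT x|m t. generator (D (m t)) \<phi>1 \<phi>2 x)\<bar>"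
      using su by (intro tendsto_intros lim0 lim1) auto
    then show "\<bar>(LINT x|m u. \<phi> x) - (LINT x|m s. \<phi> x) - (u - s) * (LINT x|m t. generator (D (m t)) \<phi>1 \<phi>2 x)\<bar> <= d * (u - s)"
      by (rule LIMSEQ_le_const2) (use inc in auto)
  qed
qed

end

lemma sqrt_error_small:
  fixes a b c d :: real assumes "0 < d" "0 <= c"
  obtains e where "0 < e" "\<And>s. 0 <= s ==> s < e ==> c * (sqrt (a * s) + s * b) <= d"
proof -
  have "((\<lambda>s. c * (sqrt (a * s) + s * b)) \<longlongrightarrow> c * (sqrt (a * 0) + 0 * b)) (at 0)" by (intro tendsto_intros)
  then have "((\<lambda>s. c * (sqrt (a * s) + s * b)) \<longlongrightarrow> 0) (at 0)" by simp
  from tendstoD[OF this assms(1)] obtain e where e: "0 < e"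
    "\<And>s. s \<noteq> 0 ==> dist s 0 < e ==> dist (c * (sqrt (a * s) + s * b)) 0 < d" unfolding eventually_at by auto
  show ?thesis
  proof (rule that[OF e(1)])
    fix s assume "0 <= s" "s < e"
    then show "c * (sqrt (a * s) + s * b) <= d" using e(2)[of s] assms by (cases "s = 0") auto
  qed
qed

lemma square_one_plus_le: "(1 + r)^2 <= 2 * (1 + (r::real)^2)"
  using zero_le_power2[of "1 - r"] by (simp add: power2_eq_square algebra_simps)

context fokker_planck
begin

text \<open>Duality in one step: integrating h at time u amounts, up to o(u - s), to integrating its
  Euler step at time s. A third of d is spent on the weak formulation, a third on comparing the
  generator integrated against m_s and m_t, a third on the Euler expansion integrated against
  m_s.\<close>

lemma euler_step_increment:
  assumes t: "0 <= t" and d: "0 < d" and A: "0 <= A"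
  shows "\<exists>e>0. \<forall>h h1 h2 h3 s u. has_derivs3 h h1 h2 h3 --> derivs_bounded A A A h1 h2 h3 --> (\<forall>x. \<bar>h x\<bar> <= A) -->
      0 <= s --> s <= t --> t <= u --> u - s < e -->
       \<bar>(LINT x|m u. h x) - (LINT x|m s. euler_step (u - s) (D (m t)) h x)\<bar> <= d * (u - s)"
proof -
  note mt = m_P2[OF t]
  define b where "b = D (m t)"
  note bC = D[OF mt, folded b_def]
  note bd = C3_drift[OF bC]
  define n where "n = norm (b 0) + M"
  have n0: "0 <= n" using bd(4) by (simp add: n_def)
  have d3: "0 < d / 3" using d by simp
  \<comment> \<open>Bounds the integral of |b|^2 under m_s: |b(x)| <= n (1 + |x|), and W2(m_s, m_t)
    < 1 keeps the second moment of m_s below 2 + 2 \<open>second_moment t\<close>.\<close>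
  define S where "S = 2 * n^2 * (1 + (2 + 2 * second_moment t))"
  define c where "c = 2 * real DIM('a) * A"
  have c0: "0 <= c" using A by (simp add: c_def)
  obtain e1 where e1: "0 < e1" "\<And>r. 0 <= r ==> r < e1 ==> c * (sqrt (2 * real DIM('a) * r) + r * (1 + S)) <= d / 3"
    using sqrt_error_small[OF d3 c0] by blast
  from C3_increment[OF t d3 A] obtain e2 where e20: "e2 > 0 \<and> (\<forall>h h1 h2 h3 s u. has_derivs3 h h1 h2 h3 --> derivs_bounded A A A h1 h2 h3 --> (\<forall>x. \<bar>h x\<bar> <= A) -->
      0 <= s --> s <= t --> t <= u --> u - s < e2 -->
       \<bar>(LINT x|m u. h x) - (LINT x|m s. h x) - (u - s) * (LINT x|m t. generator (D (m t)) h1 h2 x)\<bar> <= d / 3 * (u - s))" ..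
  from integral_generator_close[OF t d3 A] obtain e3 where e30: "e3 > 0 \<and> (\<forall>v v1 v2 u. C2L A v v1 v2 --> 0 <= u --> \<bar>u - t\<bar> < e3 -->
       \<bar>(LINT x|m u. generator (D (m u)) v1 v2 x) - (LINT x|m t. generator (D (m t)) v1 v2 x)\<bar> <= d / 3 \<and>
       \<bar>(LINT x|m u. generator (D (m t)) v1 v2 x) - (LINT x|m t. generator (D (m t)) v1 v2 x)\<bar> <= d / 3)" ..
  obtain e4 where e4: "0 < e4" "\<And>s. 0 <= s ==> \<bar>s - t\<bar> < e4 ==> W 2 (m s) (m t) < 1" using W2_close[OF t zero_less_one] by blast
  define e where "e = min (min e1 e2) (min e3 e4)"
  have e: "0 < e" using e1(1) e20 e30 e4(1) by (simp add: e_def)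
  show ?thesis
  proof (intro exI[of _ e] conjI allI impI e)
    fix h :: "'a => real" and h1 h2 h3 s u
    assume f: "has_derivs3 h h1 h2 h3" "derivs_bounded A A A h1 h2 h3" "\<forall>x. \<bar>h x\<bar> <= A"
      and su: "0 <= s" "s <= t" "t <= u" "u - s < e"
    define r where "r = u - s"
    have r0: "0 <= r" using su by (simp add: r_def)
    note C = C2L_of_derivs3[OF f(1,2) A]
    note ms = m_P2[OF su(1)]
    interpret ms: prob_space "m s" by (rule P2_D(1)[OF ms])
    have st: "\<bar>s - t\<bar> < e3" "\<bar>s - t\<bar> < e4" "u - s < e2" "r < e1" using su by (auto simp: e_def r_def)
    define L where "L = generator b h1 h2"
    have A1: "\<bar>(LINT x|m u. h x) - (LINT x|m s. h x) - r * (LINT x|m t. L x)\<bar> <= d / 3 * r" unfolding r_def L_def b_def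
      by (rule e20[THEN conjunct2, THEN spec, THEN spec, THEN spec, THEN spec, THEN spec, THEN spec, THEN mp, THEN mp, THEN mp, THEN mp, THEN mp, THEN mp, THEN mp, OF f su(1-3) st(3)])
    have A2: "\<bar>(LINT x|m s. L x) - (LINT x|m t. L x)\<bar> <= d / 3" unfolding L_def b_def
      by (rule e30[THEN conjunct2, THEN spec, THEN spec, THEN spec, THEN spec, THEN mp, THEN mp, THEN mp, THEN conjunct2, OF C su(1) st(1)])
    define Q where "Q = euler_step r b h"
    have meas: "g \<in> borel_measurable (m s)" if "continuous_on UNIV g" for g :: "'a => real"
      unfolding measurable_cong_sets[OF P2_D(2)[OF ms] refl] by (rule borel_measurable_continuous_onI[OF that])
    have Qc: "continuous_on UNIV Q"
      unfolding Q_def euler_step_def by (intro continuous_intros continuous_on_compose2[OF C2L_D(11)[OF C]] bd) auto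
    have Qb: "\<bar>Q x\<bar> <= A" for x using euler_step_bounds[of "- A" h A r b x] f(3) by (auto simp: Q_def abs_le_iff minus_le_iff)
    have Qi: "integrable (m s) Q" by (rule ms.integrable_bounded[OF meas[OF Qc] Qb])
    have hi: "integrable (m s) h" by (rule ms.integrable_bounded[OF meas[OF C2L_D(11)[OF C]]]) (use f(3) in auto)
    have Li: "integrable (m s) L"
    proof (rule Bochner_Integration.integrable_bound)
      show "integrable (m s) (\<lambda>x. (real DIM('a) * A + A * (norm (b 0) + M)) * (1 + norm x))" using P2_D(5,6)[OF ms] by simp
      show "L \<in> borel_measurable (m s)" unfolding L_def by (rule meas[OF generator_lipschitz(3)[OF C bC]])
      show "AE x in m s. norm (L x) <= norm ((real DIM('a) * A + A * (norm (b 0) + M)) * (1 + norm x))"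
        using generator_lipschitz(2)[OF C bC] unfolding L_def by (intro AE_I2) (simp add: order_trans[OF _ abs_ge_self])
    qed
    have nb: "(norm (b x))^2 <= 2 * n^2 * (1 + (norm x)^2)" for x
    proof -
      have "(norm (b x))^2 <= (n * (1 + norm x))^2" using bd(3)[of x] by (intro power_mono) (auto simp: n_def)
      also have "... = n^2 * (1 + norm x)^2" by (rule power_mult_distrib)
      also have "... <= n^2 * (2 * (1 + (norm x)^2))"
        using zero_le_power2[of "1 - norm x"] by (intro mult_left_mono) (auto simp: power2_eq_square algebra_simps)
      finally show ?thesis by (simp only: mult_ac)
    qed
    have smi: "integrable (m s) (\<lambda>x. (norm x)^2)" by (rule P2_D(4)[OF ms])
    have sms: "(LINT x|m s. (norm x)^2) <= 2 + 2 * second_moment t"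
      using second_moment_of_W2_less[OF ms mt e4(2)[OF su(1) st(2)]] by (simp add: second_moment_def)
    have pt: "\<bar>Q x - h x - r * L x\<bar> <= c * r * (sqrt (2 * real DIM('a) * r) + r * (1 + 2 * n^2 * (1 + (norm x)^2)))" for x
    proof -
      have "\<bar>Q x - h x - r * L x\<bar> <= c * r * (sqrt (2 * real DIM('a) * r) + r * (1 + (norm (b x))^2))"
        unfolding Q_def L_def c_def generator_def by (rule euler_step_expansion(1)[OF f(1,2) A r0])
      also have "... <= c * r * (sqrt (2 * real DIM('a) * r) + r * (1 + 2 * n^2 * (1 + (norm x)^2)))"
        using nb[of x] c0 r0 by (intro mult_left_mono add_left_mono) auto
      finally show ?thesis .
    qed
    have eq: "(LINT x|m s. Q x) - (LINT x|m s. h x) - r * (LINT x|m s. L x) = (LINT x|m s. Q x - h x - r * L x)"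
      using Qi hi Li by simp
    have "\<bar>(LINT x|m s. Q x) - (LINT x|m s. h x) - r * (LINT x|m s. L x)\<bar> <= (LINT x|m s. \<bar>Q x - h x - r * L x\<bar>)"
      unfolding eq by (rule integral_abs_bound)
    also have "... <= (LINT x|m s. c * r * (sqrt (2 * real DIM('a) * r) + r * (1 + 2 * n^2 * (1 + (norm x)^2))))"
      by (rule integral_mono[OF _ _ pt]) (use Qi hi Li smi in auto)
    also have "... = c * r * (sqrt (2 * real DIM('a) * r) + r * (1 + 2 * n^2 * (1 + (LINT x|m s. (norm x)^2))))"
      using smi by (simp add: ms.prob_space)
    also have "... <= c * r * (sqrt (2 * real DIM('a) * r) + r * (1 + S))"
      unfolding S_def using sms c0 r0 by (intro mult_left_mono add_left_mono) auto
    also have "... = r * (c * (sqrt (2 * real DIM('a) * r) + r * (1 + S)))" by (simp add: mult_ac)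
    also have "... <= r * (d / 3)" using e1(2)[OF r0 st(4)] r0 by (intro mult_left_mono)
    finally have A3: "\<bar>(LINT x|m s. Q x) - (LINT x|m s. h x) - r * (LINT x|m s. L x)\<bar> <= r * (d / 3)" .
    have "\<bar>r * (LINT x|m s. L x) - r * (LINT x|m t. L x)\<bar> = r * \<bar>(LINT x|m s. L x) - (LINT x|m t. L x)\<bar>"
      using r0 by (simp add: abs_mult flip: right_diff_distrib)
    also have "... <= r * (d / 3)" using A2 r0 by (rule mult_left_mono)
    finally have A4: "\<bar>r * (LINT x|m s. L x) - r * (LINT x|m t. L x)\<bar> <= r * (d / 3)" .
    have "\<bar>(LINT x|m u. h x) - (LINT x|m s. Q x)\<bar> <= d / 3 * r + r * (d / 3) + r * (d / 3)" using A1 A3 A4 by linarith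
    also have "... = d * r" by simp
    finally show "\<bar>(LINT x|m u. h x) - (LINT x|m s. euler_step (u - s) (D (m t)) h x)\<bar> <= d * (u - s)"
      by (simp add: Q_def r_def b_def)
  qed
qed

end

section \<open>The moving dual exponent and the bisection\<close>

text \<open>\<open>\<kappa>\<close> is p - 1 at time \<open>t0\<close>. It becomes 1 / (q0 - 1), so
  its sign is that of q - 1 at all times and fixes the direction of every inequality.\<close>

locale mean_field_flow = fokker_planck D m M Mmm + gibbs_measure \<mu> U "D \<mu>" Z \<rho> KB
  for D :: "'a::euclidean_space measure => 'a => 'a" and m M Mmm \<mu> U Z \<rho> KB +
  fixes t0 \<kappa> \<epsilon> :: real
  assumes t0: "0 <= t0" and \<kappa>: "\<kappa> \<noteq> 0" and \<epsilon>: "0 < \<epsilon>" "\<epsilon> <= 1"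
begin

text \<open>The dual exponent: \<open>p = q / (q - 1)\<close>, so that \<open>p - 1\<close> is the reciprocal of \<open>q - 1\<close>.\<close>

definition p :: "real => real" where
  "p t = 1 + \<kappa> * exp (- (4 * (1 - \<epsilon>) * \<rho>) * (t - t0))"

text \<open>The absolute value of the function \<delta> of the theorem, since |p - 1| is the
  reciprocal of |q - 1|.\<close>

definition rate :: "real => real" where
  "rate t = (Mmm * W 1 (m t) \<mu>)^2 / (4 * \<epsilon> * \<bar>p t - 1\<bar>)"

lemma p_minus_1: "\<bar>p t - 1\<bar> = \<bar>\<kappa>\<bar> * exp (- (4 * (1 - \<epsilon>) * \<rho>) * (t - t0))" by (simp add: p_def abs_mult)

lemma p_pos: "0 < \<bar>p t - 1\<bar>" using \<kappa> by (simp add: p_minus_1)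

lemma sgn_p: "(sgn \<kappa> = 1 \<and> 1 < p t) \<or> (sgn \<kappa> = - 1 \<and> p t < 1)" using \<kappa> by (auto simp: p_def sgn_if mult_less_0_iff)

lemma p_bound: "t0 <= t ==> \<bar>p t\<bar> <= 1 + \<bar>\<kappa>\<bar>"
proof -
  assume "t0 <= t"
  then have "exp (- (4 * (1 - \<epsilon>) * \<rho>) * (t - t0)) <= 1" using \<epsilon> \<rho> by (simp add: mult_nonneg_nonneg)
  then have "\<bar>p t - 1\<bar> <= \<bar>\<kappa>\<bar>" unfolding p_minus_1 by (simp add: mult_left_le)
  then show ?thesis by linarith
qed

text \<open>From 1 - exp(-x) <= x. The bound is relative to p - 1 at the earlier time, the exponent
  at which \<open>log_norm_euler_step\<close> evaluates the generator.\<close>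

lemma p_increment:
  assumes "s <= u" shows "\<bar>p s - p u\<bar> <= \<bar>p s - 1\<bar> * (4 * (1 - \<epsilon>) * \<rho>) * (u - s)"
proof -
  define b where "b = 4 * (1 - \<epsilon>) * \<rho>"
  have b: "0 <= b" using \<epsilon> \<rho> by (simp add: b_def)
  have p_eq: "p v = 1 + \<kappa> * exp (- b * (v - t0))" for v by (simp add: p_def b_def)
  have ex: "exp (- b * (u - t0)) = exp (- b * (s - t0)) * exp (- (b * (u - s)))"
    unfolding exp_add[symmetric] by (simp add: algebra_simps)
  have "p s - p u = (p s - 1) * (1 - exp (- (b * (u - s))))"
    unfolding p_eq[of u] ex unfolding p_eq[of s] by (simp only: right_diff_distrib) (simp add: mult.assoc)
  moreover have "1 - exp (- (b * (u - s))) <= b * (u - s)" using exp_ge_add_one_self[of "- (b * (u - s))"] by linarith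
  moreover have "0 <= 1 - exp (- (b * (u - s)))" using b assms by simp
  ultimately have "\<bar>p s - p u\<bar> <= \<bar>p s - 1\<bar> * (b * (u - s))" by (simp add: abs_mult mult_left_mono)
  then show ?thesis by (simp add: b_def mult.assoc)
qed

lemma W1_continuous: "continuous_on {0..} (\<lambda>t. W 1 (m t) \<mu>)" unfolding continuous_on_iff
proof (intro ballI allI impI)
  fix t c :: real assume t: "t \<in> {0..}" and c: "0 < c"
  have t': "0 <= t" "0 < c / 2" using t c by auto
  obtain e where e: "0 < e" "\<And>s. 0 <= s ==> \<bar>s - t\<bar> < e ==> W 2 (m s) (m t) < c / 2" using W2_close[OF t'] by blast
  have "dist (W 1 (m s) \<mu>) (W 1 (m t) \<mu>) < c" if s: "s \<in> {0..}" "dist s t < e" for s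
  proof -
    have "0 <= s" "\<bar>s - t\<bar> < e" using s by (auto simp: dist_real_def)
    then have "W 1 (m s) (m t) <= c / 2" using e(2) t' by (intro W1_le_of_W2_less m_P2) auto
    moreover have "\<bar>W 1 (m s) \<mu> - W 1 (m t) \<mu>\<bar> <= W 1 (m s) (m t)" using t' \<open>0 <= s\<close> by (intro W1_diff_le m_P2 P2)
    ultimately show ?thesis using c unfolding dist_real_def by linarith
  qed
  with e(1) show "\<exists>d>0. \<forall>s\<in>{0..}. dist s t < d --> dist (W 1 (m s) \<mu>) (W 1 (m t) \<mu>) < c" by blast
qed

lemma rate_continuous: "continuous_on {t0..} rate"
proof -
  have "p t \<noteq> 1" for t using p_pos[of t] by auto
  then show ?thesis unfolding rate_def p_def using t0 \<epsilon> \<kappa> by (intro continuous_intros continuous_on_subset[OF W1_continuous]) auto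
qed

text \<open>The step length is fixed before the function. As |p - 1| does not increase in time,
  passing from s to t in the denominator can only enlarge the drift term, which becomes
  \<open>rate t\<close>; the term of order t sqrt t is covered by d.\<close>

lemma log_norm_local:
  assumes t: "t0 <= t" and d: "0 < d" and A: "0 <= A"
  shows "\<exists>e>0. \<forall>g g1 g2 g3 s u. has_derivs3 g g1 g2 g3 --> derivs_bounded A A A g1 g2 g3 --> log_bounded \<mu> L g -->
      log_bounded \<mu> L (euler_step (u - s) (D (m t)) g) --> t0 <= s --> s <= t --> t <= u --> u - s < e -->
      sgn \<kappa> * (log_norm \<mu> (p s) (euler_step (u - s) (D (m t)) g) - log_norm \<mu> (p u) g) <= (rate t + d) * (u - s)"
proof -
  have t': "0 <= t" using t t0 by simp
  note mt = m_P2[OF t']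
  define b where "b = D (m t)"
  note bC = D[OF mt, folded b_def]
  note bd = C3_drift[OF bC]
  define n where "n = norm (b 0) + M"
  define w where "w = Mmm * W 1 (m t) \<mu>"
  define S where "S = (LINT x|\<mu>. (1 + norm (b x))^2)"
  define R where "R = 1 + \<bar>\<kappa>\<bar>"
  define K where "K = step_const A L R S (4 * (1 - \<epsilon>) * \<rho>)"
  have bi: "integrable \<mu> (\<lambda>x. (1 + norm (b x))^2)"
  proof (rule P2_integrable_quadratic[OF P2])
    show "(\<lambda>x. (1 + norm (b x))^2) \<in> borel_measurable borel" by (intro borel_measurable_continuous_onI continuous_intros bd)
    fix x
    have n0: "0 <= n" using bd(4) by (simp add: n_def)
    have "1 + norm (b x) <= (1 + n) * (1 + norm x)" using bd(3)[of x] n0 norm_ge_zero[of x] unfolding distrib_right distrib_left n_def[symmetric] by linarith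
    then have "(1 + norm (b x))^2 <= ((1 + n) * (1 + norm x))^2" by (intro power_mono) auto
    also have "... = (1 + n)^2 * (1 + norm x)^2" by (rule power_mult_distrib)
    also have "... <= (1 + n)^2 * (2 * (1 + (norm x)^2))" by (intro mult_left_mono square_one_plus_le zero_le_power2)
    finally show "\<bar>(1 + norm (b x))^2\<bar> <= (2 * (1 + n)^2) * (1 + (norm x)^2)" by (simp only: mult_ac abs_of_nonneg[OF zero_le_power2])
  qed
  obtain e1 where e1: "0 < e1" "\<And>r. 0 <= r ==> r < e1 ==> \<bar>K\<bar> * (sqrt (1 * r) + r * 0) <= d"
    using sqrt_error_small[OF d abs_ge_zero[of K], of 1 0] by blast
  show ?thesis
  proof (intro exI[of _ "min e1 1"] conjI allI impI)
    show "0 < min e1 1" using e1 by simp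
    fix g :: "'a => real" and g1 g2 g3 s u
    assume f: "has_derivs3 g g1 g2 g3" "derivs_bounded A A A g1 g2 g3" "log_bounded \<mu> L g"
      "log_bounded \<mu> L (euler_step (u - s) (D (m t)) g)"
      and su: "t0 <= s" "s <= t" "t <= u" "u - s < min e1 1"
    have r: "0 <= u - s" "u - s <= 1" "u - s < e1" "s <= u" using su by auto
    have "sgn \<kappa> * (log_norm \<mu> (p s) (euler_step (u - s) b g) - log_norm \<mu> (p u) g) <=
      (u - s) * (w^2 / (4 * \<epsilon> * \<bar>p s - 1\<bar>)) + K * ((u - s) * sqrt (u - s))" unfolding K_def
    proof (rule log_norm_euler_step[OF f(1,2) A f(3) f(4)[folded b_def] r(1,2) bd(1) bi])
      show "norm (b x - D \<mu> x) <= w" for x unfolding b_def w_def by (rule lip[OF mt P2])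
      show "\<bar>p s\<bar> <= R" "\<bar>p u\<bar> <= R" unfolding R_def using su by (auto intro!: p_bound)
      show "\<bar>p s - p u\<bar> <= \<bar>p s - 1\<bar> * (4 * (1 - \<epsilon>) * \<rho>) * (u - s)" by (rule p_increment[OF r(4)])
    qed (auto simp: S_def \<epsilon> sgn_p)
    also have "... <= (u - s) * rate t + (u - s) * d"
    proof (rule add_mono)
      have "\<bar>p t - 1\<bar> <= \<bar>p s - 1\<bar>"
        unfolding p_minus_1 using su \<epsilon> \<rho> by (intro mult_left_mono) (auto intro!: mult_left_mono mult_nonneg_nonneg)
      then have "w^2 / (4 * \<epsilon> * \<bar>p s - 1\<bar>) <= rate t" unfolding rate_def w_def using \<epsilon> p_pos[of t] p_pos[of s]
        by (intro divide_left_mono mult_left_mono mult_pos_pos) auto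
      then show "(u - s) * (w^2 / (4 * \<epsilon> * \<bar>p s - 1\<bar>)) <= (u - s) * rate t" using r by (intro mult_left_mono)
      have "K * ((u - s) * sqrt (u - s)) <= \<bar>K\<bar> * ((u - s) * sqrt (u - s))" using r by (intro mult_right_mono) auto
      also have "... = (u - s) * (\<bar>K\<bar> * (sqrt (1 * (u - s)) + (u - s) * 0))" by simp
      also have "... <= (u - s) * d" using e1(2)[OF r(1,3)] r by (intro mult_left_mono)
      finally show "K * ((u - s) * sqrt (u - s)) <= (u - s) * d" .
    qed
    finally show "sgn \<kappa> * (log_norm \<mu> (p s) (euler_step (u - s) (D (m t)) g) - log_norm \<mu> (p u) g) <= (rate t + d) * (u - s)"
      by (simp add: b_def algebra_simps)
  qed
qed

definition Rate :: "real => real" where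
  "Rate t = integral {t0..t} rate"

text \<open>The straddle form of differentiability at t, matching intervals that contain t without
  starting there.\<close>

lemma Rate_straddle:
  assumes t: "t0 <= t" "t <= T" and d: "0 < d"
  obtains e where "0 < e" "\<And>s u. t0 <= s ==> s <= t ==> t <= u ==> u <= T ==> u - s < e ==> (rate t - d) * (u - s) <= Rate u - Rate s"
proof -
  have "(Rate has_real_derivative rate t) (at t within {t0..T})"
    unfolding Rate_def using t by (intro integral_has_real_derivative continuous_on_subset[OF rate_continuous]) auto
  then have "(Rate has_derivative (\<lambda>h. rate t * h)) (at t within {t0..T})" by (simp add: has_field_derivative_def)
  then obtain e where e: "0 < e" "\<And>y. y \<in> {t0..T} ==> norm (y - t) < e ==> norm (Rate y - Rate t - rate t * (y - t)) <= d * norm (y - t)"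
    unfolding has_derivative_within_alt using d by blast
  show ?thesis
  proof (rule that[OF e(1)])
    fix s u assume su: "t0 <= s" "s <= t" "t <= u" "u <= T" "u - s < e"
    have "norm (Rate s - Rate t - rate t * (s - t)) <= d * norm (s - t)" using su by (intro e) auto
    moreover have "norm (s - t) = t - s" "norm (u - t) = u - t" using su by auto
    ultimately have 1: "Rate s - Rate t <= rate t * (s - t) + d * (t - s)" by (simp only:) (simp add: abs_le_iff)
    have "norm (Rate u - Rate t - rate t * (u - t)) <= d * norm (u - t)" using su by (intro e) auto
    then have 2: "rate t * (u - t) - d * (u - t) <= Rate u - Rate t" using \<open>norm (u - t) = u - t\<close> by (simp only:) (simp add: abs_le_iff)
    have "rate t * (u - t) - d * (u - t) - (rate t * (s - t) + d * (t - s)) <= Rate u - Rate s" using 1 2 by linarith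
    then show "(rate t - d) * (u - s) <= Rate u - Rate s" by (simp add: algebra_simps)
  qed
qed

text \<open>\<open>P s u\<close> carries any function of class \<open>Cl u\<close> back to one of
  class \<open>Cl s\<close>. Its errors are additive, so P is transitive over adjacent intervals,
  and an Euler step proves it on short intervals around each time: these are the premises of
  Bolzano's principle. The C^3 constant in \<open>Cl v\<close> grows exponentially backwards in time
  and so stays below its value at \<open>t0\<close>.\<close>

lemma backward_flow:
  assumes T: "t0 <= T" and w: "C3 A w" "\<And>x. w x \<in> {exp (- L)..exp L}" and d: "0 < d"
  shows "\<exists>w'. continuous_on UNIV w' \<and> (\<forall>x. w' x \<in> {exp (- L)..exp L}) \<and>
    \<bar>(LINT x|(m T). w x) - (LINT x|m t0. w' x)\<bar> <= d * (T - t0) \<and>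
    sgn \<kappa> * (log_norm \<mu> (p t0) w' - log_norm \<mu> (p T) w) <= Rate T + d * (T - t0)"
proof -
  define k where "k = 7 * M + 3 * M^2"
  have M0: "0 <= M" by (rule M0[OF P2])
  have k0: "0 <= k" using M0 by (simp add: k_def)
  have A0: "0 <= A" using w(1) by (simp add: C3_def)
  define Cl where "Cl v f \<longleftrightarrow> C3 (A * exp (k * (T - v))) f \<and> (\<forall>x. f x \<in> {exp (- L)..exp L})" for v and f :: "'a => real"
  \<comment> \<open>The bounds \<open>t0 <= s\<close> and \<open>u <= T\<close> are premises inside
    P because the principle tests all short intervals around t, including those that leave
    [t0, T].\<close>
  define P where "P s u \<longleftrightarrow> (t0 <= s --> u <= T --> (\<forall>f. Cl u f --> (\<exists>g. Cl s g \<and>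
     \<bar>(LINT x|m u. f x) - (LINT x|m s. g x)\<bar> <= d * (u - s) \<and>
     sgn \<kappa> * (log_norm \<mu> (p s) g - log_norm \<mu> (p u) f) <= Rate u - Rate s + d * (u - s))))" for s u
  have lbI: "log_bounded \<mu> L f" if "continuous_on UNIV f" "\<And>x. f x \<in> {exp (- L)..exp L}" for f unfolding log_bounded_def
  proof (intro conjI allI)
    show "f \<in> borel_measurable \<mu>" by (rule measurable_continuous[OF that(1)])
    fix x
    show pos: "0 < f x" using that(2)[of x] less_le_trans[OF exp_gt_zero[of "- L"], of "f x"] by simp
    show "\<bar>ln (f x)\<bar> <= L" using ln_bound_interval[OF pos] that(2) by blast
  qed
  have C3c: "continuous_on UNIV f" if "C3 a f" for a and f :: "'a => real"
    using that C2L_D(11)[OF C2L_of_derivs3] unfolding C3_def by blast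
  have "P t0 T" using T
  proof (induction rule: Bolzano)
    case (trans a b c)
    show ?case unfolding P_def
    proof (intro impI allI)
      fix f assume ac: "t0 <= a" "c <= T" and f: "Cl c f"
      have "t0 <= b" "b <= T" using trans ac by auto
      then obtain g where g: "Cl b g" "\<bar>(LINT x|m c. f x) - (LINT x|m b. g x)\<bar> <= d * (c - b)"
        "sgn \<kappa> * (log_norm \<mu> (p b) g - log_norm \<mu> (p c) f) <= Rate c - Rate b + d * (c - b)"
        using trans(2) ac f unfolding P_def by blast
      then obtain h where h: "Cl a h" "\<bar>(LINT x|m b. g x) - (LINT x|m a. h x)\<bar> <= d * (b - a)"
        "sgn \<kappa> * (log_norm \<mu> (p a) h - log_norm \<mu> (p b) g) <= Rate b - Rate a + d * (b - a)"
        using trans(1) ac \<open>b <= T\<close> unfolding P_def by blast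
      show "\<exists>g. Cl a g \<and> \<bar>(LINT x|m c. f x) - (LINT x|m a. g x)\<bar> <= d * (c - a) \<and>
         sgn \<kappa> * (log_norm \<mu> (p a) g - log_norm \<mu> (p c) f) <= Rate c - Rate a + d * (c - a)"
        using g h by (intro exI[of _ h] conjI) (auto simp: right_diff_distrib)
    qed
  next
    case (local t)
    \<comment> \<open>One constant for every function that can occur: the largest C^3 constant plus
      exp L, which bounds the values as \<open>euler_step_increment\<close> requires.\<close>
    define A' where "A' = A * exp (k * (T - t0)) + exp L"
    have A'0: "0 <= A'" using A0 by (simp add: A'_def)
    have d2: "0 < d / 2" using d by simp
    have t': "0 <= t" using local t0 by simp
    note mt = m_P2[OF t']
    from euler_step_increment[OF t' d A'0] obtain e1 where e1: "e1 > 0 \<and> (\<forall>w w1 w2 w3 s u. has_derivs3 w w1 w2 w3 --> derivs_bounded A' A' A' w1 w2 w3 --> (\<forall>x. \<bar>w x\<bar> <= A') -->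
      0 <= s --> s <= t --> t <= u --> u - s < e1 -->
       \<bar>(LINT x|m u. w x) - (LINT x|m s. euler_step (u - s) (D (m t)) w x)\<bar> <= d * (u - s))" ..
    from log_norm_local[OF local(1) d2 A'0, of L] obtain e2 where e2: "e2 > 0 \<and> (\<forall>w w1 w2 w3 s u. has_derivs3 w w1 w2 w3 --> derivs_bounded A' A' A' w1 w2 w3 --> log_bounded \<mu> L w -->
      log_bounded \<mu> L (euler_step (u - s) (D (m t)) w) --> t0 <= s --> s <= t --> t <= u --> u - s < e2 -->
      sgn \<kappa> * (log_norm \<mu> (p s) (euler_step (u - s) (D (m t)) w) - log_norm \<mu> (p u) w) <= (rate t + d / 2) * (u - s))" ..
    obtain e3 where e3: "0 < e3" "\<And>s u. t0 <= s ==> s <= t ==> t <= u ==> u <= T ==> u - s < e3 ==>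
      (rate t - d / 2) * (u - s) <= Rate u - Rate s" using Rate_straddle[OF local d2] by blast
    show ?case
    \<comment> \<open>The 1 in the minimum meets the restriction on the step length in
      \<open>C3_euler_step\<close>.\<close>
    proof (intro exI[of _ "min (min e1 e2) (min e3 1)"] conjI allI impI)
      show "0 < min (min e1 e2) (min e3 1)" using e1 e2 e3 by simp
      fix s u assume su0: "s <= t \<and> t <= u \<and> u - s < min (min e1 e2) (min e3 1)"
      then have su: "s <= t" "t <= u" "u - s < e1" "u - s < e2" "u - s < e3" "0 <= u - s" "u - s <= 1" by auto
      show "P s u" unfolding P_def
      proof (intro impI allI)
        fix f assume sT: "t0 <= s" "u <= T" and f: "Cl u f"
        have s0: "0 <= s" using sT t0 by simp
        define Q where "Q = euler_step (u - s) (D (m t)) f"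
        have fr: "f x \<in> {exp (- L)..exp L}" for x using f by (simp add: Cl_def)
        have Qr: "Q x \<in> {exp (- L)..exp L}" for x
          using euler_step_bounds[of "exp (- L)" f "exp L" "u - s" "D (m t)" x] fr by (auto simp: Q_def)
        have "C3 (A * exp (k * (T - u)) * exp (k * (u - s))) Q"
          unfolding Q_def k_def using C3_euler_step[OF _ D[OF mt] su(6,7)] f by (simp add: Cl_def k_def)
        moreover have "A * exp (k * (T - u)) * exp (k * (u - s)) = A * exp (k * (T - s))"
          by (simp add: algebra_simps flip: exp_add)
        ultimately have QC: "C3 (A * exp (k * (T - s))) Q" by simp
        have "A * exp (k * (T - u)) <= A'"
        proof -
          have "k * (T - u) <= k * (T - t0)" using k0 sT su by (intro mult_left_mono) auto
          then have "A * exp (k * (T - u)) <= A * exp (k * (T - t0))" using A0 by (intro mult_left_mono) auto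
          then show ?thesis using exp_ge_zero[of L] unfolding A'_def by linarith
        qed
        then have "C3 A' f" using f C3_mono unfolding Cl_def by blast
        then obtain f1 f2 f3 where fd: "has_derivs3 f f1 f2 f3" "derivs_bounded A' A' A' f1 f2 f3" by (auto simp: C3_def)
        have fA: "\<forall>x. \<bar>f x\<bar> <= A'"
        proof
          fix x
          have "0 <= f x" "f x <= exp L" using fr[of x] order_trans[OF exp_ge_zero[of "- L"], of "f x"] by auto
          moreover have "0 <= A * exp (k * (T - t0))" using A0 by simp
          ultimately show "\<bar>f x\<bar> <= A'" unfolding A'_def by linarith
        qed
        have lf: "log_bounded \<mu> L f" by (rule lbI[OF C3c[OF \<open>C3 A' f\<close>] fr])
        have lQ: "log_bounded \<mu> L Q" by (rule lbI[OF C3c[OF QC] Qr])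
        have a1: "\<bar>(LINT x|m u. f x) - (LINT x|m s. Q x)\<bar> <= d * (u - s)"
          unfolding Q_def by (rule e1[THEN conjunct2, THEN spec, THEN spec, THEN spec, THEN spec, THEN spec, THEN spec,
            THEN mp, THEN mp, THEN mp, THEN mp, THEN mp, THEN mp, THEN mp, OF fd fA s0 su(1-3)])
        have a2: "sgn \<kappa> * (log_norm \<mu> (p s) Q - log_norm \<mu> (p u) f) <= (rate t + d / 2) * (u - s)"
          unfolding Q_def by (rule e2[THEN conjunct2, THEN spec, THEN spec, THEN spec, THEN spec, THEN spec, THEN spec,
            THEN mp, THEN mp, THEN mp, THEN mp, THEN mp, THEN mp, THEN mp, THEN mp, OF fd lf lQ[unfolded Q_def] sT(1) su(1,2,4)])
        have "(rate t + d / 2) * (u - s) = (rate t - d / 2) * (u - s) + d * (u - s)" by (simp add: algebra_simps)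
        also have "... <= Rate u - Rate s + d * (u - s)" using e3(2)[OF sT(1) su(1,2) sT(2) su(5)] by simp
        finally have a3: "sgn \<kappa> * (log_norm \<mu> (p s) Q - log_norm \<mu> (p u) f) <= Rate u - Rate s + d * (u - s)" using a2 by linarith
        show "\<exists>g. Cl s g \<and> \<bar>(LINT x|m u. f x) - (LINT x|m s. g x)\<bar> <= d * (u - s) \<and>
           sgn \<kappa> * (log_norm \<mu> (p s) g - log_norm \<mu> (p u) f) <= Rate u - Rate s + d * (u - s)"
          using a1 a3 QC Qr by (intro exI[of _ Q]) (simp add: Cl_def)
      qed
    qed
  qed
  moreover have "Cl T w" using w by (simp add: Cl_def)
  ultimately obtain g where g: "Cl t0 g" "\<bar>(LINT x|(m T). w x) - (LINT x|m t0. g x)\<bar> <= d * (T - t0)"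
    "sgn \<kappa> * (log_norm \<mu> (p t0) g - log_norm \<mu> (p T) w) <= Rate T - Rate t0 + d * (T - t0)" unfolding P_def by blast
  have "continuous_on UNIV g" using g(1) C3c unfolding Cl_def by blast
  moreover have "Rate t0 = 0" by (simp add: Rate_def)
  ultimately show ?thesis using g by (intro exI[of _ g]) (simp add: Cl_def)
qed

end

section \<open>Duality of logarithmic norms\<close>

lemma powr_young:
  fixes y s :: real assumes "0 < y" "0 < s" "s < 1"
  shows "y powr s <= s * y + (1 - s)"
proof -
  have "exp ((1 - s) *\<^sub>R 0 + s *\<^sub>R ln y) <= (1 - s) * exp 0 + s * exp (ln y)" using assms by (intro convex_onD[OF exp_convex]) auto
  then show ?thesis using assms by (simp add: powr_def)
qed

text \<open>The sign is 1 where y^q is convex and -1 where it is concave, so one formula covers all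
  exponents. The convex cases reduce to \<open>powr_young\<close>: for q > 1 with exponent 1/q
  applied to y^q, for q < 0 with exponent 1 / (1 - q) applied to y^(q-1).\<close>

lemma powr_bernoulli:
  fixes y q :: real assumes "0 < y"
  shows "sgn (q * (q - 1)) * (1 + q * (y - 1)) <= sgn (q * (q - 1)) * y powr q"
proof -
  consider "q < 0" | "q = 0" | "0 < q" "q < 1" | "q = 1" | "1 < q" by linarith
  then show ?thesis
  proof cases
    case 1
    have "(y powr (q - 1)) powr (1 / (1 - q)) <= 1 / (1 - q) * y powr (q - 1) + (1 - 1 / (1 - q))"
      using 1 assms by (intro powr_young) auto
    moreover have "(y powr (q - 1)) powr (1 / (1 - q)) = 1 / y"
    proof -
      have "(q - 1) * (1 / (1 - q)) = - 1" using 1 by (simp add: field_simps)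
      then show ?thesis using assms by (simp only: powr_powr) (simp add: powr_minus_divide)
    qed
    ultimately have "(1 - q) * (1 / y) <= (1 - q) * (1 / (1 - q) * y powr (q - 1) + (1 - 1 / (1 - q)))"
      using 1 by (intro mult_left_mono) auto
    also have "... = y powr (q - 1) - q" using 1 by (simp add: right_diff_distrib distrib_left)
    finally have "y * ((1 - q) * (1 / y)) <= y * (y powr (q - 1) - q)" using assms by (intro mult_left_mono) auto
    also have "... = y powr q - q * y" using assms by (simp add: powr_diff algebra_simps)
    finally have "1 - q <= y powr q - q * y" using assms by simp
    with 1 show ?thesis by (simp add: sgn_mult algebra_simps)
  next
    case 3
    then show ?thesis using powr_young[OF assms 3] by (simp add: sgn_mult algebra_simps)
  next
    case 5
    have "(y powr q) powr (1 / q) <= 1 / q * y powr q + (1 - 1 / q)" using 5 assms by (intro powr_young) auto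
    then have "q * y <= q * (1 / q * y powr q + (1 - 1 / q))" using 5 assms by (intro mult_left_mono) (auto simp: powr_powr)
    also have "... = y powr q + q - 1" using 5 by (simp add: field_simps)
    finally show ?thesis using 5 by (simp add: sgn_mult algebra_simps)
  qed (use assms in auto)
qed

lemma powr_tangent:
  fixes a x q :: real assumes a: "0 < a" and x: "0 <= x" "q <= 0 ==> 0 < x"
  shows "sgn (q * (q - 1)) * (a powr q + q * a powr (q - 1) * (x - a)) <= sgn (q * (q - 1)) * x powr q"
proof (cases "x = 0")
  case True
  then have "0 < q" using x by force
  have "a powr (q - 1) * a = a powr q" using a by (simp add: powr_diff)
  then have eq: "a powr q + q * a powr (q - 1) * (x - a) = (1 - q) * a powr q" using True by (simp add: algebra_simps)
  have "sgn (q * (q - 1)) * (1 - q) <= 0" using \<open>0 < q\<close> by (cases q "1 :: real" rule: linorder_cases) (auto simp: sgn_mult)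
  then have "sgn (q * (q - 1)) * (1 - q) * a powr q <= 0" by (rule mult_nonpos_nonneg) simp
  then show ?thesis unfolding eq using True \<open>0 < q\<close> by (simp add: mult.assoc)
next
  case False
  then have x: "0 < x" using x by simp
  have "sgn (q * (q - 1)) * (1 + q * (x / a - 1)) <= sgn (q * (q - 1)) * (x / a) powr q" using a x by (intro powr_bernoulli) auto
  then have "sgn (q * (q - 1)) * (1 + q * (x / a - 1)) * a powr q <= sgn (q * (q - 1)) * (x / a) powr q * a powr q"
    by (rule mult_right_mono) simp
  moreover have "(1 + q * (x / a - 1)) * a powr q = a powr q + q * a powr (q - 1) * (x - a)"
    using a by (simp add: powr_diff field_simps)
  moreover have "(x / a) powr q * a powr q = x powr q" using a x by (simp add: powr_divide)
  ultimately show ?thesis by (simp only: mult.assoc)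
qed

text \<open>Here \<open>0 powr q = 0\<close> also for negative \<open>q\<close>, so that positivity has to be required separately.\<close>

definition finite_log_norm :: "'a measure => real => ('a => real) => bool" where
  "finite_log_norm M q k \<longleftrightarrow> (if q = 0 then integrable M (\<lambda>x. ln (k x)) else integrable M (\<lambda>x. k x powr q)) \<and>
     (q <= 0 --> (AE x in M. 0 < k x))"

locale prob_density = prob_space M for M :: "'a measure" +
  fixes k :: "'a => real"
  assumes k_measurable [measurable]: "k \<in> borel_measurable M" and k_nonneg: "\<And>x. 0 <= k x"
    and k_integrable: "integrable M k" and k_integral: "(LINT x|M. k x) = 1"
begin

text \<open>\<open>k\<close> has integral 1, so it cannot vanish almost everywhere, and neither can
  a function whose zeros are zeros of \<open>k\<close>.\<close>

lemma integral_pos_of_density: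
  fixes f :: "'a => real"
  assumes "integrable M f" "\<And>x. 0 <= f x" "\<And>x. f x = 0 ==> k x = 0"
  shows "0 < (LINT x|M. f x)"
proof (rule ccontr)
  assume "\<not> ?thesis"
  moreover have "0 <= (LINT x|M. f x)" by (intro integral_nonneg_AE AE_I2 assms(2))
  ultimately have "(LINT x|M. f x) = 0" by simp
  then have "AE x in M. f x = 0" using assms by (subst (asm) integral_nonneg_eq_0_iff_AE) auto
  then have "AE x in M. k x = 0" by (rule AE_mp) (use assms in auto)
  then have "(LINT x|M. k x) = (LINT x|M. 0)" by (intro integral_cong_AE) auto
  then show False using k_integral by simp
qed

lemma integral_powr_pos:
  assumes "integrable M (\<lambda>x. k x powr q)"
  shows "0 < (LINT x|M. k x powr q)" using assms by (rule integral_pos_of_density) auto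

lemma log_bounded_mult_density:
  assumes "log_bounded M L f"
  shows "integrable M (\<lambda>x. f x * k x)" "0 < (LINT x|M. f x * k x)"
proof -
  note d = log_boundedD[OF assms]
  note [measurable] = d(1)
  have b: "f x <= exp L" for x using d(3)[of x] ln_bound_interval[OF d(2)[of x], of L] by auto
  show i: "integrable M (\<lambda>x. f x * k x)"
  proof (rule Bochner_Integration.integrable_bound[of M "\<lambda>x. exp L * k x"])
    show "AE x in M. norm (f x * k x) <= norm (exp L * k x)"
      using b d(2) k_nonneg by (intro AE_I2) (simp add: abs_mult abs_of_pos mult_right_mono)
  qed (auto simp: k_integrable)
  show "0 < (LINT x|M. f x * k x)"
    proof (rule integral_pos_of_density[OF i])
    fix x show "0 <= f x * k x" using d(2)[of x] k_nonneg[of x] by simp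
    assume "f x * k x = 0" then show "k x = 0" using d(2)[of x] by simp
  qed
qed

text \<open>Jensen's inequality for y^q under the tilted probability g = f^p / N: the function y = k
  f^(1-p) N has mean a = int f k, and int g y^q = N^(q-1) K because p + q = p q. The tangent at a
  gives s a^q <= s N^(q-1) K with s the sign of convexity; taking logarithms and dividing by |q| is
  the claim. At q = 0 the bound ln x <= x - 1 plays this role.\<close>

lemma dual_holder:
  assumes q: "q \<noteq> 1" and fin: "finite_log_norm M q k" and f: "log_bounded M L f"
  shows "sgn (q - 1) * (ln (LINT x|M. f x * k x) - log_norm M (q / (q - 1)) f) <= sgn (q - 1) * log_norm M q k"
proof -
  note d = log_boundedD[OF f]
  note [measurable] = d(1)
  define a where "a = (LINT x|M. f x * k x)"
  note ai = log_bounded_mult_density[OF f]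
  have a0: "0 < a" using ai(2) by (simp add: a_def)
  show ?thesis
  proof (cases "q = 0")
    case True
    have k0: "AE x in M. 0 < k x" and kl: "integrable M (\<lambda>x. ln (k x))" using fin True by (auto simp: finite_log_norm_def)
    have li: "integrable M (\<lambda>x. ln (f x))" by (rule log_bounded_ln(1)[OF f])
    have "(LINT x|M. ln (f x) + ln (k x)) <= (LINT x|M. ln a + (1 / a) * (f x * k x) - 1)"
    proof (rule integral_mono_AE)
      have "ln (f x) + ln (k x) <= ln a + (1 / a) * (f x * k x) - 1" if "0 < k x" for x
      proof -
        have "ln (f x * k x / a) <= f x * k x / a - 1" using that d(2)[of x] a0 by (intro ln_le_minus_one) auto
        then show ?thesis using that d(2)[of x] a0 by (simp add: ln_div ln_mult)
      qed
      then show "AE x in M. ln (f x) + ln (k x) <= ln a + (1 / a) * (f x * k x) - 1" using k0 by auto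
    qed (use li kl ai in auto)
    also have "... = ln a" using ai a0 by (simp add: a_def[symmetric] prob_space)
    finally show ?thesis using True li kl by (simp add: log_norm_def a_def)
  next
    case False
    define p where "p = q / (q - 1)"
    have p: "p \<noteq> 0" "p + q - p * q = 0" "1 / p = (q - 1) / q" using False q by (auto simp: p_def field_simps)
    define s where "s = sgn (q * (q - 1))"
    have kq: "integrable M (\<lambda>x. k x powr q)" using fin False by (simp add: finite_log_norm_def)
    have k0: "AE x in M. q <= 0 --> 0 < k x" using fin by (auto simp: finite_log_norm_def)
    define N where "N = (LINT x|M. f x powr p)"
    have N: "0 < N" unfolding N_def by (rule log_bounded_powr(4)[OF f])
    have fp: "integrable M (\<lambda>x. f x powr p)" by (rule log_bounded_powr(1)[OF f])
    define K where "K = (LINT x|M. k x powr q)"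
    have K: "0 < K" unfolding K_def by (rule integral_powr_pos[OF kq])
    have "(LINT x|M. s * (a powr q - q * a powr (q - 1) * a) / N * f x powr p + s * q * a powr (q - 1) * (f x * k x)) <=
        (LINT x|M. s * N powr (q - 1) * k x powr q)"
    proof (rule integral_mono_AE)
      have "s * (a powr q - q * a powr (q - 1) * a) / N * f x powr p + s * q * a powr (q - 1) * (f x * k x) <= s * N powr (q - 1) * k x powr q"
        if x: "q <= 0 --> 0 < k x" for x
      proof -
        define g where "g = f x powr p / N"
        define y where "y = k x * f x powr (1 - p) * N"
        have g: "0 < g" unfolding g_def using N d(2)[of x] by simp
        have 1: "g * y = f x * k x"
        proof -
          have "f x powr p * f x powr (1 - p) = f x" unfolding powr_add[symmetric] using d(2)[of x] by simp
          then show ?thesis using N by (simp add: g_def y_def field_simps)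
        qed
        have 2: "g * y powr q = N powr (q - 1) * k x powr q"
        proof -
          have "f x powr p * f x powr ((1 - p) * q) = 1"
            unfolding powr_add[symmetric] using d(2)[of x] p(2) by (simp add: algebra_simps)
          moreover have "y powr q = k x powr q * f x powr ((1 - p) * q) * N powr q"
            using N k_nonneg[of x] by (simp add: y_def powr_mult powr_powr)
          moreover have "N powr (q - 1) = N powr q / N" using N by (simp add: powr_diff)
          ultimately show ?thesis using N unfolding g_def by (simp add: field_simps)
        qed
        have "s * (a powr q + q * a powr (q - 1) * (y - a)) <= s * y powr q" unfolding s_def using a0 x N k_nonneg[of x] d(2)[of x]
          by (intro powr_tangent) (auto simp: y_def zero_less_mult_iff)
        then have "g * (s * (a powr q + q * a powr (q - 1) * (y - a))) <= g * (s * y powr q)" using g by (rule mult_left_mono[OF _ less_imp_le])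
        moreover have "g * (s * y powr q) = s * N powr (q - 1) * k x powr q" using 2 by (simp add: mult_ac)
        moreover have "g * (s * (a powr q + q * a powr (q - 1) * (y - a))) =
          s * (a powr q - q * a powr (q - 1) * a) * g + s * q * a powr (q - 1) * (g * y)" by (simp add: algebra_simps)
        ultimately show ?thesis unfolding 1 by (simp add: g_def)
      qed
      then show "AE x in M. s * (a powr q - q * a powr (q - 1) * a) / N * f x powr p + s * q * a powr (q - 1) * (f x * k x) <= s * N powr (q - 1) * k x powr q"
        using k0 by auto
    qed (use fp kq ai in auto)
    moreover have "(LINT x|M. c * f x powr p + e * (f x * k x)) = c * N + e * a" for c e using fp ai by (simp add: N_def a_def)
    moreover have "(LINT x|M. s * N powr (q - 1) * k x powr q) = s * (N powr (q - 1) * K)" by (simp add: K_def)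
    ultimately have "s * (a powr q - q * a powr (q - 1) * a) / N * N + s * q * a powr (q - 1) * a <= s * (N powr (q - 1) * K)"
      by (simp only:)
    moreover have "c / N * N = c" for c using N by simp
    ultimately have "s * (a powr q - q * a powr (q - 1) * a) + s * q * a powr (q - 1) * a <= s * (N powr (q - 1) * K)"
      by (simp only:)
    then have "s * a powr q <= s * (N powr (q - 1) * K)" by (simp add: algebra_simps)
    moreover have ln: "ln (N powr (q - 1) * K) = (q - 1) * ln N + ln K" "ln (a powr q) = q * ln a"
      using N K a0 by (simp_all add: ln_mult ln_powr)
    moreover have pos: "0 < a powr q" "0 < N powr (q - 1) * K" using N K a0 by simp_all
    moreover have s: "s = 1 \<or> s = - 1" using False q by (auto simp: s_def sgn_if)
    ultimately have le: "s * (q * ln a) <= s * ((q - 1) * ln N + ln K)"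
      unfolding ln[symmetric] using ln_le_cancel_iff[OF pos] ln_le_cancel_iff[OF pos(2,1)] by (elim disjE) (simp_all only: mult_1_left mult_minus_left neg_le_iff_le)
    \<comment> \<open>Division by q reverses the inequality for negative q; the product of this sign
      with s is the sign in the claim.\<close>
    have "sgn (q - 1) = s * sgn q" by (simp add: s_def sgn_mult) (use False q in \<open>auto simp: sgn_if\<close>)
    moreover have "s * sgn q * ln a = s * (q * ln a) / \<bar>q\<bar>" using False by (simp add: sgn_if)
    moreover have "s * (q * ln a) / \<bar>q\<bar> <= s * ((q - 1) * ln N + ln K) / \<bar>q\<bar>" using le by (rule divide_right_mono) simp
    moreover have "s * ((q - 1) * ln N + ln K) / \<bar>q\<bar> = s * sgn q * (ln N / p + ln K / q)"
      using False q by (simp add: p_def sgn_if field_simps)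
    ultimately have "sgn (q - 1) * ln a <= sgn (q - 1) * (ln N / p + ln K / q)" by simp
    then show ?thesis using False p
      by (simp add: log_norm_def N_def[symmetric] K_def[symmetric] a_def[symmetric] p_def[symmetric] algebra_simps)
  qed
qed

end

section \<open>From the dual inequality back to the norm\<close>

text \<open>Fatou's lemma with a set S of good points: off S the functions tend to infinity, so a
  bound on the integrals forces S to have full measure. This yields positivity of the density for
  exponents q <= 0.\<close>

lemma fatou_bound:
  fixes g :: "nat => 'a => real" and f :: "'a => real"
  assumes g: "\<And>n. integrable M (g n)" "\<And>n x. 0 <= g n x" and b: "\<forall>\<^sub>F n in sequentially. (LINT x|M. g n x) <= b n" "b \<longlonglongrightarrow> B"
    and f: "\<And>x. x \<in> S ==> (\<lambda>n. g n x) \<longlonglongrightarrow> f x" "f \<in> borel_measurable M" "\<And>x. 0 <= f x"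
    and top: "\<And>x. x \<notin> S ==> filterlim (\<lambda>n. g n x) at_top sequentially"
  shows "AE x in M. x \<in> S" "integrable M f" "(LINT x|M. f x) <= B"
proof -
  define G where "G x = liminf (\<lambda>n. ennreal (g n x))" for x
  note [measurable] = borel_measurable_integrable[OF g(1)]
  note [measurable] = f(2)
  have [measurable]: "G \<in> borel_measurable M" unfolding G_def by measurable
  have inS: "G x = ennreal (f x)" if "x \<in> S" for x
    unfolding G_def using f(1)[OF that] by (intro lim_imp_Liminf tendsto_ennrealI) auto
  have out: "G x = \<infinity>" if "x \<notin> S" for x
  proof -
    have "(\<lambda>n. ennreal (g n x)) \<longlonglongrightarrow> \<infinity>" using top[OF that] by (metis ennreal_tendsto_top_eq_at_top infinity_ennreal_def)
    then show ?thesis unfolding G_def by (intro lim_imp_Liminf) auto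
  qed
  have "(\<integral>\<^sup>+x. G x \<partial>M) <= liminf (\<lambda>n. \<integral>\<^sup>+x. ennreal (g n x) \<partial>M)" unfolding G_def by (intro nn_integral_liminf) auto
  also have "... = liminf (\<lambda>n. ennreal (LINT x|M. g n x))" using g by (simp add: nn_integral_eq_integral)
  also have "... <= liminf (\<lambda>n. ennreal (b n))" by (intro Liminf_mono eventually_mono[OF b(1)] ennreal_leI)
  also have "... = ennreal B" using b(2) by (intro lim_imp_Liminf tendsto_ennrealI) auto
  finally have le: "(\<integral>\<^sup>+x. G x \<partial>M) <= ennreal B" .
  then have "(\<integral>\<^sup>+x. G x \<partial>M) \<noteq> \<infinity>" by (auto simp: top_unique)
  then have "AE x in M. G x \<noteq> \<infinity>" by (intro nn_integral_PInf_AE) auto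
  then show S: "AE x in M. x \<in> S" by eventually_elim (metis out)
  have eq: "(\<integral>\<^sup>+x. ennreal (f x) \<partial>M) = (\<integral>\<^sup>+x. G x \<partial>M)" by (intro nn_integral_cong_AE) (use S in \<open>eventually_elim, simp add: inS\<close>)
  show i: "integrable M f"
  proof (rule integrableI_nonneg)
    show "(\<integral>\<^sup>+x. ennreal (f x) \<partial>M) < \<infinity>" unfolding eq using le_less_trans[OF le ennreal_less_top] by simp
  qed (use f in auto)
  have B0: "0 <= B"
  proof (rule tendsto_lowerbound[OF b(2)])
    show "\<forall>\<^sub>F n in sequentially. 0 <= b n"
      by (rule eventually_mono[OF b(1)]) (rule order_trans[OF integral_nonneg_AE[OF AE_I2[OF g(2)]]])
  qed simp
  show "(LINT x|M. f x) <= B" using le f(3) i B0 unfolding eq[symmetric] by (simp add: nn_integral_eq_integral)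
qed

context prob_density
begin

text \<open>Truncation from both sides, so that the power q - 1 of the clipped density is a
  legitimate test function whatever the sign of q - 1.\<close>

definition clip :: "nat => 'a => real" where
  "clip n x = max (1 / real (Suc n)) (min (k x) (real (Suc n)))"

lemma clip_bounds:
  shows "1 / real (Suc n) <= clip n x" "clip n x <= real (Suc n)" "0 < clip n x" "\<bar>ln (clip n x)\<bar> <= ln (real (Suc n))"
proof -
  have "1 / real (Suc n) <= 1" by simp
  then have "1 / real (Suc n) <= real (Suc n)" by (simp add: field_simps)
  then show l: "1 / real (Suc n) <= clip n x" and u: "clip n x <= real (Suc n)" by (auto simp: clip_def)
  have "0 < 1 / real (Suc n)" by simp
  then show 0: "0 < clip n x" using l by linarith
  have "ln (1 / real (Suc n)) <= ln (clip n x)" using l 0 by (intro ln_mono) auto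
  moreover have "ln (clip n x) <= ln (real (Suc n))" using u 0 by (intro ln_mono) auto
  ultimately show "\<bar>ln (clip n x)\<bar> <= ln (real (Suc n))" by (simp add: ln_div abs_le_iff)
qed

lemma clip_le: "clip n x <= k x + 1"
proof -
  have "1 / real (Suc n) <= 1" by simp
  then show ?thesis using k_nonneg[of x] unfolding clip_def by linarith
qed

lemma clip_measurable [measurable]: "clip n \<in> borel_measurable M" unfolding clip_def[abs_def] by measurable

lemma log_bounded_clip: "log_bounded M (ln (real (Suc n))) (clip n)" using clip_bounds by (auto simp: log_bounded_def)

lemma log_bounded_clip_powr: "log_bounded M (\<bar>r\<bar> * ln (real (Suc n))) (\<lambda>x. clip n x powr r)"
proof -
  have "\<bar>ln (clip n x powr r)\<bar> <= \<bar>r\<bar> * ln (real (Suc n))" for x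
    using clip_bounds(3,4)[of n x] by (simp add: ln_powr abs_mult mult_left_mono)
  moreover have "0 < clip n x powr r" for x using clip_bounds(3)[of n x] by simp
  ultimately show ?thesis by (simp add: log_bounded_def)
qed

lemma clip_tendsto: "(\<lambda>n. clip n x) \<longlonglongrightarrow> k x"
proof -
  obtain N where N: "k x <= real N" using real_arch_simple by blast
  have "(\<lambda>n. max (1 / real (Suc n)) (k x)) \<longlonglongrightarrow> max 0 (k x)" by (intro tendsto_max tendsto_const LIMSEQ_Suc[OF lim_1_over_n])
  moreover have "\<forall>\<^sub>F n in sequentially. max (1 / real (Suc n)) (k x) = clip n x"
    using eventually_ge_at_top[of N] by eventually_elim (use N in \<open>auto simp: clip_def min_def\<close>)
  ultimately show ?thesis using k_nonneg[of x] by (simp add: tendsto_cong max_absorb2)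
qed

text \<open>Put y = 1 / (n + 1). For q > 1 the clipped density exceeds k only where it equals y, at
  a cost of at most y^(q-1) y. For q < 1 it falls short of k only where it equals 1/y, at a cost of
  at most y^(1-q) times the mass of k, which is 1.\<close>

definition clip_error :: "real => nat => real" where
  "clip_error q n = (if 1 < q then (1 / real (Suc n)) powr q else (1 / real (Suc n)) powr (1 - q))"

lemma clip_error_tendsto: assumes "q \<noteq> 1" shows "clip_error q \<longlonglongrightarrow> 0"
proof -
  have "(\<lambda>n. (1 / real (Suc n)) powr r) \<longlonglongrightarrow> 0" if "0 < r" for r
    by (rule tendsto_eq_rhs[OF tendsto_powr'[OF LIMSEQ_Suc[OF lim_1_over_n] tendsto_const]]) (use that in auto)
  from this[of q] this[of "1 - q"] show ?thesis using assms unfolding clip_error_def[abs_def] by (cases "1 < q") simp_all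
qed

lemma clip_dual:
  assumes "q \<noteq> 1"
  shows "sgn (q - 1) * ((LINT x|M. clip n x powr q) - (LINT x|M. clip n x powr (q - 1) * k x)) <= clip_error q n"
proof -
  note i1 = log_bounded_powr(1)[OF log_bounded_clip] and i2 = log_bounded_mult_density(1)[OF log_bounded_clip_powr]
  have eq: "(LINT x|M. clip n x powr q) - (LINT x|M. clip n x powr (q - 1) * k x) = (LINT x|M. clip n x powr (q - 1) * (clip n x - k x))"
  proof -
    have "clip n x powr (q - 1) * (clip n x - k x) = clip n x powr q - clip n x powr (q - 1) * k x" for x
      using clip_bounds(3)[of n x] by (simp add: powr_diff field_simps)
    then show ?thesis using i1 i2 by simp
  qed
  define y where "y = 1 / real (Suc n)"
  have y: "0 < y" "y <= 1" "real (Suc n) = 1 / y" by (auto simp: y_def)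
  have i: "integrable M (\<lambda>x. clip n x powr (q - 1) * (clip n x - k x))"
  proof -
    have "clip n x powr (q - 1) * (clip n x - k x) = clip n x powr q - clip n x powr (q - 1) * k x" for x
      using clip_bounds(3)[of n x] by (simp add: powr_diff field_simps)
    then show ?thesis using i1 i2 by simp
  qed
  have yy: "y <= 1 / y" using y by (simp add: field_simps mult_le_one)
  show ?thesis
  proof (cases "1 < q")
    case True
    have "clip n x powr (q - 1) * (clip n x - k x) <= y powr q" for x
    proof (cases "k x <= y")
      case True
      then have "clip n x = y" using yy unfolding clip_def y_def[symmetric] y(3) by auto
      moreover have "y powr (q - 1) * (y - k x) <= y powr (q - 1) * y" using k_nonneg[of x] by (intro mult_left_mono) auto
      ultimately show ?thesis using y by (simp add: powr_diff)
    next
      case False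
      then have "clip n x - k x <= 0" unfolding clip_def y_def[symmetric] y(3) using yy by auto
      then have "clip n x powr (q - 1) * (clip n x - k x) <= 0" by (intro mult_nonneg_nonpos) auto
      also have "0 <= y powr q" by simp
      finally show ?thesis .
    qed
    then have "(LINT x|M. clip n x powr (q - 1) * (clip n x - k x)) <= (LINT x|M. y powr q)" using i by (intro integral_mono) auto
    then show ?thesis using True unfolding eq by (simp add: clip_error_def y_def prob_space)
  next
    case False
    then have q: "q < 1" using assms by simp
    have "- (y powr (1 - q) * k x) <= clip n x powr (q - 1) * (clip n x - k x)" for x
    proof (cases "k x <= 1 / y")
      case True
      then have "0 <= clip n x - k x" unfolding clip_def y_def[symmetric] y(3) by auto
      then have "0 <= clip n x powr (q - 1) * (clip n x - k x)" by simp
      moreover have "0 <= y powr (1 - q) * k x" using k_nonneg[of x] by simp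
      ultimately show ?thesis by linarith
    next
      case False
      then have "clip n x = 1 / y" unfolding clip_def y_def[symmetric] y(3) using yy by auto
      moreover have "(1 / y) powr (q - 1) = y powr (1 - q)" using y by (simp add: powr_divide powr_minus_divide[symmetric])
      moreover have "y powr (1 - q) * (- k x) <= y powr (1 - q) * (1 / y - k x)" using y by (intro mult_left_mono) auto
      ultimately show ?thesis by simp
    qed
    then have "(LINT x|M. - (y powr (1 - q) * k x)) <= (LINT x|M. clip n x powr (q - 1) * (clip n x - k x))"
      using i k_integrable by (intro integral_mono) auto
    then show ?thesis using q unfolding eq by (simp add: clip_error_def y_def k_integral)
  qed
qed

text \<open>The bound is uniform in n because min(k, 1) <= clip <= max(k, 1); it turns the absolute
  error \<open>clip_error\<close> into a relative one.\<close>

lemma clip_integral_lower: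
  obtains N where "0 < N" "\<And>n. N <= (LINT x|M. clip n x powr q)"
proof -
  define N where "N = (if 0 < q then (LINT x|M. min (k x) 1 powr q) else (LINT x|M. max (k x) 1 powr q))"
  have b: "min (k x) 1 <= clip n x" "clip n x <= max (k x) 1" for n x
  proof -
    have "1 / real (Suc n) <= 1" "1 <= real (Suc n)" by simp_all
    then show "min (k x) 1 <= clip n x" "clip n x <= max (k x) 1" unfolding clip_def by linarith+
  qed
  have i: "integrable M (\<lambda>x. min (k x) 1 powr q)" if "0 < q"
    using that k_nonneg by (intro integrable_bounded[where B = 1]) (auto intro!: powr_le1)
  have i': "integrable M (\<lambda>x. max (k x) 1 powr q)" if "\<not> 0 < q"
  proof (rule integrable_bounded[where B = 1])
    fix x
    have "max (k x) 1 powr q <= max (k x) 1 powr 0" using that by (intro powr_mono) auto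
    moreover have "max (k x) 1 \<noteq> 0" by (simp add: max_def)
    ultimately show "\<bar>max (k x) 1 powr q\<bar> <= 1" by simp
  qed auto
  show ?thesis
  proof (rule that[of N])
    show "0 < N"
    proof (cases "0 < q")
      case True
      have "0 < (LINT x|M. min (k x) 1 powr q)"
        by (rule integral_pos_of_density[OF i[OF True]]) (auto simp: min_def split: if_splits)
      then show ?thesis using True by (simp add: N_def)
    next
      case False
      have "0 < (LINT x|M. max (k x) 1 powr q)"
        by (rule integral_pos_of_density[OF i'[OF False]]) (auto simp: max_def split: if_splits)
      then show ?thesis using False by (simp add: N_def)
    qed
    fix n
    note ci = log_bounded_powr(1)[OF log_bounded_clip[of n], of q]
    show "N <= (LINT x|M. clip n x powr q)"
    proof (cases "0 < q")
      case True
      then show ?thesis unfolding N_def using b(1) k_nonneg by (simp only: if_True) (intro integral_mono i ci powr_mono2, auto)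
    next
      case False
      then show ?thesis unfolding N_def using b(2) clip_bounds(3)[of n]
        by (simp only: if_False) (intro integral_mono i' ci powr_mono2', auto)
    qed
  qed
qed

text \<open>The extremal function of the duality, clip^(q-1), is inserted. As (q - 1) p = q, its log
  norm of exponent p is ln(J)/p with J = int clip^q, so the dual inequality bounds the log norm of
  clip up to the gap ln J - ln I, where I = int clip^(q-1) k. The case q = 0 is computed
  separately.\<close>

lemma dual_clip_bound:
  assumes q: "q \<noteq> 1"
    and dual: "\<And>L f. log_bounded M L f ==> sgn (q - 1) * (ln (LINT x|M. f x * k x) - log_norm M (q / (q - 1)) f) <= sgn (q - 1) * R"
  obtains d where "d \<longlonglongrightarrow> 0" "\<forall>\<^sub>F n in sequentially. sgn (q - 1) * log_norm M q (clip n) <= sgn (q - 1) * R + d n"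
proof -
  obtain N where N: "0 < N" "\<And>n. N <= (LINT x|M. clip n x powr q)" using clip_integral_lower[of q] by blast
  \<comment> \<open>Eventually the clipping error is below N/2, and then the quantity divided by, I
    for q > 1 and J for q < 1, is at least N/2.\<close>
  define d where "d n = 2 * clip_error q n / N" for n
  define J where "J n = (LINT x|M. clip n x powr q)" for n
  define I where "I n = (LINT x|M. clip n x powr (q - 1) * k x)" for n
  have dl: "d \<longlonglongrightarrow> 0" unfolding d_def[abs_def]
    by (rule tendsto_eq_rhs[OF tendsto_divide[OF tendsto_mult[OF tendsto_const clip_error_tendsto[OF q]] tendsto_const]]) (use N in auto)
  have "\<forall>\<^sub>F n in sequentially. clip_error q n < N / 2" using clip_error_tendsto[OF q] N by (intro order_tendstoD(2)) auto
  then have "\<forall>\<^sub>F n in sequentially. sgn (q - 1) * log_norm M q (clip n) <= sgn (q - 1) * R + d n"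
  proof eventually_elim
    case (elim n)
    have e0: "0 <= clip_error q n" by (simp add: clip_error_def)
    have I0: "0 < I n" unfolding I_def by (rule log_bounded_mult_density(2)[OF log_bounded_clip_powr])
    have J0: "N <= J n" unfolding J_def by (rule N)
    have IJ: "sgn (q - 1) * (J n - I n) <= clip_error q n" unfolding I_def J_def by (rule clip_dual[OF q])
    have ln: "sgn (q - 1) * (ln (J n) - ln (I n)) <= d n"
    proof (cases "1 < q")
      case True
      then have 1: "J n <= I n + clip_error q n" using IJ by simp
      have 2: "N / 2 <= I n" using 1 elim J0 by linarith
      have "ln (J n) - ln (I n) = ln (J n / I n)" using J0 N I0 by (simp add: ln_div)
      also have "... <= J n / I n - 1" using J0 N I0 by (intro ln_le_minus_one) auto
      also have "... = (J n - I n) / I n" using I0 by (simp add: field_simps)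
      also have "... <= clip_error q n / I n" using 1 I0 by (intro divide_right_mono) auto
      also have "... <= clip_error q n / (N / 2)" using e0 2 N by (intro divide_left_mono) auto
      finally show ?thesis using True by (simp add: d_def mult.commute)
    next
      case False
      then have 1: "I n - J n <= clip_error q n" using IJ q by simp
      have "ln (I n) - ln (J n) = ln (I n / J n)" using J0 N I0 by (simp add: ln_div)
      also have "... <= I n / J n - 1" using J0 N I0 by (intro ln_le_minus_one) auto
      also have "... = (I n - J n) / J n" using J0 N by (simp add: field_simps)
      also have "... <= clip_error q n / J n" using 1 J0 N by (intro divide_right_mono) auto
      also have "... <= clip_error q n / (N / 2)" using e0 J0 N by (intro divide_left_mono) auto
      finally show ?thesis using False q by (simp add: d_def mult.commute)
    qed
    have D: "sgn (q - 1) * (ln (I n) - log_norm M (q / (q - 1)) (\<lambda>x. clip n x powr (q - 1))) <= sgn (q - 1) * R"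
      unfolding I_def by (rule dual[OF log_bounded_clip_powr])
    show ?case
    proof (cases "q = 0")
      case True
      have "J n = 1" using clip_bounds(3)[of n] True by (simp add: J_def prob_space less_imp_neq[symmetric])
      moreover have "log_norm M (q / (q - 1)) (\<lambda>x. clip n x powr (q - 1)) = - log_norm M q (clip n)"
      proof -
        have "(LINT x|M. ln (clip n x powr (q - 1))) = (q - 1) * (LINT x|M. ln (clip n x))"
          using clip_bounds(3)[of n] by (simp add: ln_powr)
        then show ?thesis unfolding True log_norm_def by simp
      qed
      ultimately show ?thesis using D ln True by simp
    next
      case False
      define p where "p = q / (q - 1)"
      have p: "p \<noteq> 0" "(q - 1) * p = q" using False q by (auto simp: p_def)
      have "log_norm M p (\<lambda>x. clip n x powr (q - 1)) = ln (J n) / p" using p by (simp add: log_norm_def powr_powr J_def)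
      moreover have "log_norm M q (clip n) = ln (J n) / q" using False by (simp add: log_norm_def J_def)
      moreover have "ln (J n) / p = ln (J n) - ln (J n) / q" using False q by (simp add: p_def field_simps)
      ultimately have eq: "log_norm M q (clip n) = (ln (I n) - log_norm M p (\<lambda>x. clip n x powr (q - 1))) + (ln (J n) - ln (I n))"
        by linarith
      show ?thesis using D ln unfolding eq p_def[symmetric] distrib_left by linarith
    qed
  qed
  with dl show ?thesis by (rule that)
qed

text \<open>Passage to the limit in the clipping. For q > 1 and q < 0 the bound on int clip^q is
  from above and Fatou's lemma applies, with divergence where k = 0 if q < 0. For 0 < q < 1 the
  bound is from below, so the limit must be exact, by domination with a multiple of 1 and k. For q =
  0 Fatou is applied to k + 1 - ln clip.\<close>

lemma dual_converse:
  assumes q: "q \<noteq> 1"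
    and dual: "\<And>L h. log_bounded M L h ==> sgn (q - 1) * (ln (LINT x|M. h x * k x) - log_norm M (q / (q - 1)) h) <= sgn (q - 1) * R"
  shows "finite_log_norm M q k" "sgn (q - 1) * log_norm M q k <= sgn (q - 1) * R"
proof -
  obtain d where d: "d \<longlonglongrightarrow> 0" "\<forall>\<^sub>F n in sequentially. sgn (q - 1) * log_norm M q (clip n) <= sgn (q - 1) * R + d n"
    by (rule dual_clip_bound[OF q, of R]) (erule dual, blast)
  note ci = log_bounded_powr(1)[OF log_bounded_clip]
  have inv: "filterlim (\<lambda>n. clip n x) (at_right 0) sequentially" if "\<not> 0 < k x" for x
  proof -
    have "clip n x \<in> {0<..} \<and> clip n x \<noteq> 0" for n using clip_bounds(3)[of n x] by simp
    moreover have "(\<lambda>n. clip n x) \<longlonglongrightarrow> 0" using clip_tendsto[of x] that k_nonneg[of x] by simp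
    ultimately show ?thesis by (simp add: filterlim_at)
  qed
  have "finite_log_norm M q k \<and> sgn (q - 1) * log_norm M q k <= sgn (q - 1) * R"
  proof (cases "q = 0")
    case True
    \<comment> \<open>Nonnegative because ln clip <= clip - 1 <= k; the integral of k + 1 is 2,
      which explains the 2 below.\<close>
    define g where "g n x = k x + 1 - ln (clip n x)" for n x
    define f where "f x = (if 0 < k x then k x + 1 - ln (k x) else 0)" for x
    note cl = log_bounded_ln(1)[OF log_bounded_clip]
    have g1: "integrable M (g n)" for n unfolding g_def[abs_def] using cl k_integrable by simp
    have g2: "0 <= g n x" for n x
    proof -
      show ?thesis using ln_le_minus_one[OF clip_bounds(3)[of n x]] clip_le[of n x] by (simp add: g_def)
    qed
    have g3: "(LINT x|M. g n x) = 2 - log_norm M q (clip n)" for n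
      unfolding g_def log_norm_def using True cl k_integrable by (simp add: k_integral prob_space)
    have b1: "\<forall>\<^sub>F n in sequentially. (LINT x|M. g n x) <= 2 - R + d n" using d(2) by eventually_elim (use True g3 in simp)
    have b2: "(\<lambda>n. 2 - R + d n) \<longlonglongrightarrow> 2 - R" by (rule tendsto_eq_rhs[OF tendsto_add[OF tendsto_const d(1)]]) simp
    have f1: "(\<lambda>n. g n x) \<longlonglongrightarrow> f x" if "x \<in> {x. 0 < k x}" for x
      using that unfolding g_def f_def by (auto intro!: tendsto_intros clip_tendsto)
    have f3: "0 <= f x" for x using ln_le_minus_one[of "k x"] by (auto simp: f_def)
    have top: "filterlim (\<lambda>n. g n x) at_top sequentially" if "x \<notin> {x. 0 < k x}" for x
    proof -
      have "filterlim (\<lambda>n. ln (clip n x)) at_bot sequentially" using filterlim_compose[OF ln_at_0 inv[of x]] that by simp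
      then have "filterlim (\<lambda>n. (k x + 1) + (- ln (clip n x))) at_top sequentially"
        by (intro filterlim_tendsto_add_at_top[OF tendsto_const]) (simp add: filterlim_uminus_at_bot)
      then show ?thesis by (simp add: g_def)
    qed
    have fm: "f \<in> borel_measurable M" unfolding f_def[abs_def] by measurable
    note F = fatou_bound[where M = M and g = g and S = "{x. 0 < k x}", OF g1 g2 b1 b2 f1 fm f3 top]
    have pos: "AE x in M. 0 < k x" using F(1) by simp
    have i: "integrable M (\<lambda>x. k x + 1 - f x)" using F(2) k_integrable by simp
    have eq: "AE x in M. k x + 1 - f x = ln (k x)" using pos by eventually_elim (simp add: f_def)
    have il: "integrable M (\<lambda>x. ln (k x))" using i eq by (subst (asm) integrable_cong_AE[OF _ _ eq]) (use fm in auto)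
    have "(LINT x|M. ln (k x)) = (LINT x|M. k x + 1 - f x)" using fm by (intro integral_cong_AE) (use eq in auto)
    also have "... = 2 - (LINT x|M. f x)" using F(2) k_integrable by (simp add: k_integral prob_space)
    finally show ?thesis using True pos il F(3) by (simp add: finite_log_norm_def log_norm_def)
  next
    case q0: False
    have ln: "log_norm M q (clip n) = ln (LINT x|M. clip n x powr q) / q" for n using q0 by (simp add: log_norm_def)
    have J0: "0 < (LINT x|M. clip n x powr q)" for n by (rule log_bounded_powr(4)[OF log_bounded_clip])
    show ?thesis
    proof (cases "0 < q \<and> q < 1")
      case True
      have pb: "y powr q <= 1 + y" if "0 <= y" for y :: real
      proof (cases "y = 0")
        case False
        then have "y powr q <= q * y + (1 - q)" using that True by (intro powr_young) auto
        moreover have "q * y <= 1 * y" using that True by (intro mult_right_mono) auto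
        ultimately show ?thesis using True by linarith
      qed simp
      have i: "integrable M (\<lambda>x. k x powr q)"
        by (rule Bochner_Integration.integrable_bound[of M "\<lambda>x. 1 + k x"]) (use k_integrable k_nonneg pb in auto)
      have lim: "(\<lambda>n. LINT x|M. clip n x powr q) \<longlonglongrightarrow> (LINT x|M. k x powr q)"
      proof (rule integral_dominated_convergence[where w = "\<lambda>x. 2 + k x"])
        show "AE x in M. norm (clip n x powr q) <= 2 + k x" for n
        proof (intro AE_I2)
          fix x show "norm (clip n x powr q) <= 2 + k x" using pb[of "clip n x"] clip_bounds(3)[of n x] clip_le[of n x] by simp
        qed
        show "AE x in M. (\<lambda>n. clip n x powr q) \<longlonglongrightarrow> k x powr q"
          using True by (intro AE_I2 tendsto_powr' clip_tendsto tendsto_const) (auto simp: less_imp_le[OF clip_bounds(3)])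
      qed (use k_integrable in auto)
      have ev: "\<forall>\<^sub>F n in sequentially. exp (q * (R - d n)) <= (LINT x|M. clip n x powr q)" using d(2)
      proof eventually_elim
        case (elim n)
        then have "R - d n <= ln (LINT x|M. clip n x powr q) / q" using True by (simp add: ln)
        then have "q * (R - d n) <= ln (LINT x|M. clip n x powr q)" using True by (simp add: field_simps)
        then show ?case using J0[of n] by (metis exp_le_cancel_iff exp_ln)
      qed
      have "(\<lambda>n. exp (q * (R - d n))) \<longlonglongrightarrow> exp (q * (R - 0))" by (intro tendsto_intros d(1))
      then have "exp (q * R) <= (LINT x|M. k x powr q)" using tendsto_le[OF _ lim _ ev] by simp
      then have "q * R <= ln (LINT x|M. k x powr q)" by (simp add: ln_ge_iff integral_powr_pos[OF i])
      then show ?thesis using True i by (simp add: finite_log_norm_def log_norm_def field_simps)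
    next
      case False
      then have s: "0 < sgn (q - 1) * q" using q q0 by (auto simp: sgn_if)
      have s2: "sgn (q - 1) * sgn (q - 1) = 1" using q by (simp add: sgn_if)
      define S where "S = {x. q < 0 --> 0 < k x}"
      have b1: "\<forall>\<^sub>F n in sequentially. (LINT x|M. clip n x powr q) <= exp (q * R + sgn (q - 1) * q * d n)" using d(2)
      proof eventually_elim
        case (elim n)
        then have "sgn (q - 1) * q * (sgn (q - 1) * (ln (LINT x|M. clip n x powr q) / q)) <= sgn (q - 1) * q * (sgn (q - 1) * R + d n)"
          unfolding ln using s by (intro mult_left_mono) auto
        moreover have "sgn (q - 1) * q * (sgn (q - 1) * y) = q * y" for y using s2 by (metis mult.commute mult.left_commute mult_1)
        ultimately have "ln (LINT x|M. clip n x powr q) <= q * R + sgn (q - 1) * q * d n" using q0 by (simp add: distrib_left)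
        then show ?case using J0[of n] by (metis exp_le_cancel_iff exp_ln)
      qed
      have b2: "(\<lambda>n. exp (q * R + sgn (q - 1) * q * d n)) \<longlonglongrightarrow> exp (q * R)"
        by (rule tendsto_eq_rhs[OF tendsto_exp[OF tendsto_add[OF tendsto_const tendsto_mult[OF tendsto_const d(1)]]]]) simp
      have f1: "(\<lambda>n. clip n x powr q) \<longlonglongrightarrow> k x powr q" if "x \<in> S" for x
        using that q0 k_nonneg[of x] by (intro tendsto_powr' clip_tendsto tendsto_const) (auto simp: S_def less_imp_le[OF clip_bounds(3)])
      have top: "filterlim (\<lambda>n. clip n x powr q) at_top sequentially" if "x \<notin> S" for x
      proof -
        have "filterlim (\<lambda>n. ln (clip n x)) at_bot sequentially"
          using filterlim_compose[OF ln_at_0 inv[of x]] that by (simp add: S_def)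
        then have "filterlim (\<lambda>n. - ln (clip n x)) at_top sequentially" by (simp add: filterlim_uminus_at_bot)
        then have "filterlim (\<lambda>n. (- q) * (- ln (clip n x))) at_top sequentially"
          using that by (intro filterlim_tendsto_pos_mult_at_top[OF tendsto_const]) (auto simp: S_def)
        then have "filterlim (\<lambda>n. q * ln (clip n x)) at_top sequentially" by simp
        then have "filterlim (\<lambda>n. exp (q * ln (clip n x))) at_top sequentially" by (rule filterlim_compose[OF exp_at_top])
        then show ?thesis using clip_bounds(3)[of _ x] by (simp add: powr_def less_imp_neq[symmetric])
      qed
      have p0: "0 <= clip n x powr q" "0 <= k x powr q" for n x by simp_all
      have m: "(\<lambda>x. k x powr q) \<in> borel_measurable M" by measurable
      note F = fatou_bound[where M = M and g = "\<lambda>n x. clip n x powr q" and S = S, OF ci p0(1) b1 b2 f1 m p0(2) top]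
      have "ln (LINT x|M. k x powr q) <= q * R"
        using F(3) integral_powr_pos[OF F(2)] by (metis ln_exp ln_le_cancel_iff exp_gt_zero)
      then have "ln (LINT x|M. k x powr q) / \<bar>q\<bar> <= q * R / \<bar>q\<bar>" by (rule divide_right_mono) simp
      then have "sgn (q - 1) * (ln (LINT x|M. k x powr q) / q) <= sgn (q - 1) * R"
        using False q q0 by (auto simp: sgn_if abs_if not_less split: if_splits)
      moreover have "q <= 0 --> (AE x in M. 0 < k x)" using F(1) q0 by (auto simp: S_def)
      ultimately show ?thesis using F(2) q0 by (simp add: finite_log_norm_def log_norm_def)
    qed
  qed
  then show "finite_log_norm M q k" "sgn (q - 1) * log_norm M q k <= sgn (q - 1) * R" by auto
qed

end

lemma elog_ennreal: "0 < r ==> elog (ennreal r) = ereal (ln r)" by (simp add: elog_def)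

lemma epowr_ennreal: "0 < r ==> epowr (ennreal r) p = ennreal (r powr p)" by (simp add: epowr_def)

lemma epowr_infinity: "epowr \<infinity> p = (if p = 0 then 1 else if 0 < p then \<infinity> else 0)" by (simp add: epowr_def)

text \<open>Dictionary between the extended-valued norms of the statement and
  \<open>log_norm\<close>. The density is finite almost everywhere; for q <= 0, vanishing on a set
  of positive measure makes the norm 0, which \<open>Lp_plus\<close> and
  \<open>finite_log_norm\<close> both exclude.\<close>

lemma (in prob_space) Lp_norm_density:
  fixes h :: "'a => ennreal"
  assumes h [measurable]: "h \<in> borel_measurable M" and h1: "(\<integral>\<^sup>+x. h x \<partial>M) = 1"
  defines "k \<equiv> \<lambda>x. enn2real (h x)"
  shows "prob_density M k" "AE x in M. h x = ennreal (k x)"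
    and "h \<in> Lp_plus M q \<longleftrightarrow> finite_log_norm M q k"
    and "finite_log_norm M q k ==> elog (Lp_norm M q h) = ereal (log_norm M q k)"
proof -
  have [measurable]: "k \<in> borel_measurable M" unfolding k_def by measurable
  have k0: "0 <= k x" for x by (simp add: k_def)
  have "AE x in M. h x \<noteq> \<infinity>" using h1 by (intro nn_integral_PInf_AE) auto
  then show hk: "AE x in M. h x = ennreal (k x)" by eventually_elim (simp add: k_def less_top)
  have nk: "(\<integral>\<^sup>+x. ennreal (k x) \<partial>M) = 1"
    unfolding h1[symmetric] by (intro nn_integral_cong_AE) (use hk in \<open>eventually_elim, simp\<close>)
  have ki: "integrable M k" using nk k0 by (intro integrableI_nonneg) auto
  have k1: "(LINT x|M. k x) = 1" using nk k0 ki by (simp add: nn_integral_eq_integral)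
  show pd: "prob_density M k" by unfold_locales (use k0 ki k1 in auto)
  interpret k: prob_density M k by (rule pd)
  define I where "I = (\<integral>\<^sup>+x. epowr (h x) q \<partial>M)"
  have powr_part: "(h \<in> Lp_plus M q \<longleftrightarrow> finite_log_norm M q k) \<and>
    (finite_log_norm M q k --> elog (Lp_norm M q h) = ereal (log_norm M q k))" if q: "q \<noteq> 0"
  proof -
    have em: "(\<lambda>x. epowr (ennreal (k x)) q) \<in> borel_measurable M" unfolding epowr_def by measurable
    have Ik: "I = (\<integral>\<^sup>+x. epowr (ennreal (k x)) q \<partial>M)"
      unfolding I_def by (intro nn_integral_cong_AE) (use hk in \<open>eventually_elim, simp\<close>)
    have fin: "I = ennreal (LINT x|M. k x powr q)" "0 < (LINT x|M. k x powr q)" if f: "finite_log_norm M q k"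
    proof -
      have i: "integrable M (\<lambda>x. k x powr q)" using f q by (simp add: finite_log_norm_def)
      have "AE x in M. q <= 0 --> 0 < k x" using f by (auto simp: finite_log_norm_def)
      then have "AE x in M. epowr (ennreal (k x)) q = ennreal (k x powr q)"
        by eventually_elim (use q k0 in \<open>auto simp: epowr_def\<close>)
      then have "I = (\<integral>\<^sup>+x. ennreal (k x powr q) \<partial>M)" unfolding Ik by (rule nn_integral_cong_AE)
      then show "I = ennreal (LINT x|M. k x powr q)" using i by (simp add: nn_integral_eq_integral)
      show "0 < (LINT x|M. k x powr q)" by (rule k.integral_powr_pos[OF i])
    qed
    have conv: "finite_log_norm M q k" if I: "I \<noteq> \<infinity>"
    proof -
      have "AE x in M. epowr (ennreal (k x)) q \<noteq> \<infinity>" using I em unfolding Ik by (intro nn_integral_PInf_AE) auto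
      then have pos: "AE x in M. q <= 0 --> 0 < k x"
        by eventually_elim (use q k0 in \<open>auto simp: epowr_def less_le split: if_splits\<close>)
      then have "AE x in M. ennreal (k x powr q) = epowr (ennreal (k x)) q"
        by eventually_elim (use q k0 in \<open>auto simp: epowr_def\<close>)
      then have "(\<integral>\<^sup>+x. ennreal (k x powr q) \<partial>M) = I" unfolding Ik by (rule nn_integral_cong_AE)
      then have "integrable M (\<lambda>x. k x powr q)" using I by (intro integrableI_nonneg) (auto simp: less_top)
      then show ?thesis using q pos by (simp add: finite_log_norm_def)
    qed
    have Lp: "Lp_norm M q h = epowr I (1 / q)" using q by (simp add: Lp_norm_def I_def)
    show ?thesis
    proof (cases "finite_log_norm M q k")
      case True
      note f = fin[OF True]
      have "Lp_norm M q h = ennreal ((LINT x|M. k x powr q) powr (1 / q))" unfolding Lp f(1) by (rule epowr_ennreal[OF f(2)])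
      moreover have "0 < (LINT x|M. k x powr q) powr (1 / q)" using f(2) by simp
      ultimately show ?thesis using True q f(2) by (auto simp: Lp_plus_def elog_ennreal log_norm_def ln_powr)
    next
      case False
      then have "I = \<infinity>" using conv by blast
      then have "Lp_norm M q h = (if 0 < q then \<infinity> else 0)" unfolding Lp by (simp only: epowr_infinity) (use q in simp)
      then show ?thesis using False q by (auto simp: Lp_plus_def)
    qed
  qed
  have zero_part: "(h \<in> Lp_plus M q \<longleftrightarrow> finite_log_norm M q k) \<and>
    (finite_log_norm M q k --> elog (Lp_norm M q h) = ereal (log_norm M q k))" if q: "q = 0"
  proof -
    define J where "J = eintegral M (\<lambda>x. elog (h x))"
    have Jk: "J = eintegral M (\<lambda>x. elog (ennreal (k x)))"
    proof -
      have "(\<integral>\<^sup>+x. e2ennreal (elog (h x)) \<partial>M) = (\<integral>\<^sup>+x. e2ennreal (elog (ennreal (k x))) \<partial>M)"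
        "(\<integral>\<^sup>+x. e2ennreal (- elog (h x)) \<partial>M) = (\<integral>\<^sup>+x. e2ennreal (- elog (ennreal (k x))) \<partial>M)"
        by (intro nn_integral_cong_AE; use hk in \<open>eventually_elim, simp\<close>)+
      then show ?thesis by (simp add: J_def eintegral_def)
    qed
    have fin: "J = ereal (log_norm M q k)" if f: "finite_log_norm M q k"
    proof -
      have i: "integrable M (\<lambda>x. ln (k x))" and pos: "AE x in M. 0 < k x" using f q by (auto simp: finite_log_norm_def)
      have "eintegral M (\<lambda>x. elog (ennreal (k x))) = eintegral M (\<lambda>x. ereal (ln (k x)))"
      proof -
        have "(\<integral>\<^sup>+x. e2ennreal (elog (ennreal (k x))) \<partial>M) = (\<integral>\<^sup>+x. e2ennreal (ereal (ln (k x))) \<partial>M)"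
          "(\<integral>\<^sup>+x. e2ennreal (- elog (ennreal (k x))) \<partial>M) = (\<integral>\<^sup>+x. e2ennreal (- ereal (ln (k x))) \<partial>M)"
          by (intro nn_integral_cong_AE; use pos in \<open>eventually_elim, simp add: elog_ennreal\<close>)+
        then show ?thesis by (simp add: eintegral_def)
      qed
      then show ?thesis unfolding Jk using eintegral_real[OF i] q by (simp add: log_norm_def)
    qed
    have conv: "finite_log_norm M q k" if J: "J \<noteq> - \<infinity>"
    proof -
      define P where "P = (\<integral>\<^sup>+x. e2ennreal (elog (ennreal (k x))) \<partial>M)"
      define N where "N = (\<integral>\<^sup>+x. e2ennreal (- elog (ennreal (k x))) \<partial>M)"
      have em: "(\<lambda>x. e2ennreal (- elog (ennreal (k x)))) \<in> borel_measurable M" unfolding elog_def by measurable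
      \<comment> \<open>The positive part of ln k is at most k, so the extended integral can fail to
        be finite only by being minus infinity.\<close>
      have "P <= (\<integral>\<^sup>+x. ennreal (k x) \<partial>M)" unfolding P_def
      proof (rule nn_integral_mono)
        fix x
        show "e2ennreal (elog (ennreal (k x))) <= ennreal (k x)"
        proof (cases "k x = 0")
          case False
          then have "0 < k x" using k0[of x] by simp
          then show ?thesis using ln_le_minus_one[of "k x"] by (simp add: elog_ennreal e2ennreal_ereal ennreal_leI)
        qed (simp add: elog_def e2ennreal_neg)
      qed
      then have P: "P < \<infinity>" using nk by (auto simp: le_less_trans)
      have N: "N \<noteq> \<infinity>"
      proof
        assume "N = \<infinity>"
        then have "J = - \<infinity>" using P unfolding Jk eintegral_def P_def[symmetric] N_def[symmetric] by (cases P) auto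
        then show False using J by simp
      qed
      then have "AE x in M. e2ennreal (- elog (ennreal (k x))) \<noteq> \<infinity>" using em unfolding N_def by (intro nn_integral_PInf_AE) auto
      then have pos: "AE x in M. 0 < k x" by eventually_elim (use k0 in \<open>auto simp: elog_def less_le split: if_splits\<close>)
      have "AE x in M. e2ennreal (- elog (ennreal (k x))) = ennreal (- ln (k x))"
        using pos by eventually_elim (simp add: elog_ennreal e2ennreal_ereal)
      then have N': "(\<integral>\<^sup>+x. ennreal (- ln (k x)) \<partial>M) = N" unfolding N_def by (intro nn_integral_cong_AE) auto
      have "(\<integral>\<^sup>+x. ennreal (ln (k x)) \<partial>M) <= (\<integral>\<^sup>+x. ennreal (k x) \<partial>M)"
        using pos by (intro nn_integral_mono_AE, eventually_elim) (use ln_le_minus_one in \<open>force intro!: ennreal_leI\<close>)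
      then have "(\<integral>\<^sup>+x. ennreal (ln (k x)) \<partial>M) \<noteq> \<infinity>" using nk by (auto simp: top_unique)
      then have "integrable M (\<lambda>x. ln (k x))" using N unfolding N'[symmetric] by (simp add: real_integrable_def)
      then show ?thesis using q pos by (simp add: finite_log_norm_def)
    qed
    have Lp: "Lp_norm M q h = eexp J" using q by (simp add: Lp_norm_def J_def)
    show ?thesis
    proof (cases "finite_log_norm M q k")
      case True
      have "Lp_norm M q h = ennreal (exp (log_norm M q k))" unfolding Lp fin[OF True] by (simp add: eexp_def)
      then show ?thesis using True q by (auto simp: Lp_plus_def elog_ennreal)
    next
      case False
      then have "J = - \<infinity>" using conv by blast
      then have "Lp_norm M q h = 0" unfolding Lp by (simp add: eexp_def)
      then show ?thesis using False q by (auto simp: Lp_plus_def)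
    qed
  qed
  show "h \<in> Lp_plus M q \<longleftrightarrow> finite_log_norm M q k" using powr_part zero_part by blast
  show "finite_log_norm M q k ==> elog (Lp_norm M q h) = ereal (log_norm M q k)" using powr_part zero_part by blast
qed

section \<open>Densities along the flow\<close>

text \<open>Measurable functions are limits of continuous ones off a negligible set; clamping the
  approximants to [c, C] keeps the bounds and the limit.\<close>

lemma borel_approx_continuous:
  fixes f :: "'a::euclidean_space => real"
  assumes f: "f \<in> borel_measurable borel" "\<And>x. c <= f x" "\<And>x. f x <= C"
  obtains g where "\<And>n. continuous_on UNIV (g n)" "\<And>n x. c <= g n x" "\<And>n x. g n x <= C"
    "AE x in lborel. (\<lambda>n. g n x) \<longlonglongrightarrow> f x"
proof -
  have "f measurable_on UNIV" using f(1) by (intro lebesgue_measurable_imp_measurable_on) (auto intro: measurable_completion)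
  then obtain N g where g: "negligible N" "\<And>n :: nat. continuous_on UNIV (g n)" "\<And>x. x \<notin> N ==> (\<lambda>n. g n x) \<longlonglongrightarrow> f x"
    by (auto simp: measurable_on_def)
  show ?thesis
  proof (rule that[of "\<lambda>n x. max c (min (g n x) C)"])
    have "AE x in lebesgue. x \<notin> N" using g(1) by (intro AE_not_in) (simp add: negligible_iff_null_sets)
    then have "AE x in lborel. x \<notin> N" by (simp add: AE_completion_iff)
    then show "AE x in lborel. (\<lambda>n. max c (min (g n x) C)) \<longlonglongrightarrow> f x"
    proof eventually_elim
      case (elim x)
      have "(\<lambda>n. max c (min (g n x) C)) \<longlonglongrightarrow> max c (min (f x) C)" by (intro tendsto_intros g(3) elim)
      then show ?case using f(2,3)[of x] by simp
    qed
    show "continuous_on UNIV (\<lambda>x. max c (min (g n x) C))" for n by (intro continuous_intros g(2))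
  qed (use f in \<open>auto intro: order_trans[OF f(2,3)]\<close>)
qed

lemma C3_continuous: "C3 A f ==> continuous_on UNIV f"
  unfolding C3_def has_derivs3_def by (meson continuous_at_imp_continuous_on has_derivative_continuous)

text \<open>For measures on the Borel sets the property does not depend on the measure, which lets
  test functions pass from \<mu> to m_t and back.\<close>

lemma log_bounded_borel:
  assumes "sets M = sets borel"
  shows "log_bounded M L f \<longleftrightarrow> f \<in> borel_measurable borel \<and> (\<forall>x. f x \<in> {exp (- L)..exp L})"
proof -
  have "(0 < f x \<and> \<bar>ln (f x)\<bar> <= L) = (f x \<in> {exp (- L)..exp L})" for x
  proof (cases "0 < f x")
    case False
    then show ?thesis using exp_gt_zero[of "- L"] by (auto simp: not_less dest: order_trans)
  qed (use ln_bound_interval[of "f x" L] in simp)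
  then show ?thesis by (simp add: log_bounded_def measurable_cong_sets[OF assms refl])
qed

lemma (in prob_space) log_norm_tendsto:
  fixes f :: "nat => 'a => real"
  assumes f: "\<And>n. log_bounded M L (f n)" and g: "log_bounded M L g" and lim: "AE x in M. (\<lambda>n. f n x) \<longlonglongrightarrow> g x"
  shows "(\<lambda>n. log_norm M p (f n)) \<longlonglongrightarrow> log_norm M p g"
proof (cases "p = 0")
  case True
  have "(\<lambda>n. LINT x|M. ln (f n x)) \<longlonglongrightarrow> (LINT x|M. ln (g x))"
  proof (rule integral_dominated_convergence[where w = "\<lambda>_. L"])
    show "AE x in M. (\<lambda>n. ln (f n x)) \<longlonglongrightarrow> ln (g x)"
      using lim by eventually_elim (intro tendsto_ln, use log_boundedD(2)[OF g] in \<open>auto simp: less_imp_neq[symmetric]\<close>)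
  qed (use log_boundedD[OF f] log_boundedD[OF g] in auto)
  then show ?thesis using True by (simp add: log_norm_def)
next
  case False
  have "(\<lambda>n. LINT x|M. f n x powr p) \<longlonglongrightarrow> (LINT x|M. g x powr p)"
  proof (rule integral_dominated_convergence[where w = "\<lambda>_. exp (\<bar>p\<bar> * L)"])
    show "AE x in M. (\<lambda>n. f n x powr p) \<longlonglongrightarrow> g x powr p"
      using lim by eventually_elim (intro tendsto_powr tendsto_const, use log_boundedD(2)[OF g] in \<open>auto simp: less_imp_neq[symmetric]\<close>)
    show "AE x in M. norm (f n x powr p) <= exp (\<bar>p\<bar> * L)" for n using log_boundedD(6)[OF f[of n] order_refl] by simp
  qed (use log_boundedD(1)[OF f] log_boundedD(1)[OF g] in auto)
  then show ?thesis using False log_bounded_powr(4)[OF g]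
    by (simp add: log_norm_def) (intro tendsto_intros, auto simp: less_imp_neq[symmetric])
qed

lemma dual_inequality_limit:
  fixes f :: "nat => 'a::euclidean_space => real"
  assumes \<mu>: "prob_space \<mu>" "sets \<mu> = sets borel" and v: "prob_space v" "sets v = sets borel"
    and ac: "absolutely_continuous \<mu> v"
    and f: "\<And>n. log_bounded \<mu> L (f n)" and g: "log_bounded \<mu> L g" and lim: "AE x in \<mu>. (\<lambda>n. f n x) \<longlonglongrightarrow> g x"
    and le: "\<And>n. s * (ln (LINT x|v. f n x) - log_norm \<mu> p (f n)) <= c"
  shows "s * (ln (LINT x|v. g x) - log_norm \<mu> p g) <= c"
proof -
  have b: "log_bounded \<mu> L h \<longleftrightarrow> log_bounded v L h" for h :: "'a => real" by (simp add: log_bounded_borel \<mu> v)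
  have l: "AE x in v. (\<lambda>n. f n x) \<longlonglongrightarrow> g x" by (rule absolutely_continuous_AE[OF _ ac lim]) (simp add: \<mu> v)
  \<comment> \<open>The integral against v is a log norm of exponent 1, so one convergence lemma
    serves both terms.\<close>
  have "log_norm v 1 h = ln (LINT x|v. h x)" if "log_bounded v L h" for h
    using log_boundedD(2)[OF that] by (simp add: log_norm_def less_imp_le)
  then have "(\<lambda>n. ln (LINT x|v. f n x)) \<longlonglongrightarrow> ln (LINT x|v. g x)"
    using prob_space.log_norm_tendsto[OF v(1), of L f g 1] f g l b by simp
  then have "(\<lambda>n. s * (ln (LINT x|v. f n x) - log_norm \<mu> p (f n))) \<longlonglongrightarrow> s * (ln (LINT x|v. g x) - log_norm \<mu> p g)"
    by (intro tendsto_mult[OF tendsto_const] tendsto_diff prob_space.log_norm_tendsto[OF \<mu>(1) f g lim])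
  then show ?thesis by (rule LIMSEQ_le_const2) (use le in auto)
qed

text \<open>Two limits: C^3 functions reach continuous ones everywhere, and continuous ones reach
  Borel functions Lebesgue almost everywhere. Absolute continuity carries the second limit to \<mu>
  and on to v; this is why it has to be known before the dual inequality is available for all Borel
  functions.\<close>

lemma dual_inequality_extend:
  fixes h :: "'a::euclidean_space => real"
  assumes \<mu>: "prob_space \<mu>" "sets \<mu> = sets borel" and v: "prob_space v" "sets v = sets borel"
    and ac: "absolutely_continuous lborel \<mu>" "absolutely_continuous \<mu> v"
    and le: "\<And>A (f :: 'a => real) L. C3 A f ==> (\<And>x. f x \<in> {exp (- L)..exp L}) ==> s * (ln (LINT x|v. f x) - log_norm \<mu> p f) <= c"
    and h: "log_bounded \<mu> L h"
  shows "s * (ln (LINT x|v. h x) - log_norm \<mu> p h) <= c"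
proof -
  note lim = dual_inequality_limit[OF \<mu> v ac(2)] and lb = log_bounded_borel[OF \<mu>(2)]
  have cont: "s * (ln (LINT x|v. f x) - log_norm \<mu> p f) <= c"
    if f: "continuous_on UNIV f" "\<And>x. exp (- L) <= f x" "\<And>x. f x <= exp L" for f :: "'a => real"
  proof -
    obtain g where g: "\<And>n. \<exists>A. C3 A (g n)" "\<And>n x. exp (- L) <= g n x" "\<And>n x. g n x <= exp L" "\<And>x. (\<lambda>n. g n x) \<longlonglongrightarrow> f x"
      using C3_approx_continuous[OF f] by blast
    show ?thesis
    proof (rule lim)
      fix n
      obtain A where A: "C3 A (g n)" using g(1) by blast
      have "continuous_on UNIV (g n)" using A by (rule C3_continuous)
      then show "log_bounded \<mu> L (g n)" unfolding lb using g(2,3) by (auto intro: borel_measurable_continuous_onI)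
      show "s * (ln (LINT x|v. g n x) - log_norm \<mu> p (g n)) <= c" using A g(2,3) by (intro le[where L = L]) auto
    next
      show "log_bounded \<mu> L f" unfolding lb using f by (auto intro: borel_measurable_continuous_onI)
      show "AE x in \<mu>. (\<lambda>n. g n x) \<longlonglongrightarrow> f x" using g(4) by simp
    qed
  qed
  have h': "h \<in> borel_measurable borel" "\<And>x. exp (- L) <= h x" "\<And>x. h x <= exp L" using h by (auto simp: lb)
  obtain g where g: "\<And>n. continuous_on UNIV (g n)" "\<And>n x. exp (- L) <= g n x" "\<And>n x. g n x <= exp L"
    "AE x in lborel. (\<lambda>n. g n x) \<longlonglongrightarrow> h x" using borel_approx_continuous[OF h'] by blast
  show ?thesis
  proof (rule lim[OF _ h])
    show "log_bounded \<mu> L (g n)" for n unfolding lb using g by (auto intro: borel_measurable_continuous_onI)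
    show "AE x in \<mu>. (\<lambda>n. g n x) \<longlonglongrightarrow> h x" by (rule absolutely_continuous_AE[OF _ ac(1) g(4)]) (simp add: \<mu>)
    show "s * (ln (LINT x|v. g n x) - log_norm \<mu> p (g n)) <= c" for n by (rule cont) (use g in auto)
  qed
qed

text \<open>The test functions are bounded away from \<open>0\<close>, but uniformly in the bound, so that they can decrease
  to the indicator of a compact null set.\<close>

lemma absolutely_continuous_of_dual_bound:
  fixes \<mu> v :: "'a::euclidean_space measure"
  assumes \<mu>: "prob_space \<mu>" "sets \<mu> = sets borel" and v: "prob_space v" "sets v = sets borel"
    and bound: "\<And>d. 0 < d ==> \<exists>C. \<forall>L f. continuous_on UNIV f --> (\<forall>x. f x \<in> {exp (- L)..exp L}) -->
      (LINT x|v. f x) <= C * sqrt (LINT x|\<mu>. (f x)^2) + exp L * d"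
  shows "absolutely_continuous \<mu> v"
proof -
  interpret \<mu>: prob_space \<mu> by (rule \<mu>(1))
  interpret v: prob_space v by (rule v(1))
  have sp [simp]: "space \<mu> = UNIV" "space v = UNIV" using \<mu>(2) v(2) by (auto dest: sets_eq_imp_space_eq)
  have meas [simp]: "borel_measurable \<mu> = borel_measurable borel" "borel_measurable v = borel_measurable borel"
    using \<mu>(2) v(2) by (auto intro!: measurable_cong_sets)
  have K: "measure v K = 0" if K: "compact K" "measure \<mu> K = 0" for K
  proof (cases "K = {}")
    case False
    have clK: "closed K" using K(1) by (rule compact_imp_closed)
    have Kb: "K \<in> sets borel" using clK by simp
    \<comment> \<open>The floor exp(-2 n) is chosen so that exp(n) g_n takes values in
      [exp(-n), exp n]. The assumed bound is then used with L = n, and the common factor exp(n)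
      cancels from all its terms.\<close>
    define g where "g n x = max (exp (- 2 * real n)) (1 - real n * infdist x K)" for n :: nat and x
    have gc: "continuous_on UNIV (g n)" for n unfolding g_def by (intro continuous_intros)
    have gm: "g n \<in> borel_measurable borel" for n by (rule borel_measurable_continuous_onI[OF gc])
    have g1: "exp (- 2 * real n) <= g n x" "g n x <= 1" for n x using infdist_nonneg[of x K] by (auto simp: g_def)
    have g0: "0 < g n x" for n x using g1(1)[of n x] less_le_trans[OF exp_gt_zero] by blast
    have gK: "1 <= g n x" if "x \<in> K" for n x using that by (simp add: g_def)
    have glim: "(\<lambda>n. g n x) \<longlonglongrightarrow> indicator K x" for x
    proof (cases "x \<in> K")
      case True
      then have "g n x = 1" for n using gK g1 by (intro antisym) auto
      then show ?thesis using True by simp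
    next
      case out: False
      then have i: "0 < infdist x K" using clK False infdist_nonneg[of x K] by (metis in_closed_iff_infdist_zero less_le)
      obtain N where N: "1 / infdist x K <= real N" using real_arch_simple by blast
      have "(\<lambda>n. exp (- 2 * real n)) \<longlonglongrightarrow> 0" by real_asymp
      moreover have "\<forall>\<^sub>F n in sequentially. exp (- 2 * real n) = g n x" using eventually_ge_at_top[of N]
      proof eventually_elim
        case (elim n)
        then have "1 / infdist x K <= real n" using N by simp
        then have "1 - real n * infdist x K <= 0" using i by (simp add: field_simps)
        then show ?case unfolding g_def by (simp add: max_absorb1 order_trans[OF _ exp_ge_zero])
      qed
      ultimately show ?thesis using out by (simp add: tendsto_cong)
    qed
    have sq: "(\<lambda>n. LINT x|\<mu>. (g n x)^2) \<longlonglongrightarrow> (LINT x|\<mu>. (indicator K x)^2)"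
    proof (rule integral_dominated_convergence[where w = "\<lambda>_. 1"])
      show "AE x in \<mu>. (\<lambda>n. (g n x)^2) \<longlonglongrightarrow> (indicator K x)^2" by (intro AE_I2 tendsto_power glim)
      show "AE x in \<mu>. norm ((g n x)^2) <= 1" for n using g0[of n] g1(2)[of n] by (auto simp: power_le_one less_imp_le)
    qed (use gm Kb in auto)
    have "(LINT x|\<mu>. (indicator K x)^2) = measure \<mu> K"
      using Kb by (simp add: power2_eq_square indicator_inter_arith[symmetric] \<mu>(2))
    then have sq0: "(\<lambda>n. sqrt (LINT x|\<mu>. (g n x)^2)) \<longlonglongrightarrow> 0" using tendsto_real_sqrt[OF sq] K(2) by simp
    have "measure v K <= d" if d: "0 < d" for d
    proof -
      obtain C where C: "\<forall>L f. continuous_on UNIV f --> (\<forall>x. f x \<in> {exp (- L)..exp L}) -->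
        (LINT x|v. f x) <= C * sqrt (LINT x|\<mu>. (f x)^2) + exp L * d" using bound[OF d] ..
      have "measure v K <= C * sqrt (LINT x|\<mu>. (g n x)^2) + d" for n
      proof -
        define e where "e = exp (real n)"
        have e: "0 < e" "exp (- real n) = e * exp (- 2 * real n)" unfolding e_def by (auto simp: exp_add[symmetric])
        have "e * g n x \<in> {exp (- real n)..exp (real n)}" for x
          using g1[of n x] e unfolding e_def[symmetric] e(2) by (auto intro: mult_left_mono)
        then have "(LINT x|v. e * g n x) <= C * sqrt (LINT x|\<mu>. (e * g n x)^2) + exp (real n) * d"
          using C[THEN spec[of _ "real n"], THEN spec[of _ "\<lambda>x. e * g n x"]] gc[of n] by (auto intro!: continuous_intros)
        also have "(LINT x|\<mu>. (e * g n x)^2) = e^2 * (LINT x|\<mu>. (g n x)^2)" by (simp add: power_mult_distrib)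
        also have "sqrt ... = e * sqrt (LINT x|\<mu>. (g n x)^2)" using e by (simp add: real_sqrt_mult)
        finally have "e * (LINT x|v. g n x) <= e * (C * sqrt (LINT x|\<mu>. (g n x)^2) + d)"
          unfolding e_def[symmetric] by (simp add: algebra_simps)
        then have "(LINT x|v. g n x) <= C * sqrt (LINT x|\<mu>. (g n x)^2) + d" using e by simp
        moreover have "(LINT x|v. indicator K x) <= (LINT x|v. g n x)"
        proof (rule integral_mono)
          show "integrable v (g n)" using g0[of n] g1(2)[of n] gm by (intro v.integrable_bounded[where B = 1]) (auto simp: less_imp_le abs_le_iff intro: order_trans[OF _ less_imp_le])
          show "integrable v (indicator K :: 'a => real)" using Kb by (intro v.integrable_bounded[where B = 1]) (auto simp: indicator_def)
          show "indicator K x <= g n x" for x using gK[of x n] g0[of n x] by (auto simp: indicator_def)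
        qed
        ultimately show ?thesis using Kb by (simp add: v(2))
      qed
      moreover have "(\<lambda>n. C * sqrt (LINT x|\<mu>. (g n x)^2) + d) \<longlonglongrightarrow> C * 0 + d" by (intro tendsto_intros sq0)
      ultimately show ?thesis using LIMSEQ_le_const by fastforce
    qed
    then show ?thesis using dense_ge[of 0 "measure v K"] measure_nonneg[of v K] by (meson antisym not_le_imp_less)
  qed simp
  show ?thesis unfolding absolutely_continuous_def
  proof
    fix B assume B: "B \<in> null_sets \<mu>"
    then have Bb: "B \<in> sets borel" using \<mu>(2) by auto
    \<comment> \<open>Inner regularity reduces arbitrary Borel null sets to compact ones.\<close>
    have "emeasure v B = (SUP K \<in> {K. K \<subseteq> B \<and> compact K}. emeasure v K)" by (rule inner_regular[OF v(2) _ Bb]) simp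
    also have "... <= 0"
    proof (rule SUP_least)
      fix C assume C: "C \<in> {K. K \<subseteq> B \<and> compact K}"
      then have Cb: "C \<in> sets borel" by (auto intro: borel_compact)
      have "C \<in> null_sets \<mu>" using B C Cb \<mu>(2) by (auto intro: null_sets_subset)
      then have "measure \<mu> C = 0" by (simp add: measure_def null_setsD1)
      then have "measure v C = 0" using K C by auto
      then show "emeasure v C <= 0" by (simp add: v.emeasure_eq_measure)
    qed
    finally show "B \<in> null_sets v" using Bb v(2) by (auto intro: null_setsI)
  qed
qed

lemma (in prob_space) RN_deriv_density:
  assumes N: "prob_space N" "sets N = sets M" and ac: "absolutely_continuous M N"
  shows "(\<integral>\<^sup>+x. RN_deriv M N x \<partial>M) = 1" "prob_density M (\<lambda>x. enn2real (RN_deriv M N x))"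
    and "f \<in> borel_measurable M ==> (LINT x|N. f x) = (LINT x|M. f x * enn2real (RN_deriv M N x))"
proof -
  interpret N: prob_space N by (rule N(1))
  have d: "density M (RN_deriv M N) = N" by (rule density_RN_deriv[OF ac N(2)])
  have "emeasure N (space N) = (\<integral>\<^sup>+x. RN_deriv M N x * indicator (space M) x \<partial>M)"
    unfolding sets_eq_imp_space_eq[OF N(2)] by (subst d[symmetric]) (simp add: emeasure_density)
  also have "... = (\<integral>\<^sup>+x. RN_deriv M N x \<partial>M)" by (intro nn_integral_cong) auto
  finally show h1: "(\<integral>\<^sup>+x. RN_deriv M N x \<partial>M) = 1" using N.emeasure_space_1 by simp
  note L = Lp_norm_density[OF borel_measurable_RN_deriv h1]
  show "prob_density M (\<lambda>x. enn2real (RN_deriv M N x))" by (rule L(1))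
  assume f: "f \<in> borel_measurable M"
  have "density M (RN_deriv M N) = density M (\<lambda>x. ennreal (enn2real (RN_deriv M N x)))"
    by (rule density_cong[OF _ _ L(2)]) measurable
  then have "N = density M (\<lambda>x. ennreal (enn2real (RN_deriv M N x)))" unfolding d .
  then have "(LINT x|N. f x) = (LINT x|(density M (\<lambda>x. ennreal (enn2real (RN_deriv M N x)))). f x)" by (rule arg_cong)
  also have "... = (LINT x|M. enn2real (RN_deriv M N x) *\<^sub>R f x)" by (rule integral_density[OF f]) auto
  finally show "(LINT x|N. f x) = (LINT x|M. f x * enn2real (RN_deriv M N x))" by (simp add: mult.commute)
qed

text \<open>The density is cut at height n: the lower part is paired by Cauchy-Schwarz with constant
  n, the excess has mass below e and meets f <= exp L. This quantitative form of absolute continuity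
  is what can be transported by the flow.\<close>

lemma (in prob_density) density_dual_bound:
  assumes "0 < e"
  shows "\<exists>C\<ge>0. \<forall>L f. log_bounded M L f --> (LINT x|M. f x * k x) <= C * sqrt (LINT x|M. (f x)^2) + exp L * e"
proof -
  have "(\<lambda>n. LINT x|M. k x - min (k x) (real n)) \<longlonglongrightarrow> (LINT x|M. 0)"
  proof (rule integral_dominated_convergence[where w = k])
    have "(\<lambda>n. k x - min (k x) (real n)) \<longlonglongrightarrow> 0" for x
    proof -
      obtain N where N: "k x <= real N" using real_arch_simple by blast
      have "\<forall>\<^sub>F n in sequentially. 0 = k x - min (k x) (real n)"
        using eventually_ge_at_top[of N] by eventually_elim (use N in auto)
      then show ?thesis by (rule Lim_transform_eventually[OF tendsto_const])
    qed
    then show "AE x in M. (\<lambda>n. k x - min (k x) (real n)) \<longlonglongrightarrow> 0" by simp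
    show "AE x in M. norm (k x - min (k x) (real n)) <= k x" for n using k_nonneg by (intro AE_I2) (simp add: min_def)
  qed (use k_integrable in auto)
  then have "\<forall>\<^sub>F n in sequentially. (LINT x|M. k x - min (k x) (real n)) < e" using assms by (intro order_tendstoD(2)) auto
  then obtain n where n: "(LINT x|M. k x - min (k x) (real n)) < e" by (auto simp: eventually_sequentially)
  have ki: "integrable M (\<lambda>x. k x - min (k x) (real n))"
    by (rule Bochner_Integration.integrable_bound[OF k_integrable]) (use k_nonneg in \<open>auto simp: min_def\<close>)
  show ?thesis
  proof (intro exI[of _ "real n"] conjI allI impI)
    fix L and f :: "'a => real" assume f: "log_bounded M L f"
    note d = log_boundedD[OF f]
    have b: "f x <= exp L" for x using d(3)[of x] ln_bound_interval[OF d(2)[of x], of L] by auto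
    have i1: "integrable M f" and i2: "integrable M (\<lambda>x. (f x)^2)"
      using log_bounded_powr(1)[OF f, of 1] log_bounded_powr(1)[OF f, of 2] d(2) by (simp_all add: less_imp_le powr_numeral)
    have "(LINT x|M. f x)^2 <= (LINT x|M. (f x)^2)" using square_integral_le[OF i1 i2] d(2) by (simp add: abs_of_pos)
    then have cs: "(LINT x|M. f x) <= sqrt (LINT x|M. (f x)^2)" by (rule real_le_rsqrt)
    have "(LINT x|M. f x * k x) <= (LINT x|M. real n * f x + exp L * (k x - min (k x) (real n)))"
    proof (rule integral_mono)
      show "integrable M (\<lambda>x. real n * f x + exp L * (k x - min (k x) (real n)))" using i1 ki by auto
      show "integrable M (\<lambda>x. f x * k x)" by (rule log_bounded_mult_density(1)[OF f])
      fix x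
      have "f x * k x = f x * min (k x) (real n) + f x * (k x - min (k x) (real n))" by (simp add: algebra_simps)
      also have "... <= f x * real n + exp L * (k x - min (k x) (real n))"
        using d(2)[of x] b[of x] by (intro add_mono mult_left_mono mult_right_mono) auto
      finally show "f x * k x <= real n * f x + exp L * (k x - min (k x) (real n))" by (simp add: mult.commute)
    qed
    also have "... = real n * (LINT x|M. f x) + exp L * (LINT x|M. k x - min (k x) (real n))" using i1 ki by simp
    also have "... <= real n * sqrt (LINT x|M. (f x)^2) + exp L * e" using cs n by (intro add_mono mult_left_mono) auto
    finally show "(LINT x|M. f x * k x) <= real n * sqrt (LINT x|M. (f x)^2) + exp L * e" .
  qed simp
qed

context mean_field_flow
begin

lemma \<mu>_sets: "sets \<mu> = sets borel" and m_sets: "0 <= t ==> sets (m t) = sets borel" using P2_D(2)[OF P2] P2_D(2)[OF m_P2] by auto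

text \<open>The inequality at \<open>t0\<close> is applied to the function supplied by
  \<open>backward_flow\<close> with error 1 / (n + 1). In the limit the integrals agree, and the
  logarithm passes to the limit because the integral of f at time T is positive.\<close>

lemma dual_inequality_flow:
  assumes T: "t0 <= T"
    and init: "\<And>L f. log_bounded \<mu> L f ==> sgn \<kappa> * (ln (LINT x|m t0. f x) - log_norm \<mu> (p t0) f) <= R"
    and f: "C3 A f" "\<And>x. f x \<in> {exp (- L)..exp L}"
  shows "sgn \<kappa> * (ln (LINT x|(m T). f x) - log_norm \<mu> (p T) f) <= R + Rate T"
proof -
  have T0: "0 <= T" using T t0 by simp
  interpret mT: prob_space "m T" by (rule P2_D(1)[OF m_P2[OF T0]])
  have "\<exists>f'. continuous_on UNIV f' \<and> (\<forall>x. f' x \<in> {exp (- L)..exp L}) \<and>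
    \<bar>(LINT x|(m T). f x) - (LINT x|m t0. f' x)\<bar> <= 1 / real (Suc n) * (T - t0) \<and>
    sgn \<kappa> * (log_norm \<mu> (p t0) f' - log_norm \<mu> (p T) f) <= Rate T + 1 / real (Suc n) * (T - t0)" for n
    by (rule backward_flow[OF T f]) simp
  then obtain g where g: "\<And>n. continuous_on UNIV (g n)" "\<And>n x. g n x \<in> {exp (- L)..exp L}"
    "\<And>n. \<bar>(LINT x|(m T). f x) - (LINT x|m t0. g n x)\<bar> <= 1 / real (Suc n) * (T - t0)"
    "\<And>n. sgn \<kappa> * (log_norm \<mu> (p t0) (g n) - log_norm \<mu> (p T) f) <= Rate T + 1 / real (Suc n) * (T - t0)" by metis
  have e: "(\<lambda>n. 1 / real (Suc n) * (T - t0)) \<longlonglongrightarrow> 0" using tendsto_mult_left_zero[OF LIMSEQ_Suc[OF lim_1_over_n]] by blast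
  have fb: "log_bounded (m T) L f"
    unfolding log_bounded_borel[OF m_sets[OF T0]] using f by (auto intro: borel_measurable_continuous_onI C3_continuous)
  have I0: "0 < (LINT x|(m T). f x)" using mT.log_bounded_powr(4)[OF fb, of 1] log_boundedD(2)[OF fb] by (simp add: less_imp_le)
  have "(\<lambda>n. LINT x|m t0. g n x) \<longlonglongrightarrow> (LINT x|(m T). f x)"
    using g(3) by (intro tendsto_of_abs_bounds[OF _ e tendsto_const]) (simp add: abs_minus_commute)
  then have l: "(\<lambda>n. ln (LINT x|m t0. g n x)) \<longlonglongrightarrow> ln (LINT x|(m T). f x)" using I0 by (intro tendsto_ln) auto
  have b: "sgn \<kappa> * (ln (LINT x|m t0. g n x) - log_norm \<mu> (p T) f) <= R + Rate T + 1 / real (Suc n) * (T - t0)" for n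
  proof -
    have "log_bounded \<mu> L (g n)" unfolding log_bounded_borel[OF \<mu>_sets] using g(1,2) by (auto intro: borel_measurable_continuous_onI)
    from init[OF this] g(4)[of n] show ?thesis unfolding right_diff_distrib by linarith
  qed
  have "(\<lambda>n. sgn \<kappa> * (ln (LINT x|m t0. g n x) - log_norm \<mu> (p T) f)) \<longlonglongrightarrow> sgn \<kappa> * (ln (LINT x|(m T). f x) - log_norm \<mu> (p T) f)"
    by (intro tendsto_mult[OF tendsto_const] tendsto_diff l tendsto_const)
  moreover have "(\<lambda>n. R + Rate T + 1 / real (Suc n) * (T - t0)) \<longlonglongrightarrow> R + Rate T + 0" by (intro tendsto_add[OF tendsto_const e])
  ultimately have "sgn \<kappa> * (ln (LINT x|(m T). f x) - log_norm \<mu> (p T) f) <= R + Rate T + 0" by (rule LIMSEQ_le) (use b in blast)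
  then show ?thesis by simp
qed

text \<open>With \<open>\<epsilon> = \<kappa> = 1\<close> the dual exponent is constantly \<open>2\<close>; the other values of \<open>\<kappa>\<close> give no
  upper bound on the integrals when \<open>q < 1\<close>.\<close>

lemma absolutely_continuous_flow:
  assumes one: "\<epsilon> = 1" "\<kappa> = 1" and T: "t0 <= T" and ac: "absolutely_continuous \<mu> (m t0)"
  shows "absolutely_continuous \<mu> (m T)"
proof (rule absolutely_continuous_of_dual_bound)
  have T0: "0 <= T" using T t0 by simp
  interpret mT: prob_space "m T" by (rule P2_D(1)[OF m_P2[OF T0]])
  show "prob_space \<mu>" "prob_space (m T)" "sets \<mu> = sets borel" "sets (m T) = sets borel"
    by (auto simp: \<mu>_sets m_sets[OF T0] prob_space_axioms mT.prob_space_axioms)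
  fix e :: real assume e: "0 < e"
  define k where "k x = enn2real (RN_deriv \<mu> (m t0) x)" for x
  note RN = RN_deriv_density[OF P2_D(1)[OF m_P2[OF t0]] _ ac, unfolded \<mu>_sets m_sets[OF t0], OF refl, folded k_def]
  interpret k: prob_density \<mu> k using RN(2) by (simp add: k_def[abs_def])
  obtain C where C0: "0 <= C" and C: "\<And>L h. log_bounded \<mu> L h ==> (LINT x|\<mu>. h x * k x) <= C * sqrt (LINT x|\<mu>. (h x)^2) + exp L * e"
    using k.density_dual_bound[OF e] by blast
  define E where "E = exp (Rate T)"
  have p2: "p t = 2" for t by (simp only: p_def) (simp add: one)
  have sgn1: "sgn \<kappa> = 1" by (simp add: one)
  have ln2: "exp (log_norm \<mu> 2 f) = sqrt (LINT x|\<mu>. (f x)^2)" if f: "log_bounded \<mu> L f" for f L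
  proof -
    have "(LINT x|\<mu>. f x powr 2) = (LINT x|\<mu>. (f x)^2)" using log_boundedD(2)[OF f] by (simp add: less_imp_le powr_numeral)
    moreover have "0 < (LINT x|\<mu>. f x powr 2)" by (rule log_bounded_powr(4)[OF f])
    ultimately show ?thesis by (simp add: log_norm_def powr_half_sqrt[symmetric] powr_def)
  qed
  \<comment> \<open>Transported backwards at exponent 2, f grows in L^2 by at most the factor E, so
    the bound at \<open>t0\<close> with constant C becomes one at T with constant C E.\<close>
  have C3: "(LINT x|(m T). f x) <= C * E * sqrt (LINT x|\<mu>. (f x)^2) + exp L * e"
    if f: "C3 A f" "\<And>x. f x \<in> {exp (- L)..exp L}" for A f L
  proof -
    have fb: "log_bounded \<mu> L f" unfolding log_bounded_borel[OF \<mu>_sets] using f by (auto intro: borel_measurable_continuous_onI C3_continuous)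
    have le: "(LINT x|(m T). f x) <= C * (sqrt (LINT x|\<mu>. (f x)^2) * exp (Rate T + d * (T - t0))) + exp L * e + d * (T - t0)" if d: "0 < d" for d
    proof -
      obtain u where u: "continuous_on UNIV u" "\<And>x. u x \<in> {exp (- L)..exp L}"
        "\<bar>(LINT x|(m T). f x) - (LINT x|m t0. u x)\<bar> <= d * (T - t0)"
        "sgn \<kappa> * (log_norm \<mu> (p t0) u - log_norm \<mu> (p T) f) <= Rate T + d * (T - t0)" using backward_flow[OF T f d] by blast
      have ub: "log_bounded \<mu> L u" unfolding log_bounded_borel[OF \<mu>_sets] using u(1,2) by (auto intro: borel_measurable_continuous_onI)
      have "log_norm \<mu> 2 u <= log_norm \<mu> 2 f + (Rate T + d * (T - t0))" using u(4) unfolding p2 sgn1 by simp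
      then have "sqrt (LINT x|\<mu>. (u x)^2) <= sqrt (LINT x|\<mu>. (f x)^2) * exp (Rate T + d * (T - t0))"
        unfolding ln2[OF fb, symmetric] ln2[OF ub, symmetric] exp_add[symmetric] by simp
      then have "C * sqrt (LINT x|\<mu>. (u x)^2) <= C * (sqrt (LINT x|\<mu>. (f x)^2) * exp (Rate T + d * (T - t0)))"
        using C0 by (rule mult_left_mono)
      moreover have "(LINT x|m t0. u x) = (LINT x|\<mu>. u x * k x)" using log_boundedD(1)[OF ub] by (rule RN(3))
      ultimately show ?thesis using C[OF ub] u(3) by linarith
    qed
    have "(\<lambda>n. C * (sqrt (LINT x|\<mu>. (f x)^2) * exp (Rate T + 1 / real (Suc n) * (T - t0))) + exp L * e + 1 / real (Suc n) * (T - t0)) \<longlonglongrightarrow>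
        C * (sqrt (LINT x|\<mu>. (f x)^2) * exp (Rate T + 0 * (T - t0))) + exp L * e + 0 * (T - t0)"
      by (intro tendsto_intros LIMSEQ_Suc[OF lim_1_over_n])
    then have "(LINT x|(m T). f x) <= C * (sqrt (LINT x|\<mu>. (f x)^2) * exp (Rate T + 0 * (T - t0))) + exp L * e + 0 * (T - t0)"
      by (rule LIMSEQ_le_const) (intro exI allI impI le, simp)
    then show ?thesis by (simp add: E_def mult_ac)
  qed
  show "\<exists>C. \<forall>L f. continuous_on UNIV f --> (\<forall>x. f x \<in> {exp (- L)..exp L}) -->
      (LINT x|(m T). f x) <= C * sqrt (LINT x|\<mu>. (f x)^2) + exp L * e"
  proof (intro exI[of _ "C * E"] allI impI)
    fix L and f :: "'a => real" assume fc: "continuous_on UNIV f" and fb: "\<forall>x. f x \<in> {exp (- L)..exp L}"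
    then have f: "continuous_on UNIV f" "\<And>x. exp (- L) <= f x" "\<And>x. f x <= exp L" by auto
    obtain g where g: "\<And>n. \<exists>A. C3 A (g n)" "\<And>n x. exp (- L) <= g n x" "\<And>n x. g n x <= exp L" "\<And>x. (\<lambda>n. g n x) \<longlonglongrightarrow> f x"
      using C3_approx_continuous[OF f] by blast
    have gc: "continuous_on UNIV (g n)" for n using g(1)[of n] C3_continuous by blast
    have g0: "0 <= g n x" for n x using g(2)[of n x] order_trans[OF exp_ge_zero] by blast
    have 1: "(\<lambda>n. \<integral>x. g n x \<partial>m T) \<longlonglongrightarrow> (LINT x|(m T). f x)"
    proof (rule integral_dominated_convergence[where w = "\<lambda>_. exp L"])
      show "f \<in> borel_measurable (m T)" "g n \<in> borel_measurable (m T)" for n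
        unfolding measurable_cong_sets[OF m_sets[OF T0] refl] by (intro borel_measurable_continuous_onI gc f(1))+
    qed (use g(3,4) g0 in auto)
    have 2: "(\<lambda>n. LINT x|\<mu>. (g n x)^2) \<longlonglongrightarrow> (LINT x|\<mu>. (f x)^2)"
    proof (rule integral_dominated_convergence[where w = "\<lambda>_. (exp L)^2"])
      show "(\<lambda>x. (f x)^2) \<in> borel_measurable \<mu>" "(\<lambda>x. (g n x)^2) \<in> borel_measurable \<mu>" for n
        unfolding measurable_cong_sets[OF \<mu>_sets refl] by (intro borel_measurable_continuous_onI continuous_intros gc f(1))+
      show "AE x in \<mu>. norm ((g n x)^2) <= (exp L)^2" for n using g(3)[of n] g0[of n] by (intro AE_I2) (simp add: power_mono)
      show "AE x in \<mu>. (\<lambda>n. (g n x)^2) \<longlonglongrightarrow> (f x)^2" by (intro AE_I2 tendsto_power g(4))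
    qed auto
    have "(LINT x|(m T). g n x) <= C * E * sqrt (LINT x|\<mu>. (g n x)^2) + exp L * e" for n
      using g(1)[of n] C3[of _ "g n" L] g(2,3)[of n] by auto
    moreover have "(\<lambda>n. C * E * sqrt (LINT x|\<mu>. (g n x)^2) + exp L * e) \<longlonglongrightarrow> C * E * sqrt (LINT x|\<mu>. (f x)^2) + exp L * e"
      by (intro tendsto_intros 2)
    ultimately show "(LINT x|(m T). f x) <= C * E * sqrt (LINT x|\<mu>. (f x)^2) + exp L * e" using LIMSEQ_le[OF 1] by blast
  qed
qed

end

section \<open>From the hypotheses of the theorem to the flow, and conclusion\<close>

lemma linear_bound_of_unit:
  assumes T: "linear T" and A: "\<And>u. norm u <= 1 ==> norm (T u) <= A"
  shows "norm (T u) <= A * norm u"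
proof (cases "u = 0")
  case False
  have "norm (T ((1 / norm u) *\<^sub>R u)) <= A" using False by (intro A) simp
  then show ?thesis using False by (simp add: linear_scale[OF T] field_simps)
qed (simp add: linear_0[OF T])

text \<open>\<open>deriv_norm\<close> sees only directions in the unit ball; linearity in each slot
  rescales them one after the other. The list of directions is read backwards:
  \<open>iter_deriv [w, v, u]\<close> differentiates along u first.\<close>

lemma C3_of_Ck:
  fixes g :: "'a::euclidean_space => 'b::real_normed_vector"
  assumes g: "Ck 3 g" and A: "0 <= A" and bound: "\<And>k x. k \<in> {1, 2, 3} ==> deriv_norm k g x <= ennreal A"
  shows "C3 A g"
proof -
  have d: "(iter_deriv vs g has_derivative (\<lambda>v. iter_deriv (v # vs) g x)) (at x)" if "length vs < 3" for vs x
    using g that by (simp add: Ck_def frechet_derivative_works[symmetric] eta_contract_eq)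
  define f1 where "f1 x u = iter_deriv [u] g x" for x u
  define f2 where "f2 x u v = iter_deriv [v, u] g x" for x u v
  define f3 where "f3 x u v w = iter_deriv [w, v, u] g x" for x u v w
  have h: "has_derivs3 g f1 f2 f3"
    unfolding has_derivs3_def f1_def f2_def f3_def using d[of "[]"] d[of "[_]"] d[of "[_, _]"] by auto
  note l = has_derivs3_linear[OF h]
  have b: "norm (iter_deriv vs g x) <= A" if "length vs \<in> {1, 2, 3}" "\<forall>v\<in>set vs. norm v <= 1" for vs x
  proof -
    have "ennreal (norm (iter_deriv vs g x)) <= deriv_norm (length vs) g x"
      unfolding deriv_norm_def using that by (intro SUP_upper) auto
    also have "... <= ennreal A" by (rule bound[OF that(1)])
    finally show ?thesis using A by simp
  qed
  have b1: "norm (f1 x u) <= A" if "norm u <= 1" for x u unfolding f1_def using that by (intro b) auto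
  have b2: "norm (f2 x u v) <= A" if "norm u <= 1" "norm v <= 1" for x u v unfolding f2_def using that by (intro b) auto
  have b3: "norm (f3 x u v w) <= A" if "norm u <= 1" "norm v <= 1" "norm w <= 1" for x u v w
    unfolding f3_def using that by (intro b) auto
  have c1: "norm (f1 x u) <= A * norm u" for x u by (rule linear_bound_of_unit[OF l(1) b1])
  have c2: "norm (f2 x u v) <= A * norm u * norm v" for x u v
  proof (rule linear_bound_of_unit[OF l(2)])
    fix v :: 'a assume "norm v <= 1"
    then show "norm (f2 x u v) <= A * norm u" by (intro linear_bound_of_unit[OF l(3)] b2)
  qed
  have c3: "norm (f3 x u v w) <= A * norm u * norm v * norm w" for x u v w
  proof (rule linear_bound_of_unit[OF l(4)])
    fix w :: 'a assume w: "norm w <= 1"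
    show "norm (f3 x u v w) <= A * norm u * norm v"
    proof (rule linear_bound_of_unit[OF l(6)])
      fix v :: 'a assume "norm v <= 1"
      then show "norm (f3 x u v w) <= A * norm u" using w by (intro linear_bound_of_unit[OF l(5)] b3)
    qed
  qed
  show ?thesis unfolding C3_def using A h c1 c2 c3 by (auto simp: derivs_bounded_def)
qed

context mean_field_flow
begin

definition density_at :: "real => 'a => real" where
  "density_at t x = enn2real (RN_deriv \<mu> (m t) x)"

text \<open>\<open>dual_holder\<close> turns the norm at \<open>t0\<close> into a dual inequality,
  \<open>dual_inequality_flow\<close> carries it to T, \<open>dual_converse\<close> turns it back
  into a norm. At both ends the exponents are conjugate because q - 1 and p - 1 are reciprocal.
  Multiplying twice by \<open>sgn \<kappa>\<close> brings the right-hand side into the form that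
  \<open>dual_converse\<close> expects.\<close>

lemma log_norm_flow:
  assumes q0: "q0 \<noteq> 1" "\<kappa> = 1 / (q0 - 1)" and T: "t0 <= T" and q: "q - 1 = 1 / (p T - 1)"
    and ac: "absolutely_continuous \<mu> (m t0)" "absolutely_continuous \<mu> (m T)"
    and fin: "finite_log_norm \<mu> q0 (density_at t0)"
  shows "finite_log_norm \<mu> q (density_at T)"
    and "sgn \<kappa> * log_norm \<mu> q (density_at T) <= sgn \<kappa> * log_norm \<mu> q0 (density_at t0) + Rate T"
proof -
  have T0: "0 <= T" using T t0 by simp
  have pm: "prob_space (m t)" "sets (m t) = sets \<mu>" if "0 <= t" for t
    using P2_D(1)[OF m_P2[OF that]] m_sets[OF that] \<mu>_sets by auto
  note RN0 = RN_deriv_density[OF pm[OF t0] ac(1), folded density_at_def]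
  note RNT = RN_deriv_density[OF pm[OF T0] ac(2), folded density_at_def]
  interpret k0: prob_density \<mu> "density_at t0" using RN0(2) by (simp add: density_at_def[abs_def])
  interpret kT: prob_density \<mu> "density_at T" using RNT(2) by (simp add: density_at_def[abs_def])
  have pT: "p T \<noteq> 1" using p_pos[of T] by auto
  have q1: "q \<noteq> 1" using q pT by auto
  have sgn0: "sgn (q0 - 1) = sgn \<kappa>" using q0 by (simp add: sgn_divide)
  have sgnT: "sgn (q - 1) = sgn \<kappa>" unfolding q using sgn_p[of T] by (elim disjE conjE) simp_all
  have p0: "p t0 = q0 / (q0 - 1)"
  proof -
    have "p t0 = 1 + \<kappa>" by (simp add: p_def)
    also have "... = q0 / (q0 - 1)" using q0(1) unfolding q0(2) by (simp add: field_simps)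
    finally show ?thesis .
  qed
  have pT': "p T = q / (q - 1)" using q pT q1 by (simp add: field_simps)
  have ss: "sgn \<kappa> * (sgn \<kappa> * r) = r" for r using \<kappa> by (simp add: sgn_if)
  have init: "sgn \<kappa> * (ln (LINT x|m t0. f x) - log_norm \<mu> (p t0) f) <= sgn \<kappa> * log_norm \<mu> q0 (density_at t0)"
    if "log_bounded \<mu> L f" for L f
    using k0.dual_holder[OF q0(1) fin that] RN0(3)[OF log_boundedD(1)[OF that]] by (simp add: sgn0 p0)
  have acl: "absolutely_continuous lborel \<mu>" unfolding absolutely_continuous_def
  proof
    have [measurable]: "(\<lambda>x. ennreal (exp (- U x) / Z)) \<in> borel_measurable lborel"
    proof -
      have "continuous_on UNIV U"
        using U by (intro has_derivative_continuous_on) (auto simp: gderiv_def intro: has_derivative_at_withinI)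
      then show ?thesis using Z by (intro measurable_compose[OF _ measurable_ennreal]) (auto intro!: borel_measurable_continuous_onI continuous_intros)
    qed
    fix N :: "'a set" assume "N \<in> null_sets lborel"
    then show "N \<in> null_sets \<mu>" by (subst density) (auto simp: null_sets_density_iff dest: AE_not_in)
  qed
  have dual: "sgn (q - 1) * (ln (LINT x|\<mu>. f x * density_at T x) - log_norm \<mu> (q / (q - 1)) f) <=
      sgn (q - 1) * (log_norm \<mu> q0 (density_at t0) + sgn \<kappa> * Rate T)"
    if "log_bounded \<mu> L f" for L f
  proof -
    have "sgn \<kappa> * (ln (LINT x|(m T). f x) - log_norm \<mu> (p T) f) <= sgn \<kappa> * log_norm \<mu> q0 (density_at t0) + Rate T"
      by (rule dual_inequality_extend[OF prob_space_axioms \<mu>_sets pm(1)[OF T0] m_sets[OF T0] acl ac(2) _ that])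
        (rule dual_inequality_flow[OF T init])
    then show ?thesis using RNT(3)[OF log_boundedD(1)[OF that]] by (simp add: sgnT pT'[symmetric] distrib_left ss)
  qed
  show "finite_log_norm \<mu> q (density_at T)" by (rule kT.dual_converse(1)[OF q1 dual])
  have "sgn (q - 1) * log_norm \<mu> q (density_at T) <= sgn (q - 1) * (log_norm \<mu> q0 (density_at t0) + sgn \<kappa> * Rate T)"
    by (rule kT.dual_converse(2)[OF q1 dual])
  then show "sgn \<kappa> * log_norm \<mu> q (density_at T) <= sgn \<kappa> * log_norm \<mu> q0 (density_at t0) + Rate T"
    by (simp only: sgnT distrib_left ss)
qed

end

text \<open>Absolute continuity occurs in \<open>h0\<close> and in the conclusion because only in
  its presence is \<open>RN_deriv\<close> the density h_t.\<close>

theorem proposition2p3: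
  fixes F :: "'a::euclidean_space measure \<Rightarrow> real"
    and dF :: "'a measure \<Rightarrow> 'a \<Rightarrow> real"
    and D :: "'a measure \<Rightarrow> 'a \<Rightarrow> 'a"
    and Mmm Mmx \<rho> \<epsilon> t\<^sub>0 q\<^sub>0 :: real
    and m_inf :: "'a measure"
    and m :: "real \<Rightarrow> 'a measure"
    and q :: "real \<Rightarrow> real"
  defines "h \<equiv> \<lambda>t. RN_deriv m_inf (m t)"
    and "\<delta> \<equiv> \<lambda>t. 1 / (4 * \<epsilon>) * (q t - 1) * Mmm\<^sup>2 * (W 1 (m t) m_inf)\<^sup>2"
  assumes derivatives: "linear_functional_derivative F dF" "intrinsic_derivative dF D"
    and constants: "Mmm \<ge> 0" "Mmx \<ge> 0" "\<rho> > 0"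
    and convex: "\<forall>m\<in>P2. \<forall>m'\<in>P2. \<forall>t\<in>{0..1}. F (mix t m m') \<le> (1 - t) * F m + t * F m'"
    and lipschitz: "\<forall>m\<in>P2. \<forall>m'\<in>P2. \<forall>x. norm (D m x - D m' x) \<le> Mmm * W 1 m m'"
    and lsi: "\<forall>m\<in>P2. integrable lborel (\<lambda>x. exp (- dF m x)) \<and> log_sobolev \<rho> (hat dF m)"
    and gradient_bound: "(SUP m\<in>P2. SUP x. deriv_norm 1 (D m) x) \<le> ennreal Mmx"
    and smooth: "\<forall>m\<in>P2. Ck 3 (D m)"
    and higher_bounds: "\<forall>k\<in>{2, 3}. (SUP m\<in>P2. SUP x. deriv_norm k (D m) x) < \<infinity>"
    and m_inf: "free_energy_minimizer F m_inf"
    and solution: "fokker_planck_solution D m"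
    and t0: "t\<^sub>0 \<ge> 0" and q0: "q\<^sub>0 \<noteq> 1"
    and h0: "absolutely_continuous m_inf (m t\<^sub>0)" "h t\<^sub>0 \<in> Lp_plus m_inf q\<^sub>0"
    and \<epsilon>: "0 < \<epsilon>" "\<epsilon> \<le> 1"
    and q: "q t\<^sub>0 = q\<^sub>0"
      "\<forall>t\<ge>t\<^sub>0. (q has_real_derivative 4 * (1 - \<epsilon>) * \<rho> * (q t - 1)) (at t within {t\<^sub>0..})"
  shows "\<forall>t\<ge>t\<^sub>0.
     absolutely_continuous m_inf (m t) \<and> h t \<in> Lp_plus m_inf (q t) \<and>
     (q\<^sub>0 > 1 \<longrightarrow> elog (Lp_norm m_inf (q t) (h t)) \<le>
        elog (Lp_norm m_inf q\<^sub>0 (h t\<^sub>0)) + ereal (LBINT s:{t\<^sub>0..t}. \<delta> s)) \<and>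
     (q\<^sub>0 < 1 \<longrightarrow> elog (Lp_norm m_inf (q t) (h t)) \<ge>
        elog (Lp_norm m_inf q\<^sub>0 (h t\<^sub>0)) + ereal (LBINT s:{t\<^sub>0..t}. \<delta> s))"
proof (intro allI impI)
  fix t assume t: "t\<^sub>0 <= t"
  have mP2: "m_inf \<in> P2" using m_inf by (simp add: free_energy_minimizer_def)
  define S where "S k = (SUP m\<in>P2. SUP x. deriv_norm k (D m) x)" for k
  \<comment> \<open>One C^3 constant for all drifts D(m, .) with m in \<open>P2\<close>; the suprema
    of order 2 and 3 are known to be finite only, so they enter through
    \<open>enn2real\<close>.\<close>
  define M where "M = max Mmx (max (enn2real (S 2)) (enn2real (S 3)))"
  have M: "0 <= M" using constants by (simp add: M_def)
  have SM: "S k <= ennreal M" if "k \<in> {1, 2, 3}" for k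
  proof -
    have "S 1 <= ennreal Mmx" "S 2 = ennreal (enn2real (S 2))" "S 3 = ennreal (enn2real (S 3))"
      using gradient_bound higher_bounds by (simp_all add: S_def)
    moreover have "ennreal Mmx <= ennreal M" "ennreal (enn2real (S 2)) <= ennreal M" "ennreal (enn2real (S 3)) <= ennreal M"
      by (auto simp: M_def intro!: ennreal_leI)
    ultimately show ?thesis using that by auto
  qed
  have DC: "C3 M (D n)" if n: "n \<in> P2" for n
  proof (rule C3_of_Ck[OF _ M])
    show "Ck 3 (D n)" using smooth n by blast
    fix k :: nat and x assume k: "k \<in> {1, 2, 3}"
    have "deriv_norm k (D n) x <= S k" unfolding S_def using n by (intro SUP_upper2[OF n] SUP_upper) simp
    then show "deriv_norm k (D n) x <= ennreal M" using SM[OF k] by (rule order_trans)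
  qed
  have grad: "GDERIV (dF n) x :> D n x" if "n \<in> P2" for n x using derivatives(2) that by (simp add: intrinsic_derivative_def)
  have cont: "continuous_on UNIV (dF n)" if "n \<in> P2" for n
    using grad[OF that] by (intro has_derivative_continuous_on) (auto simp: gderiv_def intro: has_derivative_at_withinI)
  define U where "U = dF m_inf"
  define Z where "Z = (LINT y|lborel. exp (- U y))"
  have iU: "integrable lborel (\<lambda>x. exp (- U x))" using lsi mP2 by (simp add: U_def)
  have Z: "0 < Z" unfolding Z_def using exp_integral_pos(2)[OF iU cont[OF mP2, folded U_def], of 1] by simp
  have hat: "m_inf = hat dF m_inf" by (rule minimizer_eq_hat[OF derivatives(1) cont m_inf iU[unfolded U_def]])
  note drift = C3_drift[OF DC[OF mP2]]
  have gibbs: "gibbs_measure m_inf U (D m_inf) Z \<rho> (norm (D m_inf 0) + M)"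
  proof
    show "m_inf = density lborel (\<lambda>x. ennreal (exp (- U x) / Z))" using hat by (simp add: hat_def U_def Z_def)
    show "log_sobolev \<rho> m_inf" using lsi mP2 hat by metis
    show "GDERIV U x :> D m_inf x" for x unfolding U_def by (rule grad[OF mP2])
  qed (use mP2 Z drift constants in auto)
  have fp: "fokker_planck D m M Mmm" by unfold_locales (use DC lipschitz constants solution in auto)
  define \<kappa> where "\<kappa> = 1 / (q\<^sub>0 - 1)"
  have \<kappa>: "\<kappa> \<noteq> 0" using q0 by (simp add: \<kappa>_def)
  \<comment> \<open>Two instances of the flow: \<open>A\<close>, with exponent constantly 2, for
    absolute continuity, and \<open>B\<close>, with the exponent dual to q, for the norms.\<close>
  interpret A: mean_field_flow D m M Mmm m_inf U Z \<rho> "norm (D m_inf 0) + M" t\<^sub>0 1 1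
    using fp gibbs t0 by (intro mean_field_flow.intro mean_field_flow_axioms.intro) auto
  interpret B: mean_field_flow D m M Mmm m_inf U Z \<rho> "norm (D m_inf 0) + M" t\<^sub>0 \<kappa> \<epsilon>
    using fp gibbs t0 \<kappa> \<epsilon> by (intro mean_field_flow.intro mean_field_flow_axioms.intro) auto
  have ac: "absolutely_continuous m_inf (m t)" by (rule A.absolutely_continuous_flow[OF refl refl t h0(1)])
  define \<beta> where "\<beta> = 4 * (1 - \<epsilon>) * \<rho>"
  \<comment> \<open>The equation for q is solved by an integrating factor, with derivatives taken
    within the half-line, hence one-sided at its endpoint.\<close>
  have qt: "q s - 1 = (q\<^sub>0 - 1) * exp (\<beta> * (s - t\<^sub>0))" if s: "t\<^sub>0 <= s" for s
  proof -
    have "\<exists>c. \<forall>s\<in>{t\<^sub>0..}. (q s - 1) * exp (- \<beta> * (s - t\<^sub>0)) = c"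
    proof (rule has_field_derivative_zero_constant)
      fix s assume s: "s \<in> {t\<^sub>0..}"
      then have "(q has_real_derivative \<beta> * (q s - 1)) (at s within {t\<^sub>0..})" using q(2) by (simp add: \<beta>_def)
      then show "((\<lambda>s. (q s - 1) * exp (- \<beta> * (s - t\<^sub>0))) has_real_derivative 0) (at s within {t\<^sub>0..})"
        by (auto intro!: derivative_eq_intros)
    qed simp
    then obtain c where c: "(q s - 1) * exp (- \<beta> * (s - t\<^sub>0)) = c" if "t\<^sub>0 <= s" for s by auto
    have "(q s - 1) * exp (- \<beta> * (s - t\<^sub>0)) = q\<^sub>0 - 1" using c[OF s] c[of t\<^sub>0] q(1) by simp
    moreover have "(q s - 1) * exp (- \<beta> * (s - t\<^sub>0)) * exp (\<beta> * (s - t\<^sub>0)) = q s - 1" by (simp add: mult.assoc flip: exp_add)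
    ultimately show ?thesis by simp
  qed
  have pq: "q s - 1 = 1 / (B.p s - 1)" if "t\<^sub>0 <= s" for s
  proof -
    have "- (4 * (1 - \<epsilon>) * \<rho>) * (s - t\<^sub>0) = - (\<beta> * (s - t\<^sub>0))" by (simp add: \<beta>_def)
    then have "B.p s - 1 = \<kappa> * inverse (exp (\<beta> * (s - t\<^sub>0)))" unfolding B.p_def by (simp add: exp_minus)
    then show ?thesis unfolding qt[OF that] by (simp add: \<kappa>_def divide_inverse)
  qed
  have sgn: "sgn (q s - 1) = sgn \<kappa>" if "t\<^sub>0 <= s" for s unfolding qt[OF that] by (simp add: sgn_mult \<kappa>_def sgn_divide)
  \<comment> \<open>For q0 < 1 the function \<delta> is nonpositive; the two inequalities of the
    theorem are one inequality multiplied by \<open>sgn \<kappa>\<close>.\<close>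
  have \<delta>: "\<delta> s = sgn \<kappa> * B.rate s" if s: "t\<^sub>0 <= s" for s
  proof -
    have "\<bar>B.p s - 1\<bar> = 1 / \<bar>q s - 1\<bar>" unfolding pq[OF s] by simp
    moreover have "q s - 1 = sgn \<kappa> * \<bar>q s - 1\<bar>" unfolding sgn[OF s, symmetric] by (simp add: sgn_mult_abs)
    ultimately show ?thesis unfolding \<delta>_def B.rate_def by (simp add: power_mult_distrib mult_ac)
  qed
  have int: "(LBINT s:{t\<^sub>0..t}. \<delta> s) = sgn \<kappa> * B.Rate t"
  proof -
    have "(LBINT s:{t\<^sub>0..t}. \<delta> s) = (LBINT s:{t\<^sub>0..t}. sgn \<kappa> * B.rate s)" by (intro set_lebesgue_integral_cong) (auto simp: \<delta>)
    also have "... = sgn \<kappa> * (LBINT s:{t\<^sub>0..t}. B.rate s)" by simp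
    also have "(LBINT s:{t\<^sub>0..t}. B.rate s) = integral {t\<^sub>0..t} B.rate"
      by (intro set_borel_integral_eq_integral(2) borel_integrable_atLeastAtMost' continuous_on_subset[OF B.rate_continuous]) auto
    finally show ?thesis by (simp add: B.Rate_def)
  qed
  have t_nn: "0 <= t" using t t0 by simp
  have pm: "prob_space (m s)" "sets (m s) = sets m_inf" if "0 <= s" for s
    using P2_D(1)[OF A.m_P2[OF that]] A.m_sets[OF that] A.\<mu>_sets by auto
  note N0 = A.Lp_norm_density[OF borel_measurable_RN_deriv A.RN_deriv_density(1)[OF pm[OF t0] h0(1)], folded B.density_at_def h_def]
  note Nt = A.Lp_norm_density[OF borel_measurable_RN_deriv A.RN_deriv_density(1)[OF pm[OF t_nn] ac], folded B.density_at_def h_def]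
  have fin0: "finite_log_norm m_inf q\<^sub>0 (B.density_at t\<^sub>0)" using N0(3) h0(2) by (simp add: h_def B.density_at_def[abs_def])
  note flow = B.log_norm_flow[OF q0 \<kappa>_def t pq[OF t] h0(1) ac fin0]
  have "h t \<in> Lp_plus m_inf (q t)" using Nt(3) flow(1) by (simp add: h_def B.density_at_def[abs_def])
  moreover have "elog (Lp_norm m_inf (q t) (h t)) = ereal (log_norm m_inf (q t) (B.density_at t))"
    using Nt(4) flow(1) by (simp add: h_def B.density_at_def[abs_def])
  moreover have "elog (Lp_norm m_inf q\<^sub>0 (h t\<^sub>0)) = ereal (log_norm m_inf q\<^sub>0 (B.density_at t\<^sub>0))"
    using N0(4) fin0 by (simp add: h_def B.density_at_def[abs_def])
  moreover have "1 < q\<^sub>0 ==> sgn \<kappa> = 1" "q\<^sub>0 < 1 ==> sgn \<kappa> = - 1" by (simp_all add: \<kappa>_def sgn_divide)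
  ultimately show "absolutely_continuous m_inf (m t) \<and> h t \<in> Lp_plus m_inf (q t) \<and> (q\<^sub>0 > 1 --> elog (Lp_norm m_inf (q t) (h t)) <=
        elog (Lp_norm m_inf q\<^sub>0 (h t\<^sub>0)) + ereal (LBINT s:{t\<^sub>0..t}. \<delta> s)) \<and> (q\<^sub>0 < 1 --> elog (Lp_norm m_inf (q t) (h t)) \<ge>
        elog (Lp_norm m_inf q\<^sub>0 (h t\<^sub>0)) + ereal (LBINT s:{t\<^sub>0..t}. \<delta> s))" using flow(2) ac unfolding int by auto
qed

end
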